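(* Let $(R,\mathfrak{m})$ be an excellent Cohen--Macaulay local ring of dimension $d$, and assume either that $R$ is complete or that the residue field $R/\mathfrak{m}$ is uncountable. If $R$ has countable Cohen--Macaulay type, then the singular locus of $R$ has dimension at most one; that is, $R_{\mathfrak{p}}$ is a regular local ring for every prime ideal $\mathfrak{p}$ of $R$ with $\dim R/\mathfrak{p} > 1$.
   Context: All local rings are commutative and Noetherian; "complete" means complete in the $\mathfrak{m}$-adic topology. A nonzero module $M$ over a local ring $(R,\mathfrak{m})$ of dimension $d$ is called maximal Cohen--Macaulay (MCM) if it is finitely generated and there exists an $M$-regular sequence $x_1,\ldots,x_d$ of length $d$ in $\mathfrak{m}$. The ring $R$ is Cohen--Macaulay if it is MCM as a module over itself. A Cohen--Macaulay local ring is said to have countable Cohen--Macaulay type if it has only countably many (i.e. at most countably many) isomorphism classes of maximal Cohen--Macaulay modules. The singular locus of $R$ is the set of primes $\mathfrak{p}$ such that $R_{\mathfrak{p}}$ is not regular. *)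

theory Defs
  imports
    "HOL-Algebra.Algebra"
    "HOL-Library.Extended_Nat"
    "HOL-Library.Countable_Set"
    "HOL-Library.Poly_Mapping"
begin

section \<open>Spectra and Krull dimension\<close>

definition spec :: "('a, 'b) ring_scheme \<Rightarrow> 'a set set" where
  "spec R = {p. primeideal p R}"

text \<open>The supremum of the lengths of the finite strict chains \<open>p\<^sub>0 \<subset> \<dots> \<subset> p\<^sub>n\<close> in \<open>Z\<close>. For a set \<open>Z\<close>
  of primes that is closed in the Zariski topology this is the dimension of \<open>Z\<close> as a topological
  space. The dimension of the empty set is \<open>0\<close> here.\<close>

definition chain_dim :: "'a set set \<Rightarrow> enat" where
  "chain_dim Z =
    (SUP ps \<in> {ps. ps \<noteq> [] \<and> sorted_wrt (\<subset>) ps \<and> set ps \<subseteq> Z}. enat (length ps - 1))"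

definition krull_dim :: "('a, 'b) ring_scheme \<Rightarrow> enat" where
  "krull_dim R = chain_dim (spec R)"

locale noetherian_local_ring = cring R + noetherian_ring R for R (structure) and m +
  assumes maximalideal_iff: "maximalideal I R \<longleftrightarrow> I = m"


section \<open>Localization\<close>

text \<open>The fraction \<open>a/s\<close> is the set of all pairs \<open>(b, t)\<close> with \<open>u(at - bs) = 0\<close> for some \<open>u \<in> S\<close>.\<close>

definition fraction :: "('a, 'b) ring_scheme \<Rightarrow> 'a set \<Rightarrow> 'a \<Rightarrow> 'a \<Rightarrow> ('a \<times> 'a) set" where
  "fraction R S a s = {(b, t). b \<in> carrier R \<and> t \<in> S \<and>
     (\<exists>u\<in>S. u \<otimes>\<^bsub>R\<^esub> (a \<otimes>\<^bsub>R\<^esub> t) = u \<otimes>\<^bsub>R\<^esub> (b \<otimes>\<^bsub>R\<^esub> s))}"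

definition localization :: "('a, 'b) ring_scheme \<Rightarrow> 'a set \<Rightarrow> ('a \<times> 'a) set ring" where
  "localization R S =
    \<lparr>carrier = {fraction R S a s | a s. a \<in> carrier R \<and> s \<in> S},
     monoid.mult = (\<lambda>U V. {z. \<exists>a s b t. (a, s) \<in> U \<and> (b, t) \<in> V \<and>
        z \<in> fraction R S (a \<otimes>\<^bsub>R\<^esub> b) (s \<otimes>\<^bsub>R\<^esub> t)}),
     monoid.one = fraction R S \<one>\<^bsub>R\<^esub> \<one>\<^bsub>R\<^esub>,
     ring.zero = fraction R S \<zero>\<^bsub>R\<^esub> \<one>\<^bsub>R\<^esub>,
     ring.add = (\<lambda>U V. {z. \<exists>a s b t. (a, s) \<in> U \<and> (b, t) \<in> V \<and>
        z \<in> fraction R S (a \<otimes>\<^bsub>R\<^esub> t \<oplus>\<^bsub>R\<^esub> b \<otimes>\<^bsub>R\<^esub> s) (s \<otimes>\<^bsub>R\<^esub> t)})\<rparr>"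

context cring begin

lemma mem_fraction:
  "(b, t) \<in> fraction R S a s \<longleftrightarrow>
     b \<in> carrier R \<and> t \<in> S \<and> (\<exists>u\<in>S. u \<otimes> (a \<otimes> t) = u \<otimes> (b \<otimes> s))"
  by (simp add: fraction_def)

context
  fixes S assumes S: "submonoid S R"
begin

lemma S_facts:
  shows "s \<in> S \<Longrightarrow> s \<in> carrier R" "\<one> \<in> S" "s \<in> S \<Longrightarrow> t \<in> S \<Longrightarrow> s \<otimes> t \<in> S"
  using submonoid.subset[OF S] submonoid.one_closed[OF S] submonoid.m_closed[OF S] by auto

lemma fraction_subset:
  assumes "a \<in> carrier R" "s \<in> S" "b \<in> carrier R" "t \<in> S" "u \<in> S"
    and eq: "u \<otimes> (a \<otimes> t) = u \<otimes> (b \<otimes> s)"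
  shows "fraction R S a s \<subseteq> fraction R S b t"
proof
  fix z assume "z \<in> fraction R S a s"
  then obtain c w v where z: "z = (c, w)" and c: "c \<in> carrier R" "w \<in> S" "v \<in> S"
    and eq2: "v \<otimes> (a \<otimes> w) = v \<otimes> (c \<otimes> s)"
    by (auto simp: fraction_def)
  note facts = assms(1-5) c S_facts(1)[OF assms(2)] S_facts(1)[OF assms(4)] S_facts(1)[OF assms(5)]
    S_facts(1)[OF c(2)] S_facts(1)[OF c(3)]
  have "(u \<otimes> v \<otimes> s) \<otimes> (b \<otimes> w) = (v \<otimes> w) \<otimes> (u \<otimes> (b \<otimes> s))"
    using facts by (simp add: m_ac)
  also have "\<dots> = (u \<otimes> t) \<otimes> (v \<otimes> (a \<otimes> w))"
    unfolding eq[symmetric] using facts by (simp add: m_ac)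
  also have "\<dots> = (u \<otimes> v \<otimes> s) \<otimes> (c \<otimes> t)"
    unfolding eq2 using facts by (simp add: m_ac)
  finally show "z \<in> fraction R S b t"
    unfolding z mem_fraction using facts S_facts(3) by blast
qed

lemma fraction_eq_iff:
  assumes "a \<in> carrier R" "s \<in> S" "b \<in> carrier R" "t \<in> S"
  shows "fraction R S a s = fraction R S b t \<longleftrightarrow> (\<exists>u\<in>S. u \<otimes> (a \<otimes> t) = u \<otimes> (b \<otimes> s))"
proof
  assume eq: "fraction R S a s = fraction R S b t"
  have "(b, t) \<in> fraction R S b t"
    unfolding mem_fraction using assms S_facts(2) by blast
  then show "\<exists>u\<in>S. u \<otimes> (a \<otimes> t) = u \<otimes> (b \<otimes> s)"
    unfolding eq[symmetric] mem_fraction by blast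
next
  assume "\<exists>u\<in>S. u \<otimes> (a \<otimes> t) = u \<otimes> (b \<otimes> s)"
  then show "fraction R S a s = fraction R S b t"
    using fraction_subset assms by (metis subset_antisym)
qed

lemma localization_mult:
  assumes "a \<in> carrier R" "s \<in> S" "b \<in> carrier R" "t \<in> S"
  shows "fraction R S a s \<otimes>\<^bsub>localization R S\<^esub> fraction R S b t = fraction R S (a \<otimes> b) (s \<otimes> t)"
proof -
  have eq: "fraction R S (a' \<otimes> b') (s' \<otimes> t') = fraction R S (a \<otimes> b) (s \<otimes> t)"
    if m: "(a', s') \<in> fraction R S a s" "(b', t') \<in> fraction R S b t" for a' s' b' t'
  proof -
    from m obtain u v where c: "a' \<in> carrier R" "s' \<in> S" "b' \<in> carrier R" "t' \<in> S" "u \<in> S" "v \<in> S"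
      and e: "u \<otimes> (a \<otimes> s') = u \<otimes> (a' \<otimes> s)" "v \<otimes> (b \<otimes> t') = v \<otimes> (b' \<otimes> t)"
      unfolding mem_fraction by blast
    note facts = assms c assms(2,4)[THEN S_facts(1)] c(2,4,5,6)[THEN S_facts(1)]
    have "(u \<otimes> v) \<otimes> ((a' \<otimes> b') \<otimes> (s \<otimes> t)) = (u \<otimes> (a' \<otimes> s)) \<otimes> (v \<otimes> (b' \<otimes> t))"
      using facts by (simp add: m_ac)
    also have "\<dots> = (u \<otimes> v) \<otimes> ((a \<otimes> b) \<otimes> (s' \<otimes> t'))"
      unfolding e[symmetric] using facts by (simp add: m_ac)
    finally show ?thesis
      using fraction_eq_iff[of "a' \<otimes> b'" "s' \<otimes> t'" "a \<otimes> b" "s \<otimes> t"] facts S_facts(3) by blast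
  qed
  have mem: "(a, s) \<in> fraction R S a s" "(b, t) \<in> fraction R S b t"
    unfolding mem_fraction using assms S_facts(2) by blast+
  show ?thesis (is "?lhs = ?rhs")
  proof (rule Set.set_eqI, rule iffI)
    fix z assume "z \<in> ?lhs"
    then obtain a' s' b' t' where "(a', s') \<in> fraction R S a s" "(b', t') \<in> fraction R S b t"
      "z \<in> fraction R S (a' \<otimes> b') (s' \<otimes> t')"
      by (auto simp: localization_def)
    then show "z \<in> ?rhs" using eq by simp
  next
    fix z assume "z \<in> ?rhs"
    then show "z \<in> ?lhs" using mem by (simp add: localization_def) metis
  qed
qed

lemma localization_add:
  assumes "a \<in> carrier R" "s \<in> S" "b \<in> carrier R" "t \<in> S"
  shows "fraction R S a s \<oplus>\<^bsub>localization R S\<^esub> fraction R S b t =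
    fraction R S (a \<otimes> t \<oplus> b \<otimes> s) (s \<otimes> t)"
proof -
  have eq: "fraction R S (a' \<otimes> t' \<oplus> b' \<otimes> s') (s' \<otimes> t') = fraction R S (a \<otimes> t \<oplus> b \<otimes> s) (s \<otimes> t)"
    if m: "(a', s') \<in> fraction R S a s" "(b', t') \<in> fraction R S b t" for a' s' b' t'
  proof -
    from m obtain u v where c: "a' \<in> carrier R" "s' \<in> S" "b' \<in> carrier R" "t' \<in> S" "u \<in> S" "v \<in> S"
      and e: "u \<otimes> (a \<otimes> s') = u \<otimes> (a' \<otimes> s)" "v \<otimes> (b \<otimes> t') = v \<otimes> (b' \<otimes> t)"
      unfolding mem_fraction by blast
    note facts = assms c assms(2,4)[THEN S_facts(1)] c(2,4,5,6)[THEN S_facts(1)]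
    have "(u \<otimes> v) \<otimes> ((a' \<otimes> t' \<oplus> b' \<otimes> s') \<otimes> (s \<otimes> t)) =
        (u \<otimes> (a' \<otimes> s)) \<otimes> (v \<otimes> t \<otimes> t') \<oplus> (v \<otimes> (b' \<otimes> t)) \<otimes> (u \<otimes> s \<otimes> s')"
      using facts by (simp add: m_ac l_distr r_distr)
    also have "\<dots> = (u \<otimes> v) \<otimes> ((a \<otimes> t \<oplus> b \<otimes> s) \<otimes> (s' \<otimes> t'))"
      unfolding e[symmetric] using facts by (simp add: m_ac l_distr r_distr)
    finally show ?thesis
      using fraction_eq_iff[of "a' \<otimes> t' \<oplus> b' \<otimes> s'" "s' \<otimes> t'" "a \<otimes> t \<oplus> b \<otimes> s" "s \<otimes> t"]
        facts S_facts(3) by blast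
  qed
  have mem: "(a, s) \<in> fraction R S a s" "(b, t) \<in> fraction R S b t"
    unfolding mem_fraction using assms S_facts(2) by blast+
  show ?thesis (is "?lhs = ?rhs")
  proof (rule Set.set_eqI, rule iffI)
    fix z assume "z \<in> ?lhs"
    then obtain a' s' b' t' where "(a', s') \<in> fraction R S a s" "(b', t') \<in> fraction R S b t"
      "z \<in> fraction R S (a' \<otimes> t' \<oplus> b' \<otimes> s') (s' \<otimes> t')"
      by (auto simp: localization_def)
    then show "z \<in> ?rhs" using eq by simp
  next
    fix z assume "z \<in> ?rhs"
    then show "z \<in> ?lhs" using mem by (simp add: localization_def) metis
  qed
qed

lemma fraction_eqI:
  assumes "a \<in> carrier R" "s \<in> S" "b \<in> carrier R" "t \<in> S" "a \<otimes> t = b \<otimes> s"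
  shows "fraction R S a s = fraction R S b t"
  using fraction_eq_iff[OF assms(1-4)] assms(5) S_facts(2) by auto

lemma localization_cring: "cring (localization R S)"
proof -
  let ?L = "localization R S"
  have carr: "x \<in> carrier ?L \<longleftrightarrow> (\<exists>a s. x = fraction R S a s \<and> a \<in> carrier R \<and> s \<in> S)" for x
    by (auto simp: localization_def)
  have one: "\<one>\<^bsub>?L\<^esub> = fraction R S \<one> \<one>" and zero: "\<zero>\<^bsub>?L\<^esub> = fraction R S \<zero> \<one>"
    by (simp_all add: localization_def)
  have elim: P if "x \<in> carrier ?L" "\<And>a s. x = fraction R S a s \<Longrightarrow> a \<in> carrier R \<Longrightarrow> s \<in> S \<Longrightarrow> s \<in> carrier R \<Longrightarrow> P" for x P
    using that S_facts(1) unfolding carr by blast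
  have mem: "fraction R S a s \<in> carrier ?L" if "a \<in> carrier R" "s \<in> S" for a s
    unfolding carr using that by blast
  note simps = localization_mult localization_add one zero S_facts mem
  note ring_simps = m_ac a_ac l_distr r_distr S_facts
  show ?thesis
  proof (intro cringI abelian_groupI comm_monoidI)
    fix x assume "x \<in> carrier ?L"
    then show "\<exists>y\<in>carrier ?L. y \<oplus>\<^bsub>?L\<^esub> x = \<zero>\<^bsub>?L\<^esub>"
    proof (rule elim)
      fix a s assume x: "x = fraction R S a s" "a \<in> carrier R" "s \<in> S" "s \<in> carrier R"
      have "\<ominus> a \<otimes> s \<oplus> a \<otimes> s = \<zero>"
        using x by (simp add: l_minus l_neg)
      then have "fraction R S (\<ominus> a) s \<oplus>\<^bsub>?L\<^esub> x = \<zero>\<^bsub>?L\<^esub>"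
        using x by (simp add: simps, intro fraction_eqI) (simp_all add: S_facts)
      then show ?thesis using x(2,3) by (intro bexI[of _ "fraction R S (\<ominus> a) s"] mem) simp_all
    qed
  next
    show "x \<oplus>\<^bsub>?L\<^esub> y \<in> carrier ?L" if "x \<in> carrier ?L" "y \<in> carrier ?L" for x y
      using that by (elim elim) (simp add: simps)
    show "x \<otimes>\<^bsub>?L\<^esub> y \<in> carrier ?L" if "x \<in> carrier ?L" "y \<in> carrier ?L" for x y
      using that by (elim elim) (simp add: simps)
    show "x \<oplus>\<^bsub>?L\<^esub> y = y \<oplus>\<^bsub>?L\<^esub> x" if "x \<in> carrier ?L" "y \<in> carrier ?L" for x y
      using that by (elim elim) (simp add: simps ring_simps)
    show "x \<otimes>\<^bsub>?L\<^esub> y = y \<otimes>\<^bsub>?L\<^esub> x" if "x \<in> carrier ?L" "y \<in> carrier ?L" for x y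
      using that by (elim elim) (simp add: simps ring_simps)
    show "x \<oplus>\<^bsub>?L\<^esub> y \<oplus>\<^bsub>?L\<^esub> z = x \<oplus>\<^bsub>?L\<^esub> (y \<oplus>\<^bsub>?L\<^esub> z)"
      if "x \<in> carrier ?L" "y \<in> carrier ?L" "z \<in> carrier ?L" for x y z
      using that by (elim elim) (simp add: simps ring_simps)
    show "x \<otimes>\<^bsub>?L\<^esub> y \<otimes>\<^bsub>?L\<^esub> z = x \<otimes>\<^bsub>?L\<^esub> (y \<otimes>\<^bsub>?L\<^esub> z)"
      if "x \<in> carrier ?L" "y \<in> carrier ?L" "z \<in> carrier ?L" for x y z
      using that by (elim elim) (simp add: simps ring_simps)
    show "(x \<oplus>\<^bsub>?L\<^esub> y) \<otimes>\<^bsub>?L\<^esub> z = x \<otimes>\<^bsub>?L\<^esub> z \<oplus>\<^bsub>?L\<^esub> y \<otimes>\<^bsub>?L\<^esub> z"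
      if "x \<in> carrier ?L" "y \<in> carrier ?L" "z \<in> carrier ?L" for x y z
    proof -
      from that obtain a s b t c w where x: "x = fraction R S a s" "y = fraction R S b t" "z = fraction R S c w"
        and c: "a \<in> carrier R" "s \<in> S" "b \<in> carrier R" "t \<in> S" "c \<in> carrier R" "w \<in> S"
        unfolding carr by blast
      note c' = c c(2,4,6)[THEN S_facts(1)]
      have "fraction R S ((a \<otimes> t \<oplus> b \<otimes> s) \<otimes> c) (s \<otimes> t \<otimes> w) =
          fraction R S (a \<otimes> c \<otimes> (t \<otimes> w) \<oplus> b \<otimes> c \<otimes> (s \<otimes> w)) (s \<otimes> w \<otimes> (t \<otimes> w))"
        using c' by (intro fraction_eqI) (simp_all add: S_facts(3) l_distr r_distr m_ac)
      then show ?thesis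
        using c' by (simp add: x localization_mult localization_add S_facts(3))
    qed
    show "\<zero>\<^bsub>?L\<^esub> \<in> carrier ?L" "\<one>\<^bsub>?L\<^esub> \<in> carrier ?L"
      by (simp_all add: simps)
    show "\<zero>\<^bsub>?L\<^esub> \<oplus>\<^bsub>?L\<^esub> x = x" "\<one>\<^bsub>?L\<^esub> \<otimes>\<^bsub>?L\<^esub> x = x" if "x \<in> carrier ?L" for x
      using that unfolding carr by (auto simp: simps)
  qed
qed

end
end

definition local_at :: "('a, 'b) ring_scheme \<Rightarrow> 'a set \<Rightarrow> ('a \<times> 'a) set ring" where
  "local_at R p = localization R (carrier R - p)"

text \<open>The residue field \<open>\<kappa>(p)\<close> is taken to be the field of fractions of \<open>R/p\<close>.\<close>

definition residue_field_at :: "('a, 'b) ring_scheme \<Rightarrow> 'a set \<Rightarrow> ('a set \<times> 'a set) set ring" where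
  "residue_field_at R p = localization (R Quot p) (carrier (R Quot p) - {\<zero>\<^bsub>R Quot p\<^esub>})"

definition to_residue_field_at ::
    "('a, 'b) ring_scheme \<Rightarrow> 'a set \<Rightarrow> 'a \<Rightarrow> ('a set \<times> 'a set) set" where
  "to_residue_field_at R p a =
     fraction (R Quot p) (carrier (R Quot p) - {\<zero>\<^bsub>R Quot p\<^esub>}) (p +>\<^bsub>R\<^esub> a) \<one>\<^bsub>R Quot p\<^esub>"


section \<open>Regular rings\<close>

definition regular_local_ring :: "('a, 'b) ring_scheme \<Rightarrow> bool" where
  "regular_local_ring R \<longleftrightarrow> (\<exists>m. noetherian_local_ring R m \<and>
     (\<exists>U. finite U \<and> U \<subseteq> carrier R \<and> enat (card U) = krull_dim R \<and> m = genideal R U))"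

definition regular_ring :: "('a, 'b) ring_scheme \<Rightarrow> bool" where
  "regular_ring R \<longleftrightarrow> cring R \<and> noetherian_ring R \<and>
     (\<forall>p\<in>spec R. regular_local_ring (local_at R p))"

definition singular_locus :: "('a, 'b) ring_scheme \<Rightarrow> 'a set set" where
  "singular_locus R = {p \<in> spec R. \<not> regular_local_ring (local_at R p)}"


section \<open>Completion\<close>

text \<open>The inverse limit of the rings \<open>R/I\<^sup>n\<close>. The transition maps send a coset of \<open>I\<^sup>n\<^sup>+\<^sup>1\<close> to the coset
  of \<open>I\<^sup>n\<close> containing it.\<close>

definition completion :: "('a, 'b) ring_scheme \<Rightarrow> 'a set \<Rightarrow> (nat \<Rightarrow> 'a set) ring" where
  "completion R I = (let Q = (\<lambda>n::nat. R Quot (I [^]\<^bsub>ideals_set R\<^esub> n)) in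
    \<lparr>carrier = {x. (\<forall>n. x n \<in> carrier (Q n)) \<and> (\<forall>n. x (Suc n) \<subseteq> x n)},
     monoid.mult = (\<lambda>x y n. x n \<otimes>\<^bsub>Q n\<^esub> y n),
     monoid.one = (\<lambda>n. \<one>\<^bsub>Q n\<^esub>),
     ring.zero = (\<lambda>n. \<zero>\<^bsub>Q n\<^esub>),
     ring.add = (\<lambda>x y n. x n \<oplus>\<^bsub>Q n\<^esub> y n)\<rparr>)"

definition to_completion :: "('a, 'b) ring_scheme \<Rightarrow> 'a set \<Rightarrow> 'a \<Rightarrow> nat \<Rightarrow> 'a set" where
  "to_completion R I a = (\<lambda>n. (I [^]\<^bsub>ideals_set R\<^esub> n) +>\<^bsub>R\<^esub> a)"

definition adically_complete :: "('a, 'b) ring_scheme \<Rightarrow> 'a set \<Rightarrow> bool" where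
  "adically_complete R I \<longleftrightarrow>
     bij_betw (to_completion R I) (carrier R) (carrier (completion R I))"

context cring begin

lemma ideal_pow_ideal: "ideal I R \<Longrightarrow> ideal (I [^]\<^bsub>ideals_set R\<^esub> (n::nat)) R"
  by (induction n) (simp_all add: nat_pow_def ideals_set_def oneideal ideal_prod_is_ideal)

lemma completion_cring:
  assumes I: "ideal I R"
  shows "cring (completion R I)"
proof -
  define J where "J = (\<lambda>n::nat. I [^]\<^bsub>ideals_set R\<^esub> n)"
  define Q where "Q = (\<lambda>n::nat. R Quot J n)"
  let ?C = "completion R I"
  have idl: "ideal (J n) R" for n
    unfolding J_def by (rule ideal_pow_ideal[OF I])
  have sub: "J (Suc n) \<subseteq> J n" for n
    using ideal_prod_inter[OF idl[of n] I] by (auto simp: J_def nat_pow_def ideals_set_def)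
  have Q: "cring (Q n)" for n
    unfolding Q_def by (rule ideal.quotient_is_cring[OF idl]) (rule is_cring)
  have C: "completion R I = \<lparr>carrier = {x. (\<forall>n. x n \<in> carrier (Q n)) \<and> (\<forall>n. x (Suc n) \<subseteq> x n)},
     monoid.mult = (\<lambda>x y n. x n \<otimes>\<^bsub>Q n\<^esub> y n), monoid.one = (\<lambda>n. \<one>\<^bsub>Q n\<^esub>),
     ring.zero = (\<lambda>n. \<zero>\<^bsub>Q n\<^esub>), ring.add = (\<lambda>x y n. x n \<oplus>\<^bsub>Q n\<^esub> y n)\<rparr>"
    unfolding completion_def Let_def Q_def J_def ..
  have cos_mono: "J (Suc n) +> a \<subseteq> J n +> a" for n a
    using sub by (auto simp: a_r_coset_def r_coset_def)
  have mult_mono: "x \<otimes>\<^bsub>Q (Suc n)\<^esub> y \<subseteq> x' \<otimes>\<^bsub>Q n\<^esub> y'" if "x \<subseteq> x'" "y \<subseteq> y'" for n x y x' y'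
    unfolding Q_def FactRing_def rcoset_mult_def monoid.simps by (intro UN_mono that cos_mono)
  have add_mono: "x \<oplus>\<^bsub>Q (Suc n)\<^esub> y \<subseteq> x' \<oplus>\<^bsub>Q n\<^esub> y'" if "x \<subseteq> x'" "y \<subseteq> y'" for n x y x' y'
    unfolding Q_def FactRing_def set_add_def set_mult_def ring.simps monoid.simps
    by (intro UN_mono that subset_refl)
  have inv: "\<exists>y\<in>carrier ?C. y \<oplus>\<^bsub>?C\<^esub> x = \<zero>\<^bsub>?C\<^esub>" if x: "x \<in> carrier ?C" for x
  proof -
    let ?y = "\<lambda>n. \<ominus>\<^bsub>Q n\<^esub> x n"
    have xn: "x n \<in> carrier (Q n)" "x (Suc n) \<subseteq> x n" for n
      using x by (auto simp: C)
    have minus: "\<ominus>\<^bsub>Q n\<^esub> (J n +> a) = J n +> \<ominus> a" if "a \<in> carrier R" for n a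
    proof -
      interpret ideal "J n" R by (rule idl)
      have "(J n +> \<ominus> a) \<oplus>\<^bsub>Q n\<^esub> (J n +> a) = \<zero>\<^bsub>Q n\<^esub>"
        using that by (simp add: Q_def FactRing_def a_rcos_sum l_neg a_rcos_const)
      moreover have "J n +> \<ominus> a \<in> carrier (Q n)" "J n +> a \<in> carrier (Q n)"
        using that a_rcosetsI[OF additive_subgroup.a_subset[OF ideal.axioms(1)[OF idl]]]
        by (simp_all add: Q_def FactRing_def)
      ultimately show ?thesis
        using abelian_group.minus_equality ring.is_abelian_group cring.axioms(1)[OF Q] by metis
    qed
    have "?y (Suc n) \<subseteq> ?y n" for n
    proof -
      obtain a where a: "a \<in> carrier R" "x (Suc n) = J (Suc n) +> a"
        using xn(1)[of "Suc n"] by (auto simp: Q_def FactRing_def A_RCOSETS_defs a_r_coset_def r_coset_def)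
      obtain b where b: "b \<in> carrier R" "x n = J n +> b"
        using xn(1)[of n] by (auto simp: Q_def FactRing_def A_RCOSETS_defs a_r_coset_def r_coset_def)
      interpret Jn: ideal "J n" R by (rule idl)
      have aS: "a \<in> J (Suc n) +> a"
        using abelian_subgroup.a_rcos_self[OF abelian_subgroupI3[OF ideal.axioms(1)[OF idl] is_abelian_group] a(1)] .
      have "a \<in> J n +> b"
        using xn(2)[of n] aS unfolding a(2) b(2) by (rule subsetD)
      then have "J n +> b = J n +> a"
        using b(1) using abelian_subgroup.a_repr_independence'[OF abelian_subgroupI3[OF ideal.axioms(1)[OF idl] is_abelian_group] _ b(1)] by blast
      then show ?thesis
        using a b minus cos_mono by simp
    qed
    moreover have "?y n \<in> carrier (Q n)" for n
      using xn(1)[of n] cring.cring_simprules(3)[OF Q] by blast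
    ultimately have "?y \<in> carrier ?C" by (simp add: C)
    moreover have "?y \<oplus>\<^bsub>?C\<^esub> x = \<zero>\<^bsub>?C\<^esub>"
      using xn(1) by (simp add: C cring.cring_simprules(9)[OF Q])
    ultimately show ?thesis by blast
  qed
  have zc: "(\<lambda>n. \<zero>\<^bsub>Q n\<^esub>) \<in> carrier ?C" and oc: "(\<lambda>n. \<one>\<^bsub>Q n\<^esub>) \<in> carrier ?C"
    using cring.cring_simprules(2,6)[OF Q] sub cos_mono by (auto simp: C Q_def FactRing_def)
  show ?thesis
  proof (intro cringI abelian_groupI comm_monoidI inv)
    show "\<zero>\<^bsub>?C\<^esub> \<in> carrier ?C" "\<one>\<^bsub>?C\<^esub> \<in> carrier ?C"
      using zc oc by (simp_all add: C)
    show "x \<oplus>\<^bsub>?C\<^esub> y \<in> carrier ?C" "x \<otimes>\<^bsub>?C\<^esub> y \<in> carrier ?C"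
      if "x \<in> carrier ?C" "y \<in> carrier ?C" for x y
      using that by (simp_all add: C cring.cring_simprules(1,5)[OF Q] mult_mono add_mono)
    show "x \<oplus>\<^bsub>?C\<^esub> y = y \<oplus>\<^bsub>?C\<^esub> x" "x \<otimes>\<^bsub>?C\<^esub> y = y \<otimes>\<^bsub>?C\<^esub> x"
      if "x \<in> carrier ?C" "y \<in> carrier ?C" for x y
      using that by (auto simp: C cring.cring_simprules(10,14)[OF Q])
    show "x \<oplus>\<^bsub>?C\<^esub> y \<oplus>\<^bsub>?C\<^esub> z = x \<oplus>\<^bsub>?C\<^esub> (y \<oplus>\<^bsub>?C\<^esub> z)"
      "x \<otimes>\<^bsub>?C\<^esub> y \<otimes>\<^bsub>?C\<^esub> z = x \<otimes>\<^bsub>?C\<^esub> (y \<otimes>\<^bsub>?C\<^esub> z)"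
      "(x \<oplus>\<^bsub>?C\<^esub> y) \<otimes>\<^bsub>?C\<^esub> z = x \<otimes>\<^bsub>?C\<^esub> z \<oplus>\<^bsub>?C\<^esub> y \<otimes>\<^bsub>?C\<^esub> z"
      if "x \<in> carrier ?C" "y \<in> carrier ?C" "z \<in> carrier ?C" for x y z
      using that by (auto simp: C cring.cring_simprules(7,11,13)[OF Q])
    show "\<zero>\<^bsub>?C\<^esub> \<oplus>\<^bsub>?C\<^esub> x = x" "\<one>\<^bsub>?C\<^esub> \<otimes>\<^bsub>?C\<^esub> x = x"
      if "x \<in> carrier ?C" for x
      using that by (auto simp: C cring.cring_simprules(8,12)[OF Q])
  qed
qed

end


section \<open>Tensor products of algebras\<close>

text \<open>The monoid ring over the integers of the product of the multiplicative monoids of \<open>B\<close> and \<open>C\<close>;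
  its additive group is the free abelian group on the pairs \<open>(b, c)\<close>.\<close>

definition pair_mult ::
    "('b, 'x) ring_scheme \<Rightarrow> ('c, 'y) ring_scheme \<Rightarrow>
     ('b \<times> 'c \<Rightarrow>\<^sub>0 int) \<Rightarrow> ('b \<times> 'c \<Rightarrow>\<^sub>0 int) \<Rightarrow> ('b \<times> 'c \<Rightarrow>\<^sub>0 int)" where
  "pair_mult B C f g =
     frag_extend (\<lambda>x. frag_extend (\<lambda>y.
       frag_of (fst x \<otimes>\<^bsub>B\<^esub> fst y, snd x \<otimes>\<^bsub>C\<^esub> snd y)) g) f"

definition pair_ring ::
    "('b, 'x) ring_scheme \<Rightarrow> ('c, 'y) ring_scheme \<Rightarrow> ('b \<times> 'c \<Rightarrow>\<^sub>0 int) ring" where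
  "pair_ring B C =
    \<lparr>carrier = {f. Poly_Mapping.keys f \<subseteq> carrier B \<times> carrier C},
     monoid.mult = pair_mult B C,
     monoid.one = frag_of (\<one>\<^bsub>B\<^esub>, \<one>\<^bsub>C\<^esub>),
     ring.zero = 0,
     ring.add = (+)\<rparr>"

lemma pair_mult_diff_left: "pair_mult B C (f - g) h = pair_mult B C f h - pair_mult B C g h"
  by (simp add: pair_mult_def frag_extend_diff)

lemma frag_extend_fun_diff: "frag_extend (\<lambda>x. p x - q x) f = frag_extend p f - frag_extend q f"
  using subset_UNIV by (induction f rule: frag_induction) (auto simp: frag_extend_diff)

lemma pair_mult_diff_right: "pair_mult B C f (g - h) = pair_mult B C f g - pair_mult B C f h"
  by (simp add: pair_mult_def frag_extend_diff frag_extend_fun_diff)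

lemma pair_mult_of:
  "pair_mult B C (frag_of (b, c)) (frag_of (b', c')) = frag_of (b \<otimes>\<^bsub>B\<^esub> b', c \<otimes>\<^bsub>C\<^esub> c')"
  by (simp add: pair_mult_def)

lemma pair_mult_0: "pair_mult B C 0 f = 0" "pair_mult B C f 0 = 0"
  using pair_mult_diff_left[of B C f f f] pair_mult_diff_left[of B C 0 0 f] pair_mult_diff_right[of B C f 0 0] by auto

lemma pair_ring_cring:
  fixes B :: "('b, 'x) ring_scheme" and C :: "('c, 'y) ring_scheme"
  assumes "cring B" "cring C"
  shows "cring (pair_ring B C)"
proof -
  interpret B: cring B by fact
  interpret C: cring C by fact
  let ?P = "pair_ring B C" and ?D = "carrier B \<times> carrier C"
  note bil = pair_mult_0 pair_mult_diff_left pair_mult_diff_right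
  have closed: "Poly_Mapping.keys (pair_mult B C f g) \<subseteq> ?D"
    if "Poly_Mapping.keys f \<subseteq> ?D" "Poly_Mapping.keys g \<subseteq> ?D" for f g
    unfolding pair_mult_def
    using that by (intro order_trans[OF keys_frag_extend] UN_least) (force simp: subset_iff)
  have comm: "pair_mult B C f g = pair_mult B C g f"
    if "Poly_Mapping.keys f \<subseteq> ?D" "Poly_Mapping.keys g \<subseteq> ?D" for f g
    using that(1)
  proof (induction f rule: frag_induction)
    case (one x)
    show ?case using that(2)
    proof (induction g rule: frag_induction)
      case (one y)
      then show ?case using \<open>x \<in> ?D\<close> by (cases x; cases y) (auto simp: pair_mult_of B.m_comm C.m_comm)
    qed (simp_all add: bil)
  qed (simp_all add: bil)
  have assoc: "pair_mult B C (pair_mult B C f g) h = pair_mult B C f (pair_mult B C g h)"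
    if "Poly_Mapping.keys f \<subseteq> ?D" "Poly_Mapping.keys g \<subseteq> ?D" "Poly_Mapping.keys h \<subseteq> ?D" for f g h
    using that(1)
  proof (induction f rule: frag_induction)
    case (one x)
    show ?case using that(2)
    proof (induction g rule: frag_induction)
      case (one y)
      show ?case using that(3)
      proof (induction h rule: frag_induction)
        case (one z)
        then show ?case using \<open>x \<in> ?D\<close> \<open>y \<in> ?D\<close>
          by (cases x; cases y; cases z) (auto simp: pair_mult_of B.m_assoc C.m_assoc)
      qed (simp_all add: bil)
    qed (simp_all add: bil)
  qed (simp_all add: bil)
  have unit: "pair_mult B C (frag_of (\<one>\<^bsub>B\<^esub>, \<one>\<^bsub>C\<^esub>)) f = f" if "Poly_Mapping.keys f \<subseteq> ?D" for f
    using that by (induction f rule: frag_induction) (auto simp: bil pair_mult_of)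
  have add: "pair_mult B C (f + g) h = pair_mult B C f h + pair_mult B C g h" for f g h
    by (simp add: pair_mult_def frag_extend_add)
  have neg: "\<exists>y. Poly_Mapping.keys y \<subseteq> ?D \<and> y + f = 0" if "Poly_Mapping.keys f \<subseteq> ?D" for f :: "'b \<times> 'c \<Rightarrow>\<^sub>0 int"
    using that by (intro exI[of _ "- f"]) auto
  have plus: "Poly_Mapping.keys (f + g) \<subseteq> ?D"
    if "Poly_Mapping.keys f \<subseteq> ?D" "Poly_Mapping.keys g \<subseteq> ?D" for f g :: "'b \<times> 'c \<Rightarrow>\<^sub>0 int"
    using that keys_add[of f g] by blast
  show ?thesis
    by (intro cringI abelian_groupI comm_monoidI)
      (simp_all add: pair_ring_def closed plus assoc unit add neg add.assoc, simp_all add: comm add.commute)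
qed

text \<open>The relations defining \<open>B \<otimes>\<^sub>A C\<close>. They are stable under multiplication by pairs, so the ideal
  generated by them is the subgroup generated by them.\<close>

definition tensor_relations ::
    "('a, 'w) ring_scheme \<Rightarrow> ('b, 'x) ring_scheme \<Rightarrow> ('c, 'y) ring_scheme \<Rightarrow>
     ('a \<Rightarrow> 'b) \<Rightarrow> ('a \<Rightarrow> 'c) \<Rightarrow> ('b \<times> 'c \<Rightarrow>\<^sub>0 int) set" where
  "tensor_relations A B C f g =
     {frag_of (b \<oplus>\<^bsub>B\<^esub> b', c) - frag_of (b, c) - frag_of (b', c) | b b' c.
        b \<in> carrier B \<and> b' \<in> carrier B \<and> c \<in> carrier C}
   \<union> {frag_of (b, c \<oplus>\<^bsub>C\<^esub> c') - frag_of (b, c) - frag_of (b, c') | b c c'.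
        b \<in> carrier B \<and> c \<in> carrier C \<and> c' \<in> carrier C}
   \<union> {frag_of (f a \<otimes>\<^bsub>B\<^esub> b, c) - frag_of (b, g a \<otimes>\<^bsub>C\<^esub> c) | a b c.
        a \<in> carrier A \<and> b \<in> carrier B \<and> c \<in> carrier C}"

definition tensor_ideal ::
    "('a, 'w) ring_scheme \<Rightarrow> ('b, 'x) ring_scheme \<Rightarrow> ('c, 'y) ring_scheme \<Rightarrow>
     ('a \<Rightarrow> 'b) \<Rightarrow> ('a \<Rightarrow> 'c) \<Rightarrow> ('b \<times> 'c \<Rightarrow>\<^sub>0 int) set" where
  "tensor_ideal A B C f g = genideal (pair_ring B C) (tensor_relations A B C f g)"

definition tensor_ring ::
    "('a, 'w) ring_scheme \<Rightarrow> ('b, 'x) ring_scheme \<Rightarrow> ('c, 'y) ring_scheme \<Rightarrow>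
     ('a \<Rightarrow> 'b) \<Rightarrow> ('a \<Rightarrow> 'c) \<Rightarrow> ('b \<times> 'c \<Rightarrow>\<^sub>0 int) set ring" where
  "tensor_ring A B C f g = pair_ring B C Quot tensor_ideal A B C f g"

lemma tensor_relations_subset:
  fixes B :: "('b, 'x) ring_scheme" and C :: "('c, 'y) ring_scheme"
  assumes "cring B" "cring C" "f \<in> ring_hom A B" "g \<in> ring_hom A C"
  shows "tensor_relations A B C f g \<subseteq> carrier (pair_ring B C)"
proof -
  interpret B: cring B by fact
  interpret C: cring C by fact
  have diff: "Poly_Mapping.keys (x - y) \<subseteq> D" if "Poly_Mapping.keys x \<subseteq> D" "Poly_Mapping.keys y \<subseteq> D"
    for x y :: "'b \<times> 'c \<Rightarrow>\<^sub>0 int" and D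
    using that keys_diff[of x y] by (meson Un_least order_trans)
  have of: "Poly_Mapping.keys (frag_of x) \<subseteq> D" if "x \<in> D" for x :: "'b \<times> 'c" and D
    using that by simp
  show ?thesis
    unfolding tensor_relations_def pair_ring_def
    by (simp, intro conjI subsetI; elim CollectE exE conjE; simp only: mem_Collect_eq;
        intro diff of SigmaI B.add.m_closed[simplified] C.add.m_closed[simplified] B.m_closed C.m_closed
          ring_hom_closed[OF assms(3)] ring_hom_closed[OF assms(4)]; assumption)
qed

lemma tensor_ring_cring:
  assumes "cring B" "cring C" "f \<in> ring_hom A B" "g \<in> ring_hom A C"
  shows "cring (tensor_ring A B C f g)"
  unfolding tensor_ring_def tensor_ideal_def
  using ideal.quotient_is_cring ring.genideal_ideal pair_ring_cring tensor_relations_subset assms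
    cring.axioms(1) by metis

definition to_tensor_right ::
    "('a, 'w) ring_scheme \<Rightarrow> ('b, 'x) ring_scheme \<Rightarrow> ('c, 'y) ring_scheme \<Rightarrow>
     ('a \<Rightarrow> 'b) \<Rightarrow> ('a \<Rightarrow> 'c) \<Rightarrow> 'c \<Rightarrow> ('b \<times> 'c \<Rightarrow>\<^sub>0 int) set" where
  "to_tensor_right A B C f g c = tensor_ideal A B C f g +>\<^bsub>pair_ring B C\<^esub> frag_of (\<one>\<^bsub>B\<^esub>, c)"


section \<open>Excellent rings\<close>

text \<open>An algebra over \<open>R\<close> is given by a ring \<open>S\<close> and its structure map \<open>h\<close>.\<close>

definition finite_type_algebra ::
    "('a, 'b) ring_scheme \<Rightarrow> ('c, 'd) ring_scheme \<Rightarrow> ('a \<Rightarrow> 'c) \<Rightarrow> bool" where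
  "finite_type_algebra R S h \<longleftrightarrow> cring S \<and> h \<in> ring_hom R S \<and>
     (\<exists>U. finite U \<and> U \<subseteq> carrier S \<and> generate_ring S (h ` carrier R \<union> U) = carrier S)"

definition finite_field_extension ::
    "('a, 'b) ring_scheme \<Rightarrow> ('c, 'd) ring_scheme \<Rightarrow> ('a \<Rightarrow> 'c) \<Rightarrow> bool" where
  "finite_field_extension K L h \<longleftrightarrow> field K \<and> field L \<and> h \<in> ring_hom K L \<and>
     ring.finite_dimension L (h ` carrier K) (carrier L)"

text \<open>Here \<open>n\<close> is the number of primes in a maximal chain from \<open>p\<close> to \<open>q\<close>.\<close>

definition catenary :: "('a, 'b) ring_scheme \<Rightarrow> bool" where
  "catenary R \<longleftrightarrow> (\<forall>p\<in>spec R. \<forall>q\<in>spec R. p \<subseteq> q \<longrightarrow>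
     (\<exists>n. \<forall>ps. ps \<noteq> [] \<and> sorted_wrt (\<subset>) ps \<and> set ps \<subseteq> spec R \<and> hd ps = p \<and> last ps = q \<longrightarrow>
        length ps \<le> n \<and>
        ((\<forall>i. Suc i < length ps \<longrightarrow> \<not> (\<exists>r\<in>spec R. ps ! i \<subset> r \<and> r \<subset> ps ! Suc i)) \<longrightarrow>
          length ps = n)))"

text \<open>In the next three definitions a class of algebras over a ring is quantified over through their
  representatives on one fixed carrier type, because HOL cannot quantify over types. The type is
  large enough: an algebra of finite type over \<open>R\<close> is an image of the set of formal sums of terms
  \<open>a x\<^sub>1\<^sup>i \<dots> x\<^sub>n\<^sup>j\<close>, which are coded as lists of pairs \<open>(a, [i, \<dots>, j])\<close>, and a finite extension of
  \<open>K\<close> is an image of the set of coordinate lists.\<close>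

definition universally_catenary :: "('a, 'b) ring_scheme \<Rightarrow> bool" where
  "universally_catenary R \<longleftrightarrow>
     (\<forall>(S :: ('a \<times> nat list) list ring) h. finite_type_algebra R S h \<longrightarrow> catenary S)"

definition J2_ring :: "('a, 'b) ring_scheme \<Rightarrow> bool" where
  "J2_ring R \<longleftrightarrow>
     (\<forall>(S :: ('a \<times> nat list) list ring) h. finite_type_algebra R S h \<longrightarrow>
        (\<exists>I. ideal I S \<and> singular_locus S = {p \<in> spec S. I \<subseteq> p}))"

definition geometrically_regular ::
    "('k, 'x) ring_scheme \<Rightarrow> ('c, 'y) ring_scheme \<Rightarrow> ('k \<Rightarrow> 'c) \<Rightarrow> bool" where
  "geometrically_regular K C g \<longleftrightarrow>
     (\<forall>(L :: 'k list ring) h. finite_field_extension K L h \<longrightarrow>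
        regular_ring (tensor_ring K C L g h))"

text \<open>For a local ring \<open>A\<close> with maximal ideal \<open>m\<close> and a prime \<open>q\<close> of \<open>A\<close>: the tensor product over \<open>A\<close>
  of the completion of \<open>A\<close> with \<open>\<kappa>(q)\<close>, which is an algebra over \<open>\<kappa>(q)\<close> through its right
  factor.\<close>

definition formal_fibre where
  "formal_fibre A m q = tensor_ring A (completion A m) (residue_field_at A q)
     (to_completion A m) (to_residue_field_at A q)"

definition to_formal_fibre where
  "to_formal_fibre A m q = to_tensor_right A (completion A m) (residue_field_at A q)
     (to_completion A m) (to_residue_field_at A q)"

definition G_ring :: "('a, 'b) ring_scheme \<Rightarrow> bool" where
  "G_ring R \<longleftrightarrow>
     (\<forall>p\<in>spec R. \<forall>m. maximalideal m (local_at R p) \<longrightarrow>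
        (\<forall>q\<in>spec (local_at R p).
           geometrically_regular (residue_field_at (local_at R p) q)
             (formal_fibre (local_at R p) m q) (to_formal_fibre (local_at R p) m q)))"

definition excellent :: "('a, 'b) ring_scheme \<Rightarrow> bool" where
  "excellent R \<longleftrightarrow>
     cring R \<and> noetherian_ring R \<and> universally_catenary R \<and> G_ring R \<and> J2_ring R"


section \<open>Maximal Cohen--Macaulay modules\<close>

definition finitely_generated :: "('a, 'b) ring_scheme \<Rightarrow> ('a, 'c) module \<Rightarrow> bool" where
  "finitely_generated R M \<longleftrightarrow>
     (\<exists>U. finite U \<and> U \<subseteq> carrier M \<and>
        (\<forall>N. submodule N R M \<and> U \<subseteq> N \<longrightarrow> N = carrier M))"

text \<open>The submodule \<open>(x\<^sub>1, \<dots>, x\<^sub>n)M\<close>.\<close>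

primrec seq_mult :: "('a, 'c) module \<Rightarrow> 'a list \<Rightarrow> 'c set" where
  "seq_mult M [] = {\<zero>\<^bsub>M\<^esub>}"
| "seq_mult M (x # xs) = {x \<odot>\<^bsub>M\<^esub> u \<oplus>\<^bsub>M\<^esub> v | u v. u \<in> carrier M \<and> v \<in> seq_mult M xs}"

definition regular_sequence :: "('a, 'b) ring_scheme \<Rightarrow> ('a, 'c) module \<Rightarrow> 'a list \<Rightarrow> bool" where
  "regular_sequence R M xs \<longleftrightarrow>
     set xs \<subseteq> carrier R \<and>
     (\<forall>i < length xs. \<forall>u \<in> carrier M.
        xs ! i \<odot>\<^bsub>M\<^esub> u \<in> seq_mult M (take i xs) \<longrightarrow> u \<in> seq_mult M (take i xs)) \<and>
     seq_mult M xs \<noteq> carrier M"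

definition maximal_CM :: "('a, 'b) ring_scheme \<Rightarrow> 'a set \<Rightarrow> ('a, 'c) module \<Rightarrow> bool" where
  "maximal_CM R m M \<longleftrightarrow> module R M \<and> carrier M \<noteq> {\<zero>\<^bsub>M\<^esub>} \<and> finitely_generated R M \<and>
     (\<exists>xs. set xs \<subseteq> m \<and> enat (length xs) = krull_dim R \<and> regular_sequence R M xs)"

definition self_module :: "('a, 'b) ring_scheme \<Rightarrow> ('a, 'a) module" where
  "self_module R =
    \<lparr>carrier = carrier R, monoid.mult = monoid.mult R, monoid.one = \<one>\<^bsub>R\<^esub>, ring.zero = \<zero>\<^bsub>R\<^esub>,
     ring.add = add R, smult = monoid.mult R\<rparr>"

definition cohen_macaulay_ring :: "('a, 'b) ring_scheme \<Rightarrow> 'a set \<Rightarrow> bool" where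
  "cohen_macaulay_ring R m \<longleftrightarrow> noetherian_local_ring R m \<and> maximal_CM R m (self_module R)"

definition module_iso ::
    "('a, 'b) ring_scheme \<Rightarrow> ('a, 'c) module \<Rightarrow> ('a, 'd) module \<Rightarrow> ('c \<Rightarrow> 'd) set" where
  "module_iso R M N = {h. bij_betw h (carrier M) (carrier N) \<and>
     (\<forall>u\<in>carrier M. \<forall>v\<in>carrier M. h (u \<oplus>\<^bsub>M\<^esub> v) = h u \<oplus>\<^bsub>N\<^esub> h v) \<and>
     (\<forall>a\<in>carrier R. \<forall>u\<in>carrier M. h (a \<odot>\<^bsub>M\<^esub> u) = a \<odot>\<^bsub>N\<^esub> h u)}"

text \<open>Every finitely generated \<open>R\<close>-module is isomorphic to one whose elements are lists over \<open>R\<close>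
  (coordinates with respect to generators), see \<open>ex_list_module\<close> below; so the modules
  on that carrier type represent all isomorphism classes.\<close>

definition MCM_modules :: "('a, 'b) ring_scheme \<Rightarrow> 'a set \<Rightarrow> ('a, 'a list) module set" where
  "MCM_modules R m = {M. maximal_CM R m M}"

definition module_iso_rel ::
    "('a, 'b) ring_scheme \<Rightarrow> ('a, 'c) module set \<Rightarrow> (('a, 'c) module \<times> ('a, 'c) module) set" where
  "module_iso_rel R \<M> = {(M, N). M \<in> \<M> \<and> N \<in> \<M> \<and> module_iso R M N \<noteq> {}}"

definition countable_CM_type :: "('a, 'b) ring_scheme \<Rightarrow> 'a set \<Rightarrow> bool" where
  "countable_CM_type R m \<longleftrightarrow>
     cohen_macaulay_ring R m \<and>
     countable (MCM_modules R m // module_iso_rel R (MCM_modules R m))"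

lemma (in module) ex_list_cover:
  assumes "finite U" "U \<subseteq> carrier M"
  shows "\<exists>N (f :: 'a list \<Rightarrow> 'c). submodule N R M \<and> U \<subseteq> N \<and> N \<subseteq> range f"
  using assms
proof (induction U rule: finite_induct)
  case empty
  have "submodule {\<zero>\<^bsub>M\<^esub>} R M"
    by (rule submoduleI) auto
  then show ?case by (intro exI[of _ "{\<zero>\<^bsub>M\<^esub>}"] exI[of _ "\<lambda>_. \<zero>\<^bsub>M\<^esub>"]) auto
next
  case (insert x U)
  then obtain N and f :: "'a list \<Rightarrow> 'c"
    where N: "submodule N R M" and UN: "U \<subseteq> N" and f: "N \<subseteq> range f" by auto
  note Nf = submoduleE[OF N]
  have x: "x \<in> carrier M" using insert by auto
  let ?N = "{a \<odot>\<^bsub>M\<^esub> x \<oplus>\<^bsub>M\<^esub> v | a v. a \<in> carrier R \<and> v \<in> N}"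
  let ?f = "\<lambda>l. hd l \<odot>\<^bsub>M\<^esub> x \<oplus>\<^bsub>M\<^esub> f (tl l)"
  have Nc: "v \<in> carrier M" if "v \<in> N" for v using Nf(1) that by auto
  have z: "\<zero>\<^bsub>M\<^esub> \<in> N" using N by (simp add: submodule_def subgroup_def)
  have "submodule ?N R M"
  proof (rule submoduleI)
    show "?N \<subseteq> carrier M" using Nc x by auto
    show "\<zero>\<^bsub>M\<^esub> \<in> ?N" using x z by (auto intro!: exI[of _ \<zero>] exI[of _ "\<zero>\<^bsub>M\<^esub>"])
  next
    fix u assume "u \<in> ?N"
    then obtain a v where u: "u = a \<odot>\<^bsub>M\<^esub> x \<oplus>\<^bsub>M\<^esub> v" "a \<in> carrier R" "v \<in> N" by auto
    have "\<ominus>\<^bsub>M\<^esub> u = (\<ominus> a) \<odot>\<^bsub>M\<^esub> x \<oplus>\<^bsub>M\<^esub> (\<ominus>\<^bsub>M\<^esub> v)"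
      using u x Nc by (simp add: M.minus_add smult_l_minus)
    then show "\<ominus>\<^bsub>M\<^esub> u \<in> ?N" using u Nf(3) by blast
  next
    fix u u' assume "u \<in> ?N" "u' \<in> ?N"
    then obtain a v a' v' where u: "u = a \<odot>\<^bsub>M\<^esub> x \<oplus>\<^bsub>M\<^esub> v" "a \<in> carrier R" "v \<in> N"
      "u' = a' \<odot>\<^bsub>M\<^esub> x \<oplus>\<^bsub>M\<^esub> v'" "a' \<in> carrier R" "v' \<in> N" by auto
    have "u \<oplus>\<^bsub>M\<^esub> u' = (a \<oplus> a') \<odot>\<^bsub>M\<^esub> x \<oplus>\<^bsub>M\<^esub> (v \<oplus>\<^bsub>M\<^esub> v')"
      using u x Nc by (simp add: smult_l_distr M.a_ac)
    then show "u \<oplus>\<^bsub>M\<^esub> u' \<in> ?N" using u Nf(5) by blast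
  next
    fix b u assume b: "b \<in> carrier R" and "u \<in> ?N"
    then obtain a v where u: "u = a \<odot>\<^bsub>M\<^esub> x \<oplus>\<^bsub>M\<^esub> v" "a \<in> carrier R" "v \<in> N" by auto
    have "b \<odot>\<^bsub>M\<^esub> u = (b \<otimes> a) \<odot>\<^bsub>M\<^esub> x \<oplus>\<^bsub>M\<^esub> (b \<odot>\<^bsub>M\<^esub> v)"
      using u x b Nc by (simp add: smult_r_distr smult_assoc1)
    then show "b \<odot>\<^bsub>M\<^esub> u \<in> ?N" using u b Nf(4) by blast
  qed
  moreover have "insert x U \<subseteq> ?N"
  proof
    fix u assume "u \<in> insert x U"
    then have "u = \<one> \<odot>\<^bsub>M\<^esub> x \<oplus>\<^bsub>M\<^esub> \<zero>\<^bsub>M\<^esub> \<or> u = \<zero> \<odot>\<^bsub>M\<^esub> x \<oplus>\<^bsub>M\<^esub> u \<and> u \<in> N"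
      using x UN Nc by auto
    then show "u \<in> ?N" using z by blast
  qed
  moreover have "?N \<subseteq> range ?f"
  proof
    fix u assume "u \<in> ?N"
    then obtain a v where u: "u = a \<odot>\<^bsub>M\<^esub> x \<oplus>\<^bsub>M\<^esub> v" "v \<in> N" by auto
    then obtain l where "v = f l" using f by auto
    then have "u = ?f (a # l)" using u by simp
    then show "u \<in> range ?f" by blast
  qed
  ultimately show ?case by blast
qed

lemma ex_list_module:
  fixes M :: "('a, 'c) module"
  assumes M: "module R M" and fg: "finitely_generated R M"
  shows "\<exists>N :: ('a, 'a list) module. module R N \<and> module_iso R M N \<noteq> {}"
proof -
  interpret module R M by fact
  obtain f :: "'a list \<Rightarrow> 'c" where f: "carrier M \<subseteq> range f"
    using fg ex_list_cover unfolding finitely_generated_def by metis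
  define j where "j = inv_into UNIV f"
  have fj [simp]: "f (j u) = u" if "u \<in> carrier M" for u
    using that f unfolding j_def by (auto intro: f_inv_into_f)
  define N :: "('a, 'a list) module" where
    "N = \<lparr>carrier = j ` carrier M, monoid.mult = undefined, monoid.one = undefined,
      ring.zero = j \<zero>\<^bsub>M\<^esub>, ring.add = (\<lambda>l l'. j (f l \<oplus>\<^bsub>M\<^esub> f l')),
      module.smult = (\<lambda>a l. j (a \<odot>\<^bsub>M\<^esub> f l))\<rparr>"
  have "abelian_group N"
  proof (rule abelian_groupI)
    show "\<exists>y\<in>carrier N. y \<oplus>\<^bsub>N\<^esub> x = \<zero>\<^bsub>N\<^esub>" if "x \<in> carrier N" for x
    proof -
      from that obtain u where u: "u \<in> carrier M" "x = j u" by (auto simp: N_def)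
      show ?thesis
        by (rule bexI[of _ "j (\<ominus>\<^bsub>M\<^esub> u)"]) (use u in \<open>auto simp: N_def M.l_neg\<close>)
    qed
  qed (auto simp: N_def M.a_ac)
  then have "module R N"
    by (intro moduleI R.is_cring)
      (auto simp: N_def smult_l_distr smult_r_distr smult_assoc1)
  moreover have "j \<in> module_iso R M N"
    by (auto simp: module_iso_def N_def bij_betw_def intro!: inj_on_inverseI[of _ f])
  ultimately show ?thesis by blast
qed

end

theory Submission
  imports Defs
begin

text \<open>Let \<open>q\<close> be a prime in the singular locus and \<open>M\<close> the \<open>d\<close>-th syzygy of \<open>R/q\<close>, which is maximal
  Cohen--Macaulay or zero. The ideal of all \<open>a\<close> such that multiplication by \<open>a\<close> on \<open>M\<close> factors through
  a free module depends only on the isomorphism class of \<open>M\<close>, and it equals \<open>q\<close>: elements of \<open>q\<close>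
  annihilate \<open>R/q\<close>, hence act stably trivially on its syzygies, while an \<open>a \<notin> q\<close> in this ideal would
  make \<open>M\<close> projective over \<open>R\<^sub>q\<close>, so that the residue field of \<open>R\<^sub>q\<close> has finite projective dimension
  and \<open>R\<^sub>q\<close> is regular by Serre's theorem. Therefore the singular locus is countable. If it contained
  \<open>p\<close> with primes \<open>p \<subset> p' \<subset> p''\<close>, then countable prime avoidance gives an \<open>f \<in> m\<close> outside all primes
  other than \<open>m\<close> in the singular locus, and Krull's principal ideal theorem gives a prime \<open>P \<noteq> m\<close>
  containing \<open>p\<close> and \<open>f\<close>. As the singular locus is closed, \<open>P\<close> lies in it, a contradiction.\<close>

section \<open>Commutative algebra\<close>

subsection \<open>Ideals\<close>

text \<open>A high syzygy of \<open>R/q\<close> lies in a free module, where the ordinary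
  annihilator can no longer tell \<open>q\<close>; the stable annihilator survives the passage to
  syzygies. The number of steps is \<open>d\<close> because each embedding into a free module gains
  one element of a regular sequence. Homological algebra enters without Ext and Tor. A module is
  given by a presentation, and projectivity, finite projective dimension and Schanuel's lemma are
  phrased with one relation \<open>stab\<close>: a splitting up to a map through a free module. It
  passes from modules to their syzygies, and its projectivity case also to quotient rings and
  localizations. This carries Serre's theorem, proved by descent to \<open>R/x\<close> for a
  nonzerodivisor \<open>x\<close> in \<open>m\<close> outside the square of \<open>m\<close>, with
  depth zero as the base case. The descents to \<open>R/x\<close> apply an induction hypothesis to a
  new ring, so quotients are rebuilt on the carrier type of \<open>R\<close>. Closedness of the
  singular locus is the J-2 condition applied to a copy of \<open>R\<close>.\<close>

context cring begin

lemma ideal_by: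
  assumes "I \<subseteq> carrier R" "\<zero> \<in> I" "\<And>x y. x \<in> I \<Longrightarrow> y \<in> I \<Longrightarrow> x \<oplus> y \<in> I"
    "\<And>a x. a \<in> carrier R \<Longrightarrow> x \<in> I \<Longrightarrow> a \<otimes> x \<in> I"
  shows "ideal I R"
proof (rule idealI)
  show "ring R" by (rule ring_axioms)
  have neg: "\<ominus> x \<in> I" if "x \<in> I" for x
  proof -
    have "x \<in> carrier R" using that assms(1) by auto
    then have "\<ominus> x = (\<ominus> \<one>) \<otimes> x" by (simp add: l_minus)
    with assms(4)[of "\<ominus> \<one>" x] that show ?thesis by simp
  qed
  show "subgroup I (add_monoid R)"
    using assms neg by (intro add.subgroupI) (auto simp: a_inv_def)
  show "x \<otimes> a \<in> I" if "a \<in> I" "x \<in> carrier R" for a x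
    using assms that by blast
  then show "a \<otimes> x \<in> I" if "a \<in> I" "x \<in> carrier R" for a x
    using that assms(1) m_comm[of a x] by auto
qed

lemma ideal_carrier: "ideal I R \<Longrightarrow> x \<in> I \<Longrightarrow> x \<in> carrier R"
  by (rule ideal.Icarr)

lemma ideal_subset: "ideal I R \<Longrightarrow> I \<subseteq> carrier R"
  using ideal_carrier by blast

lemma ideal_zero: "ideal I R \<Longrightarrow> \<zero> \<in> I"
  by (simp add: additive_subgroup.zero_closed ideal.axioms(1))

lemma ideal_add: "ideal I R \<Longrightarrow> x \<in> I \<Longrightarrow> y \<in> I \<Longrightarrow> x \<oplus> y \<in> I"
  by (simp add: additive_subgroup.a_closed ideal.axioms(1))

lemma ideal_minus: "ideal I R \<Longrightarrow> x \<in> I \<Longrightarrow> \<ominus> x \<in> I"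
  by (simp add: additive_subgroup.a_inv_closed ideal.axioms(1) ring_axioms)

lemma ideal_diff: "ideal I R \<Longrightarrow> x \<in> I \<Longrightarrow> y \<in> I \<Longrightarrow> x \<ominus> y \<in> I"
  by (simp add: a_minus_def ideal_add ideal_minus)

lemma ideal_lmult: "ideal I R \<Longrightarrow> a \<in> carrier R \<Longrightarrow> x \<in> I \<Longrightarrow> a \<otimes> x \<in> I"
  by (simp add: ideal.I_l_closed)

lemma ideal_rmult: "ideal I R \<Longrightarrow> a \<in> carrier R \<Longrightarrow> x \<in> I \<Longrightarrow> x \<otimes> a \<in> I"
  by (simp add: ideal.I_r_closed)

lemmas ideal_rules = ideal_zero ideal_add ideal_minus ideal_diff ideal_lmult ideal_rmult

lemma ideal_add_cancel:
  assumes "ideal I R" "x \<in> I" "y \<in> carrier R" "x \<oplus> y \<in> I" shows "y \<in> I"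
proof -
  have x: "x \<in> carrier R" using assms ideal_carrier by blast
  have "(x \<oplus> y) \<ominus> x \<in> I" using assms ideal_diff by blast
  moreover have "(x \<oplus> y) \<ominus> x = y" using x assms(3) by algebra
  ultimately show ?thesis by simp
qed

lemma ideal_one: "ideal I R \<Longrightarrow> \<one> \<in> I \<Longrightarrow> I = carrier R"
  by (simp add: ideal.one_imp_carrier)

lemma ideal_unit: "ideal I R \<Longrightarrow> u \<in> I \<Longrightarrow> u \<in> Units R \<Longrightarrow> I = carrier R"
  using ideal_lmult[of I "inv u" u] ideal_one[of I] by (simp add: Units_l_inv)

text \<open>The ideal \<open>I + Rx\<close>. The explicit form splits each member into a part in
  \<open>I\<close> and a multiple of \<open>x\<close>.\<close>

definition adj :: "'a set \<Rightarrow> 'a \<Rightarrow> 'a set" where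
  "adj I x = {i \<oplus> a \<otimes> x | i a. i \<in> I \<and> a \<in> carrier R}"

lemma adj_ideal:
  assumes I: "ideal I R" and x: "x \<in> carrier R" shows "ideal (adj I x) R"
proof (rule ideal_by)
  note c = ideal_carrier[OF I]
  show "adj I x \<subseteq> carrier R" using c x by (auto simp: adj_def)
  have "\<zero> = \<zero> \<oplus> \<zero> \<otimes> x" using x by simp
  then show "\<zero> \<in> adj I x" unfolding adj_def using ideal_zero[OF I] by blast
  fix u v a assume uv: "u \<in> adj I x"
  from uv obtain i b where u: "u = i \<oplus> b \<otimes> x" "i \<in> I" "b \<in> carrier R" by (auto simp: adj_def)
  { assume "v \<in> adj I x"
    then obtain j d where v: "v = j \<oplus> d \<otimes> x" "j \<in> I" "d \<in> carrier R" by (auto simp: adj_def)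
    have "i \<in> carrier R" "j \<in> carrier R" using c u v by auto
    then have "u \<oplus> v = (i \<oplus> j) \<oplus> (b \<oplus> d) \<otimes> x"
      unfolding u(1) v(1) using u(3) v(3) x by algebra
    then show "u \<oplus> v \<in> adj I x" unfolding adj_def using u v ideal_add[OF I] by blast }
  { assume a: "a \<in> carrier R"
    have "a \<otimes> u = a \<otimes> i \<oplus> (a \<otimes> b) \<otimes> x" using u a x c by (simp add: r_distr m_assoc)
    then show "a \<otimes> u \<in> adj I x" unfolding adj_def using u a ideal_lmult[OF I] by blast }
qed

lemma adj_sup: assumes I: "ideal I R" and x: "x \<in> carrier R" shows "I \<subseteq> adj I x"
proof
  fix i assume "i \<in> I"
  then have "i = i \<oplus> \<zero> \<otimes> x" using ideal_carrier[OF I] x by simp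
  then show "i \<in> adj I x" unfolding adj_def using \<open>i \<in> I\<close> by blast
qed

lemma adj_mem: assumes I: "ideal I R" and x: "x \<in> carrier R" shows "x \<in> adj I x"
proof -
  have "x = \<zero> \<oplus> \<one> \<otimes> x" using x by simp
  then show ?thesis unfolding adj_def using ideal_zero[OF I] by blast
qed

lemma adj_least:
  assumes I: "ideal I R" and J: "ideal J R" "I \<subseteq> J" "x \<in> J" shows "adj I x \<subseteq> J"
  using J ideal_add[OF J(1)] ideal_lmult[OF J(1)] by (auto simp: adj_def)

lemma primeideal_ideal: "primeideal p R \<Longrightarrow> ideal p R"
  by (simp add: primeideal_def)

lemma primeideal_one: "primeideal p R \<Longrightarrow> \<one> \<notin> p"
  using primeideal.I_notcarr ideal_one primeideal_ideal by metis

lemma primeideal_mult: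
  "primeideal p R \<Longrightarrow> a \<in> carrier R \<Longrightarrow> b \<in> carrier R \<Longrightarrow> a \<otimes> b \<in> p \<longleftrightarrow> a \<in> p \<or> b \<in> p"
  using primeideal.I_prime ideal_lmult ideal_rmult primeideal_ideal by metis

lemma primeideal_pow:
  "primeideal p R \<Longrightarrow> a \<in> carrier R \<Longrightarrow> a [^] (n::nat) \<in> p \<Longrightarrow> a \<in> p"
  by (induction n) (auto simp: primeideal_mult dest: primeideal_one)

end

subsection \<open>Noetherian rings\<close>

text \<open>The Noetherian condition in the form used throughout: a nonempty chain of ideals
  contains its own union, so Zorn's lemma applies to an arbitrary property \<open>P\<close>.\<close>

lemma (in noetherian_ring) maximal_ideal_in:
  assumes "ideal J R" "P J"
  obtains M where "ideal M R" "P M" "J \<subseteq> M" "\<And>I. ideal I R \<Longrightarrow> P I \<Longrightarrow> M \<subseteq> I \<Longrightarrow> I = M"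
proof -
  let ?S = "{I. ideal I R \<and> P I \<and> J \<subseteq> I}"
  have "\<exists>M\<in>?S. \<forall>I\<in>?S. M \<subseteq> I \<longrightarrow> I = M"
  proof (rule subset_Zorn)
    fix C assume C: "subset.chain ?S C"
    show "\<exists>U\<in>?S. \<forall>Y\<in>C. Y \<subseteq> U"
    proof (cases "C = {}")
      case False
      have "subset.chain {I. ideal I R} C" using C by (auto simp: subset.chain_def)
      then have "\<Union>C \<in> C" using ideal_chain_is_trivial False by blast
      moreover have "C \<subseteq> ?S" using C by (auto simp: subset.chain_def)
      ultimately show ?thesis by blast
    qed (use assms in auto)
  qed
  then obtain M where M: "ideal M R" "P M" "J \<subseteq> M" and max: "\<And>I. I \<in> ?S \<Longrightarrow> M \<subseteq> I \<Longrightarrow> I = M" by auto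
  show thesis
  proof (rule that[OF M])
    fix I assume "ideal I R" "P I" "M \<subseteq> I"
    with M(3) show "I = M" by (intro max) auto
  qed
qed

locale noetherian_cring = cring R + noetherian_ring R for R (structure)

context noetherian_cring begin

lemma noetherian_ideal_induct [consumes 1, case_names step]:
  assumes "ideal J R"
    and step: "\<And>J. ideal J R \<Longrightarrow> (\<And>I. ideal I R \<Longrightarrow> J \<subset> I \<Longrightarrow> P I) \<Longrightarrow> P J"
  shows "P J"
proof (rule ccontr)
  assume "\<not> P J"
  from maximal_ideal_in[of J "\<lambda>I. \<not> P I", OF assms(1) this]
  obtain M where M: "ideal M R" "\<not> P M" "\<And>I. ideal I R \<Longrightarrow> \<not> P I \<Longrightarrow> M \<subseteq> I \<Longrightarrow> I = M" by metis
  have "P I" if "ideal I R" "M \<subset> I" for I using M(3)[of I] that by auto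
  then show False using step[OF M(1)] M(2) by blast
qed

lemma proper_ideal_in_maximal:
  assumes "ideal I R" "I \<noteq> carrier R"
  shows "\<exists>M. maximalideal M R \<and> I \<subseteq> M"
proof -
  from maximal_ideal_in[of I "\<lambda>J. J \<noteq> carrier R", OF assms]
  obtain M where M: "ideal M R" "M \<noteq> carrier R" "I \<subseteq> M"
    "\<And>J. ideal J R \<Longrightarrow> J \<noteq> carrier R \<Longrightarrow> M \<subseteq> J \<Longrightarrow> J = M" by metis
  have "maximalideal M R"
    by (rule maximalidealI) (use M in auto)
  with M show ?thesis by blast
qed

text \<open>The standard source of primes: an annihilator of a single element modulo \<open>J\<close> that is maximal
  among these.\<close>

lemma ex_prime_colon:
  assumes J: "ideal J R" and z0: "z0 \<in> carrier R" "z0 \<notin> J"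
  shows "\<exists>z\<in>carrier R. z \<notin> J \<and> primeideal {r \<in> carrier R. r \<otimes> z \<in> J} R
    \<and> {r \<in> carrier R. r \<otimes> z0 \<in> J} \<subseteq> {r \<in> carrier R. r \<otimes> z \<in> J}
    \<and> (\<forall>y\<in>carrier R. y \<notin> J \<longrightarrow> {r \<in> carrier R. r \<otimes> z \<in> J} \<subseteq> {r \<in> carrier R. r \<otimes> y \<in> J} \<longrightarrow>
      {r \<in> carrier R. r \<otimes> y \<in> J} = {r \<in> carrier R. r \<otimes> z \<in> J})"
proof -
  define A where "A = (\<lambda>z. {r \<in> carrier R. r \<otimes> z \<in> J})"
  have A: "ideal (A z) R" if "z \<in> carrier R" for z
    using that J by (intro ideal_by) (auto simp: A_def l_distr m_assoc intro: ideal_rules)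
  from maximal_ideal_in[of "A z0" "\<lambda>I. \<exists>z\<in>carrier R. z \<notin> J \<and> I = A z"] A z0
  obtain z where z: "z \<in> carrier R" "z \<notin> J" "A z0 \<subseteq> A z"
    and max: "\<And>y. y \<in> carrier R \<Longrightarrow> y \<notin> J \<Longrightarrow> A z \<subseteq> A y \<Longrightarrow> A y = A z"
    by (smt (verit, best))
  have "primeideal (A z) R"
  proof (rule primeidealI)
    have "\<one> \<notin> A z" using z by (simp add: A_def)
    then show "carrier R \<noteq> A z" using one_closed by blast
    fix a b assume ab: "a \<in> carrier R" "b \<in> carrier R" "a \<otimes> b \<in> A z"
    show "a \<in> A z \<or> b \<in> A z"
    proof (rule disjCI)
      assume nb: "b \<notin> A z"
      \<comment> \<open>Multiplying \<open>z\<close> by \<open>b\<close> can only enlarge the colon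
        ideal, so maximality forces equality as soon as \<open>b z\<close> stays outside
        \<open>J\<close>.\<close>
      have sub: "A z \<subseteq> A (b \<otimes> z)"
      proof
        fix r assume r: "r \<in> A z"
        then have "b \<otimes> (r \<otimes> z) \<in> J" using ab J ideal_lmult by (auto simp: A_def)
        then show "r \<in> A (b \<otimes> z)" using r ab z by (auto simp: A_def m_lcomm)
      qed
      have "b \<otimes> z \<notin> J" using nb ab by (auto simp: A_def)
      then have "A (b \<otimes> z) = A z" using max sub ab z by simp
      moreover have "a \<in> A (b \<otimes> z)" using ab z by (auto simp: A_def m_assoc)
      ultimately show "a \<in> A z" by simp
    qed
  qed (use A z is_cring in auto)
  then show ?thesis using z max unfolding A_def by blast
qed

end

sublocale noetherian_local_ring \<subseteq> noetherian_cring ..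

context noetherian_local_ring begin

lemma m_maximal: "maximalideal m R" using maximalideal_iff by blast

lemma m_ideal: "ideal m R" using m_maximal by (simp add: maximalideal_def)

lemma m_prime: "primeideal m R" using m_maximal by (rule maximalideal_prime)

lemma one_notin_m: "\<one> \<notin> m" using primeideal_one m_prime by blast

lemma m_carrier: "x \<in> m \<Longrightarrow> x \<in> carrier R" using m_ideal ideal_carrier by blast

lemma proper_le_m: "ideal I R \<Longrightarrow> I \<noteq> carrier R \<Longrightarrow> I \<subseteq> m"
  using proper_ideal_in_maximal maximalideal_iff by blast

lemma prime_le_m: "primeideal p R \<Longrightarrow> p \<subseteq> m"
  using proper_le_m primeideal_ideal primeideal.I_notcarr by metis

lemma unit_iff: assumes x: "x \<in> carrier R" shows "x \<in> Units R \<longleftrightarrow> x \<notin> m"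
proof
  assume "x \<in> Units R"
  then show "x \<notin> m" using ideal_unit m_ideal m_maximal maximalideal.I_notcarr by metis
next
  assume "x \<notin> m"
  have id: "ideal (adj {\<zero>} x) R" using adj_ideal zeroideal x by blast
  then have "adj {\<zero>} x = carrier R" using proper_le_m adj_mem[OF zeroideal x] \<open>x \<notin> m\<close> by blast
  then have "\<one> \<in> adj {\<zero>} x" by simp
  then obtain a where "a \<in> carrier R" "\<one> = \<zero> \<oplus> a \<otimes> x" by (auto simp: adj_def)
  then have "a \<in> carrier R" "a \<otimes> x = \<one>" using x by auto
  then show "x \<in> Units R" using x m_comm by (auto simp: Units_def)
qed

lemma one_minus_unit: assumes "x \<in> m" shows "\<one> \<ominus> x \<in> Units R"
proof -
  have x: "x \<in> carrier R" using assms m_carrier by blast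
  have "\<one> \<ominus> x \<notin> m"
  proof
    assume "\<one> \<ominus> x \<in> m"
    then have "(\<one> \<ominus> x) \<oplus> x \<in> m" using ideal_add m_ideal assms by blast
    moreover have "(\<one> \<ominus> x) \<oplus> x = \<one>" using x by algebra
    ultimately show False using one_notin_m by simp
  qed
  then show ?thesis using unit_iff x by auto
qed

text \<open>The hypothesis says that \<open>I \<subseteq> J + mI\<close>.\<close>

lemma nakayama:
  assumes I: "ideal I R" and J: "ideal J R"
    and gen: "\<And>K. ideal K R \<Longrightarrow> J \<subseteq> K \<Longrightarrow> (\<And>r i. r \<in> m \<Longrightarrow> i \<in> I \<Longrightarrow> r \<otimes> i \<in> K) \<Longrightarrow> I \<subseteq> K"
  shows "I \<subseteq> J"
proof (rule ccontr)
  assume "\<not> I \<subseteq> J"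
  \<comment> \<open>Instead of shrinking a generating set, enlarge \<open>J\<close> to an ideal
    \<open>M\<close> maximal among those not containing \<open>I\<close>. Then \<open>I\<close> lies
    in \<open>M + Rg\<close> for any \<open>g\<close> in \<open>I\<close> outside \<open>M\<close>,
    so a single generator is left to treat.\<close>
  from maximal_ideal_in[of J "\<lambda>K. \<not> I \<subseteq> K", OF J this]
  obtain M where M: "ideal M R" "J \<subseteq> M" "\<not> I \<subseteq> M"
    "\<And>K. ideal K R \<Longrightarrow> \<not> I \<subseteq> K \<Longrightarrow> M \<subseteq> K \<Longrightarrow> K = M" by metis
  obtain g where g: "g \<in> I" "g \<notin> M" using M by blast
  have gc: "g \<in> carrier R" using g I ideal_carrier by blast
  have sub: "I \<subseteq> adj M g"
    using M(4)[of "adj M g"] adj_ideal[OF M(1) gc] adj_sup[OF M(1) gc] adj_mem[OF M(1) gc] g(2) by auto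
  \<comment> \<open>\<open>K = M + mg\<close> contains \<open>J\<close> and all products of
    \<open>m\<close> with \<open>I\<close>, so the hypothesis puts \<open>g\<close> into it; then
    \<open>(1 - r) g\<close> lies in \<open>M\<close> with \<open>1 - r\<close> a unit.\<close>
  define K where "K = {j \<oplus> r \<otimes> g | j r. j \<in> M \<and> r \<in> m}"
  note Mc = ideal_carrier[OF M(1)]
  have K: "ideal K R"
  proof (rule ideal_by)
    show "K \<subseteq> carrier R" using gc Mc m_carrier by (auto simp: K_def)
    have "\<zero> = \<zero> \<oplus> \<zero> \<otimes> g" using gc by simp
    then show "\<zero> \<in> K" unfolding K_def using ideal_zero[OF M(1)] ideal_zero[OF m_ideal] by blast
    fix u v a assume "u \<in> K"
    then obtain j r where u: "u = j \<oplus> r \<otimes> g" "j \<in> M" "r \<in> m" by (auto simp: K_def)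
    { assume "v \<in> K"
      then obtain j' r' where v: "v = j' \<oplus> r' \<otimes> g" "j' \<in> M" "r' \<in> m" by (auto simp: K_def)
      have "j \<in> carrier R" "j' \<in> carrier R" "r \<in> carrier R" "r' \<in> carrier R"
        using Mc m_carrier u v by auto
      then have "u \<oplus> v = (j \<oplus> j') \<oplus> (r \<oplus> r') \<otimes> g"
        unfolding u(1) v(1) using gc by algebra
      then show "u \<oplus> v \<in> K" unfolding K_def using u v ideal_add[OF M(1)] ideal_add[OF m_ideal] by blast }
    { assume a: "a \<in> carrier R"
      have "a \<otimes> u = a \<otimes> j \<oplus> (a \<otimes> r) \<otimes> g" using u a gc Mc m_carrier by (simp add: r_distr m_assoc)
      then show "a \<otimes> u \<in> K" unfolding K_def using u a ideal_lmult[OF M(1)] ideal_lmult[OF m_ideal] by blast }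
  qed
  have "M \<subseteq> K"
  proof
    fix j assume "j \<in> M"
    then have "j = j \<oplus> \<zero> \<otimes> g" using gc Mc by simp
    then show "j \<in> K" unfolding K_def using \<open>j \<in> M\<close> ideal_zero[OF m_ideal] by blast
  qed
  moreover have "r \<otimes> i \<in> K" if ri: "r \<in> m" "i \<in> I" for r i
  proof -
    obtain j a where i: "i = j \<oplus> a \<otimes> g" "j \<in> M" "a \<in> carrier R"
      using subsetD[OF sub ri(2)] by (auto simp: adj_def)
    have "r \<otimes> i = r \<otimes> j \<oplus> (r \<otimes> a) \<otimes> g" using i ri gc Mc m_carrier by (simp add: r_distr m_assoc)
    then show ?thesis unfolding K_def
      using i ri m_carrier ideal_lmult[OF M(1)] ideal_rmult[OF m_ideal] by blast
  qed
  ultimately have "g \<in> K" using gen[OF K] M(2) g(1) by blast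
  then obtain j r where j: "g = j \<oplus> r \<otimes> g" "j \<in> M" "r \<in> m" by (auto simp: K_def)
  have rc: "r \<in> carrier R" "j \<in> carrier R" using j m_carrier Mc by auto
  have "(\<one> \<ominus> r) \<otimes> g = g \<ominus> r \<otimes> g" using rc gc by algebra
  also have "\<dots> = j" using rc gc by (subst j(1)) algebra
  finally have "inv (\<one> \<ominus> r) \<otimes> ((\<one> \<ominus> r) \<otimes> g) \<in> M"
    using j one_minus_unit ideal_lmult[OF M(1)] by simp
  moreover have "inv (\<one> \<ominus> r) \<otimes> ((\<one> \<ominus> r) \<otimes> g) = g"
    using one_minus_unit[OF j(3)] rc gc by (simp add: m_assoc[symmetric])
  ultimately show False using g by simp
qed

end

lemma (in cring) noetherian_local_ringI:
  assumes "noetherian_ring R" and M: "ideal M R" "M \<noteq> carrier R"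
    and U: "\<And>x. x \<in> carrier R \<Longrightarrow> x \<notin> M \<Longrightarrow> x \<in> Units R"
  shows "noetherian_local_ring R M"
proof -
  have max: "maximalideal M R"
  proof (rule maximalidealI)
    fix J assume J: "ideal J R" "M \<subseteq> J"
    show "J = M \<or> J = carrier R"
    proof (cases "J = M")
      case False
      then obtain x where "x \<in> J" "x \<notin> M" using J by blast
      then have "x \<in> Units R" using U J ideal_carrier by blast
      then show ?thesis using \<open>x \<in> J\<close> ideal_unit J by blast
    qed simp
  qed (use M in auto)
  have uniq: "I = M" if I: "maximalideal I R" for I
  proof -
    have I': "ideal I R" "carrier R \<noteq> I" using I by (auto simp: maximalideal_def maximalideal_axioms_def)
    have "I \<subseteq> M"
    proof
      fix x assume x: "x \<in> I"
      show "x \<in> M"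
      proof (rule ccontr)
        assume "x \<notin> M"
        then have "x \<in> Units R" using U x I' ideal_carrier by blast
        then show False using ideal_unit x I' by blast
      qed
    qed
    then show ?thesis using maximalideal.I_maximal[OF I M(1)] M(2) ideal_subset[OF M(1)] by blast
  qed
  show ?thesis
    unfolding noetherian_local_ring_def noetherian_local_ring_axioms_def
    using assms(1) is_cring uniq max by blast
qed

text \<open>An ideal \<open>P\<close> maximal among those disjoint from a multiplicatively closed
  set is prime: for \<open>a\<close> and \<open>b\<close> outside \<open>P\<close>, both
  \<open>P + Ra\<close> and \<open>P + Rb\<close> meet \<open>T\<close>, and the product of the two
  elements found would lie in \<open>P\<close> if \<open>ab\<close> did.\<close>

lemma (in noetherian_cring) ex_prime_disjoint:
  assumes J: "ideal J R" and T: "T \<subseteq> carrier R" "\<one> \<in> T" "\<And>s t. s \<in> T \<Longrightarrow> t \<in> T \<Longrightarrow> s \<otimes> t \<in> T"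
    and disj: "J \<inter> T = {}"
  shows "\<exists>P. primeideal P R \<and> J \<subseteq> P \<and> P \<inter> T = {}"
proof -
  from maximal_ideal_in[of J "\<lambda>K. K \<inter> T = {}", OF J disj]
  obtain P where P: "ideal P R" "P \<inter> T = {}" "J \<subseteq> P"
    "\<And>K. ideal K R \<Longrightarrow> K \<inter> T = {} \<Longrightarrow> P \<subseteq> K \<Longrightarrow> K = P" by metis
  have meet: "\<exists>i c. i \<in> P \<and> c \<in> carrier R \<and> i \<oplus> c \<otimes> a \<in> T" if a: "a \<in> carrier R" "a \<notin> P" for a
  proof -
    have "adj P a \<inter> T \<noteq> {}"
      using P(4)[of "adj P a"] adj_ideal[OF P(1) a(1)] adj_sup[OF P(1) a(1)] adj_mem[OF P(1) a(1)] a by auto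
    then show ?thesis by (auto simp: adj_def)
  qed
  have "primeideal P R"
  proof (rule primeidealI)
    show "carrier R \<noteq> P" using P(2) T by blast
    fix a b assume ab: "a \<in> carrier R" "b \<in> carrier R" "a \<otimes> b \<in> P"
    show "a \<in> P \<or> b \<in> P"
    proof (rule ccontr)
      assume "\<not> (a \<in> P \<or> b \<in> P)"
      then obtain i c j d where 1: "i \<in> P" "c \<in> carrier R" "i \<oplus> c \<otimes> a \<in> T"
        and 2: "j \<in> P" "d \<in> carrier R" "j \<oplus> d \<otimes> b \<in> T" using meet ab by metis
      have ij: "i \<in> carrier R" "j \<in> carrier R" using 1 2 P(1) ideal_carrier by auto
      have "(i \<oplus> c \<otimes> a) \<otimes> (j \<oplus> d \<otimes> b) = (j \<oplus> d \<otimes> b) \<otimes> i \<oplus> ((c \<otimes> a) \<otimes> j \<oplus> (c \<otimes> d) \<otimes> (a \<otimes> b))"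
        using ij 1(2) 2(2) ab(1,2) by algebra
      moreover have "\<dots> \<in> P"
        using ij 1 2 ab by (intro ideal_add[OF P(1)] ideal_lmult[OF P(1) _ 1(1)] ideal_lmult[OF P(1) _ 2(1)] ideal_lmult[OF P(1) _ ab(3)]) auto
      ultimately show False using T(3)[OF 1(3) 2(3)] P(2) by auto
    qed
  qed (use P is_cring in auto)
  then show ?thesis using P by blast
qed

subsection \<open>Surjective homomorphisms\<close>

text \<open>A quotient is any surjection with kernel \<open>I\<close>. The coset ring
  \<open>R Quot I\<close> is one instance; others are a copy of it on the carrier type of
  \<open>R\<close> and, with kernel zero, an isomorphism.\<close>

locale quot_map = R: cring R + S: cring S for R (structure) and S (structure) +
  fixes h I
  assumes hom: "h \<in> ring_hom R S" and surj: "h ` carrier R = carrier S" and I: "ideal I R"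
    and ker: "\<And>a. a \<in> carrier R \<Longrightarrow> h a = \<zero>\<^bsub>S\<^esub> \<longleftrightarrow> a \<in> I"
begin

lemma hom_simps [simp]:
  "a \<in> carrier R \<Longrightarrow> h a \<in> carrier S" "h \<one> = \<one>\<^bsub>S\<^esub>" "h \<zero> = \<zero>\<^bsub>S\<^esub>"
  "a \<in> carrier R \<Longrightarrow> b \<in> carrier R \<Longrightarrow> h (a \<otimes> b) = h a \<otimes>\<^bsub>S\<^esub> h b"
  "a \<in> carrier R \<Longrightarrow> b \<in> carrier R \<Longrightarrow> h (a \<oplus> b) = h a \<oplus>\<^bsub>S\<^esub> h b"
  using ring_hom_closed[OF hom] ring_hom_one[OF hom] ring_hom_mult[OF hom] ring_hom_add[OF hom]
    ker[OF R.zero_closed] R.ideal_zero[OF I] by auto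

lemma h_minus: "a \<in> carrier R \<Longrightarrow> h (\<ominus> a) = \<ominus>\<^bsub>S\<^esub> h a"
  by (metis R.a_inv_closed R.l_neg S.minus_equality hom_simps(1,3,5))

lemma h_diff: "a \<in> carrier R \<Longrightarrow> b \<in> carrier R \<Longrightarrow> h (a \<ominus> b) = h a \<ominus>\<^bsub>S\<^esub> h b"
  by (simp add: a_minus_def h_minus)

lemma h_eq: "a \<in> carrier R \<Longrightarrow> b \<in> carrier R \<Longrightarrow> h a = h b \<longleftrightarrow> a \<ominus> b \<in> I"
  using ker[of "a \<ominus> b"] by (simp add: h_diff)

lemma lift: assumes "y \<in> carrier S" obtains a where "a \<in> carrier R" "h a = y"
  using assms surj by (metis imageE)

lemma vimage_ideal: assumes J: "ideal J S" shows "ideal {a \<in> carrier R. h a \<in> J} R"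
  using S.ideal_rules[OF J] by (intro R.ideal_by) auto

lemma image_ideal: assumes J: "ideal J R" shows "ideal (h ` J) S"
proof (rule S.ideal_by)
  note c = R.ideal_carrier[OF J]
  show "h ` J \<subseteq> carrier S" using c by auto
  show "\<zero>\<^bsub>S\<^esub> \<in> h ` J" using R.ideal_zero[OF J] by (metis hom_simps(3) imageI)
  show "x \<oplus>\<^bsub>S\<^esub> y \<in> h ` J" if xy: "x \<in> h ` J" "y \<in> h ` J" for x y
  proof -
    obtain a b where "a \<in> J" "b \<in> J" "x = h a" "y = h b" using xy by auto
    then have "x \<oplus>\<^bsub>S\<^esub> y = h (a \<oplus> b)" "a \<oplus> b \<in> J" using c R.ideal_add[OF J] by auto
    then show ?thesis by auto
  qed
  show "z \<otimes>\<^bsub>S\<^esub> y \<in> h ` J" if zy: "z \<in> carrier S" "y \<in> h ` J" for z y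
  proof -
    obtain a where "a \<in> carrier R" "z = h a" using zy(1) surj by (metis imageE)
    moreover obtain b where "b \<in> J" "y = h b" using zy(2) by auto
    ultimately have *: "a \<in> carrier R" "b \<in> J" "z = h a" "y = h b" by auto
    then have "z \<otimes>\<^bsub>S\<^esub> y = h (a \<otimes> b)" "a \<otimes> b \<in> J" using c R.ideal_lmult[OF J] by auto
    then show ?thesis by auto
  qed
qed

lemma image_vimage: "J \<subseteq> carrier S \<Longrightarrow> h ` {a \<in> carrier R. h a \<in> J} = J"
  using surj by auto

lemma mem_image: assumes J: "ideal J R" "I \<subseteq> J" and a: "a \<in> carrier R"
  shows "h a \<in> h ` J \<longleftrightarrow> a \<in> J"
proof
  assume "h a \<in> h ` J"
  then obtain b where b: "b \<in> J" "h a = h b" by auto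
  have bc: "b \<in> carrier R" using b J R.ideal_carrier by blast
  then have "a \<ominus> b \<in> J" using b a h_eq J by auto
  then have "(a \<ominus> b) \<oplus> b \<in> J" using b R.ideal_add[OF J(1)] by blast
  moreover have "(a \<ominus> b) \<oplus> b = a" using a bc by algebra
  ultimately show "a \<in> J" by simp
qed auto

lemma vimage_prime: assumes q: "primeideal q S" shows "primeideal {a \<in> carrier R. h a \<in> q} R"
proof (rule primeidealI)
  show "ideal {a \<in> carrier R. h a \<in> q} R" by (simp add: vimage_ideal S.primeideal_ideal q)
  show "carrier R \<noteq> {a \<in> carrier R. h a \<in> q}" 
    using S.primeideal_one[OF q] R.one_closed hom_simps(2) by (metis (no_types, lifting) mem_Collect_eq)
qed (use S.primeideal_mult[OF q] R.is_cring in auto)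

lemma image_prime: assumes p: "primeideal p R" "I \<subseteq> p" shows "primeideal (h ` p) S"
proof (rule primeidealI)
  note pi = R.primeideal_ideal[OF p(1)]
  show "ideal (h ` p) S" by (simp add: image_ideal pi)
  show "carrier S \<noteq> h ` p"
    using mem_image[OF pi p(2) R.one_closed] R.primeideal_one[OF p(1)] S.one_closed by auto
  fix y z assume "y \<in> carrier S" "z \<in> carrier S" "y \<otimes>\<^bsub>S\<^esub> z \<in> h ` p"
  moreover then obtain a b where "a \<in> carrier R" "b \<in> carrier R" "y = h a" "z = h b"
    using lift by metis
  ultimately show "y \<in> h ` p \<or> z \<in> h ` p"
    using mem_image[OF pi p(2)] R.primeideal_mult[OF p(1)]
    by (metis R.m_closed hom_simps(4))
qed (rule S.is_cring)

lemma image_genideal: assumes U: "U \<subseteq> carrier R" shows "h ` (Idl U) = Idl\<^bsub>S\<^esub> (h ` U)"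
proof
  have U': "h ` U \<subseteq> carrier S" using U by auto
  have "Idl U \<subseteq> {a \<in> carrier R. h a \<in> Idl\<^bsub>S\<^esub> (h ` U)}"
    using S.genideal_self[OF U'] U
    by (intro R.genideal_minimal vimage_ideal S.genideal_ideal U') auto
  then show "h ` (Idl U) \<subseteq> Idl\<^bsub>S\<^esub> (h ` U)" by auto
  show "Idl\<^bsub>S\<^esub> (h ` U) \<subseteq> h ` (Idl U)"
    using R.genideal_self[OF U] by (intro S.genideal_minimal image_ideal R.genideal_ideal U) auto
qed

lemma noetherian_image: assumes "noetherian_ring R" shows "noetherian_ring S"
proof (rule S.noetherian_ringI)
  fix J assume J: "ideal J S"
  obtain A where A: "A \<subseteq> carrier R" "finite A" "{a \<in> carrier R. h a \<in> J} = Idl A"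
    using noetherian_ring.finetely_gen[OF assms vimage_ideal[OF J]] by blast
  have "J = Idl\<^bsub>S\<^esub> (h ` A)"
    using image_genideal[OF A(1)] A(3) image_vimage[OF S.ideal_subset[OF J]] by simp
  then show "\<exists>A\<subseteq>carrier S. finite A \<and> J = Idl\<^bsub>S\<^esub> A" using A by (intro exI[of _ "h ` A"]) auto
qed

lemma local_image: assumes loc: "noetherian_local_ring R M" and IM: "I \<subseteq> M"
  shows "noetherian_local_ring S (h ` M)"
proof -
  interpret L: noetherian_local_ring R M by fact
  show ?thesis
  proof (rule S.noetherian_local_ringI)
    show "noetherian_ring S" using noetherian_image L.noetherian_ring_axioms by blast
    show "ideal (h ` M) S" by (simp add: image_ideal L.m_ideal)
    show "h ` M \<noteq> carrier S"
      using primeideal.I_notcarr[OF image_prime[OF L.m_prime IM]] by simp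
    fix y assume y: "y \<in> carrier S" "y \<notin> h ` M"
    obtain a where a: "a \<in> carrier R" "h a = y" using y lift by metis
    have "a \<in> Units R" using a y L.unit_iff by auto
    then obtain b where b: "b \<in> carrier R" "a \<otimes> b = \<one>" by (auto simp: Units_def)
    have "y \<otimes>\<^bsub>S\<^esub> h b = \<one>\<^bsub>S\<^esub>" using a b hom_simps(2,4) by metis
    then show "y \<in> Units S" using y b S.m_comm[of y "h b"] by (auto simp: Units_def)
  qed
qed

end

text \<open>The inductions on generators and on dimension apply their hypothesis to a quotient, so
  it has to live on the type of \<open>R\<close>. Choosing a representative \<open>f a\<close> in
  each coset and transporting the operations along \<open>f\<close> achieves this.\<close>

lemma (in cring) ex_quot_map:
  assumes I: "ideal I R"
  shows "\<exists>(S :: 'a ring) h. quot_map R S h I"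
proof -
  interpret I: ideal I R by fact
  define f where "f = (\<lambda>a. SOME x. x \<in> I +> a)"
  have fm: "f a \<in> I +> a" if "a \<in> carrier R" for a
    unfolding f_def using I.a_rcos_self[OF that] by (rule someI)
  have weak: "weak_ring_morphism f I R"
  proof (rule weak_ring_morphismI[OF I])
    fix a b assume ab: "a \<in> carrier R" "b \<in> carrier R"
    have "f a = f b \<longleftrightarrow> I +> a = I +> b"
    proof
      assume "f a = f b"
      then have "I +> a = I +> f a" "I +> b = I +> f a"
        using fm[OF ab(1)] fm[OF ab(2)] ab I.a_repr_independence'[of "f a" a] I.a_repr_independence'[of "f a" b]
        by auto
      then show "I +> a = I +> b" by simp
    qed (simp add: f_def)
    also have "\<dots> \<longleftrightarrow> a \<ominus> b \<in> I"
      using quotient_eq_iff_same_a_r_cos[OF I ab] by blast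
    finally show "f a = f b \<longleftrightarrow> a \<ominus> b \<in> I" .
  qed
  let ?S = "image_ring f R"
  have hom: "f \<in> ring_hom R ?S" by (rule weak_ring_morphism_is_hom[OF weak])
  have ring: "ring ?S" by (rule image_ring_is_ring[OF weak])
  interpret S: ring ?S by (rule ring)
  have surj: "f ` carrier R = carrier ?S" by (simp add: image_ring_carrier)
  have "cring ?S"
  proof (rule cring.intro[OF ring], unfold_locales)
    fix x y assume "x \<in> carrier ?S" "y \<in> carrier ?S"
    then obtain a b where "a \<in> carrier R" "b \<in> carrier R" "x = f a" "y = f b"
      unfolding surj[symmetric] by auto
    then show "x \<otimes>\<^bsub>?S\<^esub> y = y \<otimes>\<^bsub>?S\<^esub> x" using ring_hom_mult[OF hom] m_comm by metis
  qed
  moreover have "f a = \<zero>\<^bsub>?S\<^esub> \<longleftrightarrow> a \<in> I" if "a \<in> carrier R" for a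
    using weak_ring_morphism_ker[OF weak] that unfolding a_kernel_def' by auto
  ultimately have "quot_map R ?S f I"
    unfolding quot_map_def quot_map_axioms_def using hom surj I is_cring by auto
  then show ?thesis by blast
qed

subsection \<open>Chains of primes\<close>

lemma chain_dim_ge:
  assumes "ps \<noteq> []" "sorted_wrt (\<subset>) ps" "set ps \<subseteq> Z"
  shows "enat (length ps - 1) \<le> chain_dim Z"
  unfolding chain_dim_def using assms by (intro SUP_upper) auto

text \<open>Dimension above \<open>k\<close> means a chain with at least \<open>k + 1\<close> strict
  steps, hence \<open>k + 2\<close> members; a longer one is cut off.\<close>

lemma chain_dim_obtain:
  assumes "enat k < chain_dim Z"
  obtains ps where "sorted_wrt (\<subset>) ps" "set ps \<subseteq> Z" "length ps = k + 2"
proof -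
  from assms obtain qs where qs: "qs \<noteq> []" "sorted_wrt (\<subset>) qs" "set qs \<subseteq> Z" "k < length qs - 1"
    unfolding chain_dim_def less_SUP_iff by auto
  show thesis
    using qs set_take_subset[of "k + 2" qs]
    by (intro that[of "take (k + 2) qs"] sorted_wrt_take) auto
qed

context quot_map begin

lemma vimage_strict_mono: "J \<subseteq> carrier S \<Longrightarrow> K \<subseteq> carrier S \<Longrightarrow> J \<subset> K \<Longrightarrow>
    {a \<in> carrier R. h a \<in> J} \<subset> {a \<in> carrier R. h a \<in> K}"
  using image_vimage[of J] image_vimage[of K] by blast

lemma chain_vimage:
  assumes "sorted_wrt (\<subset>) qs" "set qs \<subseteq> spec S"
  shows "sorted_wrt (\<subset>) (map (\<lambda>q. {a \<in> carrier R. h a \<in> q}) qs)"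
    "\<And>p. p \<in> set (map (\<lambda>q. {a \<in> carrier R. h a \<in> q}) qs) \<Longrightarrow> p \<in> spec R \<and> I \<subseteq> p"
proof -
  have sub: "q \<subseteq> carrier S" if "q \<in> set qs" for q
    using that assms(2) S.ideal_subset S.primeideal_ideal by (auto simp: spec_def)
  show "sorted_wrt (\<subset>) (map (\<lambda>q. {a \<in> carrier R. h a \<in> q}) qs)"
    unfolding sorted_wrt_map using assms(1) by (rule sorted_wrt_mono_rel[rotated]) (intro vimage_strict_mono sub)
  fix p assume "p \<in> set (map (\<lambda>q. {a \<in> carrier R. h a \<in> q}) qs)"
  then obtain q where q: "q \<in> set qs" "p = {a \<in> carrier R. h a \<in> q}" by auto
  then have "primeideal q S" using assms(2) by (auto simp: spec_def)
  moreover have "I \<subseteq> p"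
  proof
    fix a assume "a \<in> I"
    then have "a \<in> carrier R" "h a = \<zero>\<^bsub>S\<^esub>" using R.ideal_carrier[OF I] ker by auto
    then show "a \<in> p" using q S.ideal_zero[OF S.primeideal_ideal[OF \<open>primeideal q S\<close>]] by simp
  qed
  ultimately show "p \<in> spec R \<and> I \<subseteq> p" using q vimage_prime by (simp add: spec_def)
qed

lemma chain_image:
  assumes "sorted_wrt (\<subset>) ps" "\<And>p. p \<in> set ps \<Longrightarrow> p \<in> spec R \<and> I \<subseteq> p"
  shows "sorted_wrt (\<subset>) (map ((`) h) ps)" "set (map ((`) h) ps) \<subseteq> spec S"
proof -
  show "sorted_wrt (\<subset>) (map ((`) h) ps)"
    unfolding sorted_wrt_map using assms(1)
  proof (rule sorted_wrt_mono_rel[rotated])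
    fix p q assume pq: "p \<in> set ps" "q \<in> set ps" "p \<subset> q"
    then have p: "ideal p R" "I \<subseteq> p" using assms(2)[OF pq(1)] by (auto simp: spec_def R.primeideal_ideal)
    have "ideal q R" using assms(2)[OF pq(2)] by (auto simp: spec_def R.primeideal_ideal)
    then obtain a where "a \<in> q" "a \<notin> p" "a \<in> carrier R" using pq R.ideal_carrier by blast
    then have "h a \<in> h ` q" "h a \<notin> h ` p" using mem_image[OF p] by auto
    then show "h ` p \<subset> h ` q" using pq by blast
  qed
  show "set (map ((`) h) ps) \<subseteq> spec S"
    using assms(2) image_prime by (auto simp: spec_def)
qed

end

subsection \<open>Krull's principal ideal theorem\<close>

context noetherian_local_ring begin

text \<open>Says that \<open>R/J\<close> is Artinian, without forming the quotient.\<close>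

definition dcc_over :: "'a set \<Rightarrow> bool" where
  "dcc_over J \<longleftrightarrow> (\<forall>f :: nat \<Rightarrow> 'a set. (\<forall>n. ideal (f n) R \<and> J \<subseteq> f n \<and> f (Suc n) \<subseteq> f n) \<longrightarrow>
     (\<exists>N. \<forall>n\<ge>N. f n = f N))"

lemma dcc_overD:
  assumes "dcc_over J" "\<And>n. ideal (f n) R" "\<And>n. J \<subseteq> f n" "\<And>n. f (Suc n) \<subseteq> f n"
  shows "\<exists>N. \<forall>n\<ge>N. f n = f (N :: nat)"
  using assms unfolding dcc_over_def by blast

text \<open>Since \<open>m\<close> kills \<open>(J + Rz)/J\<close>, that module is zero or the
  residue field. If all ideals of a chain contain \<open>z\<close>, they lie over
  \<open>J + Rz\<close>. Otherwise the sums with \<open>Rz\<close> stabilize, and an element of one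
  late stage differs from one of a later stage by some \<open>az\<close> with \<open>a\<close> in
  \<open>m\<close>, which lies in \<open>J\<close>.\<close>

lemma dcc_over_adj:
  assumes J: "ideal J R" and z: "z \<in> carrier R" and mz: "\<And>r. r \<in> m \<Longrightarrow> r \<otimes> z \<in> J"
    and dcc: "dcc_over (adj J z)"
  shows "dcc_over J"
  unfolding dcc_over_def
proof (intro allI impI)
  fix f :: "nat \<Rightarrow> 'a set"
  assume "\<forall>n. ideal (f n) R \<and> J \<subseteq> f n \<and> f (Suc n) \<subseteq> f n"
  then have f: "ideal (f n) R" "J \<subseteq> f n" "f (Suc n) \<subseteq> f n" for n by auto
  have anti: "f n \<subseteq> f k" if "k \<le> n" for n k
    using f(3) that by (rule lift_Suc_antimono_le)
  show "\<exists>N. \<forall>n\<ge>N. f n = f N"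
  proof (cases "\<forall>n. z \<in> f n")
    case True
    then show ?thesis using adj_least[OF J f(1,2)] f by (intro dcc_overD[OF dcc]) auto
  next
    case False
    then obtain N1 where N1: "z \<notin> f N1" by auto
    have mono: "adj A z \<subseteq> adj B z" if "A \<subseteq> B" for A B
      using that by (auto simp: adj_def)
    obtain N where N: "\<And>n. n \<ge> N \<Longrightarrow> adj (f n) z = adj (f N) z"
      using dcc_overD[OF dcc, of "\<lambda>n. adj (f n) z"] adj_ideal[OF f(1) z] mono f by metis
    let ?N = "max N N1"
    have "f n = f ?N" if n: "n \<ge> ?N" for n
    proof
      show "f n \<subseteq> f ?N" by (rule anti[OF n])
      show "f ?N \<subseteq> f n"
      proof
        fix u assume u: "u \<in> f ?N"
        then have "u \<in> adj (f ?N) z" using adj_sup[OF f(1) z] by blast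
        then have "u \<in> adj (f n) z" using N[of n] N[of ?N] n by simp
        then obtain v a where v: "u = v \<oplus> a \<otimes> z" "v \<in> f n" "a \<in> carrier R" by (auto simp: adj_def)
        have "a \<otimes> z \<in> f ?N"
        proof (rule ideal_add_cancel[OF f(1)])
          show "v \<in> f ?N" using v anti[OF n] by blast
        qed (use u v z in auto)
        then have az: "a \<otimes> z \<in> f N1" using anti[of N1 ?N] by auto
        have "a \<in> m"
        proof (rule ccontr)
          assume "a \<notin> m"
          then have "a \<in> Units R" using unit_iff v by auto
          then have "inv a \<otimes> (a \<otimes> z) = z" "inv a \<in> carrier R" using v z by (auto simp: m_assoc[symmetric])
          then show False using ideal_lmult[OF f(1) _ az] N1 by metis
        qed
        then have "a \<otimes> z \<in> f n" using mz f(2) by blast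
        then show "u \<in> f n" using v ideal_add[OF f(1)] by blast
      qed
    qed
    then show ?thesis by blast
  qed
qed

text \<open>Noetherian induction from above: for a proper \<open>K\<close> over \<open>J\<close>
  some \<open>z\<close> has a prime colon ideal modulo \<open>K\<close>. That prime contains
  \<open>J\<close> and is therefore \<open>m\<close>, so \<open>R/K\<close> is an extension of
  \<open>R/(K + Rz)\<close> by one residue field.\<close>

lemma dcc_over_primary:
  assumes J: "ideal J R" and only: "\<And>P. primeideal P R \<Longrightarrow> J \<subseteq> P \<Longrightarrow> P = m"
  shows "dcc_over J"
proof -
  have "J \<subseteq> J' \<longrightarrow> dcc_over J'" if "ideal J' R" for J'
    using that
  proof (induction J' rule: noetherian_ideal_induct)
    case (step K)
    show ?case
    proof
      assume JK: "J \<subseteq> K"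
      show "dcc_over K"
      proof (cases "\<one> \<in> K")
        case True
        then have "K = carrier R" using ideal_one step by blast
        then have "f n = f 0" if "\<forall>n. ideal (f n) R \<and> K \<subseteq> f n \<and> f (Suc n) \<subseteq> f n" for f :: "nat \<Rightarrow> 'a set" and n
          using that ideal_subset by (metis subset_antisym)
        then show ?thesis unfolding dcc_over_def by metis
      next
        case False
        obtain z where z: "z \<in> carrier R" "z \<notin> K" "primeideal {r \<in> carrier R. r \<otimes> z \<in> K} R"
          using ex_prime_colon[OF step(1) one_closed False] by blast
        have "K \<subseteq> {r \<in> carrier R. r \<otimes> z \<in> K}"
          using ideal_carrier[OF step(1)] ideal_rmult[OF step(1) z(1)] by auto
        then have "{r \<in> carrier R. r \<otimes> z \<in> K} = m" using only z(3) JK by blast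
        then have "\<And>r. r \<in> m \<Longrightarrow> r \<otimes> z \<in> K" by blast
        moreover have "dcc_over (adj K z)"
          using step(2)[OF adj_ideal[OF step(1) z(1)]] adj_sup[OF step(1) z(1)]
            adj_mem[OF step(1) z(1)] z(2) JK by blast
        ultimately show ?thesis using dcc_over_adj step(1) z(1) by blast
      qed
    qed
  qed
  then show ?thesis using J by blast
qed

text \<open>The proof of Krull's principal ideal theorem with the symbolic powers of a principal ideal
  \<open>(a)\<close>, \<open>a \<in> Q - p\<close>, which makes a localization at \<open>Q\<close> superfluous.\<close>

theorem principal_ideal_theorem:
  assumes p: "primeideal p R" and Q: "primeideal Q R" and pQ: "p \<subset> Q" and Qm: "Q \<noteq> m"
    and x: "x \<in> m"
  shows "\<exists>P. primeideal P R \<and> p \<subseteq> P \<and> x \<in> P \<and> P \<noteq> m"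
proof (rule ccontr)
  assume "\<not> ?thesis"
  then have only: "P = m" if "primeideal P R" "p \<subseteq> P" "x \<in> P" for P using that by blast
  note pi = primeideal_ideal[OF p] and Qi = primeideal_ideal[OF Q]
  note pc = ideal_carrier[OF pi]
  have xc: "x \<in> carrier R" using x m_carrier by blast
  have xQ: "x \<notin> Q" using only[OF Q] pQ Qm by blast
  obtain a where a: "a \<in> Q" "a \<notin> p" using pQ by blast
  have ac: "a \<in> carrier R" using a Qi ideal_carrier by blast
  \<comment> \<open>\<open>I n\<close> is \<open>p + (a^n)\<close> localized at \<open>Q\<close> and
    contracted back to \<open>R\<close>; the factor \<open>s\<close> outside \<open>Q\<close> is the
    denominator.\<close>
  define I where "I = (\<lambda>n::nat. {r \<in> carrier R. \<exists>s\<in>carrier R. s \<notin> Q \<and> s \<otimes> r \<in> adj p (a [^] n)})"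
  have an: "a [^] n \<in> carrier R" for n :: nat using ac by simp
  note adji = adj_ideal[OF pi an]
  have I: "ideal (I n) R" for n
  proof (rule ideal_by)
    show "I n \<subseteq> carrier R" by (auto simp: I_def)
    show "\<zero> \<in> I n" unfolding I_def using primeideal_one[OF Q] ideal_zero[OF adji] by auto
    fix u v b assume "u \<in> I n"
    then obtain s where u: "u \<in> carrier R" "s \<in> carrier R" "s \<notin> Q" "s \<otimes> u \<in> adj p (a [^] n)"
      by (auto simp: I_def)
    { assume "v \<in> I n"
      then obtain t where v: "v \<in> carrier R" "t \<in> carrier R" "t \<notin> Q" "t \<otimes> v \<in> adj p (a [^] n)"
        by (auto simp: I_def)
      have "(s \<otimes> t) \<otimes> (u \<oplus> v) = t \<otimes> (s \<otimes> u) \<oplus> s \<otimes> (t \<otimes> v)"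
        using u(1,2) v(1,2) by algebra
      also have "\<dots> \<in> adj p (a [^] n)"
        using u v by (intro ideal_add[OF adji] ideal_lmult[OF adji _ u(4)] ideal_lmult[OF adji _ v(4)]) auto
      finally show "u \<oplus> v \<in> I n"
        unfolding I_def using u v primeideal_mult[OF Q u(2) v(2)] by auto }
    { assume b: "b \<in> carrier R"
      have "s \<otimes> (b \<otimes> u) = b \<otimes> (s \<otimes> u)" using u(1,2) b by algebra
      also have "\<dots> \<in> adj p (a [^] n)" using u b by (intro ideal_lmult[OF adji _ u(4)]) auto
      finally show "b \<otimes> u \<in> I n" unfolding I_def using u b by auto }
  qed
  have desc: "I (Suc n) \<subseteq> I n" for n
  proof -
    have "a [^] Suc n \<in> adj p (a [^] n)"
      using ideal_rmult[OF adji ac adj_mem[OF pi an]] by simp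
    then have "adj p (a [^] Suc n) \<subseteq> adj p (a [^] n)"
      using adj_least[OF pi adji adj_sup[OF pi an]] by blast
    then show ?thesis by (auto simp: I_def)
  qed
  have pI: "p \<subseteq> I n" for n
  proof
    fix r assume r: "r \<in> p"
    then have "\<one> \<otimes> r \<in> adj p (a [^] n)" using pc adj_sup[OF pi an] by auto
    then show "r \<in> I n" unfolding I_def using r pc primeideal_one[OF Q] by blast
  qed
  have aI: "a [^] n \<in> I n" for n
  proof -
    have "\<one> \<otimes> a [^] n \<in> adj p (a [^] n)" using an adj_mem[OF pi an] by simp
    then show ?thesis unfolding I_def using an primeideal_one[OF Q] by blast
  qed
  \<comment> \<open>By the assumption for contradiction \<open>m\<close> is the only prime over
    \<open>p + (x)\<close>, so the ideals \<open>I n\<close> stabilize modulo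
    \<open>x\<close>.\<close>
  have "dcc_over (adj p x)"
    using only adj_sup[OF pi xc] adj_mem[OF pi xc] by (intro dcc_over_primary adj_ideal pi xc) blast
  moreover have mono: "adj A x \<subseteq> adj B x" if "A \<subseteq> B" for A B
    using that by (auto simp: adj_def)
  ultimately obtain N where N: "\<And>n. n \<ge> N \<Longrightarrow> adj (I n) x = adj (I N) x"
    using dcc_overD[of "adj p x" "\<lambda>n. adj (I n) x"] adj_ideal[OF I xc] pI desc by metis
  \<comment> \<open>In \<open>u = v + b x\<close> with \<open>v\<close> in \<open>I (Suc N)\<close>,
    the factor \<open>x\<close> outside \<open>Q\<close> can be absorbed into the denominator, so
    \<open>b\<close> lies in \<open>I N\<close>. Thus \<open>I N\<close> is inside
    \<open>I (Suc N) + m (I N)\<close> and Nakayama's lemma applies.\<close>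
  have "I N \<subseteq> I (Suc N)"
  proof (rule nakayama[OF I I])
    fix K assume K: "ideal K R" "I (Suc N) \<subseteq> K" "\<And>r i. r \<in> m \<Longrightarrow> i \<in> I N \<Longrightarrow> r \<otimes> i \<in> K"
    show "I N \<subseteq> K"
    proof
      fix u assume u: "u \<in> I N"
      then have "u \<in> adj (I (Suc N)) x" using subsetD[OF adj_sup[OF I[of N] xc]] N[of "Suc N"] by simp
      then obtain v b where v: "u = v \<oplus> b \<otimes> x" "v \<in> I (Suc N)" "b \<in> carrier R" by (auto simp: adj_def)
      have "b \<otimes> x \<in> I N"
        using ideal_add_cancel[OF I, of v N "b \<otimes> x"] v u desc xc by blast
      then obtain s where s: "s \<in> carrier R" "s \<notin> Q" "s \<otimes> (b \<otimes> x) \<in> adj p (a [^] N)"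
        by (auto simp: I_def)
      have "s \<otimes> (b \<otimes> x) = (s \<otimes> x) \<otimes> b" using s(1) v(3) xc by algebra
      then have "b \<in> I N" unfolding I_def
        using s v xc primeideal_mult[OF Q s(1) xc] xQ by auto
      then have "x \<otimes> b \<in> K" using K(3) x by blast
      then show "u \<in> K" using v K ideal_add[OF K(1)] m_comm[OF v(3) xc] by auto
    qed
  qed
  then have "a [^] N \<in> I (Suc N)" using aI by blast
  then obtain s where s: "s \<in> carrier R" "s \<notin> Q" "s \<otimes> a [^] N \<in> adj p (a [^] Suc N)"
    by (auto simp: I_def)
  then obtain i c where i: "s \<otimes> a [^] N = i \<oplus> c \<otimes> (a [^] N \<otimes> a)" "i \<in> p" "c \<in> carrier R"
    by (auto simp: adj_def)
  \<comment> \<open>Modulo \<open>p\<close>, \<open>s a^N\<close> is the multiple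
    \<open>c a^(N+1)\<close>. Cancelling \<open>a^N\<close> leaves \<open>s - ca\<close> in
    \<open>p\<close>; as \<open>a\<close> and \<open>p\<close> lie in \<open>Q\<close>, so would
    \<open>s\<close>.\<close>
  have "(s \<ominus> c \<otimes> a) \<otimes> a [^] N = s \<otimes> a [^] N \<ominus> c \<otimes> (a [^] N \<otimes> a)"
    using s(1) i(3) ac an by algebra
  also have "\<dots> = i" unfolding i(1) using pc[OF i(2)] i(3) ac an by algebra
  finally have "(s \<ominus> c \<otimes> a) \<otimes> a [^] N \<in> p" using i(2) by simp
  moreover have "a [^] N \<notin> p" using primeideal_pow[OF p ac] a(2) by blast
  ultimately have "s \<ominus> c \<otimes> a \<in> p" using primeideal_mult[OF p, of "s \<ominus> c \<otimes> a" "a [^] N"] s i ac an by auto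
  then have "(s \<ominus> c \<otimes> a) \<oplus> c \<otimes> a \<in> Q"
    using pQ a i by (intro ideal_add[OF Qi] ideal_lmult[OF Qi]) auto
  moreover have "(s \<ominus> c \<otimes> a) \<oplus> c \<otimes> a = s" using s(1) i(3) ac by algebra
  ultimately show False using s by simp
qed

end

subsection \<open>Localization\<close>

text \<open>Localization through its characteristic properties: elements of \<open>T\<close> become
  units, every element has a denominator, and the kernel is \<open>T\<close>-torsion. Later proofs
  clear denominators with \<open>h s\<close> instead of handling fraction classes.\<close>

locale loc_map = R: cring R + L: cring L for R (structure) and L (structure) +
  fixes h T
  assumes hom: "h \<in> ring_hom R L" and T: "submonoid T R"
    and unit: "\<And>s. s \<in> T \<Longrightarrow> h s \<in> Units L"
    and frac: "\<And>y. y \<in> carrier L \<Longrightarrow> \<exists>a\<in>carrier R. \<exists>s\<in>T. h s \<otimes>\<^bsub>L\<^esub> y = h a"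
    and ker: "\<And>a. a \<in> carrier R \<Longrightarrow> h a = \<zero>\<^bsub>L\<^esub> \<Longrightarrow> \<exists>s\<in>T. s \<otimes> a = \<zero>"
begin

lemma T_carrier: "s \<in> T \<Longrightarrow> s \<in> carrier R" and T_one: "\<one> \<in> T"
  and T_mult: "s \<in> T \<Longrightarrow> t \<in> T \<Longrightarrow> s \<otimes> t \<in> T"
  using submonoid.subset[OF T] submonoid.one_closed[OF T] submonoid.m_closed[OF T] by auto

lemma hom_simps [simp]:
  "a \<in> carrier R \<Longrightarrow> h a \<in> carrier L" "h \<one> = \<one>\<^bsub>L\<^esub>" "h \<zero> = \<zero>\<^bsub>L\<^esub>"
  "a \<in> carrier R \<Longrightarrow> b \<in> carrier R \<Longrightarrow> h (a \<otimes> b) = h a \<otimes>\<^bsub>L\<^esub> h b"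
  "a \<in> carrier R \<Longrightarrow> b \<in> carrier R \<Longrightarrow> h (a \<oplus> b) = h a \<oplus>\<^bsub>L\<^esub> h b"
  using ring_hom_closed[OF hom] ring_hom_one[OF hom] ring_hom_mult[OF hom] ring_hom_add[OF hom]
    ring_hom_zero[OF hom R.ring_axioms L.ring_axioms] by auto

lemma unit_cancel:
  assumes "s \<in> T" "y \<in> carrier L" "ideal J L" "h s \<otimes>\<^bsub>L\<^esub> y \<in> J" shows "y \<in> J"
proof -
  note u = unit[OF assms(1)]
  have "inv\<^bsub>L\<^esub> (h s) \<otimes>\<^bsub>L\<^esub> (h s \<otimes>\<^bsub>L\<^esub> y) \<in> J"
    using u by (intro L.ideal_lmult[OF assms(3) _ assms(4)]) auto
  moreover have "inv\<^bsub>L\<^esub> (h s) \<otimes>\<^bsub>L\<^esub> (h s \<otimes>\<^bsub>L\<^esub> y) = y"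
    using u assms(2) T_carrier[OF assms(1)] by (simp add: L.m_assoc[symmetric])
  ultimately show ?thesis by simp
qed

lemma unit_cancel_eq:
  assumes "s \<in> T" "y \<in> carrier L" "z \<in> carrier L" "h s \<otimes>\<^bsub>L\<^esub> y = h s \<otimes>\<^bsub>L\<^esub> z" shows "y = z"
  using L.Units_l_cancel[OF unit[OF assms(1)] assms(2,3)] assms(4) by simp

lemma vimage_ideal: assumes J: "ideal J L" shows "ideal {a \<in> carrier R. h a \<in> J} R"
  using L.ideal_rules[OF J] by (intro R.ideal_by) auto

lemma vimage_prime: assumes q: "primeideal q L" shows "primeideal {a \<in> carrier R. h a \<in> q} R"
proof (rule primeidealI)
  show "ideal {a \<in> carrier R. h a \<in> q} R" by (simp add: vimage_ideal L.primeideal_ideal q)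
  show "carrier R \<noteq> {a \<in> carrier R. h a \<in> q}"
    using L.primeideal_one[OF q] R.one_closed hom_simps(2) by (metis (no_types, lifting) mem_Collect_eq)
qed (use L.primeideal_mult[OF q] R.is_cring in auto)

text \<open>The extended ideal, described by clearing denominators.\<close>

definition ext :: "'a set \<Rightarrow> 'c set" where
  "ext I = {y \<in> carrier L. \<exists>a\<in>I. \<exists>s\<in>T. h s \<otimes>\<^bsub>L\<^esub> y = h a}"

lemma extI: "y \<in> carrier L \<Longrightarrow> a \<in> I \<Longrightarrow> s \<in> T \<Longrightarrow> h s \<otimes>\<^bsub>L\<^esub> y = h a \<Longrightarrow> y \<in> ext I"
  by (auto simp: ext_def)

lemma ext_ideal: assumes I: "ideal I R" shows "ideal (ext I) L"
proof (rule L.ideal_by)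
  note c = R.ideal_carrier[OF I]
  show "ext I \<subseteq> carrier L" by (auto simp: ext_def)
  have "h \<one> \<otimes>\<^bsub>L\<^esub> \<zero>\<^bsub>L\<^esub> = h \<zero>" by simp
  then show "\<zero>\<^bsub>L\<^esub> \<in> ext I" unfolding ext_def using R.ideal_zero[OF I] T_one by blast
  fix u v b assume "u \<in> ext I"
  then obtain a s where u: "u \<in> carrier L" "a \<in> I" "s \<in> T" "h s \<otimes>\<^bsub>L\<^esub> u = h a" by (auto simp: ext_def)
  note uc = c[OF u(2)] T_carrier[OF u(3)]
  { assume "v \<in> ext I"
    then obtain b t where v: "v \<in> carrier L" "b \<in> I" "t \<in> T" "h t \<otimes>\<^bsub>L\<^esub> v = h b" by (auto simp: ext_def)
    note vc = c[OF v(2)] T_carrier[OF v(3)]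
    have hc: "h s \<in> carrier L" "h t \<in> carrier L" using uc vc by auto
    have "h (s \<otimes> t) \<otimes>\<^bsub>L\<^esub> (u \<oplus>\<^bsub>L\<^esub> v) = h t \<otimes>\<^bsub>L\<^esub> (h s \<otimes>\<^bsub>L\<^esub> u) \<oplus>\<^bsub>L\<^esub> h s \<otimes>\<^bsub>L\<^esub> (h t \<otimes>\<^bsub>L\<^esub> v)"
      unfolding hom_simps(4)[OF uc(2) vc(2)] using hc u(1) v(1) by algebra
    also have "\<dots> = h (t \<otimes> a \<oplus> s \<otimes> b)" using u v uc vc by simp
    finally show "u \<oplus>\<^bsub>L\<^esub> v \<in> ext I"
      using u v uc vc by (intro extI[of _ "t \<otimes> a \<oplus> s \<otimes> b" _ "s \<otimes> t"] R.ideal_add[OF I] R.ideal_lmult[OF I] T_mult) auto }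
  { assume bL: "b \<in> carrier L"
    obtain d t where "d \<in> carrier R" "t \<in> T" "h t \<otimes>\<^bsub>L\<^esub> b = h d"
      using frac[OF bL] by blast
    note b = bL this
    note tc = T_carrier[OF b(3)]
    have hc: "h s \<in> carrier L" "h t \<in> carrier L" using uc tc by auto
    have "h (s \<otimes> t) \<otimes>\<^bsub>L\<^esub> (b \<otimes>\<^bsub>L\<^esub> u) = (h t \<otimes>\<^bsub>L\<^esub> b) \<otimes>\<^bsub>L\<^esub> (h s \<otimes>\<^bsub>L\<^esub> u)"
      unfolding hom_simps(4)[OF uc(2) tc] using hc u(1) b(1) by algebra
    also have "\<dots> = h (d \<otimes> a)" using u b uc by simp
    finally show "b \<otimes>\<^bsub>L\<^esub> u \<in> ext I"
      using u b by (intro extI[of _ "d \<otimes> a" _ "s \<otimes> t"] R.ideal_lmult[OF I] T_mult) auto }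
qed

lemma ext_image: assumes I: "ideal I R" and a: "a \<in> I" shows "h a \<in> ext I"
proof -
  have "h \<one> \<otimes>\<^bsub>L\<^esub> h a = h a" "h a \<in> carrier L" using R.ideal_carrier[OF I a] by auto
  then show ?thesis unfolding ext_def using a T_one by blast
qed

lemma ext_prime_iff:
  assumes p: "primeideal p R" "p \<inter> T = {}" and a: "a \<in> carrier R"
  shows "h a \<in> ext p \<longleftrightarrow> a \<in> p"
proof
  note pi = R.primeideal_ideal[OF p(1)]
  assume "h a \<in> ext p"
  then obtain b s where b: "b \<in> p" "s \<in> T" "h s \<otimes>\<^bsub>L\<^esub> h a = h b" by (auto simp: ext_def)
  have bc: "b \<in> carrier R" "s \<in> carrier R" using b pi R.ideal_carrier T_carrier by auto
  \<comment> \<open>Equality of \<open>h (s a)\<close> and \<open>h b\<close> only means that some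
    \<open>t\<close> in \<open>T\<close> kills \<open>s a - b\<close>. Since \<open>t s\<close> lies
    outside \<open>p\<close>, primality moves \<open>a\<close> into \<open>p\<close>.\<close>
  have "h (s \<otimes> a \<oplus> (\<ominus> \<one>) \<otimes> b) = h b \<oplus>\<^bsub>L\<^esub> h (\<ominus> \<one>) \<otimes>\<^bsub>L\<^esub> h b" using bc a b by simp
  also have "\<dots> = h (b \<oplus> (\<ominus> \<one>) \<otimes> b)" using bc by simp
  also have "b \<oplus> (\<ominus> \<one>) \<otimes> b = \<zero>" using bc by algebra
  finally obtain t where t: "t \<in> T" "t \<otimes> (s \<otimes> a \<oplus> (\<ominus> \<one>) \<otimes> b) = \<zero>"
    using ker[of "s \<otimes> a \<oplus> (\<ominus> \<one>) \<otimes> b"] bc a by auto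
  have tc: "t \<in> carrier R" using t T_carrier by auto
  have "(t \<otimes> s) \<otimes> a = t \<otimes> (s \<otimes> a \<oplus> (\<ominus> \<one>) \<otimes> b) \<oplus> t \<otimes> b" using bc a tc by algebra
  also have "\<dots> \<in> p" unfolding t(2) using R.ideal_rules[OF pi] tc b by auto
  finally have "(t \<otimes> s) \<otimes> a \<in> p" .
  moreover have "t \<otimes> s \<notin> p" using T_mult t b p(2) by blast
  ultimately show "a \<in> p" using R.primeideal_mult[OF p(1)] bc tc a by auto
qed (use ext_image R.primeideal_ideal p in blast)

lemma ext_prime: assumes p: "primeideal p R" "p \<inter> T = {}" shows "primeideal (ext p) L"
proof (rule primeidealI)
  note pi = R.primeideal_ideal[OF p(1)]
  show "ideal (ext p) L" by (rule ext_ideal[OF pi])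
  show "carrier L \<noteq> ext p"
    using ext_prime_iff[OF p R.one_closed] R.primeideal_one[OF p(1)] L.one_closed by auto
  fix y z assume y: "y \<in> carrier L" "z \<in> carrier L" "y \<otimes>\<^bsub>L\<^esub> z \<in> ext p"
  obtain a s where a: "a \<in> carrier R" "s \<in> T" "h s \<otimes>\<^bsub>L\<^esub> y = h a" using frac y by blast
  obtain b t where b: "b \<in> carrier R" "t \<in> T" "h t \<otimes>\<^bsub>L\<^esub> z = h b" using frac y by blast
  have hc: "h s \<in> carrier L" "h t \<in> carrier L" using a b T_carrier by auto
  have "h (a \<otimes> b) = (h s \<otimes>\<^bsub>L\<^esub> y) \<otimes>\<^bsub>L\<^esub> (h t \<otimes>\<^bsub>L\<^esub> z)" using a b by simp
  also have "\<dots> = (h s \<otimes>\<^bsub>L\<^esub> h t) \<otimes>\<^bsub>L\<^esub> (y \<otimes>\<^bsub>L\<^esub> z)" using hc y(1,2) by algebra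
  also have "\<dots> \<in> ext p" using L.ideal_lmult[OF ext_ideal[OF pi]] hc y(3) by auto
  finally have "a \<otimes> b \<in> p" using ext_prime_iff[OF p, of "a \<otimes> b"] a b by simp
  then have "a \<in> p \<or> b \<in> p" using R.primeideal_mult[OF p(1)] a b by auto
  then show "y \<in> ext p \<or> z \<in> ext p" using a b y unfolding ext_def by blast
qed (rule L.is_cring)

text \<open>Every ideal of the localization is generated by the image of its contraction.\<close>

lemma noetherian: assumes "noetherian_ring R" shows "noetherian_ring L"
proof (rule L.noetherian_ringI)
  fix J assume J: "ideal J L"
  obtain A where A: "A \<subseteq> carrier R" "finite A" "{a \<in> carrier R. h a \<in> J} = Idl A"
    using noetherian_ring.finetely_gen[OF assms vimage_ideal[OF J]] by blast
  have A': "h ` A \<subseteq> carrier L" using A by auto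
  have "J = Idl\<^bsub>L\<^esub> (h ` A)"
  proof
    show "Idl\<^bsub>L\<^esub> (h ` A) \<subseteq> J" using A R.genideal_self[OF A(1)] by (intro L.genideal_minimal J) auto
    have "Idl A \<subseteq> {a \<in> carrier R. h a \<in> Idl\<^bsub>L\<^esub> (h ` A)}"
      using L.genideal_self[OF A'] A(1)
      by (intro R.genideal_minimal vimage_ideal L.genideal_ideal A') auto
    then have *: "h a \<in> Idl\<^bsub>L\<^esub> (h ` A)" if "a \<in> carrier R" "h a \<in> J" for a using that A(3) by auto
    show "J \<subseteq> Idl\<^bsub>L\<^esub> (h ` A)"
    proof
      fix y assume y: "y \<in> J"
      then have yc: "y \<in> carrier L" using J L.ideal_carrier by blast
      obtain a s where a: "a \<in> carrier R" "s \<in> T" "h s \<otimes>\<^bsub>L\<^esub> y = h a" using frac yc by blast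
      have "h a \<in> J" using a y L.ideal_lmult[OF J] T_carrier by (metis hom_simps(1))
      then show "y \<in> Idl\<^bsub>L\<^esub> (h ` A)"
        using unit_cancel[OF a(2) yc L.genideal_ideal[OF A']] * a by simp
    qed
  qed
  then show "\<exists>A\<subseteq>carrier L. finite A \<and> J = Idl\<^bsub>L\<^esub> A" using A A' by (intro exI[of _ "h ` A"]) auto
qed

end

lemma (in cring) prime_complement_submonoid:
  assumes p: "primeideal p R" shows "submonoid (carrier R - p) R"
  using primeideal_one[OF p] primeideal_mult[OF p] by unfold_locales auto

definition to_local_at :: "('a, 'b) ring_scheme \<Rightarrow> 'a set \<Rightarrow> 'a \<Rightarrow> ('a \<times> 'a) set" where
  "to_local_at R p a = fraction R (carrier R - p) a \<one>\<^bsub>R\<^esub>"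

lemma (in cring) loc_map_local_at:
  assumes p: "primeideal p R"
  shows "loc_map R (local_at R p) (to_local_at R p) (carrier R - p)"
proof -
  let ?T = "carrier R - p" and ?L = "local_at R p"
  note S = prime_complement_submonoid[OF p]
  have oneT: "\<one> \<in> ?T" using primeideal_one[OF p] by simp
  interpret L: cring ?L unfolding local_at_def by (rule localization_cring[OF S])
  have carr: "carrier ?L = {fraction R ?T a s | a s. a \<in> carrier R \<and> s \<in> ?T}"
    by (simp add: local_at_def localization_def)
  have zero: "\<zero>\<^bsub>?L\<^esub> = fraction R ?T \<zero> \<one>" and one: "\<one>\<^bsub>?L\<^esub> = fraction R ?T \<one> \<one>"
    by (simp_all add: local_at_def localization_def)
  note mult = localization_mult[OF S, folded local_at_def]
  note add = localization_add[OF S, folded local_at_def]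
  have hom: "to_local_at R p \<in> ring_hom R ?L"
  proof (rule ring_hom_memI)
    show "to_local_at R p x \<in> carrier ?L" if "x \<in> carrier R" for x
      using that oneT unfolding carr to_local_at_def by blast
  qed (use oneT in \<open>auto simp: to_local_at_def mult add one\<close>)
  show ?thesis
  proof (intro loc_map.intro loc_map_axioms.intro is_cring L.is_cring hom S)
    fix s assume s: "s \<in> ?T"
    have 1: "fraction R ?T \<one> s \<in> carrier ?L" "to_local_at R p s \<in> carrier ?L"
      unfolding carr to_local_at_def using s oneT by blast+
    have "to_local_at R p s \<otimes>\<^bsub>?L\<^esub> fraction R ?T \<one> s = fraction R ?T s s"
      using s oneT by (simp add: to_local_at_def mult)
    also have "\<dots> = \<one>\<^bsub>?L\<^esub>" unfolding one using s oneT by (intro fraction_eqI[OF S]) auto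
    finally show "to_local_at R p s \<in> Units ?L"
      using 1 L.m_comm[OF 1] by (auto simp: Units_def)
  next
    fix y assume "y \<in> carrier ?L"
    then obtain a s where y: "y = fraction R ?T a s" "a \<in> carrier R" "s \<in> ?T" unfolding carr by blast
    have "to_local_at R p s \<otimes>\<^bsub>?L\<^esub> y = fraction R ?T (s \<otimes> a) (\<one> \<otimes> s)"
      using y oneT unfolding to_local_at_def y(1) by (subst mult) auto
    also have "\<dots> = to_local_at R p a"
      unfolding to_local_at_def using y oneT by (intro fraction_eqI[OF S]) (auto simp: m_ac)
    finally show "\<exists>a\<in>carrier R. \<exists>s\<in>?T. to_local_at R p s \<otimes>\<^bsub>?L\<^esub> y = to_local_at R p a"
      using y by blast
  next
    fix a assume "a \<in> carrier R" "to_local_at R p a = \<zero>\<^bsub>?L\<^esub>"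
    then show "\<exists>s\<in>?T. s \<otimes> a = \<zero>"
      using fraction_eq_iff[OF S, of a \<one> \<zero> \<one>] oneT unfolding zero to_local_at_def by auto
  qed
qed

lemma (in loc_map) local:
  assumes "noetherian_ring R" and p: "primeideal p R" and Tp: "T = carrier R - p"
  shows "noetherian_local_ring L (ext p)"
proof (rule L.noetherian_local_ringI)
  have disj: "p \<inter> T = {}" using Tp by auto
  show "noetherian_ring L" by (rule noetherian) fact
  show "ideal (ext p) L" "ext p \<noteq> carrier L"
    using ext_prime[OF p disj] L.primeideal_ideal primeideal.I_notcarr by blast+
  fix y assume y: "y \<in> carrier L" "y \<notin> ext p"
  obtain a s where a: "a \<in> carrier R" "s \<in> T" "h s \<otimes>\<^bsub>L\<^esub> y = h a" using frac y by blast
  have "a \<notin> p" using a y by (auto simp: ext_def)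
  then have u: "h a \<in> Units L" using a Tp unit by auto
  have "y \<otimes>\<^bsub>L\<^esub> (h s \<otimes>\<^bsub>L\<^esub> inv\<^bsub>L\<^esub> h a) = \<one>\<^bsub>L\<^esub>"
    using u y(1) a T_carrier[OF a(2)] L.m_comm[of y "h s"] by (simp add: L.m_assoc[symmetric])
  moreover have "h s \<otimes>\<^bsub>L\<^esub> inv\<^bsub>L\<^esub> h a \<in> carrier L" using u T_carrier[OF a(2)] by simp
  ultimately show "y \<in> Units L"
    using y(1) L.m_comm[of y "h s \<otimes>\<^bsub>L\<^esub> inv\<^bsub>L\<^esub> h a"] unfolding Units_def by force
qed

text \<open>The principal ideal theorem in the localization at \<open>P\<close>: there
  \<open>ext P\<close> is the maximal ideal, and a prime different from it contracts to one strictly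
  below \<open>P\<close>.\<close>

lemma (in noetherian_cring) ex_prime_below:
  assumes p: "primeideal p R" and Q: "primeideal Q R" and P: "primeideal P R"
    and sub: "p \<subset> Q" "Q \<subset> P" and x: "x \<in> P"
  shows "\<exists>P'. primeideal P' R \<and> p \<subseteq> P' \<and> x \<in> P' \<and> P' \<subset> P"
proof -
  let ?T = "carrier R - P" and ?h = "to_local_at R P"
  interpret loc_map R "local_at R P" "to_local_at R P" ?T by (rule loc_map_local_at[OF P])
  have noe: "noetherian_ring R" by unfold_locales
  interpret loc: noetherian_local_ring "local_at R P" "ext P" by (rule local[OF noe P]) simp
  have disj: "p \<inter> ?T = {}" "Q \<inter> ?T = {}" "P \<inter> ?T = {}" using sub by auto
  note iff = ext_prime_iff[OF p disj(1)] ext_prime_iff[OF Q disj(2)] ext_prime_iff[OF P disj(3)]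
  note c = ideal_carrier[OF primeideal_ideal]
  obtain b c where b: "b \<in> Q" "b \<notin> p" and c: "c \<in> P" "c \<notin> Q" using sub by blast
  have "b \<in> carrier R" "c \<in> carrier R" using b c ideal_carrier primeideal_ideal P Q by blast+
  then have ne: "?h b \<in> ext Q" "?h b \<notin> ext p" "?h c \<in> ext P" "?h c \<notin> ext Q"
    using iff b c by auto
  have "ext p \<subseteq> ext Q" using sub by (auto simp: ext_def)
  with ne have "ext p \<subset> ext Q" "ext Q \<noteq> ext P" by auto
  moreover have "?h x \<in> ext P" using ext_image x primeideal_ideal[OF P] by blast
  ultimately obtain P' where P': "primeideal P' (local_at R P)" "ext p \<subseteq> P'" "?h x \<in> P'" "P' \<noteq> ext P"
    using loc.principal_ideal_theorem ext_prime p Q disj by blast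
  let ?P' = "{a \<in> carrier R. ?h a \<in> P'}"
  have le: "P' \<subseteq> ext P" using loc.prime_le_m P' by blast
  have "primeideal ?P' R" by (rule vimage_prime[OF P'(1)])
  moreover have "p \<subseteq> ?P'" using P'(2) ext_image[OF primeideal_ideal[OF p]] ideal_carrier primeideal_ideal[OF p] by blast
  moreover have "x \<in> ?P'" using P'(3) x ideal_carrier primeideal_ideal[OF P] by blast
  moreover have "?P' \<subseteq> P" using le iff(3) by blast
  \<comment> \<open>An element of \<open>ext P\<close> becomes the image of an element of
    \<open>P\<close> after multiplication by a unit, so a contraction equal to \<open>P\<close>
    would give \<open>P' = ext P\<close>.\<close>
  moreover have "?P' \<noteq> P"
  proof
    assume eq: "?P' = P"
    have "ext P \<subseteq> P'"
    proof
      fix y assume "y \<in> ext P"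
      then obtain a s where "y \<in> carrier (local_at R P)" "a \<in> P" "s \<in> ?T" "?h s \<otimes>\<^bsub>local_at R P\<^esub> y = ?h a"
        by (auto simp: ext_def)
      then show "y \<in> P'" using unit_cancel[of s y P'] L.primeideal_ideal[OF P'(1)] eq by auto
    qed
    then show False using le P'(4) by blast
  qed
  ultimately show ?thesis by blast
qed

subsection \<open>Krull's height theorem for local rings\<close>

lemma chain_dim_ge_fun:
  assumes "\<And>i. i \<le> n \<Longrightarrow> f i \<in> Z" "\<And>i. i < n \<Longrightarrow> f i \<subset> f (Suc i)"
  shows "enat n \<le> chain_dim Z"
proof -
  let ?ps = "map f [0..<Suc n]"
  have "sorted_wrt (\<subset>) ?ps"
    by (subst sorted_wrt_iff_nth_Suc_transp)
      (use assms in \<open>auto simp: transp_def nth_append less_Suc_eq simp del: upt_Suc\<close>)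
  moreover have "set ?ps \<subseteq> Z" using assms(1) by auto
  ultimately show ?thesis using chain_dim_ge[of ?ps Z] by simp
qed

lemma chain_dim_less_fun:
  assumes "enat n < chain_dim Z"
  obtains f where "\<And>i. i \<le> Suc n \<Longrightarrow> f i \<in> Z" "\<And>i. i < Suc n \<Longrightarrow> f i \<subset> f (Suc i)"
proof -
  obtain ps where ps: "sorted_wrt (\<subset>) ps" "set ps \<subseteq> Z" "length ps = n + 2"
    using chain_dim_obtain[OF assms] .
  show thesis
    using ps sorted_wrt_nth_less[OF ps(1)] nth_mem[of _ ps] by (intro that[of "(!) ps"]) auto
qed

text \<open>For \<open>n = 0\<close> the bound carries no information, because the empty set also
  has dimension \<open>0\<close>; hence the separate condition on \<open>Z\<close>.\<close>

lemma chain_dim_ge_obtain_fun: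
  assumes "enat n \<le> chain_dim Z" "Z \<noteq> {}"
  obtains f where "\<And>i. i \<le> n \<Longrightarrow> f i \<in> Z" "\<And>i. i < n \<Longrightarrow> f i \<subset> f (Suc i)"
proof (cases n)
  case 0
  then show thesis using assms(2) by (intro that[of "\<lambda>_. SOME z. z \<in> Z"]) (auto simp: some_in_eq)
next
  case (Suc k)
  then have "enat k < chain_dim Z" using assms(1) by (metis Suc_ile_eq)
  then show thesis using chain_dim_less_fun[of k Z] that Suc by auto
qed

text \<open>Puts \<open>x\<close> into every prime of a chain at the cost of one step: of the
  \<open>n + 1\<close> primes, \<open>n\<close> remain, with the same top. The principal ideal
  theorem pushes \<open>x\<close> from the top one place down, and the induction hypothesis treats
  the shorter chain.\<close>

lemma (in noetherian_cring) chain_through: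
  assumes "\<And>i. i \<le> n \<Longrightarrow> f i \<in> spec R" "\<And>i. i < n \<Longrightarrow> f i \<subset> f (Suc i)" "x \<in> f n"
  shows "\<exists>g. (\<forall>i<n. g i \<in> spec R \<and> x \<in> g i) \<and> (\<forall>i. Suc i < n \<longrightarrow> g i \<subset> g (Suc i)) \<and>
    (0 < n \<longrightarrow> g (n - 1) = f n)"
  using assms
proof (induction n arbitrary: f)
  case (Suc n)
  show ?case
  proof (cases n)
    case 0
    then show ?thesis using Suc.prems by (intro exI[of _ "\<lambda>_. f 1"]) auto
  next
    case (Suc k)
    have lt: "f k \<subset> f n" "f n \<subset> f (Suc n)" using Suc.prems(2)[of k] Suc.prems(2)[of n] Suc by auto
    have pr: "primeideal (f k) R" "primeideal (f n) R" "primeideal (f (Suc n)) R"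
      using Suc.prems(1) Suc by (auto simp: spec_def)
    \<comment> \<open>\<open>P\<close> takes the place of \<open>f n\<close>, between
      \<open>f k\<close> and the top.\<close>
    have "\<exists>P. primeideal P R \<and> f k \<subset> P \<and> x \<in> P \<and> P \<subset> f (Suc n)"
    proof (cases "x \<in> f n")
      case True
      then show ?thesis using lt pr by blast
    next
      case False
      then show ?thesis using ex_prime_below[OF pr lt Suc.prems(3)] lt by blast
    qed
    then obtain P where P: "primeideal P R" "f k \<subset> P" "x \<in> P" "P \<subset> f (Suc n)" by blast
    have "\<exists>g. (\<forall>i<n. g i \<in> spec R \<and> x \<in> g i) \<and> (\<forall>i. Suc i < n \<longrightarrow> g i \<subset> g (Suc i)) \<and>
      (0 < n \<longrightarrow> g (n - 1) = (f(n := P)) n)"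
    proof (rule Suc.IH[of "f(n := P)"])
      show "(f(n := P)) i \<in> spec R" if "i \<le> n" for i
        using that Suc.prems(1)[of i] P by (auto simp: spec_def)
      show "(f(n := P)) i \<subset> (f(n := P)) (Suc i)" if "i < n" for i
        using that Suc.prems(2)[of i] P Suc by (cases "i = k") auto
    qed (use P in auto)
    then obtain g where g: "\<And>i. i < n \<Longrightarrow> g i \<in> spec R \<and> x \<in> g i"
      "\<And>i. Suc i < n \<Longrightarrow> g i \<subset> g (Suc i)" "g k = P" using Suc by auto
    show ?thesis
    proof (intro exI[of _ "g(n := f (Suc n))"] conjI allI impI)
      show "(g(n := f (Suc n))) i \<in> spec R" if "i < Suc n" for i
        using that g(1)[of i] Suc.prems(1) by auto
      show "x \<in> (g(n := f (Suc n))) i" if "i < Suc n" for i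
        using that g(1)[of i] Suc.prems(3) by auto
      show "(g(n := f (Suc n))) i \<subset> (g(n := f (Suc n))) (Suc i)" if "Suc i < Suc n" for i
        using that g(2)[of i] g(3) P Suc by (cases "i = k") auto
    qed simp
  qed
qed simp

text \<open>Induction on the number of generators: modulo one of them, \<open>x\<close>, the maximal
  ideal needs one less, and a chain that is too long can be changed into one whose primes all
  contain \<open>x\<close> and which survives in \<open>R/x\<close>. The bound on
  \<open>card U\<close> is an inequality because passing to the quotient may identify
  generators.\<close>

theorem krull_height_local:
  fixes R :: "'a ring"
  assumes "noetherian_local_ring R m" "finite U" "U \<subseteq> carrier R" "m = Idl\<^bsub>R\<^esub> U" "card U \<le> n"
  shows "krull_dim R \<le> enat n"
  using assms
proof (induction n arbitrary: R m U)
  case (0 R m U)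
  interpret noetherian_local_ring R m by fact
  have "m \<subseteq> {\<zero>\<^bsub>R\<^esub>}" using 0 genideal_minimal[OF zeroideal] by simp
  show ?case
  proof (rule ccontr)
    assume "\<not> ?thesis"
    then have "enat 0 < chain_dim (spec R)" by (simp add: krull_dim_def)
    then obtain f where f: "\<And>i. i \<le> Suc 0 \<Longrightarrow> f i \<in> spec R" "\<And>i. i < Suc 0 \<Longrightarrow> f i \<subset> f (Suc i)"
      by (rule chain_dim_less_fun) blast
    have "primeideal (f 0) R" "primeideal (f 1) R" using f(1) by (auto simp: spec_def)
    then have "f 1 \<subseteq> {\<zero>\<^bsub>R\<^esub>}" "\<zero>\<^bsub>R\<^esub> \<in> f 0"
      using prime_le_m \<open>m \<subseteq> _\<close> ideal_zero primeideal_ideal by blast+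
    then show False using f(2)[of 0] by auto
  qed
next
  case (Suc n R m U)
  interpret noetherian_local_ring R m by fact
  show ?case
  proof (cases "card U \<le> n")
    case True
    then have "krull_dim R \<le> enat n" using Suc.IH Suc.prems by blast
    then show ?thesis using order_trans[of _ "enat n" "enat (Suc n)"] by simp
  next
    case False
    then obtain x where x: "x \<in> U" using Suc.prems by (metis card.empty ex_in_conv le0)
    have xm: "x \<in> m" using x Suc.prems(3,4) genideal_self by blast
    have xc: "x \<in> carrier R" using xm m_carrier by blast
    define I where "I = adj {\<zero>\<^bsub>R\<^esub>} x"
    have I: "ideal I R" "x \<in> I" unfolding I_def using adj_ideal adj_mem zeroideal xc by auto
    have Ile: "I \<subseteq> J" if "ideal J R" "x \<in> J" for J
      unfolding I_def using adj_least[OF zeroideal] that ideal_zero by auto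
    obtain S :: "'a ring" and h where S: "quot_map R S h I" using ex_quot_map[OF I(1)] by blast
    interpret S: quot_map R S h I by fact
    have loc: "noetherian_local_ring S (h ` m)"
      by (rule S.local_image[OF noetherian_local_ring_axioms Ile[OF m_ideal xm]])
    interpret SL: noetherian_local_ring S "h ` m" by fact
    have hx: "h x = \<zero>\<^bsub>S\<^esub>" using S.ker xc I by simp
    let ?V = "h ` (U - {x})"
    have V: "?V \<subseteq> carrier S" using Suc.prems(3) by auto
    have "h ` m = Idl\<^bsub>S\<^esub> (h ` U)" using S.image_genideal Suc.prems(3,4) by simp
    also have "\<dots> = Idl\<^bsub>S\<^esub> ?V"
    proof
      have "h u \<in> Idl\<^bsub>S\<^esub> ?V" if "u \<in> U" for u
        using hx S.S.ideal_zero[OF S.S.genideal_ideal[OF V]] S.S.genideal_self[OF V] that by (cases "u = x") auto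
      then have "h ` U \<subseteq> Idl\<^bsub>S\<^esub> ?V" by blast
      then show "Idl\<^bsub>S\<^esub> (h ` U) \<subseteq> Idl\<^bsub>S\<^esub> ?V" by (rule S.S.genideal_minimal[OF S.S.genideal_ideal[OF V]])
      have hU: "h ` U \<subseteq> carrier S" using Suc.prems(3) by auto
      show "Idl\<^bsub>S\<^esub> ?V \<subseteq> Idl\<^bsub>S\<^esub> (h ` U)"
        using S.S.genideal_self[OF hU] by (intro S.S.genideal_minimal S.S.genideal_ideal hU) auto
    qed
    finally have "h ` m = Idl\<^bsub>S\<^esub> ?V" .
    moreover have "card ?V \<le> n"
      using Suc.prems(2,5) x card_image_le[of "U - {x}" h] by (auto simp: card_Diff_singleton)
    ultimately have IH: "krull_dim S \<le> enat n" using Suc.IH[OF loc _ V] Suc.prems(2) by auto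
    show ?thesis
    proof (rule ccontr)
      assume "\<not> ?thesis"
      then have "enat (Suc n) < chain_dim (spec R)" by (simp add: krull_dim_def)
      then obtain f where f: "\<And>i. i \<le> Suc (Suc n) \<Longrightarrow> f i \<in> spec R"
        "\<And>i. i < Suc (Suc n) \<Longrightarrow> f i \<subset> f (Suc i)"
        by (rule chain_dim_less_fun) blast
      \<comment> \<open>With \<open>m\<close> on top the chain ends in a prime containing
        \<open>x\<close>. Of its \<open>n + 3\<close> primes \<open>chain_through\<close> leaves
        \<open>n + 2\<close>, all over \<open>x\<close>, which is one step too many for the
        quotient.\<close>
      let ?f = "f(Suc (Suc n) := m)"
      have "f (Suc (Suc n)) \<subseteq> m" using f(1)[of "Suc (Suc n)"] prime_le_m by (auto simp: spec_def)
      then have lt: "f (Suc n) \<subset> m" using f(2)[of "Suc n"] by auto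
      have "\<exists>g. (\<forall>i<Suc (Suc n). g i \<in> spec R \<and> x \<in> g i) \<and>
        (\<forall>i. Suc i < Suc (Suc n) \<longrightarrow> g i \<subset> g (Suc i)) \<and> (0 < Suc (Suc n) \<longrightarrow> g (Suc (Suc n) - 1) = ?f (Suc (Suc n)))"
      proof (rule chain_through[of "Suc (Suc n)" ?f])
        show "?f i \<in> spec R" if "i \<le> Suc (Suc n)" for i
          using that f(1)[of i] m_prime by (auto simp: spec_def)
        show "?f i \<subset> ?f (Suc i)" if "i < Suc (Suc n)" for i
          using that f(2)[of i] lt by (cases "i = Suc n") auto
      qed (use xm in auto)
      then obtain g where g0: "\<forall>i<Suc (Suc n). g i \<in> spec R \<and> x \<in> g i"
        "\<forall>i. Suc i < Suc (Suc n) \<longrightarrow> g i \<subset> g (Suc i)" by blast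
      then have g: "\<And>i. i \<le> Suc n \<Longrightarrow> g i \<in> spec R \<and> x \<in> g i"
        "\<And>i. i < Suc n \<Longrightarrow> g i \<subset> g (Suc i)" by auto
      have gi: "ideal (g i) R" "I \<subseteq> g i" "primeideal (g i) R" if "i \<le> Suc n" for i
        using g(1)[OF that] Ile by (auto simp: spec_def primeideal_ideal)
      have "enat (Suc n) \<le> chain_dim (spec S)"
      proof (rule chain_dim_ge_fun[of _ "\<lambda>i. h ` g i"])
        show "h ` g i \<in> spec S" if "i \<le> Suc n" for i
          using S.image_prime gi that by (auto simp: spec_def)
        show "h ` g i \<subset> h ` g (Suc i)" if "i < Suc n" for i
        proof -
          obtain a where a: "a \<in> g (Suc i)" "a \<notin> g i" using g(2)[OF \<open>i < Suc n\<close>] by blast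
          then have "a \<in> carrier R" using gi(1)[of "Suc i"] ideal_carrier that by auto
          then have "h a \<notin> h ` g i" using S.mem_image gi[of i] a that by auto
          then show ?thesis using a g(2)[OF that] by blast
        qed
      qed
      from order_trans[OF this IH[unfolded krull_dim_def]] have "enat (Suc n) \<le> enat n" .
      then show False by simp
    qed
  qed
qed

text \<open>A nonzerodivisor lies in no minimal prime: the set of all \<open>s x\<^sup>k\<close> with \<open>s \<notin> p\<close> does not
  contain \<open>\<zero>\<close>, so it avoids some prime below \<open>p\<close>.\<close>

lemma (in noetherian_cring) ex_prime_below_nonzerodivisor:
  assumes p: "primeideal p R" and x: "x \<in> p"
    and nzd: "\<And>a. a \<in> carrier R \<Longrightarrow> a \<otimes> x = \<zero> \<Longrightarrow> a = \<zero>"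
  shows "\<exists>q. primeideal q R \<and> q \<subset> p"
proof -
  note pi = primeideal_ideal[OF p]
  have xc: "x \<in> carrier R" using x pi ideal_carrier by blast
  let ?T = "{s \<otimes> x [^] k | s k. s \<in> carrier R \<and> s \<notin> p \<and> k \<in> (UNIV :: nat set)}"
  have nz: "s = \<zero>" if "s \<in> carrier R" "s \<otimes> x [^] k = \<zero>" for s and k :: nat
    using that
  proof (induction k)
    case (Suc k)
    have "(s \<otimes> x [^] k) \<otimes> x = \<zero>" using Suc.prems xc by (simp add: m_assoc)
    then show ?case using nzd[of "s \<otimes> x [^] k"] Suc xc by simp
  qed simp
  have "\<exists>q. primeideal q R \<and> {\<zero>} \<subseteq> q \<and> q \<inter> ?T = {}"
  proof (rule ex_prime_disjoint[OF zeroideal])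
    show "?T \<subseteq> carrier R" using xc by auto
    have "\<one> = \<one> \<otimes> x [^] (0::nat)" by simp
    then show "\<one> \<in> ?T" using primeideal_one[OF p] by blast
    show "s \<otimes> t \<in> ?T" if st: "s \<in> ?T" "t \<in> ?T" for s t
    proof -
      obtain a and k :: nat where a: "s = a \<otimes> x [^] k" "a \<in> carrier R" "a \<notin> p" using st(1) by blast
      obtain b and l :: nat where b: "t = b \<otimes> x [^] l" "b \<in> carrier R" "b \<notin> p" using st(2) by blast
      have "s \<otimes> t = (a \<otimes> b) \<otimes> x [^] (k + l)"
        using a b xc by (simp add: nat_pow_mult[symmetric] m_ac)
      moreover have "a \<otimes> b \<notin> p" using primeideal_mult[OF p] a b by blast
      ultimately show ?thesis using a b by blast
    qed
    show "{\<zero>} \<inter> ?T = {}" using nz ideal_zero[OF pi] by (auto dest: sym)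
  qed
  then obtain q where q: "primeideal q R" "q \<inter> ?T = {}" by blast
  have "s \<in> ?T" if "s \<in> carrier R" "s \<notin> p" for s
  proof -
    have "s = s \<otimes> x [^] (0::nat)" using that by simp
    then show ?thesis using that by blast
  qed
  then have "q \<subseteq> p" using q ideal_carrier[OF primeideal_ideal[OF q(1)]] by blast
  moreover have "x \<notin> q"
  proof -
    have "x = \<one> \<otimes> x [^] (1::nat)" using xc by simp
    then have "x \<in> ?T" using primeideal_one[OF p] by blast
    then show ?thesis using q by blast
  qed
  ultimately show ?thesis using q x by blast
qed

text \<open>The pullback of a chain of the quotient starts at a prime containing the nonzerodivisor
  \<open>x\<close>. Such a prime is not minimal, so one more prime fits below.\<close>

lemma (in noetherian_local_ring) krull_dim_quotient_nonzerodivisor: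
  assumes S: "quot_map R S h (adj {\<zero>} x)" and x: "x \<in> m"
    and nzd: "\<And>a. a \<in> carrier R \<Longrightarrow> a \<otimes> x = \<zero> \<Longrightarrow> a = \<zero>"
    and n: "enat n \<le> krull_dim S"
  shows "enat (Suc n) \<le> krull_dim R"
proof -
  interpret S: quot_map R S h "adj {\<zero>} x" by fact
  have xc: "x \<in> carrier R" using x m_carrier by blast
  have "h ` m \<in> spec S"
    using S.image_prime m_prime adj_least[OF zeroideal m_ideal] x ideal_zero[OF m_ideal] by (auto simp: spec_def)
  then obtain g where g: "\<And>i. i \<le> n \<Longrightarrow> g i \<in> spec S" "\<And>i. i < n \<Longrightarrow> g i \<subset> g (Suc i)"
    using chain_dim_ge_obtain_fun[OF n[unfolded krull_dim_def]] by blast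
  let ?f = "\<lambda>i. {a \<in> carrier R. h a \<in> g i}"
  have g': "primeideal (g i) S" if "i \<le> n" for i using g(1)[OF that] by (simp add: spec_def)
  have f: "primeideal (?f i) R" if "i \<le> n" for i by (rule S.vimage_prime[OF g'[OF that]])
  have "h x = \<zero>\<^bsub>S\<^esub>" using S.ker xc adj_mem[OF zeroideal xc] by simp
  then have "x \<in> ?f 0" using xc S.S.ideal_zero S.S.primeideal_ideal g'[of 0] by auto
  then obtain q where q: "primeideal q R" "q \<subset> ?f 0"
    using ex_prime_below_nonzerodivisor[OF f[of 0]] nzd by blast
  show ?thesis
    unfolding krull_dim_def
  proof (rule chain_dim_ge_fun[of _ "\<lambda>i. case i of 0 \<Rightarrow> q | Suc j \<Rightarrow> ?f j"])
    show "(case i of 0 \<Rightarrow> q | Suc j \<Rightarrow> ?f j) \<in> spec R" if "i \<le> Suc n" for i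
      using that q f by (auto simp: spec_def split: nat.split)
    show "(case i of 0 \<Rightarrow> q | Suc j \<Rightarrow> ?f j) \<subset> (case Suc i of 0 \<Rightarrow> q | Suc j \<Rightarrow> ?f j)" if "i < Suc n" for i
    proof (cases i)
      case 0
      then show ?thesis using q by simp
    next
      case (Suc j)
      then have "g j \<subset> g (Suc j)" "g j \<subseteq> carrier S" "g (Suc j) \<subseteq> carrier S"
        using g(2) g' that S.S.ideal_subset S.S.primeideal_ideal by auto
      then show ?thesis using S.vimage_strict_mono[of "g j" "g (Suc j)"] Suc by simp
    qed
  qed
qed

subsection \<open>Prime avoidance\<close>

context noetherian_local_ring begin

lemma diff_in_ideal: "ideal J R \<Longrightarrow> u \<in> carrier R \<Longrightarrow> v \<in> carrier R \<Longrightarrow> w \<in> carrier R \<Longrightarrow>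
    w \<oplus> u \<in> J \<Longrightarrow> w \<oplus> v \<in> J \<Longrightarrow> u \<ominus> v \<in> J"
proof -
  assume a: "ideal J R" "u \<in> carrier R" "v \<in> carrier R" "w \<in> carrier R" "w \<oplus> u \<in> J" "w \<oplus> v \<in> J"
  have "(w \<oplus> u) \<ominus> (w \<oplus> v) \<in> J" using a ideal_diff by blast
  moreover have "(w \<oplus> u) \<ominus> (w \<oplus> v) = u \<ominus> v" using a(2-4) by algebra
  ultimately show ?thesis by simp
qed

text \<open>A prime not containing \<open>y \<in> m\<close> contains at most one of the elements \<open>w + y\<^sup>k\<close>, since
  \<open>1 - y\<^sup>j\<close> is a unit.\<close>

lemma ex_add_pow_avoiding:
  assumes F: "finite F" "\<And>P. P \<in> F \<Longrightarrow> primeideal P R" "\<And>P. P \<in> F \<Longrightarrow> y \<notin> P"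
    and y: "y \<in> m" and w: "w \<in> carrier R"
  shows "\<exists>k\<ge>1. \<forall>P\<in>F. w \<oplus> y [^] (k::nat) \<notin> P"
proof -
  have yc: "y \<in> carrier R" using y m_carrier by blast
  have uniq: False if P: "P \<in> F" and kl: "k < l" "w \<oplus> y [^] k \<in> P" "w \<oplus> y [^] l \<in> P" for P k and l :: nat
  proof -
    note Pp = F(2)[OF P]
    obtain j where j: "l = k + Suc j" using kl(1) less_iff_Suc_add by auto
    have yj: "y [^] Suc j \<in> m" using ideal_lmult[OF m_ideal _ y] yc by simp
    have "y [^] k \<ominus> y [^] l \<in> P"
      using diff_in_ideal[OF primeideal_ideal[OF Pp]] kl yc w by simp
    also have "y [^] k \<ominus> y [^] l = y [^] k \<otimes> (\<one> \<ominus> y [^] Suc j)"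
    proof -
      have 1: "y [^] k \<in> carrier R" "y [^] Suc j \<in> carrier R" using yc by auto
      have "y [^] l = y [^] k \<otimes> y [^] Suc j" using j yc using nat_pow_mult[OF yc, of k "Suc j"] by simp
      then show ?thesis using 1 by algebra
    qed
    finally have "y [^] k \<in> P \<or> \<one> \<ominus> y [^] Suc j \<in> P" using primeideal_mult[OF Pp] yc by simp
    moreover have "\<one> \<ominus> y [^] Suc j \<notin> P"
      using one_minus_unit[OF yj] ideal_unit[OF primeideal_ideal[OF Pp]] primeideal.I_notcarr[OF Pp] by blast
    ultimately show False using primeideal_pow[OF Pp yc] F(3)[OF P] by blast
  qed
  let ?bad = "\<lambda>P. {k::nat. w \<oplus> y [^] k \<in> P}"
  have "finite (?bad P)" if P: "P \<in> F" for P
  proof -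
    have "i = k" if "i \<in> ?bad P" "k \<in> ?bad P" for i k
      using uniq[OF P, of i k] uniq[OF P, of k i] that by (cases i k rule: linorder_cases) auto
    then have "?bad P \<subseteq> {k}" if "k \<in> ?bad P" for k using that by blast
    then show ?thesis by (cases "?bad P = {}") (simp, meson ex_in_conv finite.emptyI finite.insertI finite_subset)
  qed
  then have "finite (\<Union>P\<in>F. ?bad P)" using F(1) by blast
  then obtain k where k: "\<And>i. i \<in> (\<Union>P\<in>F. ?bad P) \<Longrightarrow> i < k" by (meson bounded_nat_set_is_finite finite_nat_set_iff_bounded)
  show ?thesis
  \<comment> \<open>The exponent lies beyond all bad ones and is positive, so that the added power
    stays in every ideal containing \<open>y\<close>.\<close>
  proof (intro exI[of _ "Suc k"] conjI ballI)
    fix P assume P: "P \<in> F"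
    show "w \<oplus> y [^] Suc k \<notin> P"
    proof
      assume "w \<oplus> y [^] Suc k \<in> P"
      then have "Suc k \<in> (\<Union>P\<in>F. ?bad P)" using P by blast
      then show False using k[of "Suc k"] by simp
    qed
  qed simp
qed

text \<open>If the element \<open>y\<close> found so far lies in the new prime \<open>P\<close>, it
  is replaced by \<open>w + y^k\<close> with \<open>w\<close> in \<open>m\<close> outside
  \<open>P\<close>: the power does not disturb \<open>w\<close> modulo \<open>P\<close>, and a
  suitable exponent keeps the sum out of the earlier primes.\<close>

lemma finite_prime_avoidance:
  assumes "finite F" "\<And>P. P \<in> F \<Longrightarrow> primeideal P R \<and> P \<noteq> m"
  shows "\<exists>y\<in>m. \<forall>P\<in>F. y \<notin> P"
  using assms
proof (induction F rule: finite_induct)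
  case empty
  then show ?case using ideal_zero[OF m_ideal] by blast
next
  case (insert P F)
  then obtain y where y: "y \<in> m" "\<forall>P\<in>F. y \<notin> P" by auto
  have P: "primeideal P R" "P \<noteq> m" using insert by auto
  show ?case
  proof (cases "y \<in> P")
    case True
    obtain w where w: "w \<in> m" "w \<notin> P" using prime_le_m[OF P(1)] P(2) by blast
    have c: "w \<in> carrier R" "y \<in> carrier R" using w y m_carrier by auto
    obtain k :: nat where k: "k \<ge> 1" "\<forall>P\<in>F. w \<oplus> y [^] k \<notin> P"
      using ex_add_pow_avoiding[OF insert(1) _ _ y(1) c(1)] insert y(2) by blast
    obtain j where j: "k = Suc j" using k(1) by (cases k) auto
    have yk: "y [^] k \<in> P" "y [^] k \<in> m"
      unfolding j using ideal_lmult primeideal_ideal[OF P(1)] m_ideal True y(1) c by auto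
    have "w \<oplus> y [^] k \<notin> P"
    proof
      assume "w \<oplus> y [^] k \<in> P"
      then have "y [^] k \<oplus> w \<in> P" using c by (simp add: a_comm)
      then show False using ideal_add_cancel[OF primeideal_ideal[OF P(1)] yk(1) c(1)] w by blast
    qed
    moreover have "w \<oplus> y [^] k \<in> m" using w yk ideal_add[OF m_ideal] by blast
    ultimately show ?thesis using k by blast
  qed (use y in blast)
qed

section \<open>Zero divisors and maximal annihilators\<close>

definition ann :: "'a \<Rightarrow> 'a set" where
  "ann z = {r \<in> carrier R. r \<otimes> z = \<zero>}"

text \<open>The maximal annihilators are primes whose union is the set of zero divisors. Finitely
  many witnesses generate an ideal containing all witnesses. If \<open>ann z\<close> differed from
  the annihilators of these generators, some element outside it would kill all of them, and
  therefore \<open>z\<close> as well.\<close>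

lemma finite_maximal_annihilators:
  obtains F where "finite F" "\<And>P. P \<in> F \<Longrightarrow> primeideal P R \<and> (\<exists>z\<in>carrier R. z \<noteq> \<zero> \<and> P = ann z)"
    "\<And>z. z \<in> carrier R \<Longrightarrow> z \<noteq> \<zero> \<Longrightarrow> \<exists>P\<in>F. ann z \<subseteq> P"
proof -
  define Z where "Z = {z \<in> carrier R. z \<noteq> \<zero> \<and> primeideal (ann z) R \<and>
    (\<forall>y\<in>carrier R. y \<noteq> \<zero> \<longrightarrow> ann z \<subseteq> ann y \<longrightarrow> ann y = ann z)}"
  have Zc: "Z \<subseteq> carrier R" by (auto simp: Z_def)
  have above: "\<exists>z\<in>Z. ann z0 \<subseteq> ann z" if "z0 \<in> carrier R" "z0 \<noteq> \<zero>" for z0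
    using ex_prime_colon[OF zeroideal that(1)] that(2) unfolding Z_def ann_def by auto
  have fin: "\<exists>Z0. finite Z0 \<and> Z0 \<subseteq> Z \<and> Z \<subseteq> Idl Z0"
  proof -
    have "ideal (Idl {}) R" by (rule genideal_ideal) simp
    from maximal_ideal_in[of "Idl {}" "\<lambda>I. \<exists>Z0. finite Z0 \<and> Z0 \<subseteq> Z \<and> I = Idl Z0", OF this]
    obtain Z0 where Z0: "finite Z0" "Z0 \<subseteq> Z"
      and max: "\<And>Z1. finite Z1 \<Longrightarrow> Z1 \<subseteq> Z \<Longrightarrow> Idl Z0 \<subseteq> Idl Z1 \<Longrightarrow> Idl Z1 = Idl Z0"
      using genideal_ideal Zc by (smt (verit, ccfv_threshold) empty_subsetI finite.emptyI subset_trans)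
    have "z \<in> Idl Z0" if "z \<in> Z" for z
    proof -
      have c: "insert z Z0 \<subseteq> carrier R" "Z0 \<subseteq> carrier R" using that Z0 Zc by auto
      have "Idl Z0 \<subseteq> Idl (insert z Z0)"
        using genideal_self[OF c(1)] by (intro genideal_minimal genideal_ideal c) auto
      then have "Idl (insert z Z0) = Idl Z0" using max[of "insert z Z0"] Z0 that by auto
      then show ?thesis using genideal_self[OF c(1)] by blast
    qed
    then show ?thesis using Z0 by blast
  qed
  then obtain Z0 where Z0: "finite Z0" "Z0 \<subseteq> Z" "Z \<subseteq> Idl Z0" by blast
  have "ann z \<in> ann ` Z0" if z: "z \<in> Z" for z
  proof (rule ccontr)
    assume neg: "ann z \<notin> ann ` Z0"
    have P: "primeideal (ann z) R" using z by (simp add: Z_def)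
    have nsub: "\<not> ann y \<subseteq> ann z" if "y \<in> Z0" for y
    proof
      assume sub: "ann y \<subseteq> ann z"
      have "y \<in> Z" using that Z0 by blast
      then have "ann z = ann y" using sub z unfolding Z_def by blast
      then show False using neg that by blast
    qed
    \<comment> \<open>The product of one element from each \<open>ann y\<close>, all chosen outside
      the prime \<open>ann z\<close>.\<close>
    have "\<exists>r\<in>carrier R. r \<notin> ann z \<and> (\<forall>y\<in>Y. r \<otimes> y = \<zero>)" if "finite Y" "Y \<subseteq> Z0" for Y
      using that
    proof (induction Y rule: finite_induct)
      case empty
      then show ?case using primeideal_one[OF P] one_closed by blast
    next
      case (insert y Y)
      then obtain r where r: "r \<in> carrier R" "r \<notin> ann z" "\<forall>y\<in>Y. r \<otimes> y = \<zero>" by auto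
      have Yc: "\<And>u. u \<in> insert y Y \<Longrightarrow> u \<in> carrier R" using insert Z0 Zc by blast
      obtain s where s: "s \<in> carrier R" "s \<notin> ann z" "s \<otimes> y = \<zero>"
        using nsub[of y] insert unfolding ann_def by blast
      have "(r \<otimes> s) \<otimes> u = \<zero>" if u: "u \<in> insert y Y" for u
      proof (cases "u = y")
        case True
        then show ?thesis using r s Yc[OF u] by (simp add: m_assoc)
      next
        case False
        have "(r \<otimes> s) \<otimes> u = s \<otimes> (r \<otimes> u)" using r(1) s(1) Yc[OF u] by algebra
        then show ?thesis using r s u False by simp
      qed
      moreover have "r \<otimes> s \<notin> ann z" using primeideal_mult[OF P] r s by blast
      ultimately show ?case using r s by blast
    qed
    then obtain r where r: "r \<in> carrier R" "r \<notin> ann z" "\<forall>y\<in>Z0. r \<otimes> y = \<zero>" using Z0(1) by blast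
    have "ideal {y \<in> carrier R. r \<otimes> y = \<zero>} R"
      using r(1) by (intro ideal_by) (auto simp: r_distr m_lcomm)
    then have "Idl Z0 \<subseteq> {y \<in> carrier R. r \<otimes> y = \<zero>}"
      using r(3) Z0(2) Zc by (intro genideal_minimal) auto
    then have "r \<otimes> z = \<zero>" using Z0(3) z by blast
    then show False using r by (simp add: ann_def)
  qed
  then have "\<forall>z\<in>carrier R. z \<noteq> \<zero> \<longrightarrow> (\<exists>P\<in>ann ` Z0. ann z \<subseteq> P)" using above by metis
  moreover have "\<forall>P\<in>ann ` Z0. primeideal P R \<and> (\<exists>z\<in>carrier R. z \<noteq> \<zero> \<and> P = ann z)"
    using Z0(2) by (auto simp: Z_def)
  ultimately show thesis using Z0(1) by (intro that[of "ann ` Z0"]) auto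
qed

text \<open>Prime avoidance with one further ideal \<open>J\<close>, which will be the square of
  \<open>m\<close>. The primes are the maximal annihilators, different from \<open>m\<close> by the
  depth hypothesis, and a \<open>y\<close> that falls into \<open>J\<close> is repaired by
  \<open>w + y^k\<close> as before.\<close>

lemma ex_nonzerodivisor_avoiding:
  assumes depth: "\<And>z. z \<in> carrier R \<Longrightarrow> z \<noteq> \<zero> \<Longrightarrow> \<exists>r\<in>m. r \<otimes> z \<noteq> \<zero>"
    and J: "ideal J R" "J \<subset> m"
  shows "\<exists>x\<in>m. x \<notin> J \<and> (\<forall>a\<in>carrier R. a \<otimes> x = \<zero> \<longrightarrow> a = \<zero>)"
proof -
  obtain F where F: "finite F" "\<And>P. P \<in> F \<Longrightarrow> primeideal P R \<and> (\<exists>z\<in>carrier R. z \<noteq> \<zero> \<and> P = ann z)"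
    "\<And>z. z \<in> carrier R \<Longrightarrow> z \<noteq> \<zero> \<Longrightarrow> \<exists>P\<in>F. ann z \<subseteq> P"
    by (rule finite_maximal_annihilators) (rule that, assumption, blast+)
  have Fm: "P \<noteq> m" if PF: "P \<in> F" for P
  proof -
    obtain z where z: "z \<in> carrier R" "z \<noteq> \<zero>" "P = ann z"
      using F(2)[OF PF] by blast
    obtain r where "r \<in> m" "r \<otimes> z \<noteq> \<zero>" using depth z by blast
    then show ?thesis using z by (auto simp: ann_def)
  qed
  have nzd: "\<forall>a\<in>carrier R. a \<otimes> x = \<zero> \<longrightarrow> a = \<zero>" if x: "x \<in> m" "\<forall>P\<in>F. x \<notin> P" for x
  proof (intro ballI impI, rule ccontr)
    fix a assume a: "a \<in> carrier R" "a \<otimes> x = \<zero>" "a \<noteq> \<zero>"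
    then obtain P where "P \<in> F" "ann a \<subseteq> P" using F(3) by blast
    moreover have "x \<in> ann a" using a x m_carrier m_comm by (auto simp: ann_def)
    ultimately show False using x by blast
  qed
  obtain y where y: "y \<in> m" "\<forall>P\<in>F. y \<notin> P" using finite_prime_avoidance[OF F(1)] F(2) Fm by blast
  show ?thesis
  proof (cases "y \<in> J")
    case True
    obtain w where w: "w \<in> m" "w \<notin> J" using J by blast
    have c: "w \<in> carrier R" "y \<in> carrier R" using w y m_carrier by auto
    obtain k :: nat where k: "k \<ge> 1" "\<forall>P\<in>F. w \<oplus> y [^] k \<notin> P"
      using ex_add_pow_avoiding[OF F(1) _ _ y(1) c(1)] F(2) y(2) by blast
    obtain j where j: "k = Suc j" using k(1) by (cases k) auto
    have yk: "y [^] k \<in> J" unfolding j using ideal_lmult[OF J(1)] True c by simp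
    have "w \<oplus> y [^] k \<notin> J"
    proof
      assume "w \<oplus> y [^] k \<in> J"
      then have "y [^] k \<oplus> w \<in> J" using c by (simp add: a_comm)
      then show False using ideal_add_cancel[OF J(1) yk c(1)] w by blast
    qed
    moreover have "w \<oplus> y [^] k \<in> m" using w yk J ideal_add[OF m_ideal] by blast
    ultimately show ?thesis using k nzd by blast
  qed (use y nzd in blast)
qed

subsection \<open>Krull's intersection theorem\<close>

abbreviation mpow :: "nat \<Rightarrow> 'a set" where "mpow n \<equiv> m [^]\<^bsub>ideals_set R\<^esub> n"

lemma mpow_0: "mpow 0 = carrier R" and mpow_Suc: "mpow (Suc n) = mpow n \<cdot> m"
  by (simp_all add: nat_pow_def ideals_set_def)

lemma mpow_ideal: "ideal (mpow n) R" by (rule ideal_pow_ideal[OF m_ideal])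

lemma mpow_antimono: "k \<le> n \<Longrightarrow> mpow n \<subseteq> mpow k"
proof (rule lift_Suc_antimono_le[of mpow])
  show "mpow (Suc n) \<subseteq> mpow n" for n
    unfolding mpow_Suc using ideal_prod_inter[OF mpow_ideal m_ideal] by blast
qed

lemma pow_in_mpow: "x \<in> m \<Longrightarrow> x [^] n \<in> mpow n"
proof (induction n)
  case (Suc n)
  then show ?case unfolding mpow_Suc by (simp add: ideal_prod.prod)
qed (simp only: mpow_0 nat_pow_0 one_closed)

lemma mpow_1: "mpow 1 = m"
proof -
  have "mpow (Suc 0) = m" unfolding mpow_Suc mpow_0 using ideal_prod_one[OF m_ideal] ideal_prod_commute[OF m_ideal oneideal] by metis
  then show ?thesis by simp
qed

text \<open>Noetherian induction from above: if \<open>K\<close> is proper, the prime colon ideal of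
  some \<open>z\<close> contains \<open>m\<close>, because powers of the elements of
  \<open>m\<close> lie in \<open>K\<close>. Hence a power of \<open>m\<close> inside
  \<open>K + Rz\<close> yields the next power inside \<open>K\<close>.\<close>

lemma mpow_subset:
  assumes K: "ideal K R" and rad: "\<And>x. x \<in> m \<Longrightarrow> \<exists>k::nat. x [^] k \<in> K"
  shows "\<exists>n. mpow n \<subseteq> K"
proof -
  have "(\<forall>x\<in>m. \<exists>k::nat. x [^] k \<in> K) \<longrightarrow> (\<exists>n. mpow n \<subseteq> K)"
    using K
  proof (induction K rule: noetherian_ideal_induct)
    case (step K)
    show ?case
    proof
      assume rad: "\<forall>x\<in>m. \<exists>k::nat. x [^] k \<in> K"
      show "\<exists>n. mpow n \<subseteq> K"
      proof (cases "\<one> \<in> K")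
        case True
        then show ?thesis using ideal_one step mpow_0 by (metis subset_refl)
      next
        case False
        obtain z where z: "z \<in> carrier R" "z \<notin> K" "primeideal {r \<in> carrier R. r \<otimes> z \<in> K} R" (is "primeideal ?P R")
          using ex_prime_colon[OF step(1) one_closed False] by blast
        have KP: "K \<subseteq> ?P" using ideal_carrier[OF step(1)] ideal_rmult[OF step(1) z(1)] by auto
        have mP: "m \<subseteq> ?P"
        proof
          fix x assume x: "x \<in> m"
          then obtain k :: nat where "x [^] k \<in> K" using rad by blast
          then show "x \<in> ?P" using KP primeideal_pow[OF z(3)] x m_carrier by blast
        qed
        have sup: "K \<subset> adj K z" using adj_sup[OF step(1) z(1)] adj_mem[OF step(1) z(1)] z(2) by blast
        then have "\<exists>n. mpow n \<subseteq> adj K z" using step(2)[OF adj_ideal[OF step(1) z(1)] sup] rad by blast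
        then obtain n where n: "mpow n \<subseteq> adj K z" by blast
        have "mpow (Suc n) \<subseteq> K"
          unfolding mpow_Suc ideal_prod_eq_genideal[OF mpow_ideal m_ideal]
        proof (rule genideal_minimal[OF step(1)], rule subsetI)
          fix v assume "v \<in> mpow n <#> m"
          then obtain u x where v: "v = u \<otimes> x" "u \<in> mpow n" "x \<in> m" by (auto simp: set_mult_def)
          then have "u \<in> adj K z" using n by blast
          then obtain i a where u: "u = i \<oplus> a \<otimes> z" "i \<in> K" "a \<in> carrier R" by (auto simp: adj_def)
          have c: "i \<in> carrier R" "x \<in> carrier R" using u ideal_carrier[OF step(1)] v m_carrier by auto
          have "v = x \<otimes> i \<oplus> a \<otimes> (x \<otimes> z)" unfolding v(1) u(1) using c u(3) z(1) by algebra
          also have "\<dots> \<in> K" using v(3) mP c u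
            by (intro ideal_add[OF step(1)] ideal_lmult[OF step(1) _ u(2)] ideal_lmult[OF step(1) u(3)]) auto
          finally show "v \<in> K" .
        qed
        then show ?thesis by blast
      qed
    qed
  qed
  then show ?thesis using rad by blast
qed

text \<open>Ideals are closed in the adic topology. In place of the Artin-Rees lemma, take
  \<open>K\<close> maximal with \<open>K \<inter> (P + Ry)\<close> inside \<open>E = P + my\<close>.
  Such a \<open>K\<close> contains a power of \<open>m\<close>, so the approximations put
  \<open>y\<close> into \<open>K\<close>, hence into \<open>P + my\<close>, and \<open>1 - r\<close>
  is a unit.\<close>

theorem krull_intersection:
  assumes P: "ideal P R" and y: "y \<in> carrier R"
    and app: "\<And>n. \<exists>p\<in>P. \<exists>u\<in>mpow n. y = p \<oplus> u"
  shows "y \<in> P"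
proof -
  note Pc = ideal_carrier[OF P]
  define E where "E = {p \<oplus> r \<otimes> y | p r. p \<in> P \<and> r \<in> m}"
  have E: "ideal E R"
  proof (rule ideal_by)
    show "E \<subseteq> carrier R" using y Pc m_carrier by (auto simp: E_def)
    have "\<zero> = \<zero> \<oplus> \<zero> \<otimes> y" using y by simp
    then show "\<zero> \<in> E" unfolding E_def using ideal_zero[OF P] ideal_zero[OF m_ideal] by blast
    fix u v a assume "u \<in> E"
    then obtain j r where u: "u = j \<oplus> r \<otimes> y" "j \<in> P" "r \<in> m" by (auto simp: E_def)
    note uc = Pc[OF u(2)] m_carrier[OF u(3)]
    { assume "v \<in> E"
      then obtain j' r' where v: "v = j' \<oplus> r' \<otimes> y" "j' \<in> P" "r' \<in> m" by (auto simp: E_def)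
      have "u \<oplus> v = (j \<oplus> j') \<oplus> (r \<oplus> r') \<otimes> y"
        unfolding u(1) v(1) using y uc Pc[OF v(2)] m_carrier[OF v(3)] by algebra
      then show "u \<oplus> v \<in> E" unfolding E_def using u v ideal_add[OF P] ideal_add[OF m_ideal] by blast }
    { assume a: "a \<in> carrier R"
      have "a \<otimes> u = a \<otimes> j \<oplus> (a \<otimes> r) \<otimes> y" unfolding u(1) using a y uc by algebra
      then show "a \<otimes> u \<in> E" unfolding E_def using u a ideal_lmult[OF P] ideal_lmult[OF m_ideal] by blast }
  qed
  have PE: "P \<subseteq> E"
  proof
    fix p assume "p \<in> P"
    then have "p = p \<oplus> \<zero> \<otimes> y" using Pc y by simp
    then show "p \<in> E" unfolding E_def using \<open>p \<in> P\<close> ideal_zero[OF m_ideal] by blast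
  qed
  let ?B = "adj P y"
  have xB: "x \<otimes> u \<in> E" if "x \<in> m" "u \<in> ?B" for x u
  proof -
    obtain p a where u: "u = p \<oplus> a \<otimes> y" "p \<in> P" "a \<in> carrier R" using \<open>u \<in> ?B\<close> by (auto simp: adj_def)
    have c: "p \<in> carrier R" "x \<in> carrier R" using u Pc that m_carrier by auto
    have "x \<otimes> u = x \<otimes> p \<oplus> (x \<otimes> a) \<otimes> y" unfolding u(1) using c u(3) y by algebra
    then show ?thesis unfolding E_def using u that c ideal_lmult[OF P] ideal_rmult[OF m_ideal] by blast
  qed
  from maximal_ideal_in[of E "\<lambda>K. K \<inter> ?B \<subseteq> E", OF E]
  obtain K where K: "ideal K R" "K \<inter> ?B \<subseteq> E" "E \<subseteq> K"
    "\<And>I. ideal I R \<Longrightarrow> I \<inter> ?B \<subseteq> E \<Longrightarrow> K \<subseteq> I \<Longrightarrow> I = K" by auto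
  have "\<exists>k::nat. x [^] k \<in> K" if x: "x \<in> m" for x
  proof -
    have xc: "x \<in> carrier R" using x m_carrier by blast
    \<comment> \<open>The increasing chain of colon ideals stops at some \<open>k\<close>. Then
      adding \<open>x^k\<close> to \<open>K\<close> keeps the intersection inside \<open>E\<close>,
      and maximality gives \<open>x^k\<close> in \<open>K\<close>.\<close>
    define C where "C = (\<lambda>k::nat. {a \<in> carrier R. a \<otimes> x [^] k \<in> K})"
    have Ci: "ideal (C k) R" for k
      using ideal_rules[OF K(1)] xc by (intro ideal_by) (auto simp: C_def l_distr m_assoc)
    from maximal_ideal_in[of "C 0" "\<lambda>I. \<exists>k. I = C k"] Ci
    obtain k where k: "\<And>l. C k \<subseteq> C l \<Longrightarrow> C l = C k" by metis
    have "C k \<subseteq> C (Suc k)"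
    proof
      fix a assume "a \<in> C k"
      then have a: "a \<in> carrier R" "a \<otimes> x [^] k \<in> K" by (auto simp: C_def)
      have "a \<otimes> x [^] Suc k = (a \<otimes> x [^] k) \<otimes> x" using a(1) xc by (simp add: m_assoc)
      then show "a \<in> C (Suc k)" using a ideal_rmult[OF K(1) xc] by (auto simp: C_def)
    qed
    then have Ck: "C (Suc k) = C k" by (rule k)
    have xk: "x [^] k \<in> carrier R" using xc by simp
    have "adj K (x [^] k) \<inter> ?B \<subseteq> E"
    proof
      fix u assume "u \<in> adj K (x [^] k) \<inter> ?B"
      then obtain i a where u: "u = i \<oplus> a \<otimes> x [^] k" "i \<in> K" "a \<in> carrier R" "u \<in> ?B"
        by (auto simp: adj_def)
      have ic: "i \<in> carrier R" using u K(1) ideal_carrier by blast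
      have "x \<otimes> i \<oplus> a \<otimes> (x [^] k \<otimes> x) = x \<otimes> u" unfolding u(1) using ic u(3) xk xc by algebra
      then have "x \<otimes> i \<oplus> a \<otimes> (x [^] k \<otimes> x) \<in> K" using xB[OF x u(4)] K(3) by auto
      then have "a \<otimes> (x [^] k \<otimes> x) \<in> K"
        using ideal_add_cancel[OF K(1), of "x \<otimes> i" "a \<otimes> (x [^] k \<otimes> x)"] ideal_lmult[OF K(1) xc u(2)] u(3) xc by simp
      then have "a \<in> C (Suc k)" using u(3) by (simp add: C_def)
      then have "a \<otimes> x [^] k \<in> K" unfolding Ck by (simp add: C_def)
      then have "u \<in> K" unfolding u(1) using ideal_add[OF K(1)] u(2) by blast
      then show "u \<in> E" using K(2) u(4) by blast
    qed
    then have "adj K (x [^] k) = K" using K(4) adj_ideal[OF K(1) xk] adj_sup[OF K(1) xk] by blast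
    then show ?thesis using adj_mem[OF K(1) xk] by auto
  qed
  then obtain n where n: "mpow n \<subseteq> K" using mpow_subset[OF K(1)] by blast
  obtain p u where "p \<in> P" "u \<in> mpow n" "y = p \<oplus> u" using app by blast
  then have "y \<in> K" using n PE K(3) ideal_add[OF K(1)] by blast
  then have "y \<in> E" using K(2) adj_mem[OF P y] by blast
  then obtain p r where p: "y = p \<oplus> r \<otimes> y" "p \<in> P" "r \<in> m" by (auto simp: E_def)
  have c: "p \<in> carrier R" "r \<in> carrier R" using p Pc m_carrier by auto
  have "(\<one> \<ominus> r) \<otimes> y = y \<ominus> r \<otimes> y" using c y by algebra
  also have "\<dots> = p" using c y by (subst p(1)) algebra
  finally have "inv (\<one> \<ominus> r) \<otimes> ((\<one> \<ominus> r) \<otimes> y) \<in> P"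
    using p one_minus_unit ideal_lmult[OF P] by simp
  moreover have "inv (\<one> \<ominus> r) \<otimes> ((\<one> \<ominus> r) \<otimes> y) = y"
    using one_minus_unit[OF p(3)] c y by (simp add: m_assoc[symmetric])
  ultimately show "y \<in> P" by simp
qed

end

subsection \<open>Countable prime avoidance\<close>

context noetherian_local_ring begin

text \<open>Induction on the generators. There are uncountably many \<open>x + t y\<close> with
  \<open>t\<close> from a set of representatives of the residue field, and an ideal not containing
  \<open>y\<close> catches at most one such \<open>t\<close>, since differences of representatives
  are units.\<close>

lemma countable_avoidance_uncountable:
  assumes unc: "uncountable (carrier (R Quot m))"
    and A: "finite A" "A \<subseteq> carrier R"
    and PS: "countable PS" "\<And>P. P \<in> PS \<Longrightarrow> ideal P R \<and> \<not> A \<subseteq> P"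
  shows "\<exists>y\<in>Idl A. \<forall>P\<in>PS. y \<notin> P"
proof -
  interpret I: ideal m R by (rule m_ideal)
  define f where "f = (\<lambda>c :: 'a set. SOME t. t \<in> c)"
  define T where "T = f ` carrier (R Quot m)"
  have quot: "carrier (R Quot m) = {m +> a | a. a \<in> carrier R}"
    unfolding FactRing_def A_RCOSETS_def' by auto
  have fm: "f c \<in> carrier R \<and> c = m +> f c" if c: "c \<in> carrier (R Quot m)" for c
  proof -
    obtain a where a: "a \<in> carrier R" "c = m +> a" using c quot by blast
    have "f c \<in> c" unfolding f_def by (rule someI[of _ a]) (use a I.a_rcos_self in simp)
    then show ?thesis
      using a I.a_repr_independence'[of "f c" a] I.a_elemrcos_carrier by auto
  qed
  have "inj_on f (carrier (R Quot m))" using fm by (metis inj_onI)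
  then have Tunc: "uncountable T" unfolding T_def using unc countable_image_inj_on by blast
  have Tc: "t \<in> carrier R" if "t \<in> T" for t using that fm unfolding T_def by blast
  have Tdiff: "t \<ominus> t' \<in> Units R" if t: "t \<in> T" "t' \<in> T" "t \<noteq> t'" for t t'
  proof -
    have "m +> t \<noteq> m +> t'" using t fm unfolding T_def by (metis imageE)
    then have "t \<ominus> t' \<notin> m" using quotient_eq_iff_same_a_r_cos[OF m_ideal] t Tc by blast
    then show ?thesis using unit_iff t Tc by auto
  qed
  show ?thesis using A PS
  proof (induction A arbitrary: PS rule: finite_induct)
    case empty
    then have "PS = {}" by auto
    moreover have "\<zero> \<in> Idl {}" using ideal_zero genideal_ideal by blast
    ultimately show ?case by blast
  next
    case (insert x A)
    have c: "x \<in> carrier R" "A \<subseteq> carrier R" "insert x A \<subseteq> carrier R" using insert by auto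
    \<comment> \<open>The ideals containing \<open>A\<close> are set aside: they contain
      \<open>y\<close> but not \<open>x\<close>, so \<open>x + t y\<close> avoids them for every
      \<open>t\<close>.\<close>
    let ?PS = "{P \<in> PS. \<not> A \<subseteq> P}"
    have "countable ?PS" using insert.prems(2) by (rule countable_subset[rotated]) blast
    then obtain y where y: "y \<in> Idl A" "\<forall>P\<in>?PS. y \<notin> P"
      using insert.IH[of ?PS] insert.prems c by blast
    have yc: "y \<in> carrier R" using y ideal_carrier genideal_ideal c by blast
    define bad where "bad = (\<lambda>P. {t \<in> T. x \<oplus> t \<otimes> y \<in> P})"
    have uniq: "t = t'" if P: "P \<in> ?PS" and t: "t \<in> bad P" "t' \<in> bad P" for P t t'
    proof (rule ccontr)
      assume "t \<noteq> t'"
      then have u: "t \<ominus> t' \<in> Units R" using Tdiff t by (auto simp: bad_def)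
      have tc: "t \<in> carrier R" "t' \<in> carrier R" using t Tc by (auto simp: bad_def)
      have Pi: "ideal P R" using P insert.prems by blast
      have "t \<otimes> y \<ominus> t' \<otimes> y \<in> P"
        using diff_in_ideal[OF Pi _ _ c(1), of "t \<otimes> y" "t' \<otimes> y"] t tc yc by (auto simp: bad_def)
      moreover have "t \<otimes> y \<ominus> t' \<otimes> y = (t \<ominus> t') \<otimes> y" using tc yc by algebra
      ultimately have "inv (t \<ominus> t') \<otimes> ((t \<ominus> t') \<otimes> y) \<in> P"
        using ideal_lmult[OF Pi] u by simp
      moreover have "inv (t \<ominus> t') \<otimes> ((t \<ominus> t') \<otimes> y) = y"
        using u tc yc by (simp add: m_assoc[symmetric])
      ultimately show False using y P by auto
    qed
    have "countable (bad P)" if P: "P \<in> ?PS" for P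
    proof (cases "bad P = {}")
      case False
      then obtain t where "t \<in> bad P" by blast
      then have "bad P \<subseteq> {t}" using uniq[OF P] by blast
      then show ?thesis using countable_subset by blast
    qed simp
    then have "countable (\<Union>P\<in>?PS. bad P)" using \<open>countable ?PS\<close> by blast
    then have "\<not> T \<subseteq> (\<Union>P\<in>?PS. bad P)" using Tunc countable_subset by blast
    then obtain t where t: "t \<in> T" "t \<notin> (\<Union>P\<in>?PS. bad P)" by blast
    let ?z = "x \<oplus> t \<otimes> y"
    have "y \<in> Idl (insert x A)" "x \<in> Idl (insert x A)"
      using y genideal_self[OF c(3)] genideal_minimal[OF genideal_ideal[OF c(3)], of A] by auto
    then have "?z \<in> Idl (insert x A)"
      using ideal_rules[OF genideal_ideal[OF c(3)]] Tc t by auto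
    moreover have "?z \<notin> P" if P: "P \<in> PS" for P
    proof (cases "A \<subseteq> P")
      case True
      have Pi: "ideal P R" "\<not> insert x A \<subseteq> P" using P insert.prems by blast+
      then have "x \<notin> P" using True by blast
      have "t \<otimes> y \<in> P" using genideal_minimal[OF Pi(1) True] y ideal_lmult[OF Pi(1)] Tc t by blast
      show ?thesis
      proof
        assume "?z \<in> P"
        then have "t \<otimes> y \<oplus> x \<in> P" using c(1) yc Tc t by (simp add: a_comm)
        then show False using ideal_add_cancel[OF Pi(1) \<open>t \<otimes> y \<in> P\<close> c(1)] \<open>x \<notin> P\<close> by blast
      qed
    next
      case False
      then show ?thesis using t P by (auto simp: bad_def)
    qed
    ultimately show ?case by blast
  qed
qed

text \<open>In the complete case this is the Baire category theorem: by Krull's intersection theorem primes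
  are closed in the adic topology, and they are nowhere dense in \<open>m\<close>.\<close>

lemma countable_avoidance_complete:
  assumes comp: "adically_complete R m"
    and PS: "\<And>i :: nat. primeideal (P i) R" "\<And>i. P i \<noteq> m"
  shows "\<exists>y\<in>m. \<forall>i. y \<notin> P i"
proof -
  note mi = mpow_ideal
  note Pi = primeideal_ideal[OF PS(1)]
  \<comment> \<open>One step of the Baire argument: move \<open>x\<close> by an element of
    \<open>m^n\<close> out of \<open>P i\<close>, then find a whole neighbourhood of the new point
    that misses \<open>P i\<close>. Exponents start at 1 so that the limit stays in
    \<open>m\<close>.\<close>
  have step: "\<exists>x' n'. x' \<in> m \<and> n < n' \<and> x' \<ominus> x \<in> mpow n \<and> (\<forall>u\<in>mpow n'. x' \<oplus> u \<notin> P i)"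
    if x: "x \<in> m" "n \<ge> 1" for x n i
  proof -
    have xc: "x \<in> carrier R" using x m_carrier by blast
    obtain x' where x': "x' \<in> m" "x' \<ominus> x \<in> mpow n" "x' \<notin> P i"
    proof (cases "x \<in> P i")
      case False
      moreover have "x \<ominus> x \<in> mpow n" using ideal_zero[OF mi] xc by (simp add: r_neg a_minus_def)
      ultimately show thesis using x that by blast
    next
      case True
      obtain w where w: "w \<in> m" "w \<notin> P i" using prime_le_m[OF PS(1)] PS(2) by blast
      have wc: "w \<in> carrier R" using w m_carrier by blast
      obtain k where n: "n = Suc k" using x(2) by (cases n) auto
      have wn: "w [^] n \<in> mpow n" "w [^] n \<in> m" "w [^] n \<notin> P i"
        using pow_in_mpow[OF w(1)] mpow_antimono[of 1 n] mpow_1 x(2) primeideal_pow[OF PS(1) wc] w(2) by auto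
      show thesis
      proof (rule that[of "x \<oplus> w [^] n"])
        show "x \<oplus> w [^] n \<in> m" using ideal_add[OF m_ideal] x wn by blast
        have "(x \<oplus> b) \<ominus> x = b" if "b \<in> carrier R" for b using xc that by algebra
        then have "(x \<oplus> w [^] n) \<ominus> x = w [^] n" using wc by simp
        then show "(x \<oplus> w [^] n) \<ominus> x \<in> mpow n" using wn by simp
        show "x \<oplus> w [^] n \<notin> P i" using ideal_add_cancel[OF Pi True] wn wc by auto
      qed
    qed
    have x'c: "x' \<in> carrier R" using x' m_carrier by blast
    \<comment> \<open>Otherwise \<open>x'\<close> would be a limit of elements of
      \<open>P i\<close>, which is closed.\<close>
    have "\<exists>n0. \<forall>u\<in>mpow n0. x' \<oplus> u \<notin> P i"
    proof (rule ccontr)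
      assume "\<not> ?thesis"
      then have *: "\<exists>u\<in>mpow n0. x' \<oplus> u \<in> P i" for n0 by blast
      have "\<exists>p\<in>P i. \<exists>u\<in>mpow n0. x' = p \<oplus> u" for n0
      proof -
        obtain u where u: "u \<in> mpow n0" "x' \<oplus> u \<in> P i" using * by blast
        have uc: "u \<in> carrier R" using u ideal_carrier[OF mi] by blast
        have "x' = (x' \<oplus> u) \<oplus> \<ominus> u" using x'c uc by algebra
        then show ?thesis using u ideal_minus[OF mi] by blast
      qed
      then show False using krull_intersection[OF Pi x'c] x'(3) by blast
    qed
    then obtain n0 where n0: "\<forall>u\<in>mpow n0. x' \<oplus> u \<notin> P i" by blast
    have "mpow (max n0 (Suc n)) \<subseteq> mpow n0" by (rule mpow_antimono) simp
    then have "\<forall>u\<in>mpow (max n0 (Suc n)). x' \<oplus> u \<notin> P i" using n0 by blast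
    moreover have "n < max n0 (Suc n)" by simp
    ultimately show ?thesis using x' by blast
  qed
  let ?Q = "\<lambda>i (s :: 'a \<times> nat) (s' :: 'a \<times> nat). snd s < snd s' \<and> fst s' \<ominus> fst s \<in> mpow (snd s) \<and>
    (\<forall>u\<in>mpow (snd s'). fst s' \<oplus> u \<notin> P i)"
  have "\<exists>f. \<forall>i. (fst (f i) \<in> m \<and> snd (f i) \<ge> 1) \<and> ?Q i (f i) (f (Suc i))"
  proof (rule dependent_nat_choice)
    show "\<exists>s. fst s \<in> m \<and> snd s \<ge> (1::nat)" using ideal_zero[OF m_ideal] by (intro exI[of _ "(\<zero>, 1)"]) simp
    fix s :: "'a \<times> nat" and i assume "fst s \<in> m \<and> snd s \<ge> 1"
    then obtain x' n' where "x' \<in> m" "snd s < n'" "x' \<ominus> fst s \<in> mpow (snd s)" "\<forall>u\<in>mpow n'. x' \<oplus> u \<notin> P i"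
      using step by blast
    then show "\<exists>s'. (fst s' \<in> m \<and> snd s' \<ge> 1) \<and> ?Q i s s'" by (intro exI[of _ "(x', n')"]) auto
  qed
  then obtain f where f: "\<And>i. (fst (f i) \<in> m \<and> snd (f i) \<ge> 1) \<and> ?Q i (f i) (f (Suc i))" by blast
  define x where "x = (\<lambda>i. fst (f i))"
  define n where "n = (\<lambda>i. snd (f i))"
  have x: "x i \<in> m" "n i \<ge> 1" "n i < n (Suc i)" "x (Suc i) \<ominus> x i \<in> mpow (n i)"
    "\<And>u. u \<in> mpow (n (Suc i)) \<Longrightarrow> x (Suc i) \<oplus> u \<notin> P i" for i
    using f[of i] by (auto simp: x_def n_def)
  have xc: "x i \<in> carrier R" for i using x(1) m_carrier by blast
  have nk: "n k \<ge> k" for k by (induction k) (use x(3) in \<open>auto simp: Suc_le_eq intro: le_less_trans\<close>)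
  have nmono: "n i \<le> n j" if "i \<le> j" for i j
    using lift_Suc_mono_le[of n i j] x(3) that by (simp add: less_imp_le)
  have tele: "x j \<ominus> x i \<in> mpow (n i)" if "i \<le> j" for i j
    using that
  proof (induction j rule: dec_induct)
    case base
    then show ?case using ideal_zero[OF mi] xc by (simp add: r_neg a_minus_def)
  next
    case (step j)
    have "x (Suc j) \<ominus> x j \<in> mpow (n i)" using x(4)[of j] mpow_antimono nmono step(1) by blast
    then have "(x (Suc j) \<ominus> x j) \<oplus> (x j \<ominus> x i) \<in> mpow (n i)" using step ideal_add[OF mi] by blast
    moreover have "(x (Suc j) \<ominus> x j) \<oplus> (x j \<ominus> x i) = x (Suc j) \<ominus> x i" using xc by algebra
    ultimately show ?case by simp
  qed
  \<comment> \<open>The exponents \<open>n k\<close> are at least \<open>k\<close>, so the cosets of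
    \<open>x k\<close> modulo \<open>m^k\<close> are compatible; completeness gives their limit
    \<open>z\<close>.\<close>
  let ?y = "\<lambda>k. mpow k +> x k"
  have "?y \<in> carrier (completion R m)"
  proof -
    have "?y k \<in> carrier (R Quot mpow k)" for k
      unfolding FactRing_def A_RCOSETS_def' using xc by auto
    moreover have "?y (Suc k) \<subseteq> ?y k" for k
    proof -
      have "x (Suc k) \<ominus> x k \<in> mpow k" using x(4)[of k] mpow_antimono[OF nk] by blast
      then have "mpow k +> x (Suc k) = mpow k +> x k"
        using quotient_eq_iff_same_a_r_cos[OF mi] xc by blast
      moreover have "mpow (Suc k) +> x (Suc k) \<subseteq> mpow k +> x (Suc k)"
        using mpow_antimono[of k "Suc k"] by (auto simp: a_r_coset_def')
      ultimately show ?thesis by simp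
    qed
    ultimately show ?thesis by (simp add: completion_def Let_def)
  qed
  moreover have "to_completion R m ` carrier R = carrier (completion R m)"
    using comp by (simp add: adically_complete_def bij_betw_def)
  ultimately have "?y \<in> to_completion R m ` carrier R" by simp
  then obtain z where z: "?y = to_completion R m z" "z \<in> carrier R" by (rule imageE)
  note z = z(2,1)
  have zk: "z \<ominus> x k \<in> mpow k" for k
  proof -
    have "mpow k +> z = mpow k +> x k" using fun_cong[OF z(2), of k] by (simp add: to_completion_def)
    then show ?thesis using quotient_eq_iff_same_a_r_cos[OF mi z(1) xc] by blast
  qed
  have zn: "z \<ominus> x i \<in> mpow (n i)" for i
  proof -
    have "(z \<ominus> x (n i)) \<oplus> (x (n i) \<ominus> x i) \<in> mpow (n i)"
      by (rule ideal_add[OF mi zk tele[OF nk]])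
    moreover have "(z \<ominus> x j) \<oplus> (x j \<ominus> x i) = z \<ominus> x i" for j using xc[of i] xc[of j] z(1) by algebra
    ultimately show ?thesis by simp
  qed
  have split: "z = x i \<oplus> (z \<ominus> x i)" for i using xc[of i] z(1) by algebra
  have "z \<ominus> x 0 \<in> m" using subsetD[OF mpow_antimono[OF x(2)[of 0]] zn[of 0]] unfolding mpow_1 .
  then have "x 0 \<oplus> (z \<ominus> x 0) \<in> m" by (rule ideal_add[OF m_ideal x(1)])
  then have "z \<in> m" unfolding split[of 0, symmetric] .
  moreover have "z \<notin> P i" for i
    using x(5)[OF zn[of "Suc i"]] unfolding split[of "Suc i", symmetric] .
  ultimately show ?thesis by blast
qed

theorem countable_prime_avoidance:
  assumes "adically_complete R m \<or> uncountable (carrier (R Quot m))"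
    and PS: "countable PS" "\<And>P. P \<in> PS \<Longrightarrow> primeideal P R \<and> P \<noteq> m"
  shows "\<exists>y\<in>m. \<forall>P\<in>PS. y \<notin> P"
  using assms(1)
proof
  assume comp: "adically_complete R m"
  show ?thesis
  proof (cases "PS = {}")
    case True
    then show ?thesis using ideal_zero[OF m_ideal] by blast
  next
    case False
    then have "range (from_nat_into PS) = PS" using PS(1) by simp
    then show ?thesis using countable_avoidance_complete[OF comp, of "from_nat_into PS"] PS(2) by (metis rangeI imageE)
  qed
next
  assume unc: "uncountable (carrier (R Quot m))"
  obtain A where A: "A \<subseteq> carrier R" "finite A" "m = Idl A" using finetely_gen[OF m_ideal] by blast
  have "ideal P R \<and> \<not> A \<subseteq> P" if "P \<in> PS" for P
    using PS(2)[OF that] genideal_minimal[of P A] A(3) prime_le_m primeideal_ideal by blast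
  then show ?thesis using countable_avoidance_uncountable[OF unc A(2,1) PS(1)] A(3) by blast
qed

end

section \<open>Syzygies and regularity\<close>

subsection \<open>Finite free modules and their submodules\<close>

text \<open>All free modules live inside the module of sequences: \<open>R\<^sup>n\<close> is the set of sequences vanishing from
  index \<open>n\<close> on.\<close>

definition fun_module :: "('a, 'b) ring_scheme \<Rightarrow> ('a, nat \<Rightarrow> 'a) module" where
  "fun_module R = \<lparr>carrier = {v. \<forall>i. v i \<in> carrier R}, monoid.mult = undefined, monoid.one = undefined,
     ring.zero = (\<lambda>_. \<zero>\<^bsub>R\<^esub>), ring.add = (\<lambda>u v i. u i \<oplus>\<^bsub>R\<^esub> v i), module.smult = (\<lambda>a v i. a \<otimes>\<^bsub>R\<^esub> v i)\<rparr>"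

definition vec :: "('a, 'b) ring_scheme \<Rightarrow> nat \<Rightarrow> (nat \<Rightarrow> 'a) set" where
  "vec R n = {v. (\<forall>i. v i \<in> carrier R) \<and> (\<forall>i\<ge>n. v i = \<zero>\<^bsub>R\<^esub>)}"

text \<open>Linear maps from \<open>R^r\<close> to \<open>R^s\<close> as functions on all sequences,
  with no condition outside \<open>vec R r\<close>; they take the place of matrices.\<close>

definition lin :: "('a, 'b) ring_scheme \<Rightarrow> nat \<Rightarrow> nat \<Rightarrow> ((nat \<Rightarrow> 'a) \<Rightarrow> (nat \<Rightarrow> 'a)) \<Rightarrow> bool" where
  "lin R r s f \<longleftrightarrow> (\<forall>v\<in>vec R r. f v \<in> vec R s) \<and>
     (\<forall>u\<in>vec R r. \<forall>v\<in>vec R r. f (u \<oplus>\<^bsub>fun_module R\<^esub> v) = f u \<oplus>\<^bsub>fun_module R\<^esub> f v) \<and>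
     (\<forall>a\<in>carrier R. \<forall>v\<in>vec R r. f (a \<odot>\<^bsub>fun_module R\<^esub> v) = a \<odot>\<^bsub>fun_module R\<^esub> f v)"

definition subvec :: "('a, 'b) ring_scheme \<Rightarrow> nat \<Rightarrow> (nat \<Rightarrow> 'a) set \<Rightarrow> bool" where
  "subvec R n K \<longleftrightarrow> submodule K R (fun_module R) \<and> K \<subseteq> vec R n"

definition unit_vec :: "('a, 'b) ring_scheme \<Rightarrow> nat \<Rightarrow> nat \<Rightarrow> 'a" where
  "unit_vec R i = (\<lambda>j. if j = i then \<one>\<^bsub>R\<^esub> else \<zero>\<^bsub>R\<^esub>)"

lemma fun_module_simps [simp]:
  "carrier (fun_module R) = {v. \<forall>i. v i \<in> carrier R}"
  "\<zero>\<^bsub>fun_module R\<^esub> = (\<lambda>_. \<zero>\<^bsub>R\<^esub>)"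
  "(u \<oplus>\<^bsub>fun_module R\<^esub> v) i = u i \<oplus>\<^bsub>R\<^esub> v i"
  "(a \<odot>\<^bsub>fun_module R\<^esub> v) i = a \<otimes>\<^bsub>R\<^esub> v i"
  by (simp_all add: fun_module_def)

lemma (in cring) fun_module_module: "module R (fun_module R)"
proof (intro moduleI is_cring abelian_groupI)
  fix x assume x: "x \<in> carrier (fun_module R)"
  then show "\<exists>y\<in>carrier (fun_module R). y \<oplus>\<^bsub>fun_module R\<^esub> x = \<zero>\<^bsub>fun_module R\<^esub>"
    by (intro bexI[of _ "\<lambda>i. \<ominus> x i"]) (auto simp: l_neg)
qed (auto simp: a_ac l_distr r_distr m_assoc intro!: ext)

context cring begin

abbreviation "F \<equiv> fun_module R"

interpretation V: module R F by (rule fun_module_module)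

lemma vec_carrier: "v \<in> vec R n \<Longrightarrow> v \<in> carrier F"
  by (auto simp: vec_def)

lemma vec_nth: "v \<in> vec R n \<Longrightarrow> v i \<in> carrier R"
  by (auto simp: vec_def)

lemma fun_module_minus: "v \<in> carrier F \<Longrightarrow> (\<ominus>\<^bsub>F\<^esub> v) i = \<ominus> v i"
proof -
  assume v: "v \<in> carrier F"
  have "\<ominus>\<^bsub>F\<^esub> v = (\<lambda>i. \<ominus> v i)"
    using v by (intro V.M.minus_equality) (auto simp: l_neg)
  then show ?thesis by simp
qed

lemma fun_module_diff: "u \<in> carrier F \<Longrightarrow> v \<in> carrier F \<Longrightarrow> (u \<ominus>\<^bsub>F\<^esub> v) i = u i \<ominus> v i"
  by (simp add: a_minus_def[of F] a_minus_def[of R] fun_module_minus)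

lemma subvecI:
  assumes "K \<subseteq> vec R n" "\<zero>\<^bsub>F\<^esub> \<in> K" "\<And>u v. u \<in> K \<Longrightarrow> v \<in> K \<Longrightarrow> u \<oplus>\<^bsub>F\<^esub> v \<in> K"
    "\<And>a v. a \<in> carrier R \<Longrightarrow> v \<in> K \<Longrightarrow> a \<odot>\<^bsub>F\<^esub> v \<in> K"
  shows "subvec R n K"
proof -
  have c: "K \<subseteq> carrier F" using assms(1) vec_carrier by blast
  have "\<ominus>\<^bsub>F\<^esub> v \<in> K" if "v \<in> K" for v
  proof -
    have "(\<ominus> \<one>) \<odot>\<^bsub>F\<^esub> v = \<ominus>\<^bsub>F\<^esub> v" using that c V.smult_l_minus[of \<one> v] by auto
    then show ?thesis using assms(4)[of "\<ominus> \<one>" v] that by simp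
  qed
  then show ?thesis unfolding subvec_def using assms c by (intro conjI V.submoduleI) auto
qed

lemma subvec_subset: "subvec R n K \<Longrightarrow> v \<in> K \<Longrightarrow> v \<in> vec R n"
  and subvec_zero: "subvec R n K \<Longrightarrow> \<zero>\<^bsub>F\<^esub> \<in> K"
  and subvec_add: "subvec R n K \<Longrightarrow> u \<in> K \<Longrightarrow> v \<in> K \<Longrightarrow> u \<oplus>\<^bsub>F\<^esub> v \<in> K"
  and subvec_smult: "subvec R n K \<Longrightarrow> a \<in> carrier R \<Longrightarrow> v \<in> K \<Longrightarrow> a \<odot>\<^bsub>F\<^esub> v \<in> K"
  and subvec_minus: "subvec R n K \<Longrightarrow> v \<in> K \<Longrightarrow> \<ominus>\<^bsub>F\<^esub> v \<in> K"
  and subvec_carrier: "subvec R n K \<Longrightarrow> v \<in> K \<Longrightarrow> v \<in> carrier F"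
proof -
  assume "subvec R n K"
  then have K: "submodule K R F" "K \<subseteq> vec R n" by (auto simp: subvec_def)
  note E = V.submoduleE[OF K(1)]
  show "v \<in> vec R n" if "v \<in> K" using that K by blast
  show "v \<in> carrier F" if "v \<in> K" using that E(1) by blast
  show "u \<oplus>\<^bsub>F\<^esub> v \<in> K" if "u \<in> K" "v \<in> K" using that E(5) by blast
  show "\<ominus>\<^bsub>F\<^esub> v \<in> K" if "v \<in> K" using that E(3) by blast
  show "a \<odot>\<^bsub>F\<^esub> v \<in> K" if "a \<in> carrier R" "v \<in> K" using that E(4) by blast
  obtain v where v: "v \<in> K" using E(2) by blast
  then have "\<zero> \<odot>\<^bsub>F\<^esub> v \<in> K" using E(4) by blast
  then show "\<zero>\<^bsub>F\<^esub> \<in> K" using v E(1) V.smult_l_null by (metis subsetD)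
qed

lemma subvec_diff: "subvec R n K \<Longrightarrow> u \<in> K \<Longrightarrow> v \<in> K \<Longrightarrow> u \<ominus>\<^bsub>F\<^esub> v \<in> K"
  by (simp add: a_minus_def subvec_add subvec_minus)

lemma subvec_vec: "subvec R n (vec R n)"
  by (rule subvecI) (auto simp: vec_def)

lemmas vec_rules = subvec_zero[OF subvec_vec] subvec_add[OF subvec_vec] subvec_smult[OF subvec_vec]
  subvec_minus[OF subvec_vec] subvec_diff[OF subvec_vec]

lemma subvec_0: "subvec R n {\<zero>\<^bsub>F\<^esub>}"
  by (rule subvecI) (auto simp: vec_def)

lemma vec_0: "vec R 0 = {\<zero>\<^bsub>F\<^esub>}"
  by (auto simp: vec_def)

lemma vec_mono: "m \<le> n \<Longrightarrow> vec R m \<subseteq> vec R n"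
  by (auto simp: vec_def)

lemma unit_vec_vec: "i < n \<Longrightarrow> unit_vec R i \<in> vec R n"
  by (auto simp: vec_def unit_vec_def)

lemma vec_upd: "v \<in> vec R (Suc n) \<Longrightarrow> v(n := \<zero>) \<in> vec R n"
  by (auto simp: vec_def)

lemma vec_split: "v \<in> vec R (Suc n) \<Longrightarrow> v = v(n := \<zero>) \<oplus>\<^bsub>F\<^esub> v n \<odot>\<^bsub>F\<^esub> unit_vec R n"
  by (intro ext) (auto simp: vec_def unit_vec_def)

lemma vec_upd_id: "v \<in> vec R n \<Longrightarrow> v(n := \<zero>) = v"
  by (auto simp: vec_def)

subsection \<open>Linear maps\<close>

lemma linI:
  assumes "\<And>v. v \<in> vec R r \<Longrightarrow> f v \<in> vec R s"
    "\<And>u v. u \<in> vec R r \<Longrightarrow> v \<in> vec R r \<Longrightarrow> f (u \<oplus>\<^bsub>F\<^esub> v) = f u \<oplus>\<^bsub>F\<^esub> f v"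
    "\<And>a v. a \<in> carrier R \<Longrightarrow> v \<in> vec R r \<Longrightarrow> f (a \<odot>\<^bsub>F\<^esub> v) = a \<odot>\<^bsub>F\<^esub> f v"
  shows "lin R r s f"
  using assms by (auto simp: lin_def)

lemma lin_vec: "lin R r s f \<Longrightarrow> v \<in> vec R r \<Longrightarrow> f v \<in> vec R s"
  and lin_add: "lin R r s f \<Longrightarrow> u \<in> vec R r \<Longrightarrow> v \<in> vec R r \<Longrightarrow> f (u \<oplus>\<^bsub>F\<^esub> v) = f u \<oplus>\<^bsub>F\<^esub> f v"
  and lin_smult: "lin R r s f \<Longrightarrow> a \<in> carrier R \<Longrightarrow> v \<in> vec R r \<Longrightarrow> f (a \<odot>\<^bsub>F\<^esub> v) = a \<odot>\<^bsub>F\<^esub> f v"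
  by (auto simp: lin_def)

lemma lin_carrier: "lin R r s f \<Longrightarrow> v \<in> vec R r \<Longrightarrow> f v \<in> carrier F"
  using lin_vec vec_carrier by blast

lemma lin_zero: assumes "lin R r s f" shows "f \<zero>\<^bsub>F\<^esub> = \<zero>\<^bsub>F\<^esub>"
proof -
  have z: "\<zero>\<^bsub>F\<^esub> \<in> vec R r" by (rule vec_rules)
  then have "f (\<zero> \<odot>\<^bsub>F\<^esub> \<zero>\<^bsub>F\<^esub>) = \<zero> \<odot>\<^bsub>F\<^esub> f \<zero>\<^bsub>F\<^esub>" using lin_smult[OF assms] by blast
  then show ?thesis using V.smult_l_null[OF lin_carrier[OF assms z]] V.smult_l_null[OF V.M.zero_closed] by metis
qed

lemma lin_minus: assumes f: "lin R r s f" and v: "v \<in> vec R r" shows "f (\<ominus>\<^bsub>F\<^esub> v) = \<ominus>\<^bsub>F\<^esub> f v"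
proof -
  have "\<ominus>\<^bsub>F\<^esub> v = (\<ominus> \<one>) \<odot>\<^bsub>F\<^esub> v" using V.smult_l_minus[of \<one> v] vec_carrier[OF v] by simp
  then have "f (\<ominus>\<^bsub>F\<^esub> v) = (\<ominus> \<one>) \<odot>\<^bsub>F\<^esub> f v" using lin_smult[OF f _ v] by simp
  then show ?thesis using V.smult_l_minus[of \<one> "f v"] lin_carrier[OF f v] by simp
qed

lemma lin_diff: "lin R r s f \<Longrightarrow> u \<in> vec R r \<Longrightarrow> v \<in> vec R r \<Longrightarrow> f (u \<ominus>\<^bsub>F\<^esub> v) = f u \<ominus>\<^bsub>F\<^esub> f v"
  by (simp only: a_minus_def lin_add lin_minus vec_rules)

lemma lin_comp: "lin R r s f \<Longrightarrow> lin R s t g \<Longrightarrow> lin R r t (\<lambda>v. g (f v))"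
  by (intro linI) (simp_all only: lin_vec lin_add lin_smult)

lemma lin_ident: "lin R r r (\<lambda>v. v)"
  by (intro linI) simp_all

lemma lin_const_zero: "lin R r s (\<lambda>v. \<zero>\<^bsub>F\<^esub>)"
  using vec_rules(1) by (intro linI) (auto intro!: ext)

lemma lin_scale: "a \<in> carrier R \<Longrightarrow> lin R r s f \<Longrightarrow> lin R r s (\<lambda>v. a \<odot>\<^bsub>F\<^esub> f v)"
proof (intro linI)
  assume a: "a \<in> carrier R" and f: "lin R r s f"
  fix u v assume v: "v \<in> vec R r"
  note c = lin_carrier[OF f v]
  show "a \<odot>\<^bsub>F\<^esub> f v \<in> vec R s" using a f v lin_vec vec_rules by blast
  show "a \<odot>\<^bsub>F\<^esub> f (u \<oplus>\<^bsub>F\<^esub> v) = a \<odot>\<^bsub>F\<^esub> f u \<oplus>\<^bsub>F\<^esub> a \<odot>\<^bsub>F\<^esub> f v" if "u \<in> vec R r"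
    using lin_add[OF f that v] V.smult_r_distr[OF a lin_carrier[OF f that] c] by simp
  show "a \<odot>\<^bsub>F\<^esub> f (b \<odot>\<^bsub>F\<^esub> v) = b \<odot>\<^bsub>F\<^esub> (a \<odot>\<^bsub>F\<^esub> f v)" if b: "b \<in> carrier R" for b
    unfolding lin_smult[OF f b v] using V.smult_assoc1[OF a b c] V.smult_assoc1[OF b a c] m_comm[OF a b] by simp
qed

lemma lin_plus: "lin R r s f \<Longrightarrow> lin R r s g \<Longrightarrow> lin R r s (\<lambda>v. f v \<oplus>\<^bsub>F\<^esub> g v)"
proof (intro linI)
  assume f: "lin R r s f" and g: "lin R r s g"
  fix u v assume v: "v \<in> vec R r"
  note c = lin_carrier[OF f v] lin_carrier[OF g v]
  show "f v \<oplus>\<^bsub>F\<^esub> g v \<in> vec R s" by (rule vec_rules(2)[OF lin_vec[OF f v] lin_vec[OF g v]])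
  show "f (u \<oplus>\<^bsub>F\<^esub> v) \<oplus>\<^bsub>F\<^esub> g (u \<oplus>\<^bsub>F\<^esub> v) = (f u \<oplus>\<^bsub>F\<^esub> g u) \<oplus>\<^bsub>F\<^esub> (f v \<oplus>\<^bsub>F\<^esub> g v)" if u: "u \<in> vec R r"
    unfolding lin_add[OF f u v] lin_add[OF g u v]
    using c lin_carrier[OF f u] lin_carrier[OF g u] by (simp only: V.M.a_ac V.M.add.m_closed)
  show "f (b \<odot>\<^bsub>F\<^esub> v) \<oplus>\<^bsub>F\<^esub> g (b \<odot>\<^bsub>F\<^esub> v) = b \<odot>\<^bsub>F\<^esub> (f v \<oplus>\<^bsub>F\<^esub> g v)" if b: "b \<in> carrier R" for b
    unfolding lin_smult[OF f b v] lin_smult[OF g b v] V.smult_r_distr[OF b c] ..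
qed

lemma lin_minus_fun: assumes f: "lin R r s f" shows "lin R r s (\<lambda>v. \<ominus>\<^bsub>F\<^esub> f v)"
proof -
  have "lin R r s (\<lambda>v. (\<ominus> \<one>) \<odot>\<^bsub>F\<^esub> f v)" using f by (intro lin_scale) auto
  moreover have "(\<ominus> \<one>) \<odot>\<^bsub>F\<^esub> f v = \<ominus>\<^bsub>F\<^esub> f v" if "v \<in> vec R r" for v
    using V.smult_l_minus[of \<one> "f v"] lin_carrier[OF f that] by simp
  ultimately show ?thesis unfolding lin_def using vec_rules by simp
qed

lemma lin_sub: "lin R r s f \<Longrightarrow> lin R r s g \<Longrightarrow> lin R r s (\<lambda>v. f v \<ominus>\<^bsub>F\<^esub> g v)"
  unfolding a_minus_def by (intro lin_plus lin_minus_fun)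

text \<open>The universal property of \<open>R^(n+1)\<close>, one basis vector at a time: the last
  one goes to \<open>w\<close>.\<close>

lemma lin_extend:
  assumes f: "lin R n s f" and w: "w \<in> vec R s"
  shows "lin R (Suc n) s (\<lambda>v. f (v(n := \<zero>)) \<oplus>\<^bsub>F\<^esub> v n \<odot>\<^bsub>F\<^esub> w)"
proof (intro linI)
  fix u v assume v: "v \<in> vec R (Suc n)"
  note fv = vec_upd[OF v]
  have wc: "w \<in> carrier F" using w vec_carrier by blast
  have c: "f (v(n := \<zero>)) \<in> carrier F" "v n \<in> carrier R" using lin_carrier[OF f fv] v vec_nth by auto
  show "f (v(n := \<zero>)) \<oplus>\<^bsub>F\<^esub> v n \<odot>\<^bsub>F\<^esub> w \<in> vec R s" using lin_vec[OF f fv] w c vec_rules by blast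
  show "f ((u \<oplus>\<^bsub>F\<^esub> v)(n := \<zero>)) \<oplus>\<^bsub>F\<^esub> (u \<oplus>\<^bsub>F\<^esub> v) n \<odot>\<^bsub>F\<^esub> w =
      (f (u(n := \<zero>)) \<oplus>\<^bsub>F\<^esub> u n \<odot>\<^bsub>F\<^esub> w) \<oplus>\<^bsub>F\<^esub> (f (v(n := \<zero>)) \<oplus>\<^bsub>F\<^esub> v n \<odot>\<^bsub>F\<^esub> w)" if u: "u \<in> vec R (Suc n)"
  proof -
    have cu: "f (u(n := \<zero>)) \<in> carrier F" "u n \<in> carrier R" using lin_carrier[OF f vec_upd[OF u]] u vec_nth by auto
    have "(u \<oplus>\<^bsub>F\<^esub> v)(n := \<zero>) = u(n := \<zero>) \<oplus>\<^bsub>F\<^esub> v(n := \<zero>)" by (intro ext) auto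
    then have "f ((u \<oplus>\<^bsub>F\<^esub> v)(n := \<zero>)) = f (u(n := \<zero>)) \<oplus>\<^bsub>F\<^esub> f (v(n := \<zero>))"
      using lin_add[OF f vec_upd[OF u] fv] by simp
    moreover have "(u \<oplus>\<^bsub>F\<^esub> v) n \<odot>\<^bsub>F\<^esub> w = u n \<odot>\<^bsub>F\<^esub> w \<oplus>\<^bsub>F\<^esub> v n \<odot>\<^bsub>F\<^esub> w"
      using V.smult_l_distr[OF cu(2) c(2) wc] by simp
    moreover have "u n \<odot>\<^bsub>F\<^esub> w \<in> carrier F" "v n \<odot>\<^bsub>F\<^esub> w \<in> carrier F"
      using V.smult_closed cu c wc by blast+
    ultimately show ?thesis using cu(1) c(1) by (simp only: V.M.a_ac V.M.add.m_closed)
  qed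
  show "f ((b \<odot>\<^bsub>F\<^esub> v)(n := \<zero>)) \<oplus>\<^bsub>F\<^esub> (b \<odot>\<^bsub>F\<^esub> v) n \<odot>\<^bsub>F\<^esub> w =
      b \<odot>\<^bsub>F\<^esub> (f (v(n := \<zero>)) \<oplus>\<^bsub>F\<^esub> v n \<odot>\<^bsub>F\<^esub> w)" if b: "b \<in> carrier R" for b
  proof -
    have "(b \<odot>\<^bsub>F\<^esub> v)(n := \<zero>) = b \<odot>\<^bsub>F\<^esub> v(n := \<zero>)" using b by (intro ext) auto
    then have "f ((b \<odot>\<^bsub>F\<^esub> v)(n := \<zero>)) = b \<odot>\<^bsub>F\<^esub> f (v(n := \<zero>))" using lin_smult[OF f b fv] by simp
    moreover have "(b \<odot>\<^bsub>F\<^esub> v) n \<odot>\<^bsub>F\<^esub> w = b \<odot>\<^bsub>F\<^esub> (v n \<odot>\<^bsub>F\<^esub> w)"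
      using V.smult_assoc1[OF b c(2) wc] by simp
    moreover have "v n \<odot>\<^bsub>F\<^esub> w \<in> carrier F" using V.smult_closed c wc by blast
    ultimately show ?thesis using V.smult_r_distr[OF b c(1)] by simp
  qed
qed

text \<open>Projectivity of \<open>R^r\<close>, by choosing preimages of the basis vectors in
  turn.\<close>

lemma lin_lift:
  assumes f: "lin R r s f" and p: "lin R t s p" and im: "f ` vec R r \<subseteq> p ` vec R t"
  shows "\<exists>g. lin R r t g \<and> (\<forall>v\<in>vec R r. p (g v) = f v)"
  using f im
proof (induction r arbitrary: f)
  case 0
  then show ?case using lin_zero[OF p] lin_zero[OF 0(1)] lin_const_zero
    by (intro exI[of _ "\<lambda>v. \<zero>\<^bsub>F\<^esub>"]) (simp only: vec_0, simp)
next
  case (Suc r)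
  have sub: "vec R r \<subseteq> vec R (Suc r)" by (rule vec_mono) simp
  have "lin R r s f" using Suc.prems(1) sub by (auto simp: lin_def subset_iff)
  moreover have "f ` vec R r \<subseteq> p ` vec R t" using Suc.prems(2) sub by blast
  ultimately obtain g where g: "lin R r t g" "\<forall>v\<in>vec R r. p (g v) = f v"
    using Suc.IH[of f] by blast
  have e: "unit_vec R r \<in> vec R (Suc r)" by (simp add: unit_vec_vec)
  then have "f (unit_vec R r) \<in> p ` vec R t" using Suc.prems(2) by blast
  then obtain w where w: "w \<in> vec R t" "p w = f (unit_vec R r)" by (metis imageE)
  have "p (g (v(r := \<zero>)) \<oplus>\<^bsub>F\<^esub> v r \<odot>\<^bsub>F\<^esub> w) = f v" if v: "v \<in> vec R (Suc r)" for v
  proof -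
    note fv = vec_upd[OF v] and vr = vec_nth[OF v, of r]
    have "p (g (v(r := \<zero>)) \<oplus>\<^bsub>F\<^esub> v r \<odot>\<^bsub>F\<^esub> w) = p (g (v(r := \<zero>))) \<oplus>\<^bsub>F\<^esub> v r \<odot>\<^bsub>F\<^esub> p w"
      using lin_add[OF p lin_vec[OF g(1) fv]] lin_smult[OF p vr w(1)] vec_rules(3)[OF vr w(1)] by simp
    also have "\<dots> = f (v(r := \<zero>)) \<oplus>\<^bsub>F\<^esub> f (v r \<odot>\<^bsub>F\<^esub> unit_vec R r)"
      unfolding bspec[OF g(2) fv] w(2) lin_smult[OF Suc.prems(1) vr e] ..
    also have "\<dots> = f v"
      using lin_add[OF Suc.prems(1), of "v(r := \<zero>)" "v r \<odot>\<^bsub>F\<^esub> unit_vec R r"] fv sub vec_rules(3)[OF vr e]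
        vec_split[OF v] by (metis subsetD)
    finally show ?thesis .
  qed
  then show ?case using lin_extend[OF g(1) w(1)] by blast
qed

lemma subvec_ker: assumes f: "lin R r s f" shows "subvec R r {v \<in> vec R r. f v = \<zero>\<^bsub>F\<^esub>}"
proof (rule subvecI)
  show "\<zero>\<^bsub>F\<^esub> \<in> {v \<in> vec R r. f v = \<zero>\<^bsub>F\<^esub>}" using lin_zero[OF f] vec_rules by blast
  fix u v a assume v: "v \<in> {v \<in> vec R r. f v = \<zero>\<^bsub>F\<^esub>}"
  { assume "u \<in> {v \<in> vec R r. f v = \<zero>\<^bsub>F\<^esub>}"
    then show "u \<oplus>\<^bsub>F\<^esub> v \<in> {v \<in> vec R r. f v = \<zero>\<^bsub>F\<^esub>}"
      using v lin_add[OF f, of u v] vec_rules(2)[of u r v] by (auto simp del: fun_module_simps(2) intro: V.M.l_zero) }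
  { assume "a \<in> carrier R"
    then show "a \<odot>\<^bsub>F\<^esub> v \<in> {v \<in> vec R r. f v = \<zero>\<^bsub>F\<^esub>}"
      using v lin_smult[OF f, of a v] vec_rules(3)[of a v r] V.smult_r_null[of a] by simp }
qed auto

lemma subvec_image: assumes f: "lin R r s f" and K: "subvec R r K" shows "subvec R s (f ` K)"
proof (rule subvecI)
  show "f ` K \<subseteq> vec R s" using lin_vec[OF f] subvec_subset[OF K] by blast
  show "\<zero>\<^bsub>F\<^esub> \<in> f ` K" using lin_zero[OF f] subvec_zero[OF K] by (metis imageI)
  fix u v a assume "v \<in> f ` K"
  then obtain v' where v: "v = f v'" "v' \<in> K" by auto
  { assume "u \<in> f ` K"
    then obtain u' where u: "u = f u'" "u' \<in> K" by auto
    have "f (u' \<oplus>\<^bsub>F\<^esub> v') = u \<oplus>\<^bsub>F\<^esub> v" using u v lin_add[OF f] subvec_subset[OF K] by simp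
    then show "u \<oplus>\<^bsub>F\<^esub> v \<in> f ` K" using subvec_add[OF K u(2) v(2)] by (metis imageI) }
  { assume a: "a \<in> carrier R"
    have "f (a \<odot>\<^bsub>F\<^esub> v') = a \<odot>\<^bsub>F\<^esub> v" using a v lin_smult[OF f] subvec_subset[OF K] by simp
    then show "a \<odot>\<^bsub>F\<^esub> v \<in> f ` K" using subvec_smult[OF K a v(2)] by (metis imageI) }
qed

lemma vec_induct:
  assumes K: "submodule K R F" and e: "\<And>i. i < t \<Longrightarrow> f (unit_vec R i) \<in> K" and f: "lin R t s f"
    and v: "v \<in> vec R t"
  shows "f v \<in> K"
proof -
  note E = V.submoduleE[OF K]
  have "f v \<in> K" if "v \<in> vec R k" "k \<le> t" for k v
    using that
  proof (induction k arbitrary: v)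
    case 0
    then have "v = \<zero>\<^bsub>F\<^esub>" by (simp only: vec_0) simp
    moreover have "\<zero>\<^bsub>F\<^esub> \<in> K" using K by (simp add: submodule_def subgroup_def)
    ultimately show ?case using lin_zero[OF f] by simp
  next
    case (Suc k)
    note fv = vec_upd[OF Suc.prems(1)] and vk = vec_nth[OF Suc.prems(1), of k]
    have sub: "vec R k \<subseteq> vec R t" using Suc.prems vec_mono by simp
    have ek: "unit_vec R k \<in> vec R t" using Suc.prems unit_vec_vec by simp
    have "f v = f (v(k := \<zero>)) \<oplus>\<^bsub>F\<^esub> v k \<odot>\<^bsub>F\<^esub> f (unit_vec R k)"
      using lin_add[OF f subsetD[OF sub fv] vec_rules(3)[OF vk ek]] lin_smult[OF f vk ek]
        vec_split[OF Suc.prems(1)] by simp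
    moreover have "f (v(k := \<zero>)) \<in> K" by (rule Suc.IH[OF fv]) (use Suc.prems in simp)
    moreover have "f (unit_vec R k) \<in> K" using e Suc.prems by simp
    ultimately show ?case using E(4,5) vk by metis
  qed
  then show ?thesis using v by blast
qed

end

section \<open>Finite generation of submodules of free modules\<close>

context cring begin

interpretation V: module R F by (rule fun_module_module)

lemma vec_adjoin:
  assumes p: "lin R t n p" and w: "w \<in> vec R n"
  shows "\<exists>p'. lin R (Suc t) n p' \<and> p ` vec R t \<subseteq> p' ` vec R (Suc t) \<and> w \<in> p' ` vec R (Suc t) \<and>
    (\<forall>v\<in>vec R (Suc t). \<exists>u\<in>vec R t. p' v = p u \<oplus>\<^bsub>F\<^esub> v t \<odot>\<^bsub>F\<^esub> w) \<and>
    (\<forall>v\<in>vec R t. p' v = p v) \<and> p' (unit_vec R t) = w"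
proof -
  let ?p = "\<lambda>v. p (v(t := \<zero>)) \<oplus>\<^bsub>F\<^esub> v t \<odot>\<^bsub>F\<^esub> w"
  have wc: "w \<in> carrier F" using w vec_carrier by blast
  have 1: "?p v = p v" if v: "v \<in> vec R t" for v
  proof -
    have "v t = \<zero>" using v by (auto simp: vec_def)
    then have "v t \<odot>\<^bsub>F\<^esub> w = \<zero>\<^bsub>F\<^esub>" using V.smult_l_null[OF wc] by simp
    then show ?thesis using vec_upd_id[OF v] V.M.r_zero[OF lin_carrier[OF p v]] by simp
  qed
  have e: "unit_vec R t \<in> vec R (Suc t)" by (rule unit_vec_vec) simp
  have 2: "?p (unit_vec R t) = w"
  proof -
    have "(unit_vec R t)(t := \<zero>) = \<zero>\<^bsub>F\<^esub>" by (auto simp: unit_vec_def)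
    moreover have "unit_vec R t t = \<one>" by (simp add: unit_vec_def)
    ultimately show ?thesis using lin_zero[OF p] V.smult_one[OF wc] V.M.l_zero[OF wc] by metis
  qed
  have sub: "vec R t \<subseteq> vec R (Suc t)" by (rule vec_mono) simp
  show ?thesis
    using lin_extend[OF p w] 1 2 e sub vec_upd
    by (intro exI[of _ ?p] conjI) (auto simp: image_iff simp del: fun_upd_apply intro: sym)
qed

lemma subvec_ideal: assumes "ideal I R" shows "subvec R 1 {v \<in> vec R 1. v 0 \<in> I}"
  using ideal_rules[OF assms] by (intro subvecI) (auto simp: vec_def)

lemma fun_module_diff_add: "u \<in> carrier F \<Longrightarrow> v \<in> carrier F \<Longrightarrow> (u \<ominus>\<^bsub>F\<^esub> v) \<oplus>\<^bsub>F\<^esub> v = u"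
  unfolding a_minus_def by (metis V.M.add.m_assoc V.M.a_inv_closed V.M.l_neg V.M.r_zero)

lemma subvec_Int: assumes K: "subvec R r K" and L: "subvec R n L" shows "subvec R n (K \<inter> L)"
proof (rule subvecI)
  show "K \<inter> L \<subseteq> vec R n" using subvec_subset[OF L] by blast
  show "\<zero>\<^bsub>F\<^esub> \<in> K \<inter> L" using subvec_zero[OF K] subvec_zero[OF L] by (rule IntI)
  show "u \<oplus>\<^bsub>F\<^esub> v \<in> K \<inter> L" if "u \<in> K \<inter> L" "v \<in> K \<inter> L" for u v
    using that subvec_add[OF K, of u v] subvec_add[OF L, of u v] by blast
  show "a \<odot>\<^bsub>F\<^esub> v \<in> K \<inter> L" if "a \<in> carrier R" "v \<in> K \<inter> L" for a v
    using that subvec_smult[OF K, of a v] subvec_smult[OF L, of a v] by blast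
qed

text \<open>Induction on the rank: the members of \<open>K\<close> with zero last coordinate fall
  under the induction hypothesis, and the last coordinates form an ideal. The map \<open>p\<close>
  is chosen so that its image contains the former and its ideal of last coordinates is as large as
  possible.\<close>

lemma (in noetherian_cring) subvec_is_image:
  assumes "subvec R n K"
  shows "\<exists>t p. lin R t n p \<and> p ` vec R t = K"
  using assms
proof (induction n arbitrary: K)
  case 0
  then have "K = {\<zero>\<^bsub>F\<^esub>}" using subvec_zero[OF 0] subvec_subset[OF 0] by (auto simp only: vec_0)
  then show ?case using lin_const_zero[of 0 0] by (intro exI[of _ 0] exI[of _ "\<lambda>v. \<zero>\<^bsub>F\<^esub>"]) (auto simp only: vec_0)
next
  case (Suc n)
  note K = Suc.prems
  have sub: "vec R n \<subseteq> vec R (Suc n)" by (rule vec_mono) simp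
  have "subvec R n (K \<inter> vec R n)" by (rule subvec_Int[OF K subvec_vec])
  then obtain t0 p0 where p0: "lin R t0 n p0" "p0 ` vec R t0 = K \<inter> vec R n" using Suc.IH by blast
  have p0': "lin R t0 (Suc n) p0" using p0(1) sub by (auto simp: lin_def)
  let ?L = "\<lambda>A :: (nat \<Rightarrow> 'a) set. {v n | v. v \<in> A}"
  have L_ideal: "ideal (?L A) R" if A: "subvec R (Suc n) A" for A
  proof (rule ideal_by)
    show "?L A \<subseteq> carrier R" using subvec_subset[OF A] vec_nth by auto
    show "\<zero> \<in> ?L A" using subvec_zero[OF A] by force
    fix x y assume "x \<in> ?L A" "y \<in> ?L A"
    then obtain u v where "x = u n" "u \<in> A" "y = v n" "v \<in> A" by auto
    then have "x \<oplus> y = (u \<oplus>\<^bsub>F\<^esub> v) n" "u \<oplus>\<^bsub>F\<^esub> v \<in> A" using subvec_add[OF A] by auto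
    then show "x \<oplus> y \<in> ?L A" by blast
  next
    fix a x assume a: "a \<in> carrier R" and "x \<in> ?L A"
    then obtain u where "x = u n" "u \<in> A" by auto
    then have "a \<otimes> x = (a \<odot>\<^bsub>F\<^esub> u) n" "a \<odot>\<^bsub>F\<^esub> u \<in> A" using subvec_smult[OF A a] by auto
    then show "a \<otimes> x \<in> ?L A" by blast
  qed
  let ?P = "\<lambda>J. \<exists>t p. lin R t (Suc n) p \<and> K \<inter> vec R n \<subseteq> p ` vec R t \<and> p ` vec R t \<subseteq> K \<and> J = ?L (p ` vec R t)"
  have P0: "?P (?L (p0 ` vec R t0))" using p0' p0(2) by blast
  obtain M where "ideal M R" and M: "?P M" and "?L (p0 ` vec R t0) \<subseteq> M"
    and max: "\<And>J. ideal J R \<Longrightarrow> ?P J \<Longrightarrow> M \<subseteq> J \<Longrightarrow> J = M"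
    by (rule maximal_ideal_in[of _ ?P, OF L_ideal[OF subvec_image[OF p0' subvec_vec]] P0]) (rule that)
  from M obtain t p where p: "lin R t (Suc n) p" "K \<inter> vec R n \<subseteq> p ` vec R t" "p ` vec R t \<subseteq> K"
    "M = ?L (p ` vec R t)" by blast
  have "K \<subseteq> p ` vec R t"
  proof
    fix w assume w: "w \<in> K"
    have wv: "w \<in> vec R (Suc n)" using subvec_subset[OF K w] .
    \<comment> \<open>Adjoining \<open>w\<close> cannot enlarge the ideal of last coordinates, so
      some \<open>v\<close> in the image of \<open>p\<close> has the last coordinate of
      \<open>w\<close>, and \<open>w - v\<close> drops to \<open>R^n\<close>.\<close>
    obtain p' where p': "lin R (Suc t) (Suc n) p'" "p ` vec R t \<subseteq> p' ` vec R (Suc t)" "w \<in> p' ` vec R (Suc t)"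
      "\<forall>v\<in>vec R (Suc t). \<exists>u\<in>vec R t. p' v = p u \<oplus>\<^bsub>F\<^esub> v t \<odot>\<^bsub>F\<^esub> w"
      using vec_adjoin[OF p(1) wv] by blast
    have "p' v \<in> K" if v: "v \<in> vec R (Suc t)" for v
    proof -
      obtain u where u: "u \<in> vec R t" "p' v = p u \<oplus>\<^bsub>F\<^esub> v t \<odot>\<^bsub>F\<^esub> w" using p'(4) v by blast
      have "p u \<in> K" using p(3) u by blast
      then show ?thesis unfolding u(2) by (intro subvec_add[OF K] subvec_smult[OF K vec_nth[OF v] w])
    qed
    then have 1: "p' ` vec R (Suc t) \<subseteq> K" by blast
    have 2: "K \<inter> vec R n \<subseteq> p' ` vec R (Suc t)" using p(2) p'(2) by (rule order_trans)
    have "?P (?L (p' ` vec R (Suc t)))"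
      by (intro exI conjI) (rule p'(1), rule 2, rule 1, rule refl)
    moreover have "M \<subseteq> ?L (p' ` vec R (Suc t))" unfolding p(4) using p'(2) by blast
    ultimately have "?L (p' ` vec R (Suc t)) = M"
      by (intro max L_ideal[OF subvec_image[OF p'(1) subvec_vec]])
    then have "w n \<in> M" using p'(3) by blast
    then have "\<exists>v. w n = v n \<and> v \<in> p ` vec R t" unfolding p(4) by (rule CollectD)
    then obtain v where v0: "w n = v n" "v \<in> p ` vec R t" by (elim exE conjE)
    note v = v0(2) v0(1)[symmetric]
    have vK: "v \<in> K" using v p(3) by blast
    have vc: "v \<in> carrier F" "w \<in> carrier F" using subvec_carrier[OF K] vK w by blast+
    have "w \<ominus>\<^bsub>F\<^esub> v \<in> vec R n"
    proof -
      have "(w \<ominus>\<^bsub>F\<^esub> v) i = \<zero>" if "i \<ge> n" for i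
      proof (cases "i = n")
        case True
        then show ?thesis unfolding fun_module_diff[OF vc(2,1)] using v(2) vc by (simp add: a_minus_def r_neg)
      next
        case False
        then have "w i = \<zero>" "v i = \<zero>" using that wv subvec_subset[OF K vK] by (auto simp: vec_def)
        then show ?thesis unfolding fun_module_diff[OF vc(2,1)] by (simp add: a_minus_def)
      qed
      then show ?thesis using subvec_carrier[OF K subvec_diff[OF K w vK]] by (auto simp: vec_def)
    qed
    then have "w \<ominus>\<^bsub>F\<^esub> v \<in> p ` vec R t" using p(2) subvec_diff[OF K w vK] by blast
    then have "(w \<ominus>\<^bsub>F\<^esub> v) \<oplus>\<^bsub>F\<^esub> v \<in> p ` vec R t"
      using subvec_add[OF subvec_image[OF p(1) subvec_vec]] v by blast
    moreover have "(w \<ominus>\<^bsub>F\<^esub> v) \<oplus>\<^bsub>F\<^esub> v = w"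
      by (rule fun_module_diff_add[OF vc(2,1)])
    ultimately show "w \<in> p ` vec R t" by simp
  qed
  then show ?case using p by blast
qed

end

subsection \<open>Syzygies\<close>

text \<open>A pair \<open>r\<close>, \<open>K\<close> with \<open>K \<subseteq> R\<^sup>r\<close> stands for the module \<open>R\<^sup>r/K\<close>. Its syzygy is \<open>K\<close>, presented as
  \<open>R\<^sup>s/L\<close>.\<close>

definition syz :: "('a, 'b) ring_scheme \<Rightarrow> nat \<Rightarrow> (nat \<Rightarrow> 'a) set \<Rightarrow> nat \<Rightarrow> (nat \<Rightarrow> 'a) set \<Rightarrow> bool" where
  "syz R r K s L \<longleftrightarrow> (\<exists>p. lin R s r p \<and> p ` vec R s = K \<and> L = {v \<in> vec R s. p v = \<zero>\<^bsub>fun_module R\<^esub>})"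

text \<open>Multiplication by \<open>a\<close> on \<open>R\<^sup>r/K\<close> equals a map through \<open>R\<^sup>s/L\<close> up to a map through a free module.
  For \<open>a = 1\<close> this makes \<open>R\<^sup>r/K\<close> a stable direct summand of \<open>R\<^sup>s/L\<close>.\<close>

definition stab ::
    "('a, 'b) ring_scheme \<Rightarrow> 'a \<Rightarrow> nat \<Rightarrow> (nat \<Rightarrow> 'a) set \<Rightarrow> nat \<Rightarrow> (nat \<Rightarrow> 'a) set \<Rightarrow> bool" where
  "stab R a r K s L \<longleftrightarrow> (\<exists>I P E. lin R r s I \<and> lin R s r P \<and> lin R r r E \<and>
     (\<forall>v\<in>K. I v \<in> L) \<and> (\<forall>w\<in>L. P w \<in> K) \<and> (\<forall>v\<in>K. E v = \<zero>\<^bsub>fun_module R\<^esub>) \<and>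
     (\<forall>v\<in>vec R r. a \<odot>\<^bsub>fun_module R\<^esub> v \<ominus>\<^bsub>fun_module R\<^esub> (P (I v) \<oplus>\<^bsub>fun_module R\<^esub> E v) \<in> K))"

text \<open>The quotient of rank \<open>rk i\<close> by \<open>K i\<close> is the
  \<open>i\<close>-th syzygy of the module presented at index 0, so \<open>K i\<close> itself is the
  \<open>(i + 1)\<close>-st.\<close>

definition resolution :: "('a, 'b) ring_scheme \<Rightarrow> (nat \<Rightarrow> nat) \<Rightarrow> (nat \<Rightarrow> (nat \<Rightarrow> 'a) set) \<Rightarrow> bool" where
  "resolution R rk K \<longleftrightarrow>
     (\<forall>i. subvec R (rk i) (K i) \<and> syz R (rk i) (K i) (rk (Suc i)) (K (Suc i)))"

text \<open>Being stably a summand of \<open>0\<close> means being projective, so this asks for some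
  projective syzygy.\<close>

definition finite_pd :: "('a, 'b) ring_scheme \<Rightarrow> nat \<Rightarrow> (nat \<Rightarrow> 'a) set \<Rightarrow> bool" where
  "finite_pd R r K \<longleftrightarrow> (\<exists>rk L n. resolution R rk L \<and> rk 0 = r \<and> L 0 = K \<and>
     stab R \<one>\<^bsub>R\<^esub> (rk n) (L n) 0 {\<zero>\<^bsub>fun_module R\<^esub>})"

context cring begin

interpretation V: module R F by (rule fun_module_module)

lemma stabI:
  assumes "lin R r s I" "lin R s r P" "lin R r r E" "\<And>v. v \<in> K \<Longrightarrow> I v \<in> L" "\<And>w. w \<in> L \<Longrightarrow> P w \<in> K"
    "\<And>v. v \<in> K \<Longrightarrow> E v = \<zero>\<^bsub>F\<^esub>" "\<And>v. v \<in> vec R r \<Longrightarrow> a \<odot>\<^bsub>F\<^esub> v \<ominus>\<^bsub>F\<^esub> (P (I v) \<oplus>\<^bsub>F\<^esub> E v) \<in> K"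
  shows "stab R a r K s L"
  unfolding stab_def using assms by blast

lemma fun_module_cancel:
  assumes "x \<in> carrier F" "y \<in> carrier F"
  shows "x \<ominus>\<^bsub>F\<^esub> (y \<oplus>\<^bsub>F\<^esub> (x \<ominus>\<^bsub>F\<^esub> y)) = \<zero>\<^bsub>F\<^esub>"
proof -
  have "y \<oplus>\<^bsub>F\<^esub> (x \<ominus>\<^bsub>F\<^esub> y) = x"
    using fun_module_diff_add[OF assms] V.M.add.m_comm[of y "x \<ominus>\<^bsub>F\<^esub> y"] V.M.minus_closed[OF assms] assms(2)
    by metis
  then show ?thesis using V.M.r_neg[OF assms(1)] by (simp only: a_minus_def)
qed

text \<open>Both maps lift to the presentations of the syzygies because free modules are projective.
  The error term of the old relation has values in \<open>K\<close>, so it lifts to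
  \<open>H\<close>, and \<open>H o p\<close> is the free part of the new relation.\<close>

lemma stab_syz:
  assumes st: "stab R a r K s L" and a: "a \<in> carrier R" and K: "subvec R r K" and L: "subvec R s L"
    and M: "syz R r K r' K'" and N: "syz R s L s' L'"
  shows "stab R a r' K' s' L'"
proof -
  obtain I P E where I: "lin R r s I" and P: "lin R s r P" and E: "lin R r r E"
    and IK: "\<And>v. v \<in> K \<Longrightarrow> I v \<in> L" and PL: "\<And>w. w \<in> L \<Longrightarrow> P w \<in> K" and EK: "\<And>v. v \<in> K \<Longrightarrow> E v = \<zero>\<^bsub>F\<^esub>"
    and d: "\<And>v. v \<in> vec R r \<Longrightarrow> a \<odot>\<^bsub>F\<^esub> v \<ominus>\<^bsub>F\<^esub> (P (I v) \<oplus>\<^bsub>F\<^esub> E v) \<in> K"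
    using st unfolding stab_def by blast
  obtain p where p: "lin R r' r p" "p ` vec R r' = K" "K' = {v \<in> vec R r'. p v = \<zero>\<^bsub>F\<^esub>}"
    using M unfolding syz_def by blast
  obtain q where q: "lin R s' s q" "q ` vec R s' = L" "L' = {v \<in> vec R s'. q v = \<zero>\<^bsub>F\<^esub>}"
    using N unfolding syz_def by blast
  have pK: "p v \<in> K" if "v \<in> vec R r'" for v using p(2) that by blast
  have qL: "q v \<in> L" if "v \<in> vec R s'" for v using q(2) that by blast
  have "(\<lambda>v. I (p v)) ` vec R r' \<subseteq> q ` vec R s'" unfolding q(2) using IK pK by blast
  then obtain I' where I': "lin R r' s' I'" "\<And>v. v \<in> vec R r' \<Longrightarrow> q (I' v) = I (p v)"
    using lin_lift[OF lin_comp[OF p(1) I] q(1)] by blast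
  have "(\<lambda>v. P (q v)) ` vec R s' \<subseteq> p ` vec R r'" unfolding p(2) using PL qL by blast
  then obtain P' where P': "lin R s' r' P'" "\<And>v. v \<in> vec R s' \<Longrightarrow> p (P' v) = P (q v)"
    using lin_lift[OF lin_comp[OF q(1) P] p(1)] by blast
  let ?G = "\<lambda>v. a \<odot>\<^bsub>F\<^esub> v \<ominus>\<^bsub>F\<^esub> (P (I v) \<oplus>\<^bsub>F\<^esub> E v)"
  have G: "lin R r r ?G"
    by (intro lin_sub lin_scale[OF a lin_ident] lin_plus lin_comp[OF I P] E)
  have "?G ` vec R r \<subseteq> p ` vec R r'" unfolding p(2) using d by blast
  then obtain H where H: "lin R r r' H" "\<And>v. v \<in> vec R r \<Longrightarrow> p (H v) = ?G v"
    using lin_lift[OF G p(1)] by blast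
  show ?thesis
  proof (rule stabI[OF I'(1) P'(1) lin_comp[OF p(1) H(1)]])
    show "I' v \<in> L'" if "v \<in> K'" for v
      using that I' lin_vec[OF I'(1)] lin_zero[OF I] unfolding p(3) q(3) by auto
    show "P' v \<in> K'" if "v \<in> L'" for v
      using that P' lin_vec[OF P'(1)] lin_zero[OF P] unfolding p(3) q(3) by auto
    show "H (p v) = \<zero>\<^bsub>F\<^esub>" if "v \<in> K'" for v
      using that lin_zero[OF H(1)] unfolding p(3) by auto
    fix v assume v: "v \<in> vec R r'"
    note Iv = lin_vec[OF I'(1) v] and pv = lin_vec[OF p(1) v]
    have av: "a \<odot>\<^bsub>F\<^esub> v \<in> vec R r'" by (rule vec_rules(3)[OF a v])
    have PIv: "P' (I' v) \<in> vec R r'" by (rule lin_vec[OF P'(1) Iv])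
    have Hv: "H (p v) \<in> vec R r'" by (rule lin_vec[OF H(1) pv])
    have sum: "P' (I' v) \<oplus>\<^bsub>F\<^esub> H (p v) \<in> vec R r'" by (rule vec_rules(2)[OF PIv Hv])
    have c: "a \<odot>\<^bsub>F\<^esub> p v \<in> carrier F" "P (I (p v)) \<in> carrier F"
      using vec_carrier[OF vec_rules(3)[OF a pv]] vec_carrier[OF lin_vec[OF P lin_vec[OF I pv]]] by blast+
    have "p (a \<odot>\<^bsub>F\<^esub> v \<ominus>\<^bsub>F\<^esub> (P' (I' v) \<oplus>\<^bsub>F\<^esub> H (p v))) = a \<odot>\<^bsub>F\<^esub> p v \<ominus>\<^bsub>F\<^esub> (P (I (p v)) \<oplus>\<^bsub>F\<^esub> ?G (p v))"
      unfolding lin_diff[OF p(1) av sum] lin_add[OF p(1) PIv Hv] lin_smult[OF p(1) a v] P'(2)[OF Iv] I'(2)[OF v] H(2)[OF pv] ..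
    also have "P (I (p v)) \<oplus>\<^bsub>F\<^esub> E (p v) = P (I (p v))"
      unfolding EK[OF pK[OF v]] by (rule V.M.r_zero[OF c(2)])
    also have "a \<odot>\<^bsub>F\<^esub> p v \<ominus>\<^bsub>F\<^esub> (P (I (p v)) \<oplus>\<^bsub>F\<^esub> (a \<odot>\<^bsub>F\<^esub> p v \<ominus>\<^bsub>F\<^esub> P (I (p v)))) = \<zero>\<^bsub>F\<^esub>"
      by (rule fun_module_cancel[OF c])
    finally show "a \<odot>\<^bsub>F\<^esub> v \<ominus>\<^bsub>F\<^esub> (P' (I' v) \<oplus>\<^bsub>F\<^esub> H (p v)) \<in> K'"
      unfolding p(3) using vec_rules(5)[OF av sum] by blast
  qed
qed

lemma stab_refl: assumes K: "subvec R r K" shows "stab R \<one> r K r K"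
proof (rule stabI[OF lin_ident lin_ident lin_const_zero])
  fix v assume v: "v \<in> vec R r"
  have "\<one> \<odot>\<^bsub>F\<^esub> v \<ominus>\<^bsub>F\<^esub> (v \<oplus>\<^bsub>F\<^esub> \<zero>\<^bsub>F\<^esub>) = \<zero>\<^bsub>F\<^esub>"
    using vec_carrier[OF v] V.M.r_neg[OF vec_carrier[OF v]] V.smult_one[OF vec_carrier[OF v]] V.M.r_zero[OF vec_carrier[OF v]]
    by (simp only: a_minus_def)
  then show "\<one> \<odot>\<^bsub>F\<^esub> v \<ominus>\<^bsub>F\<^esub> (v \<oplus>\<^bsub>F\<^esub> \<zero>\<^bsub>F\<^esub>) \<in> K" using subvec_zero[OF K] by metis
qed auto

text \<open>Inserting the second relation into the first, the free part \<open>D\<close> of the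
  middle module contributes \<open>P o D o I\<close> to the new free part.\<close>

lemma stab_trans:
  assumes 1: "stab R \<one> r K s L" and 2: "stab R \<one> s L t M" and K: "subvec R r K"
  shows "stab R \<one> r K t M"
proof -
  obtain I P E where I: "lin R r s I" and P: "lin R s r P" and E: "lin R r r E"
    and IK: "\<And>v. v \<in> K \<Longrightarrow> I v \<in> L" and PL: "\<And>w. w \<in> L \<Longrightarrow> P w \<in> K" and EK: "\<And>v. v \<in> K \<Longrightarrow> E v = \<zero>\<^bsub>F\<^esub>"
    and d: "\<And>v. v \<in> vec R r \<Longrightarrow> \<one> \<odot>\<^bsub>F\<^esub> v \<ominus>\<^bsub>F\<^esub> (P (I v) \<oplus>\<^bsub>F\<^esub> E v) \<in> K"
    using 1 unfolding stab_def by blast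
  obtain J Q D where J: "lin R s t J" and Q: "lin R t s Q" and D: "lin R s s D"
    and JL: "\<And>v. v \<in> L \<Longrightarrow> J v \<in> M" and QM: "\<And>w. w \<in> M \<Longrightarrow> Q w \<in> L" and DL: "\<And>v. v \<in> L \<Longrightarrow> D v = \<zero>\<^bsub>F\<^esub>"
    and d': "\<And>v. v \<in> vec R s \<Longrightarrow> \<one> \<odot>\<^bsub>F\<^esub> v \<ominus>\<^bsub>F\<^esub> (Q (J v) \<oplus>\<^bsub>F\<^esub> D v) \<in> L"
    using 2 unfolding stab_def by blast
  show ?thesis
  proof (rule stabI[OF lin_comp[OF I J] lin_comp[OF Q P] lin_plus[OF lin_comp[OF lin_comp[OF I D] P] E]])
    show "J (I v) \<in> M" if "v \<in> K" for v using that IK JL by blast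
    show "P (Q w) \<in> K" if "w \<in> M" for w using that PL QM by blast
    show "P (D (I v)) \<oplus>\<^bsub>F\<^esub> E v = \<zero>\<^bsub>F\<^esub>" if v: "v \<in> K" for v
      unfolding EK[OF v] DL[OF IK[OF v]] lin_zero[OF P] by (rule V.M.r_zero[OF V.M.zero_closed])
    fix v assume v: "v \<in> vec R r"
    note Iv = lin_vec[OF I v]
    let ?k = "\<one> \<odot>\<^bsub>F\<^esub> v \<ominus>\<^bsub>F\<^esub> (P (I v) \<oplus>\<^bsub>F\<^esub> E v)"
    let ?l = "\<one> \<odot>\<^bsub>F\<^esub> I v \<ominus>\<^bsub>F\<^esub> (Q (J (I v)) \<oplus>\<^bsub>F\<^esub> D (I v))"
    note QJ = lin_vec[OF Q lin_vec[OF J Iv]] and DI = lin_vec[OF D Iv]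
    have Pl: "P ?l = P (I v) \<ominus>\<^bsub>F\<^esub> (P (Q (J (I v))) \<oplus>\<^bsub>F\<^esub> P (D (I v)))"
      unfolding V.smult_one[OF vec_carrier[OF Iv]] lin_diff[OF P Iv vec_rules(2)[OF QJ DI]] lin_add[OF P QJ DI] ..
    have "?k \<oplus>\<^bsub>F\<^esub> P ?l \<in> K" using d[OF v] PL[OF d'[OF Iv]] subvec_add[OF K] by blast
    moreover have "?k \<oplus>\<^bsub>F\<^esub> P ?l = \<one> \<odot>\<^bsub>F\<^esub> v \<ominus>\<^bsub>F\<^esub> (P (Q (J (I v))) \<oplus>\<^bsub>F\<^esub> (P (D (I v)) \<oplus>\<^bsub>F\<^esub> E v))"
    proof
      fix i
      have c: "v i \<in> carrier R" "P (I v) i \<in> carrier R" "E v i \<in> carrier R"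
        "P (Q (J (I v))) i \<in> carrier R" "P (D (I v)) i \<in> carrier R"
        using vec_nth[OF v] vec_nth[OF lin_vec[OF P Iv]] vec_nth[OF lin_vec[OF E v]]
          vec_nth[OF lin_vec[OF P QJ]] vec_nth[OF lin_vec[OF P DI]] by blast+
      have vc: "v \<in> carrier F" "P (I v) \<in> carrier F" "E v \<in> carrier F" "P (Q (J (I v))) \<in> carrier F" "P (D (I v)) \<in> carrier F"
        using vec_carrier[OF v] vec_carrier[OF lin_vec[OF P Iv]] vec_carrier[OF lin_vec[OF E v]]
          vec_carrier[OF lin_vec[OF P QJ]] vec_carrier[OF lin_vec[OF P DI]] by blast+
      have "(?k \<oplus>\<^bsub>F\<^esub> P ?l) i = (\<one> \<otimes> v i \<ominus> (P (I v) i \<oplus> E v i)) \<oplus> (P (I v) i \<ominus> (P (Q (J (I v))) i \<oplus> P (D (I v)) i))"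
        unfolding Pl fun_module_simps(3) using vc by (simp add: fun_module_diff)
      also have "\<dots> = \<one> \<otimes> v i \<ominus> (P (Q (J (I v))) i \<oplus> (P (D (I v)) i \<oplus> E v i))"
        using c by algebra
      also have "\<dots> = (\<one> \<odot>\<^bsub>F\<^esub> v \<ominus>\<^bsub>F\<^esub> (P (Q (J (I v))) \<oplus>\<^bsub>F\<^esub> (P (D (I v)) \<oplus>\<^bsub>F\<^esub> E v))) i"
        using vc by (simp add: fun_module_diff)
      finally show "(?k \<oplus>\<^bsub>F\<^esub> P ?l) i = (\<one> \<odot>\<^bsub>F\<^esub> v \<ominus>\<^bsub>F\<^esub> (P (Q (J (I v))) \<oplus>\<^bsub>F\<^esub> (P (D (I v)) \<oplus>\<^bsub>F\<^esub> E v))) i" .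
    qed
    ultimately show "\<one> \<odot>\<^bsub>F\<^esub> v \<ominus>\<^bsub>F\<^esub> (P (Q (J (I v))) \<oplus>\<^bsub>F\<^esub> (P (D (I v)) \<oplus>\<^bsub>F\<^esub> E v)) \<in> K" by simp
  qed
qed

text \<open>The case \<open>s = 0\<close>: multiplication by \<open>a\<close> factors through a free module.\<close>

lemma stab_zero_iff:
  assumes K: "subvec R r K" and a: "a \<in> carrier R"
  shows "stab R a r K 0 {\<zero>\<^bsub>F\<^esub>} \<longleftrightarrow>
    (\<exists>E. lin R r r E \<and> (\<forall>v\<in>K. E v = \<zero>\<^bsub>F\<^esub>) \<and> (\<forall>v\<in>vec R r. a \<odot>\<^bsub>F\<^esub> v \<ominus>\<^bsub>F\<^esub> E v \<in> K))"
proof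
  assume "stab R a r K 0 {\<zero>\<^bsub>F\<^esub>}"
  then obtain I P E where I: "lin R r 0 I" and P: "lin R 0 r P" and E: "lin R r r E"
    and EK: "\<forall>v\<in>K. E v = \<zero>\<^bsub>F\<^esub>" and d: "\<forall>v\<in>vec R r. a \<odot>\<^bsub>F\<^esub> v \<ominus>\<^bsub>F\<^esub> (P (I v) \<oplus>\<^bsub>F\<^esub> E v) \<in> K"
    unfolding stab_def by blast
  have "P (I v) \<oplus>\<^bsub>F\<^esub> E v = E v" if v: "v \<in> vec R r" for v
  proof -
    have "I v = \<zero>\<^bsub>F\<^esub>" using lin_vec[OF I v] unfolding vec_0 by blast
    then have "P (I v) = \<zero>\<^bsub>F\<^esub>" using lin_zero[OF P] by metis
    then show ?thesis using V.M.l_zero[OF lin_carrier[OF E v]] by metis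
  qed
  then show "\<exists>E. lin R r r E \<and> (\<forall>v\<in>K. E v = \<zero>\<^bsub>F\<^esub>) \<and> (\<forall>v\<in>vec R r. a \<odot>\<^bsub>F\<^esub> v \<ominus>\<^bsub>F\<^esub> E v \<in> K)"
    using E EK d by (intro exI[of _ E]) auto
next
  assume "\<exists>E. lin R r r E \<and> (\<forall>v\<in>K. E v = \<zero>\<^bsub>F\<^esub>) \<and> (\<forall>v\<in>vec R r. a \<odot>\<^bsub>F\<^esub> v \<ominus>\<^bsub>F\<^esub> E v \<in> K)"
  then obtain E where E: "lin R r r E" "\<And>v. v \<in> K \<Longrightarrow> E v = \<zero>\<^bsub>F\<^esub>"
    "\<And>v. v \<in> vec R r \<Longrightarrow> a \<odot>\<^bsub>F\<^esub> v \<ominus>\<^bsub>F\<^esub> E v \<in> K" by blast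
  show "stab R a r K 0 {\<zero>\<^bsub>F\<^esub>}"
  proof (rule stabI[OF lin_const_zero lin_const_zero E(1)])
    show "a \<odot>\<^bsub>F\<^esub> v \<ominus>\<^bsub>F\<^esub> (\<zero>\<^bsub>F\<^esub> \<oplus>\<^bsub>F\<^esub> E v) \<in> K" if "v \<in> vec R r" for v
      using E(3)[OF that] V.M.l_zero[OF lin_carrier[OF E(1) that]] by metis
  qed (use E(2) subvec_zero[OF K] in blast)+
qed

lemma syz_subvec: "syz R r K s L \<Longrightarrow> subvec R s L"
  unfolding syz_def using subvec_ker by blast

lemma resolution_zero: "resolution R (\<lambda>_. 0) (\<lambda>_. {\<zero>\<^bsub>F\<^esub>})"
  unfolding resolution_def
proof (intro allI conjI subvec_0)
  show "syz R 0 {\<zero>\<^bsub>F\<^esub>} 0 {\<zero>\<^bsub>F\<^esub>}"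
    unfolding syz_def vec_0 using lin_const_zero[of 0 0] by (intro exI[of _ "\<lambda>v. \<zero>\<^bsub>F\<^esub>"]) auto
qed

lemma stab_resolution:
  assumes "resolution R rk K" "resolution R rk' K'" "a \<in> carrier R" "stab R a (rk 0) (K 0) (rk' 0) (K' 0)"
  shows "stab R a (rk i) (K i) (rk' i) (K' i)"
proof (induction i)
  case (Suc i)
  then show ?case using assms(1-3) stab_syz[of a "rk i" "K i" "rk' i" "K' i"] unfolding resolution_def by blast
qed (rule assms(4))

text \<open>Takes the role of Schanuel's lemma: projectivity of a late syzygy carries over to any
  resolution of any stable direct summand.\<close>

lemma finite_pd_resolution:
  assumes fpd: "finite_pd R s L" and st: "stab R \<one> r K s L"
    and res: "resolution R rk M" "rk 0 = r" "M 0 = K"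
  shows "\<exists>n. stab R \<one> (rk n) (M n) 0 {\<zero>\<^bsub>F\<^esub>}"
proof -
  obtain rk' L' n where r: "resolution R rk' L'" "rk' 0 = s" "L' 0 = L" "stab R \<one> (rk' n) (L' n) 0 {\<zero>\<^bsub>F\<^esub>}"
    using fpd unfolding finite_pd_def by blast
  have "stab R \<one> (rk n) (M n) (rk' n) (L' n)"
    using stab_resolution[OF res(1) r(1) one_closed] st res(2,3) r(2,3) by simp
  then show ?thesis using stab_trans r(4) res(1) unfolding resolution_def by blast
qed

end

text \<open>The property \<open>Q\<close> is left open so that arbitrary and minimal resolutions
  come from the same dependent choice.\<close>

lemma (in cring) ex_resolution_with:
  assumes K: "subvec R r K"
    and step: "\<And>r K. subvec R r K \<Longrightarrow> \<exists>s L. syz R r K s L \<and> Q L"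
  shows "\<exists>rk L. resolution R rk L \<and> rk 0 = r \<and> L 0 = K \<and> (\<forall>i. Q (L (Suc i)))"
proof -
  let ?P = "\<lambda>(x :: nat \<times> (nat \<Rightarrow> 'a) set) y. syz R (fst x) (snd x) (fst y) (snd y) \<and> Q (snd y)"
  have "\<exists>f. \<forall>n. (subvec R (fst (f n)) (snd (f n)) \<and> (n = 0 \<longrightarrow> f n = (r, K))) \<and> ?P (f n) (f (Suc n))"
  proof (rule dependent_nat_choice)
    show "\<exists>x. subvec R (fst x) (snd x) \<and> (0 = 0 \<longrightarrow> x = (r, K))" using K by auto
    fix x :: "nat \<times> (nat \<Rightarrow> 'a) set" and n :: nat
    assume "subvec R (fst x) (snd x) \<and> (n = 0 \<longrightarrow> x = (r, K))"
    then obtain s L where "syz R (fst x) (snd x) s L" "Q L" using step by blast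
    then show "\<exists>y. (subvec R (fst y) (snd y) \<and> (Suc n = 0 \<longrightarrow> y = (r, K))) \<and> ?P x y"
      using syz_subvec by (intro exI[of _ "(s, L)"]) auto
  qed
  then obtain f where f: "\<And>n. subvec R (fst (f n)) (snd (f n)) \<and> (n = 0 \<longrightarrow> f n = (r, K))"
    "\<And>n. ?P (f n) (f (Suc n))" by blast
  show ?thesis
    using f f(1)[of 0] by (intro exI[of _ "\<lambda>n. fst (f n)"] exI[of _ "\<lambda>n. snd (f n)"]) (auto simp: resolution_def)
qed

lemma (in noetherian_cring) ex_resolution:
  assumes K: "subvec R r K"
  shows "\<exists>rk L. resolution R rk L \<and> rk 0 = r \<and> L 0 = K"
proof -
  have "\<exists>s L. syz R r K s L \<and> True" if K: "subvec R r K" for r K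
  proof -
    obtain t p where "lin R t r p" "p ` vec R t = K" using subvec_is_image[OF K] by blast
    then show ?thesis unfolding syz_def by blast
  qed
  from ex_resolution_with[OF K, of "\<lambda>_. True", OF this] show ?thesis by auto
qed

lemma (in noetherian_cring) finite_pd_stab:
  assumes "finite_pd R s L" "stab R \<one> r K s L" "subvec R r K"
  shows "finite_pd R r K"
  using ex_resolution[OF assms(3)] finite_pd_resolution[OF assms(1,2)] unfolding finite_pd_def by blast

subsection \<open>Minimal resolutions\<close>

abbreviation residue_rel :: "('a, 'b) ring_scheme \<Rightarrow> 'a set \<Rightarrow> (nat \<Rightarrow> 'a) set" where
  "residue_rel R I \<equiv> {v \<in> vec R 1. v 0 \<in> I}"

context noetherian_local_ring begin

interpretation V: module R F by (rule fun_module_module)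

text \<open>The number of generators is taken least: a relation with a unit coordinate expresses
  that generator through the others and would allow one less.\<close>

lemma ex_minimal_generators:
  assumes K: "subvec R n K"
  shows "\<exists>t p. lin R t n p \<and> p ` vec R t = K \<and> (\<forall>v\<in>vec R t. p v = \<zero>\<^bsub>F\<^esub> \<longrightarrow> (\<forall>i. v i \<in> m))"
proof -
  define t where "t = (LEAST t. \<exists>p. lin R t n p \<and> p ` vec R t = K)"
  have "\<exists>p. lin R t n p \<and> p ` vec R t = K"
    unfolding t_def using subvec_is_image[OF K] by (rule LeastI_ex)
  then obtain p where p: "lin R t n p" "p ` vec R t = K" by blast
  have min: "t \<le> s" if "lin R s n q" "q ` vec R s = K" for s q
    unfolding t_def using that by (intro Least_le) blast
  have "v i \<in> m" if v: "v \<in> vec R t" "p v = \<zero>\<^bsub>F\<^esub>" for v i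
  proof (rule ccontr)
    assume vi: "v i \<notin> m"
    have "i < t"
    proof (rule ccontr)
      assume "\<not> i < t"
      then have "v i = \<zero>" using v(1) by (simp add: vec_def)
      then show False using vi ideal_zero[OF m_ideal] by simp
    qed
    then obtain t' where t': "t = Suc t'" by (cases t) auto
    have u: "v i \<in> Units R" using vi unit_iff vec_nth[OF v(1)] by blast
    \<comment> \<open>Inserts a zero at position \<open>i\<close>, so that the image uses all
      generators except the \<open>i\<close>-th.\<close>
    define \<sigma> where "\<sigma> = (\<lambda>(u :: nat \<Rightarrow> 'a) j. if j < i then u j else if j = i then \<zero> else u (j - 1))"
    have \<sigma>: "lin R t' t \<sigma>"
      using \<open>i < t\<close> by (intro linI) (auto simp: \<sigma>_def vec_def t' fun_eq_iff)
    have "p ` vec R t \<subseteq> (\<lambda>u. p (\<sigma> u)) ` vec R t'"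
    proof
      fix y assume "y \<in> p ` vec R t"
      then obtain w where w: "w \<in> vec R t" "y = p w" by auto
      \<comment> \<open>The multiple of the relation \<open>v\<close> that clears the
        \<open>i\<close>-th coordinate of \<open>w\<close> without changing
        \<open>p w\<close>.\<close>
      let ?c = "w i \<otimes> inv (v i)"
      have c: "?c \<in> carrier R" using u vec_nth[OF w(1)] by simp
      note cv = vec_rules(3)[OF c v(1)]
      let ?w = "w \<ominus>\<^bsub>F\<^esub> ?c \<odot>\<^bsub>F\<^esub> v"
      have wv: "?w \<in> vec R t" using vec_rules(5)[OF w(1) cv] .
      have "?w i = w i \<ominus> ?c \<otimes> v i"
        unfolding fun_module_diff[OF vec_carrier[OF w(1)] vec_carrier[OF cv]] by simp
      also have "?c \<otimes> v i = w i" using u vec_nth[OF w(1)] vec_nth[OF v(1)] by (simp add: m_assoc)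
      also have "w i \<ominus> w i = \<zero>" using vec_nth[OF w(1)] by (simp add: a_minus_def r_neg)
      finally have wi: "?w i = \<zero>" .
      define u' where "u' = (\<lambda>j. if j < i then ?w j else ?w (Suc j))"
      have "u' \<in> vec R t'" using wv \<open>i < t\<close> by (auto simp: u'_def vec_def t')
      moreover have "\<sigma> u' = ?w" using wi by (auto simp: \<sigma>_def u'_def fun_eq_iff)
      moreover have "p ?w = y"
      proof -
        have "p ?w = p w \<ominus>\<^bsub>F\<^esub> ?c \<odot>\<^bsub>F\<^esub> p v"
          unfolding lin_diff[OF p(1) w(1) cv] lin_smult[OF p(1) c v(1)] ..
        also have "\<dots> = p w"
          unfolding v(2) V.smult_r_null[OF c] using lin_carrier[OF p(1) w(1)] by (simp add: a_minus_def del: fun_module_simps(1,2))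
        finally show ?thesis using w(2) by simp
      qed
      ultimately show "y \<in> (\<lambda>u. p (\<sigma> u)) ` vec R t'" by (metis imageI)
    qed
    moreover have "(\<lambda>u. p (\<sigma> u)) ` vec R t' \<subseteq> p ` vec R t" using lin_vec[OF \<sigma>] by blast
    ultimately have "t \<le> t'" using min[OF lin_comp[OF \<sigma> p(1)]] p(2) by blast
    then show False using t' by simp
  qed
  then show ?thesis using p by blast
qed

lemma ex_minimal_resolution:
  assumes "subvec R r K"
  shows "\<exists>rk L. resolution R rk L \<and> rk 0 = r \<and> L 0 = K \<and> (\<forall>i. \<forall>v\<in>L (Suc i). \<forall>j. v j \<in> m)"
proof (rule ex_resolution_with[OF assms, of "\<lambda>L. \<forall>v\<in>L. \<forall>j. v j \<in> m"])
  fix r K assume "subvec R r K"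
  then obtain t p where "lin R t r p" "p ` vec R t = K" "\<forall>v\<in>vec R t. p v = \<zero>\<^bsub>F\<^esub> \<longrightarrow> (\<forall>i. v i \<in> m)"
    using ex_minimal_generators by blast
  then show "\<exists>s L. syz R r K s L \<and> (\<forall>v\<in>L. \<forall>j. v j \<in> m)"
    unfolding syz_def by (intro exI[of _ t] exI[of _ "{v \<in> vec R t. p v = \<zero>\<^bsub>F\<^esub>}"]) blast
qed

text \<open>A matrix over \<open>m\<close> maps vectors over \<open>U\<close> to vectors over
  \<open>mU\<close>. The ideal \<open>K\<close> stands for any ideal containing these products,
  which is the shape that \<open>nakayama\<close> asks for.\<close>

lemma lin_coords:
  assumes G: "lin R r s G" and e: "\<And>i j. i < r \<Longrightarrow> G (unit_vec R i) j \<in> m"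
    and U: "ideal U R" and K: "ideal K R" "\<And>x y. x \<in> m \<Longrightarrow> y \<in> U \<Longrightarrow> x \<otimes> y \<in> K"
    and v: "v \<in> vec R r" "\<And>i. v i \<in> U"
  shows "G v j \<in> K"
proof -
  have "\<forall>j. G v j \<in> K" if "v \<in> vec R k" "k \<le> r" "\<And>i. v i \<in> U" for k v
    using that
  proof (induction k arbitrary: v)
    case 0
    then have "v = \<zero>\<^bsub>F\<^esub>" by (simp only: vec_0) simp
    then show ?case using lin_zero[OF G] ideal_zero[OF K(1)] by simp
  next
    case (Suc k)
    note fv = vec_upd[OF Suc.prems(1)] and vk = vec_nth[OF Suc.prems(1), of k]
    have sub: "vec R k \<subseteq> vec R r" using Suc.prems vec_mono by simp
    have ek: "unit_vec R k \<in> vec R r" using Suc.prems unit_vec_vec by simp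
    have Gv: "G v = G (v(k := \<zero>)) \<oplus>\<^bsub>F\<^esub> v k \<odot>\<^bsub>F\<^esub> G (unit_vec R k)"
      using lin_add[OF G subsetD[OF sub fv] vec_rules(3)[OF vk ek]] lin_smult[OF G vk ek]
        vec_split[OF Suc.prems(1)] by simp
    have IH: "\<forall>j. G (v(k := \<zero>)) j \<in> K"
      by (rule Suc.IH[OF fv]) (use Suc.prems ideal_zero[OF U] in auto)
    show ?case
    proof
      fix j
      have "G (unit_vec R k) j \<in> m" using e Suc.prems by simp
      then have "v k \<otimes> G (unit_vec R k) j \<in> K"
        using K(2) Suc.prems(3) m_comm[OF vk] m_carrier by metis
      then show "G v j \<in> K" unfolding Gv using IH ideal_add[OF K(1)] by simp
    qed
  qed
  then show ?thesis using v by blast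
qed

text \<open>The map \<open>1 - E\<close> sends basis vectors into \<open>K\<close>, so its matrix
  has entries in \<open>m\<close>, and it fixes every \<open>u\<close> in \<open>K\<close>. The
  ideal \<open>U\<close> generated by the coordinates of \<open>u\<close> therefore lies in
  \<open>mU\<close> and vanishes.\<close>

lemma stab_zero_minimal:
  assumes K: "subvec R r K" and Km: "\<And>v j. v \<in> K \<Longrightarrow> v j \<in> m" and st: "stab R \<one> r K 0 {\<zero>\<^bsub>F\<^esub>}"
  shows "K = {\<zero>\<^bsub>F\<^esub>}"
proof -
  obtain E where E: "lin R r r E" "\<And>v. v \<in> K \<Longrightarrow> E v = \<zero>\<^bsub>F\<^esub>"
    "\<And>v. v \<in> vec R r \<Longrightarrow> \<one> \<odot>\<^bsub>F\<^esub> v \<ominus>\<^bsub>F\<^esub> E v \<in> K"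
    using st stab_zero_iff[OF K one_closed] by blast
  let ?G = "\<lambda>v. \<one> \<odot>\<^bsub>F\<^esub> v \<ominus>\<^bsub>F\<^esub> E v"
  have G: "lin R r r ?G" by (intro lin_sub lin_scale lin_ident E one_closed)
  have "u = \<zero>\<^bsub>F\<^esub>" if u: "u \<in> K" for u
  proof -
    have uv: "u \<in> vec R r" by (rule subvec_subset[OF K u])
    have Gu: "?G u = u"
      unfolding E(2)[OF u] V.smult_one[OF vec_carrier[OF uv]]
      using vec_carrier[OF uv] by (simp add: a_minus_def del: fun_module_simps(1,2))
    have uc: "range u \<subseteq> carrier R" using vec_nth[OF uv] by auto
    let ?U = "Idl (range u)"
    have U: "ideal ?U R" by (rule genideal_ideal[OF uc])
    have uU: "u i \<in> ?U" for i using genideal_self[OF uc] by blast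
    have "?U \<subseteq> {\<zero>}"
    proof (rule nakayama[OF U zeroideal])
      fix K' assume K': "ideal K' R" "\<And>r i. r \<in> m \<Longrightarrow> i \<in> ?U \<Longrightarrow> r \<otimes> i \<in> K'"
      have "?G u j \<in> K'" for j
        by (rule lin_coords[OF G _ U K' uv uU]) (use Km E(3) unit_vec_vec in auto)
      then have "u j \<in> K'" for j using Gu by metis
      then show "?U \<subseteq> K'" by (intro genideal_minimal K'(1)) auto
    qed
    then have "u i = \<zero>" for i using uU by blast
    then show ?thesis by auto
  qed
  then show ?thesis using subvec_zero[OF K] by blast
qed

lemma subvec_residue_rel: "subvec R 1 (residue_rel R m)"
  by (rule subvec_ideal[OF m_ideal])

text \<open>In the minimal resolution all relations have entries in \<open>m\<close>, so
  \<open>z\<close> kills the image of each basis vector. If \<open>L (Suc i)\<close> is zero, this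
  leaves no basis vector at all, and \<open>L i\<close> is zero too. Descending from a projective
  syzygy ends at \<open>L 0 = 0\<close>, that is, \<open>m = 0\<close>.\<close>

lemma finite_pd_depth_zero:
  assumes fpd: "finite_pd R 1 (residue_rel R m)"
    and z: "z \<in> carrier R" "z \<noteq> \<zero>" "\<And>r. r \<in> m \<Longrightarrow> r \<otimes> z = \<zero>"
  shows "m = {\<zero>}"
proof -
  obtain rk L where res: "resolution R rk L" "rk 0 = 1" "L 0 = residue_rel R m"
    and min: "\<forall>i. \<forall>v\<in>L (Suc i). \<forall>j. v j \<in> m"
    using ex_minimal_resolution[OF subvec_residue_rel] by blast
  have L: "subvec R (rk i) (L i)" "syz R (rk i) (L i) (rk (Suc i)) (L (Suc i))" for i
    using res(1) unfolding resolution_def by blast+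
  have Lm: "v j \<in> m" if "v \<in> L i" for v i j
  proof (cases i)
    case 0
    then have "v \<in> vec R 1" "v 0 \<in> m" using that res(3) by auto
    then show ?thesis using ideal_zero[OF m_ideal] by (cases j) (auto simp: vec_def)
  next
    case (Suc k)
    then show ?thesis using min that by blast
  qed
  have step: "stab R \<one> (rk i) (L i) 0 {\<zero>\<^bsub>F\<^esub>}" if st: "stab R \<one> (rk (Suc i)) (L (Suc i)) 0 {\<zero>\<^bsub>F\<^esub>}" for i
  proof -
    have L0: "L (Suc i) = {\<zero>\<^bsub>F\<^esub>}" by (rule stab_zero_minimal[OF L(1) _ st]) (rule Lm)
    obtain p where p: "lin R (rk (Suc i)) (rk i) p" "p ` vec R (rk (Suc i)) = L i"
      "L (Suc i) = {v \<in> vec R (rk (Suc i)). p v = \<zero>\<^bsub>F\<^esub>}"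
      using L(2)[of i] unfolding syz_def by blast
    have "rk (Suc i) = 0"
    proof (rule ccontr)
      assume "rk (Suc i) \<noteq> 0"
      then have e: "unit_vec R 0 \<in> vec R (rk (Suc i))" by (simp add: unit_vec_vec)
      have "z \<odot>\<^bsub>F\<^esub> p (unit_vec R 0) = \<zero>\<^bsub>F\<^esub>"
      proof
        fix j
        have "p (unit_vec R 0) \<in> L i" using p(2) e by blast
        then have "p (unit_vec R 0) j \<in> m" by (rule Lm)
        then show "(z \<odot>\<^bsub>F\<^esub> p (unit_vec R 0)) j = \<zero>\<^bsub>F\<^esub> j"
          using z(3) m_comm[OF z(1)] m_carrier by simp
      qed
      then have "z \<odot>\<^bsub>F\<^esub> unit_vec R 0 \<in> L (Suc i)"
        unfolding p(3) using lin_smult[OF p(1) z(1) e] vec_rules(3)[OF z(1) e] by simp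
      then have "z \<odot>\<^bsub>F\<^esub> unit_vec R 0 = \<zero>\<^bsub>F\<^esub>" using L0 by blast
      then have "z \<otimes> \<one> = \<zero>" by (auto simp: unit_vec_def fun_eq_iff split: if_splits dest: spec[of _ 0])
      then show False using z by simp
    qed
    then have "L i = {\<zero>\<^bsub>F\<^esub>}" using p(2) lin_zero[OF p(1)] unfolding vec_0 by (metis vec_0 image_insert image_empty)
    show ?thesis
      unfolding stab_zero_iff[OF L(1) one_closed]
    proof (intro exI[of _ "\<lambda>v. v"] conjI ballI lin_ident)
      fix v assume v: "v \<in> vec R (rk i)"
      have "\<one> \<odot>\<^bsub>F\<^esub> v \<ominus>\<^bsub>F\<^esub> v = \<zero>\<^bsub>F\<^esub>"
        unfolding V.smult_one[OF vec_carrier[OF v]] a_minus_def by (rule V.M.r_neg[OF vec_carrier[OF v]])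
      then show "\<one> \<odot>\<^bsub>F\<^esub> v \<ominus>\<^bsub>F\<^esub> v \<in> L i" using subvec_zero[OF L(1)] by metis
    qed (use \<open>L i = _\<close> in blast)
  qed
  obtain n where "stab R \<one> (rk n) (L n) 0 {\<zero>\<^bsub>F\<^esub>}"
    using finite_pd_resolution[OF fpd stab_refl[OF subvec_residue_rel] res] by blast
  then have "stab R \<one> (rk 0) (L 0) 0 {\<zero>\<^bsub>F\<^esub>}" by (induction n) (use step in blast)+
  then have L0: "L 0 = {\<zero>\<^bsub>F\<^esub>}" by (intro stab_zero_minimal[OF L(1)] Lm)
  have "a = \<zero>" if a: "a \<in> m" for a
  proof -
    let ?v = "\<lambda>i :: nat. if i = 0 then a else \<zero>"
    have "?v \<in> L 0" unfolding res(3) using a m_carrier[OF a] by (simp add: vec_def)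
    then have "?v = \<zero>\<^bsub>F\<^esub>" unfolding L0 by (rule singletonD)
    then have "?v 0 = \<zero>\<^bsub>F\<^esub> 0" by (rule fun_cong)
    then show ?thesis by simp
  qed
  then show ?thesis using ideal_zero[OF m_ideal] by blast
qed

end

subsection \<open>Change of rings\<close>

locale cring_hom = R: cring R + S: cring S for R (structure) and S (structure) +
  fixes h
  assumes hom: "h \<in> ring_hom R S"
begin

lemma hom_rules [simp]:
  "a \<in> carrier R \<Longrightarrow> h a \<in> carrier S" "h \<one> = \<one>\<^bsub>S\<^esub>" "h \<zero> = \<zero>\<^bsub>S\<^esub>"
  "a \<in> carrier R \<Longrightarrow> b \<in> carrier R \<Longrightarrow> h (a \<otimes> b) = h a \<otimes>\<^bsub>S\<^esub> h b"
  "a \<in> carrier R \<Longrightarrow> b \<in> carrier R \<Longrightarrow> h (a \<oplus> b) = h a \<oplus>\<^bsub>S\<^esub> h b"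
  using ring_hom_closed[OF hom] ring_hom_one[OF hom] ring_hom_mult[OF hom] ring_hom_add[OF hom]
    ring_hom_zero[OF hom R.ring_axioms S.ring_axioms] by auto

lemma comp_vec: "v \<in> vec R n \<Longrightarrow> h \<circ> v \<in> vec S n"
  by (auto simp: vec_def)

lemma comp_add: "u \<in> vec R n \<Longrightarrow> v \<in> vec R n \<Longrightarrow>
    h \<circ> (u \<oplus>\<^bsub>fun_module R\<^esub> v) = (h \<circ> u) \<oplus>\<^bsub>fun_module S\<^esub> (h \<circ> v)"
  by (auto simp: vec_def)

lemma comp_smult: "a \<in> carrier R \<Longrightarrow> v \<in> vec R n \<Longrightarrow>
    h \<circ> (a \<odot>\<^bsub>fun_module R\<^esub> v) = h a \<odot>\<^bsub>fun_module S\<^esub> (h \<circ> v)"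
  by (auto simp: vec_def)

lemma comp_zero: "h \<circ> \<zero>\<^bsub>fun_module R\<^esub> = \<zero>\<^bsub>fun_module S\<^esub>"
  by auto

lemma comp_diff: "u \<in> vec R n \<Longrightarrow> v \<in> vec R n \<Longrightarrow>
    h \<circ> (u \<ominus>\<^bsub>fun_module R\<^esub> v) = (h \<circ> u) \<ominus>\<^bsub>fun_module S\<^esub> (h \<circ> v)"
proof
  fix i
  assume u: "u \<in> vec R n" and v: "v \<in> vec R n"
  have c: "u i \<in> carrier R" "v i \<in> carrier R" using u v R.vec_nth by blast+
  have "h (\<ominus> v i) \<oplus>\<^bsub>S\<^esub> h (v i) = \<zero>\<^bsub>S\<^esub>" using c by (simp add: R.l_neg flip: hom_rules(5))
  then have "h (\<ominus> v i) = \<ominus>\<^bsub>S\<^esub> h (v i)" using c S.minus_equality by simp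
  then have "h (u i \<ominus> v i) = h (u i) \<ominus>\<^bsub>S\<^esub> h (v i)" using c by (simp add: a_minus_def)
  then show "(h \<circ> (u \<ominus>\<^bsub>fun_module R\<^esub> v)) i = ((h \<circ> u) \<ominus>\<^bsub>fun_module S\<^esub> (h \<circ> v)) i"
    unfolding S.fun_module_diff[OF S.vec_carrier[OF comp_vec[OF u]] S.vec_carrier[OF comp_vec[OF v]]]
    by (simp add: R.fun_module_diff[OF R.vec_carrier[OF u] R.vec_carrier[OF v]])
qed

text \<open>The matrix of \<open>f\<close> with \<open>h\<close> applied to its entries, again built
  one basis vector at a time.\<close>

lemma lin_base_change:
  assumes "lin R r s f"
  shows "\<exists>f'. lin S r s f' \<and> (\<forall>v\<in>vec R r. f' (h \<circ> v) = h \<circ> f v)"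
  using assms
proof (induction r arbitrary: f)
  case 0
  have "h \<circ> f v = \<zero>\<^bsub>fun_module S\<^esub>" if "v \<in> vec R 0" for v
    using that R.lin_zero[OF 0] unfolding R.vec_0 by auto
  then show ?case using S.lin_const_zero by (intro exI[of _ "\<lambda>v. \<zero>\<^bsub>fun_module S\<^esub>"]) metis
next
  case (Suc r)
  have sub: "vec R r \<subseteq> vec R (Suc r)" by (rule R.vec_mono) simp
  have "lin R r s f" using Suc.prems sub by (auto simp: lin_def subset_iff)
  then obtain g where g: "lin S r s g" "\<forall>v\<in>vec R r. g (h \<circ> v) = h \<circ> f v" using Suc.IH by blast
  have e: "unit_vec R r \<in> vec R (Suc r)" by (rule R.unit_vec_vec) simp
  let ?w = "f (unit_vec R r)"
  have w: "?w \<in> vec R s" by (rule R.lin_vec[OF Suc.prems e])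
  let ?g = "\<lambda>v. g (v(r := \<zero>\<^bsub>S\<^esub>)) \<oplus>\<^bsub>fun_module S\<^esub> v r \<odot>\<^bsub>fun_module S\<^esub> (h \<circ> ?w)"
  have "?g (h \<circ> v) = h \<circ> f v" if v: "v \<in> vec R (Suc r)" for v
  proof -
    note fv = R.vec_upd[OF v] and vr = R.vec_nth[OF v, of r]
    have upd: "(h \<circ> v)(r := \<zero>\<^bsub>S\<^esub>) = h \<circ> v(r := \<zero>)" by (auto simp: fun_eq_iff)
    have "?g (h \<circ> v) = (h \<circ> f (v(r := \<zero>))) \<oplus>\<^bsub>fun_module S\<^esub> (h \<circ> (v r \<odot>\<^bsub>fun_module R\<^esub> ?w))"
      unfolding upd bspec[OF g(2) fv] comp_smult[OF vr w] comp_apply ..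
    also have "\<dots> = h \<circ> (f (v(r := \<zero>)) \<oplus>\<^bsub>fun_module R\<^esub> v r \<odot>\<^bsub>fun_module R\<^esub> ?w)"
      by (rule comp_add[symmetric, OF R.lin_vec[OF Suc.prems subsetD[OF sub fv]] R.vec_rules(3)[OF vr w]])
    also have "f (v(r := \<zero>)) \<oplus>\<^bsub>fun_module R\<^esub> v r \<odot>\<^bsub>fun_module R\<^esub> ?w = f v"
      using R.lin_add[OF Suc.prems subsetD[OF sub fv] R.vec_rules(3)[OF vr e]] R.lin_smult[OF Suc.prems vr e]
        R.vec_split[OF v] by metis
    finally show ?thesis .
  qed
  then show ?case using S.lin_extend[OF g(1) comp_vec[OF w]] by blast
qed

end

sublocale quot_map \<subseteq> cring_hom R S h
  by (intro cring_hom.intro cring_hom_axioms.intro R.is_cring S.is_cring hom)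

sublocale loc_map \<subseteq> cring_hom R L h
  by (intro cring_hom.intro cring_hom_axioms.intro R.is_cring L.is_cring hom)

section \<open>Reduction of presentations modulo an ideal\<close>

context quot_map begin

abbreviation comp_image :: "(nat \<Rightarrow> 'a) set \<Rightarrow> (nat \<Rightarrow> 'c) set" where
  "comp_image K \<equiv> (\<lambda>v. h \<circ> v) ` K"

lemma lift_vec: assumes u: "u \<in> vec S n" obtains v where "v \<in> vec R n" "h \<circ> v = u"
proof -
  have "\<exists>a. a \<in> carrier R \<and> h a = u i \<and> (n \<le> i \<longrightarrow> a = \<zero>)" for i
  proof (cases "n \<le> i")
    case True
    then show ?thesis using u by (intro exI[of _ \<zero>]) (auto simp: vec_def)
  next
    case False
    then show ?thesis using lift[of "u i"] S.vec_nth[OF u] by metis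
  qed
  then obtain v where "\<forall>i. v i \<in> carrier R \<and> h (v i) = u i \<and> (n \<le> i \<longrightarrow> v i = \<zero>)" by metis
  then show thesis by (intro that[of v]) (auto simp: vec_def)
qed

lemma comp_image_vec: "comp_image (vec R n) = vec S n"
  using comp_vec lift_vec by (metis (mono_tags, lifting) image_eqI image_subset_iff subsetI subset_antisym)

lemma comp_image_subvec: assumes K: "subvec R n K" shows "subvec S n (comp_image K)"
proof (rule S.subvecI)
  note Kv = R.subvec_subset[OF K]
  show "comp_image K \<subseteq> vec S n" using comp_vec Kv by blast
  show "\<zero>\<^bsub>fun_module S\<^esub> \<in> comp_image K" using comp_zero R.subvec_zero[OF K] by (metis imageI)
  fix u v a assume "v \<in> comp_image K"
  then obtain v' where v: "v' \<in> K" "v = h \<circ> v'" by auto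
  { assume "u \<in> comp_image K"
    then obtain u' where u: "u' \<in> K" "u = h \<circ> u'" by auto
    show "u \<oplus>\<^bsub>fun_module S\<^esub> v \<in> comp_image K"
      unfolding u(2) v(2) comp_add[OF Kv[OF u(1)] Kv[OF v(1)], symmetric]
      using R.subvec_add[OF K u(1) v(1)] by (rule imageI) }
  { assume "a \<in> carrier S"
    then obtain a' where a: "a' \<in> carrier R" "h a' = a" by (rule lift)
    show "a \<odot>\<^bsub>fun_module S\<^esub> v \<in> comp_image K"
      unfolding a(2)[symmetric] v(2) comp_smult[OF a(1) Kv[OF v(1)], symmetric]
      using R.subvec_smult[OF K a(1) v(1)] by (rule imageI) }
qed

lemma stab_zero_image:
  assumes K: "subvec R r K" and a: "a \<in> carrier R" and st: "stab R a r K 0 {\<zero>\<^bsub>fun_module R\<^esub>}"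
  shows "stab S (h a) r (comp_image K) 0 {\<zero>\<^bsub>fun_module S\<^esub>}"
proof -
  obtain E where E: "lin R r r E" "\<forall>v\<in>K. E v = \<zero>\<^bsub>fun_module R\<^esub>"
    "\<forall>v\<in>vec R r. a \<odot>\<^bsub>fun_module R\<^esub> v \<ominus>\<^bsub>fun_module R\<^esub> E v \<in> K"
    using st R.stab_zero_iff[OF K a] by blast
  obtain E' where E': "lin S r r E'" "\<forall>v\<in>vec R r. E' (h \<circ> v) = h \<circ> E v"
    using lin_base_change[OF E(1)] by blast
  have "E' u = \<zero>\<^bsub>fun_module S\<^esub>" if "u \<in> comp_image K" for u
    using that E'(2) E(2) R.subvec_subset[OF K] comp_zero by force
  moreover have "h a \<odot>\<^bsub>fun_module S\<^esub> u \<ominus>\<^bsub>fun_module S\<^esub> E' u \<in> comp_image K" if u: "u \<in> vec S r" for u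
  proof -
    obtain v where v: "v \<in> vec R r" "h \<circ> v = u" using lift_vec[OF u] by blast
    have "h a \<odot>\<^bsub>fun_module S\<^esub> u \<ominus>\<^bsub>fun_module S\<^esub> E' u = h \<circ> (a \<odot>\<^bsub>fun_module R\<^esub> v \<ominus>\<^bsub>fun_module R\<^esub> E v)"
      unfolding v(2)[symmetric] comp_diff[OF R.vec_rules(3)[OF a v(1)] R.lin_vec[OF E(1) v(1)]]
        comp_smult[OF a v(1)] bspec[OF E'(2) v(1)] ..
    then show ?thesis using E(3) v(1) by blast
  qed
  ultimately show ?thesis
    using S.stab_zero_iff[OF comp_image_subvec[OF K], of "h a"] E'(1) a by auto
qed

end

text \<open>Reduction modulo a nonzerodivisor \<open>x\<close> preserves syzygies of modules on which \<open>x\<close> is regular.\<close>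

locale nonzerodivisor_quot = quot_map R S h I for R (structure) and S (structure) and h I +
  fixes x
  assumes x: "x \<in> carrier R" and I_eq: "I = R.adj {\<zero>} x"
    and nzd: "\<And>a. a \<in> carrier R \<Longrightarrow> a \<otimes> x = \<zero> \<Longrightarrow> a = \<zero>"
begin

text \<open>Says that \<open>x\<close> is a nonzerodivisor on the module
  \<open>R^r/K\<close>.\<close>

definition torsion_free :: "nat \<Rightarrow> (nat \<Rightarrow> 'a) set \<Rightarrow> bool" where
  "torsion_free r K \<longleftrightarrow> (\<forall>v\<in>vec R r. x \<odot>\<^bsub>fun_module R\<^esub> v \<in> K \<longrightarrow> v \<in> K)"

lemma vec_nzd: assumes v: "v \<in> vec R n" "x \<odot>\<^bsub>fun_module R\<^esub> v = \<zero>\<^bsub>fun_module R\<^esub>" shows "v = \<zero>\<^bsub>fun_module R\<^esub>"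
proof
  fix i
  have "x \<otimes> v i = \<zero>" using fun_cong[OF v(2), of i] by simp
  then show "v i = \<zero>\<^bsub>fun_module R\<^esub> i" using nzd[of "v i"] R.vec_nth[OF v(1)] R.m_comm[OF x] by simp
qed

lemma comp_zero_iff: assumes v: "v \<in> vec R n" "h \<circ> v = \<zero>\<^bsub>fun_module S\<^esub>"
  obtains w where "w \<in> vec R n" "v = x \<odot>\<^bsub>fun_module R\<^esub> w"
proof -
  have "\<exists>a. a \<in> carrier R \<and> v i = x \<otimes> a \<and> (n \<le> i \<longrightarrow> a = \<zero>)" for i
  proof (cases "n \<le> i")
    case True
    then show ?thesis using v x by (intro exI[of _ \<zero>]) (auto simp: vec_def)
  next
    case False
    have "h (v i) = \<zero>\<^bsub>S\<^esub>" using fun_cong[OF v(2), of i] by simp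
    then have "v i \<in> R.adj {\<zero>} x" using ker R.vec_nth[OF v(1)] I_eq by simp
    then obtain a where "a \<in> carrier R" "v i = \<zero> \<oplus> a \<otimes> x" by (auto simp: R.adj_def)
    then show ?thesis using False x R.m_comm[OF x] by auto
  qed
  then obtain w where w: "\<forall>i. w i \<in> carrier R \<and> v i = x \<otimes> w i \<and> (n \<le> i \<longrightarrow> w i = \<zero>)" by metis
  then have "w \<in> vec R n" "v = x \<odot>\<^bsub>fun_module R\<^esub> w" by (auto simp: vec_def fun_eq_iff)
  then show thesis by (rule that)
qed

text \<open>The module \<open>R^s/L\<close> is isomorphic to the submodule \<open>K\<close> of a
  free module, and \<open>x\<close> is a nonzerodivisor there.\<close>

lemma syz_torsion_free:
  assumes "syz R r K s L" shows "torsion_free s L"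
  unfolding torsion_free_def
proof (intro ballI impI)
  fix v assume v: "v \<in> vec R s" "x \<odot>\<^bsub>fun_module R\<^esub> v \<in> L"
  obtain p where p: "lin R s r p" "L = {v \<in> vec R s. p v = \<zero>\<^bsub>fun_module R\<^esub>}"
    using assms unfolding syz_def by blast
  have "x \<odot>\<^bsub>fun_module R\<^esub> p v = \<zero>\<^bsub>fun_module R\<^esub>" using v(2) R.lin_smult[OF p(1) x v(1)] p(2) by simp
  then have "p v = \<zero>\<^bsub>fun_module R\<^esub>" using vec_nzd R.lin_vec[OF p(1) v(1)] by blast
  then show "v \<in> L" using p(2) v(1) by blast
qed

text \<open>This is the vanishing of the first Tor of \<open>R/x\<close> with the module
  \<open>R^r/K\<close>, carried out on elements.\<close>

lemma syz_image:
  assumes K: "subvec R r K" and tf: "torsion_free r K" and sy: "syz R r K s L"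
  shows "syz S r (comp_image K) s (comp_image L)"
proof -
  obtain p where p: "lin R s r p" "p ` vec R s = K" "L = {v \<in> vec R s. p v = \<zero>\<^bsub>fun_module R\<^esub>}"
    using sy unfolding syz_def by blast
  obtain p' where p': "lin S s r p'" "\<forall>v\<in>vec R s. p' (h \<circ> v) = h \<circ> p v"
    using lin_base_change[OF p(1)] by blast
  have im: "p' ` vec S s = comp_image K"
    unfolding comp_image_vec[symmetric] p(2)[symmetric] image_image using p'(2) by (intro image_cong) auto
  have "{u \<in> vec S s. p' u = \<zero>\<^bsub>fun_module S\<^esub>} = comp_image L"
  proof
    show "comp_image L \<subseteq> {u \<in> vec S s. p' u = \<zero>\<^bsub>fun_module S\<^esub>}"
    proof
      fix u assume "u \<in> comp_image L"
      then obtain v where v: "v \<in> vec R s" "p v = \<zero>\<^bsub>fun_module R\<^esub>" "u = h \<circ> v" unfolding p(3) by blast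
      then have "p' u = \<zero>\<^bsub>fun_module S\<^esub>" using p'(2) comp_zero by metis
      then show "u \<in> {u \<in> vec S s. p' u = \<zero>\<^bsub>fun_module S\<^esub>}" using v comp_vec by blast
    qed
    show "{u \<in> vec S s. p' u = \<zero>\<^bsub>fun_module S\<^esub>} \<subseteq> comp_image L"
    proof
      fix u assume "u \<in> {u \<in> vec S s. p' u = \<zero>\<^bsub>fun_module S\<^esub>}"
      then have u: "u \<in> vec S s" "p' u = \<zero>\<^bsub>fun_module S\<^esub>" by blast+
      obtain v where v: "v \<in> vec R s" "h \<circ> v = u" using lift_vec[OF u(1)] by blast
      have "h \<circ> p v = \<zero>\<^bsub>fun_module S\<^esub>" using p'(2) v u(2) by metis
      then obtain w where w: "w \<in> vec R r" "p v = x \<odot>\<^bsub>fun_module R\<^esub> w"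
        using comp_zero_iff[OF R.lin_vec[OF p(1) v(1)]] by blast
      \<comment> \<open>Regularity of \<open>x\<close> modulo \<open>K\<close> turns
        \<open>x w\<close> in \<open>K\<close> into \<open>w = p v'\<close>; subtracting
        \<open>x v'\<close> corrects \<open>v\<close> to an element of \<open>L\<close> with the
        same reduction.\<close>
      have "x \<odot>\<^bsub>fun_module R\<^esub> w \<in> K" using w(2) p(2) v(1) by (metis imageI)
      then have "w \<in> K" using tf w(1) unfolding torsion_free_def by blast
      then obtain v' where v': "v' \<in> vec R s" "w = p v'" using p(2) by blast
      note xv' = R.vec_rules(3)[OF x v'(1)]
      have "p (v \<ominus>\<^bsub>fun_module R\<^esub> x \<odot>\<^bsub>fun_module R\<^esub> v') = p v \<ominus>\<^bsub>fun_module R\<^esub> p v"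
        unfolding R.lin_diff[OF p(1) v(1) xv'] R.lin_smult[OF p(1) x v'(1)] w(2) v'(2) ..
      also have "\<dots> = \<zero>\<^bsub>fun_module R\<^esub>"
        using module.axioms(2)[OF R.fun_module_module] R.lin_carrier[OF p(1) v(1)]
        unfolding a_minus_def by (rule abelian_group.r_neg)
      finally have "v \<ominus>\<^bsub>fun_module R\<^esub> x \<odot>\<^bsub>fun_module R\<^esub> v' \<in> L"
        unfolding p(3) using R.vec_rules(5)[OF v(1) xv'] by blast
      moreover have "h \<circ> (v \<ominus>\<^bsub>fun_module R\<^esub> x \<odot>\<^bsub>fun_module R\<^esub> v') = u"
      proof
        fix i
        have "h x = \<zero>\<^bsub>S\<^esub>" using ker[OF x] I_eq R.adj_mem[OF R.zeroideal x] by simp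
        then have "h (v i \<ominus> x \<otimes> v' i) = h (v i)"
          using x R.vec_nth[OF v(1), of i] R.vec_nth[OF v'(1), of i] by (simp add: a_minus_def h_minus)
        then show "(h \<circ> (v \<ominus>\<^bsub>fun_module R\<^esub> x \<odot>\<^bsub>fun_module R\<^esub> v')) i = u i"
          using v(2) by (auto simp: R.fun_module_diff[OF R.vec_carrier[OF v(1)] R.vec_carrier[OF xv']])
      qed
      ultimately show "u \<in> comp_image L" by (metis imageI)
    qed
  qed
  then have "comp_image L = {u \<in> vec S s. p' u = \<zero>\<^bsub>fun_module S\<^esub>}" by (rule sym)
  then show ?thesis unfolding syz_def by (intro exI[of _ p'] conjI p'(1) im)
qed

lemma resolution_image:
  assumes res: "resolution R rk K" and tf: "torsion_free (rk 0) (K 0)"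
  shows "resolution S rk (\<lambda>i. comp_image (K i))"
proof -
  have K: "subvec R (rk i) (K i)" "syz R (rk i) (K i) (rk (Suc i)) (K (Suc i))" for i
    using res unfolding resolution_def by blast+
  have "torsion_free (rk i) (K i)" for i
    by (cases i) (use tf syz_torsion_free[OF K(2)] in auto)
  then show ?thesis unfolding resolution_def using syz_image K comp_image_subvec by blast
qed

end

subsection \<open>Serre's theorem: finite projective dimension of the residue field implies regularity\<close>

context noetherian_local_ring begin

interpretation V: module R F by (rule fun_module_module)

lemma resolution_Cons:
  assumes K: "subvec R r K" and sy: "syz R r K (rk 0) (L 0)" and res: "resolution R rk L"
  shows "resolution R (case_nat r rk) (case_nat K L)"
  unfolding resolution_def
proof
  fix i
  show "subvec R (case i of 0 \<Rightarrow> r | Suc j \<Rightarrow> rk j) (case i of 0 \<Rightarrow> K | Suc j \<Rightarrow> L j) \<and>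
    syz R (case i of 0 \<Rightarrow> r | Suc j \<Rightarrow> rk j) (case i of 0 \<Rightarrow> K | Suc j \<Rightarrow> L j)
      (case Suc i of 0 \<Rightarrow> r | Suc j \<Rightarrow> rk j) (case Suc i of 0 \<Rightarrow> K | Suc j \<Rightarrow> L j)"
    using K sy res by (cases i) (auto simp: resolution_def)
qed

lemma finite_pd_syz:
  assumes fpd: "finite_pd R r K" and K: "subvec R r K" and sy: "syz R r K s L"
  obtains rk M n where "resolution R rk M" "rk 0 = s" "M 0 = L" "stab R \<one> (rk n) (M n) 0 {\<zero>\<^bsub>F\<^esub>}"
proof -
  obtain rk M where res: "resolution R rk M" "rk 0 = s" "M 0 = L"
    using ex_resolution[OF syz_subvec[OF sy]] by blast
  have res': "resolution R (case_nat r rk) (case_nat K M)"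
    by (rule resolution_Cons[OF K _ res(1)]) (use sy res in simp)
  obtain n where n: "stab R \<one> (case_nat r rk n) (case_nat K M n) 0 {\<zero>\<^bsub>F\<^esub>}"
    using finite_pd_resolution[OF fpd stab_refl[OF K] res'] by auto
  \<comment> \<open>One further syzygy moves the index to \<open>Suc n\<close>, so it belongs to the
    resolution \<open>M\<close> even if \<open>n = 0\<close>.\<close>
  have "stab R \<one> (case_nat r rk (Suc n)) (case_nat K M (Suc n)) 0 {\<zero>\<^bsub>F\<^esub>}"
    using stab_syz[OF n one_closed _ subvec_0] res' resolution_zero unfolding resolution_def by blast
  then show thesis using that[OF res] by simp
qed

text \<open>Choose an ideal \<open>J\<close> maximal with \<open>m\<^sup>2 \<subseteq> J \<subseteq> m\<close> and \<open>x \<notin> J\<close>. Then \<open>m = J + (x)\<close>, and the coordinate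
  along \<open>x\<close> makes the residue field a direct summand of \<open>m/xm\<close> over \<open>R/x\<close>.\<close>

lemma ex_complement_ideal:
  assumes x: "x \<in> m" "x \<notin> m \<cdot> m"
  obtains J where "ideal J R" "J \<subseteq> m" "x \<notin> J" "\<And>y. y \<in> m \<Longrightarrow> \<exists>j\<in>J. \<exists>a\<in>carrier R. y = j \<oplus> a \<otimes> x"
proof -
  have xc: "x \<in> carrier R" using x m_carrier by blast
  have mm: "ideal (m \<cdot> m) R" by (rule ideal_prod_is_ideal[OF m_ideal m_ideal])
  have mm_le: "m \<cdot> m \<subseteq> m" using ideal_prod_inter[OF m_ideal m_ideal] by blast
  have base: "x \<notin> m \<cdot> m \<and> m \<cdot> m \<subseteq> m" using x mm_le by blast
  obtain J where J: "ideal J R" "x \<notin> J \<and> J \<subseteq> m" "m \<cdot> m \<subseteq> J"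
    and max: "\<And>I. ideal I R \<Longrightarrow> x \<notin> I \<and> I \<subseteq> m \<Longrightarrow> J \<subseteq> I \<Longrightarrow> I = J"
    by (rule maximal_ideal_in[of _ "\<lambda>J. x \<notin> J \<and> J \<subseteq> m", OF mm base]) (rule that)
  have "\<exists>j\<in>J. \<exists>a\<in>carrier R. y = j \<oplus> a \<otimes> x" if y: "y \<in> m" for y
  proof (cases "y \<in> J")
    case True
    have "y = y \<oplus> \<zero> \<otimes> x" using xc m_carrier[OF y] by simp
    then show ?thesis using True by blast
  next
    case False
    have yc: "y \<in> carrier R" using y m_carrier by blast
    have "x \<in> adj J y"
    proof (rule ccontr)
      assume "x \<notin> adj J y"
      then have "adj J y = J"
        using J(2) adj_least[OF J(1) m_ideal _ y] by (intro max adj_ideal[OF J(1) yc] adj_sup[OF J(1) yc]) blast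
      then show False using adj_mem[OF J(1) yc] False by blast
    qed
    then obtain j a where j: "x = j \<oplus> a \<otimes> y" "j \<in> J" "a \<in> carrier R" by (auto simp: adj_def)
    have jc: "j \<in> carrier R" using j J(1) ideal_carrier by blast
    \<comment> \<open>Otherwise \<open>a y\<close> lies in the square of \<open>m\<close>, hence in
      \<open>J\<close>, and so would \<open>x\<close>.\<close>
    have "a \<notin> m"
    proof
      assume "a \<in> m"
      then have "a \<otimes> y \<in> J" using y J(3) ideal_prod.prod[of a m y] by blast
      then show False using j ideal_add[OF J(1)] J(2) by blast
    qed
    then have u: "a \<in> Units R" using unit_iff j by blast
    have "y = (inv a \<otimes> \<ominus> j) \<oplus> inv a \<otimes> x"
    proof -
      have "x = j \<oplus> a \<otimes> y \<Longrightarrow> \<ominus> j \<oplus> x = a \<otimes> y" using jc yc j(3) xc by algebra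
      then have "inv a \<otimes> (\<ominus> j \<oplus> x) = inv a \<otimes> (a \<otimes> y)" using j(1) by simp
      also have "\<dots> = y" using u yc j(3) by (simp add: m_assoc[symmetric])
      finally show ?thesis using u jc xc by (simp add: r_distr)
    qed
    moreover have "inv a \<otimes> \<ominus> j \<in> J" using ideal_lmult[OF J(1)] ideal_minus[OF J(1)] j u by simp
    ultimately show ?thesis using u by blast
  qed
  then show thesis using that J by blast
qed

lemma m_square_proper: assumes "m \<noteq> {\<zero>}" shows "m \<cdot> m \<subset> m"
proof -
  have "\<not> m \<subseteq> m \<cdot> m"
  proof
    assume sub: "m \<subseteq> m \<cdot> m"
    have "m \<subseteq> {\<zero>}"
    proof (rule nakayama[OF m_ideal zeroideal])
      fix K assume K: "ideal K R" "\<And>r i. r \<in> m \<Longrightarrow> i \<in> m \<Longrightarrow> r \<otimes> i \<in> K"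
      have "m \<cdot> m \<subseteq> K"
        unfolding ideal_prod_eq_genideal[OF m_ideal m_ideal]
        by (rule genideal_minimal[OF K(1)]) (use K(2) in \<open>auto simp: set_mult_def\<close>)
      then show "m \<subseteq> K" using sub by blast
    qed
    then show False using assms ideal_zero[OF m_ideal] by blast
  qed
  then show ?thesis using ideal_prod_inter[OF m_ideal m_ideal] by blast
qed

text \<open>The presentation \<open>p\<close> of \<open>m\<close> sends the last basis vector to
  \<open>x\<close> and the others to generators of \<open>J\<close>. Its kernel \<open>K\<close>
  reduces to a presentation of \<open>m/xm\<close> over \<open>S\<close>, which has finite
  projective dimension since \<open>x\<close> is regular on \<open>m\<close>; the last coordinate
  splits off the residue field.\<close>

lemma finite_pd_quotient:
  assumes S: "quot_map R S h (adj {\<zero>} x)" and x: "x \<in> m" "x \<notin> m \<cdot> m"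
    and nzd: "\<And>a. a \<in> carrier R \<Longrightarrow> a \<otimes> x = \<zero> \<Longrightarrow> a = \<zero>"
    and fpd: "finite_pd R 1 (residue_rel R m)"
  shows "finite_pd S 1 (residue_rel S (h ` m))"
proof -
  have xc: "x \<in> carrier R" using x m_carrier by blast
  interpret S: nonzerodivisor_quot R S h "adj {\<zero>} x" x
    using S xc nzd unfolding nonzerodivisor_quot_def nonzerodivisor_quot_axioms_def by blast
  have I_le: "adj {\<zero>} x \<subseteq> m" using adj_least[OF zeroideal m_ideal] x ideal_zero[OF m_ideal] by blast
  interpret SL: noetherian_local_ring S "h ` m"
    by (rule S.local_image[OF noetherian_local_ring_axioms I_le])
  let ?FS = "fun_module S"
  obtain J where J: "ideal J R" "J \<subseteq> m" "x \<notin> J" "\<And>y. y \<in> m \<Longrightarrow> \<exists>j\<in>J. \<exists>a\<in>carrier R. y = j \<oplus> a \<otimes> x"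
    using ex_complement_ideal[OF x] by blast
  obtain t q where q: "lin R t 1 q" "q ` vec R t = residue_rel R J"
    using subvec_is_image[OF subvec_ideal[OF J(1)]] by blast
  let ?w = "x \<odot>\<^bsub>F\<^esub> unit_vec R 0"
  have e0: "unit_vec R 0 \<in> vec R 1" by (rule unit_vec_vec) simp
  have w: "?w \<in> vec R 1" "?w 0 = x" using vec_rules(3)[OF xc e0] xc by (auto simp: unit_vec_def)
  define p where "p = (\<lambda>v. q (v(t := \<zero>)) \<oplus>\<^bsub>F\<^esub> v t \<odot>\<^bsub>F\<^esub> ?w)"
  have p: "lin R (Suc t) 1 p" unfolding p_def by (rule lin_extend[OF q(1) w(1)])
  have p0: "p v 0 = q (v(t := \<zero>)) 0 \<oplus> v t \<otimes> x" for v by (simp add: p_def w(2)[simplified])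
  have qJ: "q v 0 \<in> J" if "v \<in> vec R t" for v using q(2) that by blast
  have pm: "p v 0 \<in> m" if v: "v \<in> vec R (Suc t)" for v
    unfolding p0 using qJ[OF vec_upd[OF v]] J(2) x(1) vec_nth[OF v]
    by (intro ideal_add[OF m_ideal] ideal_lmult[OF m_ideal]) auto
  have vec1_eq: "u = v" if "u \<in> vec R 1" "v \<in> vec R 1" "u 0 = v 0" for u v
    using that by (intro ext) (metis (mono_tags, lifting) One_nat_def Suc_leI mem_Collect_eq neq0_conv vec_def)
  have pim: "p ` vec R (Suc t) = residue_rel R m"
  proof
    show "p ` vec R (Suc t) \<subseteq> residue_rel R m" using pm lin_vec[OF p] by blast
    show "residue_rel R m \<subseteq> p ` vec R (Suc t)"
    proof
      fix y assume y: "y \<in> residue_rel R m"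
      then obtain j a where j: "j \<in> J" "a \<in> carrier R" "y 0 = j \<oplus> a \<otimes> x" using J(4)[of "y 0"] by blast
      have jc: "j \<in> carrier R" using j J(1) ideal_carrier by blast
      have "(\<lambda>i. if i = 0 then j else \<zero>) \<in> residue_rel R J" using j jc by (auto simp: vec_def)
      then have "(\<lambda>i. if i = 0 then j else \<zero>) \<in> q ` vec R t" unfolding q(2) .
      then obtain u where u: "(\<lambda>i. if i = 0 then j else \<zero>) = q u" "u \<in> vec R t" by (rule imageE)
      note u = u(2) u(1)[symmetric]
      have ut: "u(t := a) \<in> vec R (Suc t)" using u(1) j(2) by (auto simp: vec_def)
      have "(u(t := a))(t := \<zero>) = u" using vec_upd_id[OF u(1)] by simp
      then have "p (u(t := a)) 0 = y 0" unfolding p0 using u(2) j(3) by simp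
      then have "p (u(t := a)) = y" using vec1_eq lin_vec[OF p ut] y by blast
      then show "y \<in> p ` vec R (Suc t)" using ut by blast
    qed
  qed
  define K where "K = {v \<in> vec R (Suc t). p v = \<zero>\<^bsub>F\<^esub>}"
  have sy: "syz R 1 (residue_rel R m) (Suc t) K" 
    unfolding syz_def by (intro exI[of _ p] conjI p pim K_def)
  have K: "subvec R (Suc t) K" by (rule syz_subvec[OF sy])
  obtain rk M n where res: "resolution R rk M" "rk 0 = Suc t" "M 0 = K"
    "stab R \<one> (rk n) (M n) 0 {\<zero>\<^bsub>F\<^esub>}"
    by (rule finite_pd_syz[OF fpd subvec_residue_rel sy]) (rule that)
  have "resolution S rk (\<lambda>i. S.comp_image (M i))"
    using S.resolution_image[OF res(1)] S.syz_torsion_free[OF sy] res(2,3) by simp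
  moreover have "stab S \<one>\<^bsub>S\<^esub> (rk n) (S.comp_image (M n)) 0 {\<zero>\<^bsub>?FS\<^esub>}"
    using S.stab_zero_image[OF _ one_closed res(4)] res(1) unfolding resolution_def S.hom_simps(2) by blast
  ultimately have fpdK: "finite_pd S (Suc t) (S.comp_image K)"
    unfolding finite_pd_def using res(2,3) by blast
  have "stab S \<one>\<^bsub>S\<^esub> 1 (residue_rel S (h ` m)) (Suc t) (S.comp_image K)"
  \<comment> \<open>The class of \<open>x\<close> in \<open>m/xm\<close> spans a copy of the residue
    field: \<open>I\<close> puts a scalar at position \<open>t\<close>, and \<open>P\<close> reads
    that position.\<close>
  proof (rule S.S.stabI[where I = "\<lambda>u i. if i = t then u 0 else \<zero>\<^bsub>S\<^esub>" and P = "\<lambda>v i. if i = 0 then v t else \<zero>\<^bsub>S\<^esub>"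
        and E = "\<lambda>v. \<zero>\<^bsub>?FS\<^esub>"])
    show "lin S 1 (Suc t) (\<lambda>u i. if i = t then u 0 else \<zero>\<^bsub>S\<^esub>)"
      by (rule S.S.linI) (auto simp: vec_def fun_eq_iff)
    show "lin S (Suc t) 1 (\<lambda>v i. if i = 0 then v t else \<zero>\<^bsub>S\<^esub>)"
      by (rule S.S.linI) (auto simp: vec_def fun_eq_iff)
    show "lin S 1 1 (\<lambda>v. \<zero>\<^bsub>?FS\<^esub>)" by (rule S.S.lin_const_zero)
  next
    fix u assume "u \<in> residue_rel S (h ` m)"
    then obtain y where y: "y \<in> m" "u 0 = h y" by auto
    have yc: "y \<in> carrier R" using y m_carrier by blast
    let ?e = "unit_vec R t"
    have e: "?e \<in> vec R (Suc t)" by (rule unit_vec_vec) simp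
    \<comment> \<open>To see that \<open>y e\<close> with \<open>e\<close> the last basis vector
      reduces into the image of \<open>K\<close>, choose \<open>c\<close> with
      \<open>p c = y\<close>: then \<open>y e - x c\<close> lies in \<open>K\<close>, as
      \<open>y x - x y = 0\<close>, and it has the same reduction as \<open>y e\<close>.\<close>
    have "y \<odot>\<^bsub>F\<^esub> unit_vec R 0 \<in> residue_rel R m"
      using vec_rules(3)[OF yc e0] y(1) yc by (simp add: unit_vec_def)
    then have "y \<odot>\<^bsub>F\<^esub> unit_vec R 0 \<in> p ` vec R (Suc t)" unfolding pim .
    then obtain c where c: "y \<odot>\<^bsub>F\<^esub> unit_vec R 0 = p c" "c \<in> vec R (Suc t)" by (rule imageE)
    note c = c(2) c(1)[symmetric]
    let ?k = "y \<odot>\<^bsub>F\<^esub> ?e \<ominus>\<^bsub>F\<^esub> x \<odot>\<^bsub>F\<^esub> c"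
    note ye = vec_rules(3)[OF yc e] and xcv = vec_rules(3)[OF xc c(1)]
    have kv: "?k \<in> vec R (Suc t)" by (rule vec_rules(5)[OF ye xcv])
    have "p ?k = \<zero>\<^bsub>F\<^esub>"
    proof -
      have pe: "p ?e = ?w"
      proof -
        have "?e(t := \<zero>) = \<zero>\<^bsub>F\<^esub>" by (auto simp: unit_vec_def)
        moreover have "?e t = \<one>" by (simp add: unit_vec_def)
        ultimately show ?thesis
          unfolding p_def using lin_zero[OF q(1)] V.smult_one[OF vec_carrier[OF w(1)]] V.M.l_zero[OF vec_carrier[OF w(1)]]
          by metis
      qed
      have "p ?k = y \<odot>\<^bsub>F\<^esub> ?w \<ominus>\<^bsub>F\<^esub> x \<odot>\<^bsub>F\<^esub> (y \<odot>\<^bsub>F\<^esub> unit_vec R 0)"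
        unfolding lin_diff[OF p ye xcv] lin_smult[OF p yc e] lin_smult[OF p xc c(1)] pe c(2) ..
      also have "x \<odot>\<^bsub>F\<^esub> (y \<odot>\<^bsub>F\<^esub> unit_vec R 0) = y \<odot>\<^bsub>F\<^esub> ?w"
        using V.smult_assoc1[OF xc yc vec_carrier[OF e0]] V.smult_assoc1[OF yc xc vec_carrier[OF e0]] m_comm[OF xc yc] by simp
      also have "y \<odot>\<^bsub>F\<^esub> ?w \<ominus>\<^bsub>F\<^esub> y \<odot>\<^bsub>F\<^esub> ?w = \<zero>\<^bsub>F\<^esub>"
        unfolding a_minus_def by (rule V.M.r_neg[OF vec_carrier[OF vec_rules(3)[OF yc w(1)]]])
      finally show ?thesis .
    qed
    then have kK: "?k \<in> K" unfolding K_def using kv by blast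
    have hk: "h \<circ> ?k = (\<lambda>i. if i = t then u 0 else \<zero>\<^bsub>S\<^esub>)"
    proof
      fix i
      have hx: "h x = \<zero>\<^bsub>S\<^esub>" using S.ker[OF xc] adj_mem[OF zeroideal xc] by simp
      have "(h \<circ> ?k) i = h (y \<otimes> ?e i \<ominus> x \<otimes> c i)"
        by (simp add: fun_module_diff[OF vec_carrier[OF ye] vec_carrier[OF xcv]])
      also have "\<dots> = h (y \<otimes> ?e i)"
        using hx xc yc vec_nth[OF c(1), of i] vec_nth[OF e, of i] by (simp add: a_minus_def S.h_minus)
      also have "\<dots> = (if i = t then u 0 else \<zero>\<^bsub>S\<^esub>)" using y(2) yc by (simp add: unit_vec_def)
      finally show "(h \<circ> ?k) i = (if i = t then u 0 else \<zero>\<^bsub>S\<^esub>)" .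
    qed
    show "(\<lambda>i. if i = t then u 0 else \<zero>\<^bsub>S\<^esub>) \<in> S.comp_image K"
      using imageI[OF kK, of "\<lambda>v. h \<circ> v"] unfolding hk .
  next
    fix v assume "v \<in> S.comp_image K"
    then obtain k where k: "k \<in> K" "v = h \<circ> k" by blast
    have kv: "k \<in> vec R (Suc t)" "p k = \<zero>\<^bsub>F\<^esub>" using k by (auto simp: K_def)
    have kt: "k t \<in> carrier R" by (rule vec_nth[OF kv(1)])
    \<comment> \<open>A relation has \<open>k t\<close> times \<open>x\<close> in \<open>J\<close>,
      and \<open>x\<close> is not in \<open>J\<close>, so \<open>k t\<close> cannot be a
      unit.\<close>
    have "q (k(t := \<zero>)) 0 \<oplus> k t \<otimes> x = \<zero>" using p0[of k] kv(2) by simp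
    then have "q (k(t := \<zero>)) 0 \<oplus> k t \<otimes> x \<in> J" using ideal_zero[OF J(1)] by simp
    then have kx: "k t \<otimes> x \<in> J" using ideal_add_cancel[OF J(1) qJ[OF vec_upd[OF kv(1)]]] kt xc by blast
    have "k t \<in> m"
    proof (rule ccontr)
      assume "k t \<notin> m"
      then have u: "k t \<in> Units R" using unit_iff kt by blast
      then have "inv (k t) \<otimes> (k t \<otimes> x) \<in> J" using kx ideal_lmult[OF J(1)] by simp
      moreover have "inv (k t) \<otimes> (k t \<otimes> x) = x" using u xc kt by (simp add: m_assoc[symmetric])
      ultimately show False using J(3) by simp
    qed
    then show "(\<lambda>i. if i = 0 then v t else \<zero>\<^bsub>S\<^esub>) \<in> residue_rel S (h ` m)"
      using k(2) kt by (auto simp: vec_def)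
  next
    fix v :: "nat \<Rightarrow> 'c" assume v: "v \<in> vec S 1"
    have "(\<lambda>i. if i = 0 then if t = t then v 0 else \<zero>\<^bsub>S\<^esub> else \<zero>\<^bsub>S\<^esub>) = v"
      using v by (auto simp: vec_def fun_eq_iff)
    moreover have "\<one>\<^bsub>S\<^esub> \<odot>\<^bsub>?FS\<^esub> v \<ominus>\<^bsub>?FS\<^esub> (v \<oplus>\<^bsub>?FS\<^esub> \<zero>\<^bsub>?FS\<^esub>) = \<zero>\<^bsub>?FS\<^esub>"
    proof -
      interpret W: module S ?FS by (rule S.S.fun_module_module)
      note vc = S.S.vec_carrier[OF v]
      show ?thesis unfolding W.smult_one[OF vc] W.M.r_zero[OF vc] a_minus_def by (rule W.M.r_neg[OF vc])
    qed
    ultimately show "\<one>\<^bsub>S\<^esub> \<odot>\<^bsub>?FS\<^esub> v \<ominus>\<^bsub>?FS\<^esub> ((\<lambda>i. if i = 0 then if t = t then v 0 else \<zero>\<^bsub>S\<^esub> else \<zero>\<^bsub>S\<^esub>) \<oplus>\<^bsub>?FS\<^esub> \<zero>\<^bsub>?FS\<^esub>)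
      \<in> residue_rel S (h ` m)"
      using S.S.subvec_zero[OF SL.subvec_residue_rel] by metis
  qed simp
  then show ?thesis using SL.finite_pd_stab[OF fpdK] SL.subvec_residue_rel by blast
qed

end

text \<open>Induction on a bound \<open>n\<close> for the dimension. If \<open>m\<close> kills a
  nonzero element, the depth zero case gives \<open>m = 0\<close>. Otherwise some nonzerodivisor
  \<open>x\<close> in \<open>m\<close> lies outside the square of \<open>m\<close>, finite
  projective dimension descends to \<open>R/x\<close>, and the dimension drops. Generators of the
  maximal ideal there lift and are completed by \<open>x\<close>.\<close>

theorem serre:
  fixes R :: "'a ring"
  assumes "noetherian_local_ring R m" "finite_pd R 1 (residue_rel R m)" "krull_dim R \<le> enat n"
  shows "\<exists>U. finite U \<and> U \<subseteq> carrier R \<and> m = Idl\<^bsub>R\<^esub> U \<and> enat (card U) \<le> krull_dim R"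
  using assms
proof (induction n arbitrary: R m rule: less_induct)
  case (less n R m)
  interpret noetherian_local_ring R m by fact
  show ?case
  proof (cases "\<exists>z\<in>carrier R. z \<noteq> \<zero>\<^bsub>R\<^esub> \<and> (\<forall>r\<in>m. r \<otimes>\<^bsub>R\<^esub> z = \<zero>\<^bsub>R\<^esub>)")
    case True
    then have "m = {\<zero>\<^bsub>R\<^esub>}" using finite_pd_depth_zero[OF less.prems(2)] by blast
    moreover have "Idl\<^bsub>R\<^esub> {} = {\<zero>\<^bsub>R\<^esub>}"
      using genideal_minimal[OF zeroideal, of "{}"] ideal_zero[OF genideal_ideal[of "{}"]] by auto
    ultimately show ?thesis by (intro exI[of _ "{}"]) (auto simp: zero_enat_def[symmetric])
  next
    case False
    then have depth: "\<exists>r\<in>m. r \<otimes>\<^bsub>R\<^esub> z \<noteq> \<zero>\<^bsub>R\<^esub>" if "z \<in> carrier R" "z \<noteq> \<zero>\<^bsub>R\<^esub>" for z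
      using that by blast
    have "m \<noteq> {\<zero>\<^bsub>R\<^esub>}"
    proof
      assume "m = {\<zero>\<^bsub>R\<^esub>}"
      moreover have "\<one>\<^bsub>R\<^esub> \<noteq> \<zero>\<^bsub>R\<^esub>" using one_notin_m ideal_zero[OF m_ideal] by auto
      ultimately show False using depth[OF one_closed] by simp
    qed
    then obtain x where x: "x \<in> m" "x \<notin> m \<cdot>\<^bsub>R\<^esub> m" "\<forall>a\<in>carrier R. a \<otimes>\<^bsub>R\<^esub> x = \<zero>\<^bsub>R\<^esub> \<longrightarrow> a = \<zero>\<^bsub>R\<^esub>"
      using ex_nonzerodivisor_avoiding[OF depth ideal_prod_is_ideal[OF m_ideal m_ideal] m_square_proper] by blast
    then have nzd: "a = \<zero>\<^bsub>R\<^esub>" if "a \<in> carrier R" "a \<otimes>\<^bsub>R\<^esub> x = \<zero>\<^bsub>R\<^esub>" for a using that by blast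
    have xc: "x \<in> carrier R" using x m_carrier by blast
    note I = adj_ideal[OF zeroideal xc]
    obtain S :: "'a ring" and h where S: "quot_map R S h (adj {\<zero>\<^bsub>R\<^esub>} x)"
      using ex_quot_map[OF I] by blast
    interpret S: quot_map R S h "adj {\<zero>\<^bsub>R\<^esub>} x" by fact
    have I_le: "adj {\<zero>\<^bsub>R\<^esub>} x \<subseteq> m" using adj_least[OF zeroideal m_ideal] x ideal_zero[OF m_ideal] by blast
    have loc: "noetherian_local_ring S (h ` m)"
      by (rule S.local_image[OF noetherian_local_ring_axioms I_le])
    have fpd: "finite_pd S 1 (residue_rel S (h ` m))"
      by (rule finite_pd_quotient[OF S x(1,2) _ less.prems(2)]) (rule nzd)
    have dim: "enat (Suc j) \<le> krull_dim R" if "enat j \<le> krull_dim S" for j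
      by (rule krull_dim_quotient_nonzerodivisor[OF S x(1) _ that]) (rule nzd)
    \<comment> \<open>A nonzerodivisor in \<open>m\<close> forces positive dimension, which excludes
      \<open>n = 0\<close>.\<close>
    obtain k where k: "n = Suc k"
    proof (cases n)
      case 0
      have "enat (Suc 0) \<le> krull_dim R" by (rule dim) (simp add: zero_enat_def[symmetric])
      then show thesis using less.prems(3) 0 order_trans by fastforce
    qed
    have "krull_dim S \<le> enat k"
    proof (rule ccontr)
      assume "\<not> ?thesis"
      then have "enat (Suc k) \<le> krull_dim S" by (simp add: Suc_ile_eq not_le)
      then have "enat (Suc (Suc k)) \<le> krull_dim R" by (rule dim)
      then show False using less.prems(3) k order_trans by fastforce
    qed
    then obtain V where V: "finite V" "V \<subseteq> carrier S" "h ` m = Idl\<^bsub>S\<^esub> V" "enat (card V) \<le> krull_dim S"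
      using less.IH[of k S "h ` m"] loc fpd k by blast
    define U0 where "U0 = inv_into (carrier R) h ` V"
    have g: "inv_into (carrier R) h v \<in> carrier R" "h (inv_into (carrier R) h v) = v" if "v \<in> V" for v
    proof -
      have "v \<in> h ` carrier R" using that V(2) S.surj by blast
      then show "inv_into (carrier R) h v \<in> carrier R" "h (inv_into (carrier R) h v) = v"
        by (rule inv_into_into, rule f_inv_into_f)
    qed
    have U0: "U0 \<subseteq> carrier R" "h ` U0 = V" "finite U0" "card U0 \<le> card V"
      unfolding U0_def image_image using g V(1) card_image_le[OF V(1)] by auto
    let ?U = "insert x U0"
    have Uc: "?U \<subseteq> carrier R" using U0 xc by blast
    have "m = Idl\<^bsub>R\<^esub> ?U"
    proof
      have "u \<in> m" if "u \<in> U0" for u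
      proof -
        have "h u \<in> h ` m" unfolding V(3) using S.S.genideal_self[OF V(2)] U0(2) that by blast
        then show ?thesis using S.mem_image[OF m_ideal I_le] U0(1) that by blast
      qed
      then show "Idl\<^bsub>R\<^esub> ?U \<subseteq> m" using x(1) by (intro genideal_minimal m_ideal) blast
      show "m \<subseteq> Idl\<^bsub>R\<^esub> ?U"
      proof
        fix a assume a: "a \<in> m"
        note UI = genideal_ideal[OF Uc] and Us = genideal_self[OF Uc]
        have "h a \<in> h ` (Idl\<^bsub>R\<^esub> U0)" using a V(3) S.image_genideal[OF U0(1)] U0(2) by auto
        then obtain b where b: "b \<in> Idl\<^bsub>R\<^esub> U0" "h a = h b" by blast
        have b': "b \<in> Idl\<^bsub>R\<^esub> ?U" using b(1) genideal_minimal[OF UI, of U0] Us by blast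
        have c: "a \<in> carrier R" "b \<in> carrier R" using a m_carrier b' ideal_carrier[OF UI] by blast+
        have "a \<ominus>\<^bsub>R\<^esub> b \<in> adj {\<zero>\<^bsub>R\<^esub>} x" using S.h_eq c b(2) by blast
        then have "a \<ominus>\<^bsub>R\<^esub> b \<in> Idl\<^bsub>R\<^esub> ?U"
          using adj_least[OF zeroideal UI] ideal_zero[OF UI] Us by blast
        then have "(a \<ominus>\<^bsub>R\<^esub> b) \<oplus>\<^bsub>R\<^esub> b \<in> Idl\<^bsub>R\<^esub> ?U" using b' ideal_add[OF UI] by blast
        moreover have "(a \<ominus>\<^bsub>R\<^esub> b) \<oplus>\<^bsub>R\<^esub> b = a" using c by algebra
        ultimately show "a \<in> Idl\<^bsub>R\<^esub> ?U" by simp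
      qed
    qed
    moreover have "enat (card ?U) \<le> krull_dim R"
    proof -
      have "enat (Suc (card V)) \<le> krull_dim R" by (rule dim[OF V(4)])
      moreover have "card ?U \<le> Suc (card V)" using U0 card_insert_le_m1 by (metis card_insert_if le_SucI Suc_le_mono)
      ultimately show ?thesis by (meson enat_ord_simps(1) order_trans)
    qed
    ultimately show ?thesis using Uc U0(3) by (intro exI[of _ ?U]) auto
  qed
qed

text \<open>The height theorem is used twice: a finite generating set bounds the dimension, which
  starts Serre's induction, and the generators found there cannot be fewer than the
  dimension.\<close>

theorem finite_pd_regular:
  fixes R :: "'a ring"
  assumes loc: "noetherian_local_ring R m" and fpd: "finite_pd R 1 (residue_rel R m)"
  shows "regular_local_ring R"
proof -
  interpret noetherian_local_ring R m by fact
  obtain A where A: "A \<subseteq> carrier R" "finite A" "m = Idl\<^bsub>R\<^esub> A" using finetely_gen[OF m_ideal] by blast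
  have "krull_dim R \<le> enat (card A)" by (rule krull_height_local[OF loc A(2,1,3)]) simp
  then obtain U where U: "finite U" "U \<subseteq> carrier R" "m = Idl\<^bsub>R\<^esub> U" "enat (card U) \<le> krull_dim R"
    using serre[OF loc fpd] by blast
  have "krull_dim R \<le> enat (card U)" by (rule krull_height_local[OF loc U(1,2,3)]) simp
  then show ?thesis unfolding regular_local_ring_def using loc U by (intro exI[of _ m] conjI exI[of _ U]) auto
qed

subsection \<open>Localization of resolutions\<close>

context loc_map begin

abbreviation "FL \<equiv> fun_module L"

interpretation V: module R "fun_module R" by (rule R.fun_module_module)
interpretation W: module L FL by (rule L.fun_module_module)

text \<open>The localized submodule of \<open>L^n\<close>, described by clearing denominators as in
  \<open>ext\<close>.\<close>

definition ext_vec :: "nat \<Rightarrow> (nat \<Rightarrow> 'a) set \<Rightarrow> (nat \<Rightarrow> 'c) set" where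
  "ext_vec n K = {y \<in> vec L n. \<exists>v\<in>K. \<exists>s\<in>T. h s \<odot>\<^bsub>FL\<^esub> y = h \<circ> v}"

lemma ext_vecI: "y \<in> vec L n \<Longrightarrow> v \<in> K \<Longrightarrow> s \<in> T \<Longrightarrow> h s \<odot>\<^bsub>FL\<^esub> y = h \<circ> v \<Longrightarrow> y \<in> ext_vec n K"
  unfolding ext_vec_def by blast

lemma clear_denominators:
  assumes "y \<in> vec L n"
  shows "\<exists>v\<in>vec R n. \<exists>s\<in>T. h s \<odot>\<^bsub>FL\<^esub> y = h \<circ> v"
  using assms
proof (induction n arbitrary: y)
  case 0
  then have "y = \<zero>\<^bsub>FL\<^esub>" by (simp only: L.vec_0) simp
  then have "h \<one> \<odot>\<^bsub>FL\<^esub> y = h \<circ> \<zero>\<^bsub>fun_module R\<^esub>" by auto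
  then show ?case using T_one R.vec_rules(1) by blast
next
  case (Suc n)
  obtain v s where v: "v \<in> vec R n" "s \<in> T" "h s \<odot>\<^bsub>FL\<^esub> y(n := \<zero>\<^bsub>L\<^esub>) = h \<circ> v"
    using Suc.IH[OF L.vec_upd[OF Suc.prems]] by blast
  note yc = L.vec_nth[OF Suc.prems]
  obtain a t where a: "a \<in> carrier R" "t \<in> T" "h t \<otimes>\<^bsub>L\<^esub> y n = h a" using frac[OF yc] by blast
  have c: "s \<in> carrier R" "t \<in> carrier R" using v a T_carrier by auto
  let ?v = "(\<lambda>i. t \<otimes> v i)(n := s \<otimes> a)"
  have "?v \<in> vec R (Suc n)" using v(1) a(1) c by (auto simp: vec_def)
  moreover have "h (s \<otimes> t) \<odot>\<^bsub>FL\<^esub> y = h \<circ> ?v"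
  proof
    fix i
    have hc: "h s \<in> carrier L" "h t \<in> carrier L" using c by auto
    show "(h (s \<otimes> t) \<odot>\<^bsub>FL\<^esub> y) i = (h \<circ> ?v) i"
    proof (cases "i = n")
      case True
      have "h s \<otimes>\<^bsub>L\<^esub> h t \<otimes>\<^bsub>L\<^esub> y n = h s \<otimes>\<^bsub>L\<^esub> (h t \<otimes>\<^bsub>L\<^esub> y n)" using hc yc by (simp add: L.m_assoc)
      then show ?thesis using True a c by simp
    next
      case False
      have "h s \<otimes>\<^bsub>L\<^esub> y i = h (v i)" using fun_cong[OF v(3), of i] False by simp
      moreover have "h s \<otimes>\<^bsub>L\<^esub> h t \<otimes>\<^bsub>L\<^esub> y i = h t \<otimes>\<^bsub>L\<^esub> (h s \<otimes>\<^bsub>L\<^esub> y i)"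
        using hc yc[of i] by (simp add: L.m_ac)
      ultimately show ?thesis using False c R.vec_nth[OF v(1), of i] by simp
    qed
  qed
  moreover have "s \<otimes> t \<in> T" using T_mult v a by blast
  ultimately show ?case by blast
qed

text \<open>Each of the finitely many coordinates is killed by some element of \<open>T\<close>, and
  the product kills them all.\<close>

lemma comp_zero_annihilator:
  assumes "v \<in> vec R n" "h \<circ> v = \<zero>\<^bsub>FL\<^esub>"
  shows "\<exists>t\<in>T. t \<odot>\<^bsub>fun_module R\<^esub> v = \<zero>\<^bsub>fun_module R\<^esub>"
proof -
  have "\<exists>t\<in>T. \<forall>i<k. t \<otimes> v i = \<zero>" for k
  proof (induction k)
    case 0
    then show ?case using T_one by auto
  next
    case (Suc k)
    then obtain t where t: "t \<in> T" "\<forall>i<k. t \<otimes> v i = \<zero>" by blast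
    have "h (v k) = \<zero>\<^bsub>L\<^esub>" using fun_cong[OF assms(2), of k] by simp
    then obtain s where s: "s \<in> T" "s \<otimes> v k = \<zero>" using ker[OF R.vec_nth[OF assms(1)]] by blast
    have c: "s \<in> carrier R" "t \<in> carrier R" "\<And>i. v i \<in> carrier R" using s t T_carrier R.vec_nth[OF assms(1)] by auto
    have "(s \<otimes> t) \<otimes> v i = \<zero>" if "i < Suc k" for i
    proof (cases "i = k")
      case True
      have "(s \<otimes> t) \<otimes> v k = t \<otimes> (s \<otimes> v k)" using c(1,2) c(3)[of k] by algebra
      then show ?thesis using True s(2) c by simp
    next
      case False
      then have "t \<otimes> v i = \<zero>" using t(2) that by simp
      then show ?thesis using c by (simp add: R.m_assoc)
    qed
    then show ?case using T_mult s(1) t(1) by blast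
  qed
  then obtain t where t: "t \<in> T" "\<forall>i<n. t \<otimes> v i = \<zero>" by blast
  have "t \<odot>\<^bsub>fun_module R\<^esub> v = \<zero>\<^bsub>fun_module R\<^esub>"
  proof
    fix i
    show "(t \<odot>\<^bsub>fun_module R\<^esub> v) i = \<zero>\<^bsub>fun_module R\<^esub> i"
      using t assms(1) T_carrier[OF t(1)] by (cases "i < n") (auto simp: vec_def)
  qed
  then show ?thesis using t(1) by blast
qed

lemma vec_unit_cancel:
  assumes "s \<in> T" "y \<in> vec L n" "h s \<odot>\<^bsub>FL\<^esub> y = \<zero>\<^bsub>FL\<^esub>" shows "y = \<zero>\<^bsub>FL\<^esub>"
proof
  fix i
  have "h s \<otimes>\<^bsub>L\<^esub> y i = h s \<otimes>\<^bsub>L\<^esub> \<zero>\<^bsub>L\<^esub>" using fun_cong[OF assms(3), of i] T_carrier[OF assms(1)] by simp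
  then show "y i = \<zero>\<^bsub>FL\<^esub> i" using unit_cancel_eq[OF assms(1) L.vec_nth[OF assms(2)] L.zero_closed] by simp
qed

lemma ext_vec_image:
  assumes K: "subvec R n K" and v: "v \<in> K" shows "h \<circ> v \<in> ext_vec n K"
proof (rule ext_vecI[OF comp_vec[OF R.subvec_subset[OF K v]] v T_one])
  show "h \<one> \<odot>\<^bsub>FL\<^esub> (h \<circ> v) = h \<circ> v"
    using W.smult_one[OF L.vec_carrier[OF comp_vec[OF R.subvec_subset[OF K v]]]] by simp
qed

lemma ext_vec_smult_unit:
  assumes "s \<in> T" "y \<in> vec L n" "h s \<odot>\<^bsub>FL\<^esub> y \<in> ext_vec n K" shows "y \<in> ext_vec n K"
proof -
  obtain v t where v: "v \<in> K" "t \<in> T" "h t \<odot>\<^bsub>FL\<^esub> (h s \<odot>\<^bsub>FL\<^esub> y) = h \<circ> v"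
    using assms(3) unfolding ext_vec_def by blast
  have c: "s \<in> carrier R" "t \<in> carrier R" using assms v T_carrier by auto
  have "h (t \<otimes> s) \<odot>\<^bsub>FL\<^esub> y = h t \<odot>\<^bsub>FL\<^esub> (h s \<odot>\<^bsub>FL\<^esub> y)"
    unfolding hom_rules(4)[OF c(2,1)] by (rule W.smult_assoc1[OF hom_rules(1)[OF c(2)] hom_rules(1)[OF c(1)] L.vec_carrier[OF assms(2)]])
  then show ?thesis using ext_vecI[OF assms(2) v(1) T_mult[OF v(2) assms(1)]] v(3) by simp
qed

lemma ext_vec_subvec: assumes K: "subvec R n K" shows "subvec L n (ext_vec n K)"
proof (rule L.subvecI)
  note Kv = R.subvec_subset[OF K]
  show "ext_vec n K \<subseteq> vec L n" by (auto simp: ext_vec_def)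
  show "\<zero>\<^bsub>FL\<^esub> \<in> ext_vec n K" using ext_vec_image[OF K R.subvec_zero[OF K]] unfolding comp_zero .
  fix u v a assume "u \<in> ext_vec n K"
  then obtain u' s where u: "u \<in> vec L n" "u' \<in> K" "s \<in> T" "h s \<odot>\<^bsub>FL\<^esub> u = h \<circ> u'"
    unfolding ext_vec_def by blast
  note uc = L.vec_carrier[OF u(1)] and sc = T_carrier[OF u(3)]
  { assume "v \<in> ext_vec n K"
    then obtain v' t where v: "v \<in> vec L n" "v' \<in> K" "t \<in> T" "h t \<odot>\<^bsub>FL\<^esub> v = h \<circ> v'"
      unfolding ext_vec_def by blast
    note vc = L.vec_carrier[OF v(1)] and tc = T_carrier[OF v(3)]
    have "h (s \<otimes> t) \<odot>\<^bsub>FL\<^esub> (u \<oplus>\<^bsub>FL\<^esub> v) = h t \<odot>\<^bsub>FL\<^esub> (h s \<odot>\<^bsub>FL\<^esub> u) \<oplus>\<^bsub>FL\<^esub> h s \<odot>\<^bsub>FL\<^esub> (h t \<odot>\<^bsub>FL\<^esub> v)"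
    proof
      fix i
      have "h s \<in> carrier L" "h t \<in> carrier L" "u i \<in> carrier L" "v i \<in> carrier L"
        using sc tc uc vc by auto
      then show "(h (s \<otimes> t) \<odot>\<^bsub>FL\<^esub> (u \<oplus>\<^bsub>FL\<^esub> v)) i = (h t \<odot>\<^bsub>FL\<^esub> (h s \<odot>\<^bsub>FL\<^esub> u) \<oplus>\<^bsub>FL\<^esub> h s \<odot>\<^bsub>FL\<^esub> (h t \<odot>\<^bsub>FL\<^esub> v)) i"
        unfolding fun_module_simps hom_rules(4)[OF sc tc] by algebra
    qed
    also have "\<dots> = h \<circ> (t \<odot>\<^bsub>fun_module R\<^esub> u' \<oplus>\<^bsub>fun_module R\<^esub> s \<odot>\<^bsub>fun_module R\<^esub> v')"
      unfolding u(4) v(4) comp_smult[OF tc Kv[OF u(2)], symmetric] comp_smult[OF sc Kv[OF v(2)], symmetric]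
      by (rule comp_add[symmetric, OF R.vec_rules(3)[OF tc Kv[OF u(2)]] R.vec_rules(3)[OF sc Kv[OF v(2)]]])
    finally show "u \<oplus>\<^bsub>FL\<^esub> v \<in> ext_vec n K"
      by (rule ext_vecI[OF L.vec_rules(2)[OF u(1) v(1)] R.subvec_add[OF K R.subvec_smult[OF K tc u(2)] R.subvec_smult[OF K sc v(2)]] T_mult[OF u(3) v(3)]]) }
  { assume aL: "a \<in> carrier L"
    obtain b t where b: "b \<in> carrier R" "t \<in> T" "h t \<otimes>\<^bsub>L\<^esub> a = h b" using frac[OF aL] by blast
    note tc = T_carrier[OF b(2)]
    have "h (t \<otimes> s) \<odot>\<^bsub>FL\<^esub> (a \<odot>\<^bsub>FL\<^esub> u) = (h t \<otimes>\<^bsub>L\<^esub> a) \<odot>\<^bsub>FL\<^esub> (h s \<odot>\<^bsub>FL\<^esub> u)"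
    proof
      fix i
      have "h s \<in> carrier L" "h t \<in> carrier L" "u i \<in> carrier L" using sc tc uc by auto
      then show "(h (t \<otimes> s) \<odot>\<^bsub>FL\<^esub> (a \<odot>\<^bsub>FL\<^esub> u)) i = ((h t \<otimes>\<^bsub>L\<^esub> a) \<odot>\<^bsub>FL\<^esub> (h s \<odot>\<^bsub>FL\<^esub> u)) i"
        unfolding fun_module_simps hom_rules(4)[OF tc sc] using aL by algebra
    qed
    also have "\<dots> = h \<circ> (b \<odot>\<^bsub>fun_module R\<^esub> u')" unfolding b(3) u(4) by (rule comp_smult[symmetric, OF b(1) Kv[OF u(2)]])
    finally show "a \<odot>\<^bsub>FL\<^esub> u \<in> ext_vec n K"
      by (rule ext_vecI[OF L.vec_rules(3)[OF aL u(1)] R.subvec_smult[OF K b(1) u(2)] T_mult[OF b(2) u(3)]]) }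
qed

text \<open>Exactness of localization. On the kernel side \<open>p v\<close> vanishes only after
  multiplication by some \<open>t'\<close>, so it is \<open>t' v\<close> that lies in
  \<open>M\<close>; both denominators are divided out at the end.\<close>

lemma ext_vec_syz:
  assumes K: "subvec R r K" and sy: "syz R r K s M"
  shows "syz L r (ext_vec r K) s (ext_vec s M)"
proof -
  obtain p where p: "lin R s r p" "p ` vec R s = K" "M = {v \<in> vec R s. p v = \<zero>\<^bsub>fun_module R\<^esub>}"
    using sy unfolding syz_def by blast
  obtain p' where p': "lin L s r p'" "\<forall>v\<in>vec R s. p' (h \<circ> v) = h \<circ> p v"
    using lin_base_change[OF p(1)] by blast
  note ph = bspec[OF p'(2)]
  have im: "p' ` vec L s = ext_vec r K"
  proof
    show "p' ` vec L s \<subseteq> ext_vec r K"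
    proof
      fix z assume "z \<in> p' ` vec L s"
      then obtain y where y: "y \<in> vec L s" "z = p' y" by blast
      obtain v t where v: "v \<in> vec R s" "t \<in> T" "h t \<odot>\<^bsub>FL\<^esub> y = h \<circ> v" using clear_denominators[OF y(1)] by blast
      have "h t \<odot>\<^bsub>FL\<^esub> p' y = h \<circ> p v"
        using L.lin_smult[OF p'(1) hom_rules(1)[OF T_carrier[OF v(2)]] y(1)] v(3) ph[OF v(1)] by simp
      then show "z \<in> ext_vec r K"
        unfolding y(2) using ext_vecI[OF L.lin_vec[OF p'(1) y(1)] _ v(2)] p(2) v(1) by blast
    qed
    show "ext_vec r K \<subseteq> p' ` vec L s"
    proof
      fix y assume "y \<in> ext_vec r K"
      then obtain k t where y: "y \<in> vec L r" "k \<in> K" "t \<in> T" "h t \<odot>\<^bsub>FL\<^esub> y = h \<circ> k"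
        unfolding ext_vec_def by blast
      obtain v where v: "v \<in> vec R s" "p v = k" using y(2) p(2) by blast
      have u: "inv\<^bsub>L\<^esub> h t \<in> carrier L" "h t \<in> carrier L" using unit[OF y(3)] by auto
      note hv = comp_vec[OF v(1)]
      have "p' (inv\<^bsub>L\<^esub> h t \<odot>\<^bsub>FL\<^esub> (h \<circ> v)) = inv\<^bsub>L\<^esub> h t \<odot>\<^bsub>FL\<^esub> (h t \<odot>\<^bsub>FL\<^esub> y)"
        unfolding L.lin_smult[OF p'(1) u(1) hv] ph[OF v(1)] v(2) y(4) ..
      also have "\<dots> = (inv\<^bsub>L\<^esub> h t \<otimes>\<^bsub>L\<^esub> h t) \<odot>\<^bsub>FL\<^esub> y" by (rule W.smult_assoc1[symmetric, OF u L.vec_carrier[OF y(1)]])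
      also have "\<dots> = y"
        unfolding L.Units_l_inv[OF unit[OF y(3)]] by (rule W.smult_one[OF L.vec_carrier[OF y(1)]])
      finally show "y \<in> p' ` vec L s" using L.vec_rules(3)[OF u(1) hv] by (rule image_eqI[OF sym])
    qed
  qed
  have "ext_vec s M = {y \<in> vec L s. p' y = \<zero>\<^bsub>FL\<^esub>}"
  proof
    show "ext_vec s M \<subseteq> {y \<in> vec L s. p' y = \<zero>\<^bsub>FL\<^esub>}"
    proof
      fix y assume "y \<in> ext_vec s M"
      then obtain v t where y: "y \<in> vec L s" "v \<in> vec R s" "p v = \<zero>\<^bsub>fun_module R\<^esub>" "t \<in> T" "h t \<odot>\<^bsub>FL\<^esub> y = h \<circ> v"
        unfolding ext_vec_def p(3) by blast
      have "h t \<odot>\<^bsub>FL\<^esub> p' y = h \<circ> p v"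
        using L.lin_smult[OF p'(1) hom_rules(1)[OF T_carrier[OF y(4)]] y(1)] y(5) ph[OF y(2)] by simp
      then have "p' y = \<zero>\<^bsub>FL\<^esub>"
        unfolding y(3) comp_zero by (rule vec_unit_cancel[OF y(4) L.lin_vec[OF p'(1) y(1)]])
      then show "y \<in> {y \<in> vec L s. p' y = \<zero>\<^bsub>FL\<^esub>}" using y(1) by blast
    qed
    show "{y \<in> vec L s. p' y = \<zero>\<^bsub>FL\<^esub>} \<subseteq> ext_vec s M"
    proof
      fix y assume "y \<in> {y \<in> vec L s. p' y = \<zero>\<^bsub>FL\<^esub>}"
      then have y: "y \<in> vec L s" "p' y = \<zero>\<^bsub>FL\<^esub>" by blast+
      obtain v t where v: "v \<in> vec R s" "t \<in> T" "h t \<odot>\<^bsub>FL\<^esub> y = h \<circ> v" using clear_denominators[OF y(1)] by blast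
      note ht = hom_rules(1)[OF T_carrier[OF v(2)]]
      have "h \<circ> p v = h t \<odot>\<^bsub>FL\<^esub> p' y"
        using L.lin_smult[OF p'(1) ht y(1)] v(3) ph[OF v(1)] by simp
      also have "\<dots> = \<zero>\<^bsub>FL\<^esub>" unfolding y(2) by (rule W.smult_r_null[OF ht])
      finally obtain t' where t': "t' \<in> T" "t' \<odot>\<^bsub>fun_module R\<^esub> p v = \<zero>\<^bsub>fun_module R\<^esub>"
        using comp_zero_annihilator[OF R.lin_vec[OF p(1) v(1)]] by blast
      note tc = T_carrier[OF t'(1)]
      have "t' \<odot>\<^bsub>fun_module R\<^esub> v \<in> M"
        unfolding p(3) using R.vec_rules(3)[OF tc v(1)] R.lin_smult[OF p(1) tc v(1)] t'(2) by simp
      then have "h \<circ> (t' \<odot>\<^bsub>fun_module R\<^esub> v) \<in> ext_vec s M"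
        by (rule ext_vec_image[OF R.syz_subvec[OF sy]])
      then have "h t' \<odot>\<^bsub>FL\<^esub> (h t \<odot>\<^bsub>FL\<^esub> y) \<in> ext_vec s M" unfolding comp_smult[OF tc v(1)] v(3) .
      then show "y \<in> ext_vec s M"
        by (intro ext_vec_smult_unit[OF v(2) y(1)] ext_vec_smult_unit[OF t'(1) L.vec_rules(3)[OF ht y(1)]])
    qed
  qed
  then show ?thesis unfolding syz_def by (intro exI[of _ p'] conjI p'(1) im)
qed

text \<open>Since \<open>h a\<close> is invertible, dividing the localized \<open>E\<close> by it
  turns a factorization of multiplication by \<open>a\<close> into one of the identity.\<close>

lemma ext_vec_stab_zero:
  assumes K: "subvec R r K" and a: "a \<in> T" and st: "stab R a r K 0 {\<zero>\<^bsub>fun_module R\<^esub>}"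
  shows "stab L \<one>\<^bsub>L\<^esub> r (ext_vec r K) 0 {\<zero>\<^bsub>FL\<^esub>}"
proof -
  note ac = T_carrier[OF a] and u = unit[OF a]
  have uc: "inv\<^bsub>L\<^esub> h a \<in> carrier L" "h a \<in> carrier L" using u by auto
  obtain E where E: "lin R r r E" "\<forall>v\<in>K. E v = \<zero>\<^bsub>fun_module R\<^esub>"
    "\<forall>v\<in>vec R r. a \<odot>\<^bsub>fun_module R\<^esub> v \<ominus>\<^bsub>fun_module R\<^esub> E v \<in> K"
    using st R.stab_zero_iff[OF K ac] by blast
  obtain E' where E': "lin L r r E'" "\<forall>v\<in>vec R r. E' (h \<circ> v) = h \<circ> E v"
    using lin_base_change[OF E(1)] by blast
  let ?E = "\<lambda>y. inv\<^bsub>L\<^esub> h a \<odot>\<^bsub>FL\<^esub> E' y"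
  have lin: "lin L r r ?E" by (rule L.lin_scale[OF uc(1) E'(1)])
  have zero: "?E y = \<zero>\<^bsub>FL\<^esub>" if "y \<in> ext_vec r K" for y
  proof -
    obtain k t where y: "y \<in> vec L r" "k \<in> K" "t \<in> T" "h t \<odot>\<^bsub>FL\<^esub> y = h \<circ> k"
      using \<open>y \<in> ext_vec r K\<close> unfolding ext_vec_def by blast
    have "h t \<odot>\<^bsub>FL\<^esub> E' y = h \<circ> E k"
      using L.lin_smult[OF E'(1) hom_rules(1)[OF T_carrier[OF y(3)]] y(1)] y(4)
        bspec[OF E'(2) R.subvec_subset[OF K y(2)]] by simp
    then have "E' y = \<zero>\<^bsub>FL\<^esub>"
      unfolding bspec[OF E(2) y(2)] comp_zero by (rule vec_unit_cancel[OF y(3) L.lin_vec[OF E'(1) y(1)]])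
    then show ?thesis using W.smult_r_null[OF uc(1)] by simp
  qed
  have "\<one>\<^bsub>L\<^esub> \<odot>\<^bsub>FL\<^esub> y \<ominus>\<^bsub>FL\<^esub> ?E y \<in> ext_vec r K" if y: "y \<in> vec L r" for y
  proof -
    obtain v t where v: "v \<in> vec R r" "t \<in> T" "h t \<odot>\<^bsub>FL\<^esub> y = h \<circ> v" using clear_denominators[OF y] by blast
    note ht = hom_rules(1)[OF T_carrier[OF v(2)]]
    let ?z = "\<one>\<^bsub>L\<^esub> \<odot>\<^bsub>FL\<^esub> y \<ominus>\<^bsub>FL\<^esub> ?E y"
    have Ey: "E' y \<in> vec L r" "?E y \<in> vec L r" using L.lin_vec[OF E'(1) y] L.lin_vec[OF lin y] by blast+
    have z: "?z \<in> vec L r" using L.vec_rules(5)[OF L.vec_rules(3)[OF L.one_closed y] Ey(2)] .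
    have "h a \<odot>\<^bsub>FL\<^esub> (h t \<odot>\<^bsub>FL\<^esub> ?z) = h a \<odot>\<^bsub>FL\<^esub> (h t \<odot>\<^bsub>FL\<^esub> y) \<ominus>\<^bsub>FL\<^esub> h t \<odot>\<^bsub>FL\<^esub> E' y"
    proof
      fix i
      have c: "y i \<in> carrier L" "E' y i \<in> carrier L" using y Ey L.vec_nth by blast+
      have 1: "?z i = y i \<ominus>\<^bsub>L\<^esub> inv\<^bsub>L\<^esub> h a \<otimes>\<^bsub>L\<^esub> E' y i"
        using L.fun_module_diff[OF L.vec_carrier[OF L.vec_rules(3)[OF L.one_closed y]] L.vec_carrier[OF Ey(2)]] c by simp
      have "h a \<otimes>\<^bsub>L\<^esub> (h t \<otimes>\<^bsub>L\<^esub> (y i \<ominus>\<^bsub>L\<^esub> inv\<^bsub>L\<^esub> h a \<otimes>\<^bsub>L\<^esub> E' y i)) =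
          h a \<otimes>\<^bsub>L\<^esub> (h t \<otimes>\<^bsub>L\<^esub> y i) \<ominus>\<^bsub>L\<^esub> (h a \<otimes>\<^bsub>L\<^esub> inv\<^bsub>L\<^esub> h a) \<otimes>\<^bsub>L\<^esub> (h t \<otimes>\<^bsub>L\<^esub> E' y i)"
        using c uc ht by algebra
      also have "\<dots> = h a \<otimes>\<^bsub>L\<^esub> (h t \<otimes>\<^bsub>L\<^esub> y i) \<ominus>\<^bsub>L\<^esub> h t \<otimes>\<^bsub>L\<^esub> E' y i"
        unfolding L.Units_r_inv[OF u] using c ht by simp
      finally show "(h a \<odot>\<^bsub>FL\<^esub> (h t \<odot>\<^bsub>FL\<^esub> ?z)) i = (h a \<odot>\<^bsub>FL\<^esub> (h t \<odot>\<^bsub>FL\<^esub> y) \<ominus>\<^bsub>FL\<^esub> h t \<odot>\<^bsub>FL\<^esub> E' y) i"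
        unfolding fun_module_simps(4) 1
          L.fun_module_diff[OF L.vec_carrier[OF L.vec_rules(3)[OF uc(2) L.vec_rules(3)[OF ht y]]] L.vec_carrier[OF L.vec_rules(3)[OF ht Ey(1)]]] .
    qed
    also have "h t \<odot>\<^bsub>FL\<^esub> E' y = h \<circ> E v"
      using L.lin_smult[OF E'(1) ht y] v(3) bspec[OF E'(2) v(1)] by simp
    also have "h a \<odot>\<^bsub>FL\<^esub> (h t \<odot>\<^bsub>FL\<^esub> y) = h \<circ> (a \<odot>\<^bsub>fun_module R\<^esub> v)"
      unfolding v(3) by (rule comp_smult[symmetric, OF ac v(1)])
    also have "(h \<circ> (a \<odot>\<^bsub>fun_module R\<^esub> v)) \<ominus>\<^bsub>FL\<^esub> (h \<circ> E v) = h \<circ> (a \<odot>\<^bsub>fun_module R\<^esub> v \<ominus>\<^bsub>fun_module R\<^esub> E v)"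
      by (rule comp_diff[symmetric, OF R.vec_rules(3)[OF ac v(1)] R.lin_vec[OF E(1) v(1)]])
    finally have eq: "h a \<odot>\<^bsub>FL\<^esub> (h t \<odot>\<^bsub>FL\<^esub> ?z) = h \<circ> (a \<odot>\<^bsub>fun_module R\<^esub> v \<ominus>\<^bsub>fun_module R\<^esub> E v)" .
    have "h a \<odot>\<^bsub>FL\<^esub> (h t \<odot>\<^bsub>FL\<^esub> ?z) \<in> ext_vec r K"
      unfolding eq by (rule ext_vec_image[OF K bspec[OF E(3) v(1)]])
    then show ?thesis
      by (intro ext_vec_smult_unit[OF v(2) z] ext_vec_smult_unit[OF a L.vec_rules(3)[OF ht z]])
  qed
  then show ?thesis using L.stab_zero_iff[OF ext_vec_subvec[OF K] L.one_closed] lin zero by blast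
qed

lemma ext_vec_resolution:
  assumes "resolution R rk K" shows "resolution L rk (\<lambda>i. ext_vec (rk i) (K i))"
  using assms ext_vec_subvec ext_vec_syz unfolding resolution_def by blast

lemma ext_vec_residue_rel: assumes "ideal I R" shows "ext_vec 1 (residue_rel R I) = residue_rel L (ext I)"
proof
  show "ext_vec 1 (residue_rel R I) \<subseteq> residue_rel L (ext I)"
  proof
    fix y assume "y \<in> ext_vec 1 (residue_rel R I)"
    then obtain v s where y: "y \<in> vec L 1" "v \<in> residue_rel R I" "s \<in> T" "h s \<odot>\<^bsub>FL\<^esub> y = h \<circ> v"
      unfolding ext_vec_def by blast
    have "h s \<otimes>\<^bsub>L\<^esub> y 0 = h (v 0)" using fun_cong[OF y(4), of 0] by simp
    then show "y \<in> residue_rel L (ext I)" using y(1-3) extI[OF L.vec_nth[OF y(1)]] by blast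
  qed
  show "residue_rel L (ext I) \<subseteq> ext_vec 1 (residue_rel R I)"
  proof
    fix y assume "y \<in> residue_rel L (ext I)"
    then obtain a s where y: "y \<in> vec L 1" "a \<in> I" "s \<in> T" "h s \<otimes>\<^bsub>L\<^esub> y 0 = h a" by (auto simp: ext_def)
    have ac: "a \<in> carrier R" using R.ideal_carrier[OF assms y(2)] .
    let ?v = "\<lambda>i :: nat. if i = 0 then a else \<zero>"
    have "?v \<in> residue_rel R I" using ac y(2) by (simp add: vec_def)
    moreover have "h s \<odot>\<^bsub>FL\<^esub> y = h \<circ> ?v"
    proof
      fix i
      show "(h s \<odot>\<^bsub>FL\<^esub> y) i = (h \<circ> ?v) i"
      proof (cases "i = 0")
        case True
        then show ?thesis using y(4) by simp
      next
        case False
        then have "y i = \<zero>\<^bsub>L\<^esub>" using y(1) by (simp add: vec_def)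
        then show ?thesis using False hom_rules(1)[OF T_carrier[OF y(3)]] by simp
      qed
    qed
    ultimately show "y \<in> ext_vec 1 (residue_rel R I)" by (rule ext_vecI[OF y(1) _ y(3)])
  qed
qed

end

text \<open>If multiplication by some \<open>a \<notin> q\<close> on a syzygy of \<open>R/q\<close> factors through a free module, then that
  syzygy becomes projective over \<open>R\<^sub>q\<close>.\<close>

theorem (in noetherian_cring) regular_local_at:
  assumes q: "primeideal q R" and res: "resolution R rk K" "rk 0 = 1" "K 0 = residue_rel R q"
    and a: "a \<in> carrier R" "a \<notin> q" "stab R a (rk n) (K n) 0 {\<zero>\<^bsub>F\<^esub>}"
  shows "regular_local_ring (local_at R q)"
proof -
  let ?T = "carrier R - q" and ?h = "to_local_at R q"
  interpret loc_map R "local_at R q" ?h ?T by (rule loc_map_local_at[OF q])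
  have noe: "noetherian_ring R" by unfold_locales
  have loc: "noetherian_local_ring (local_at R q) (ext q)" by (rule local[OF noe q]) simp
  have Kn: "subvec R (rk n) (K n)" using res(1) unfolding resolution_def by blast
  have aT: "a \<in> ?T" using a by blast
  have "finite_pd (local_at R q) 1 (residue_rel (local_at R q) (ext q))"
    unfolding finite_pd_def
    using ext_vec_resolution[OF res(1)] res(2,3) ext_vec_residue_rel[OF primeideal_ideal[OF q]]
      ext_vec_stab_zero[OF Kn aT a(3)]
    by (intro exI[of _ rk] exI[of _ "\<lambda>i. ext_vec (rk i) (K i)"] exI[of _ n]) auto
  then show ?thesis by (rule finite_pd_regular[OF loc])
qed

subsection \<open>Regular sequences on syzygies\<close>

definition sub_module :: "('a, 'b) ring_scheme \<Rightarrow> (nat \<Rightarrow> 'a) set \<Rightarrow> ('a, nat \<Rightarrow> 'a) module" where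
  "sub_module R K = (fun_module R)\<lparr>carrier := K\<rparr>"

lemma sub_module_simps [simp]:
  "carrier (sub_module R K) = K" "\<zero>\<^bsub>sub_module R K\<^esub> = \<zero>\<^bsub>fun_module R\<^esub>"
  "u \<oplus>\<^bsub>sub_module R K\<^esub> v = u \<oplus>\<^bsub>fun_module R\<^esub> v" "a \<odot>\<^bsub>sub_module R K\<^esub> v = a \<odot>\<^bsub>fun_module R\<^esub> v"
  by (simp_all add: sub_module_def)

text \<open>The nonzerodivisor part of regularity. Properness is kept apart, since it needs the
  submodule to be nonzero and comes from \<open>sm_proper\<close>.\<close>

definition wreg :: "('a, 'b) ring_scheme \<Rightarrow> (nat \<Rightarrow> 'a) set \<Rightarrow> 'a list \<Rightarrow> bool" where
  "wreg R K xs \<longleftrightarrow> (\<forall>i<length xs. \<forall>u\<in>K. xs ! i \<odot>\<^bsub>fun_module R\<^esub> u \<in> seq_mult (sub_module R K) (take i xs) \<longrightarrow>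
     u \<in> seq_mult (sub_module R K) (take i xs))"

context cring begin

interpretation V: module R F by (rule fun_module_module)

lemma subvec_module: "subvec R n K \<Longrightarrow> module R (sub_module R K)"
  unfolding subvec_def sub_module_def using submodule.submodule_is_module fun_module_module by blast

abbreviation "sm K \<equiv> seq_mult (sub_module R K)"

lemma sm_Cons: "sm K (x # xs) = {x \<odot>\<^bsub>F\<^esub> u \<oplus>\<^bsub>F\<^esub> v | u v. u \<in> K \<and> v \<in> sm K xs}"
  by simp

lemma sm_subvec:
  assumes K: "subvec R n K" and xs: "set xs \<subseteq> carrier R"
  shows "subvec R n (sm K xs) \<and> sm K xs \<subseteq> K"
  using xs
proof (induction xs)
  case Nil
  then show ?case using subvec_0 subvec_zero[OF K] by (simp del: fun_module_simps)
next
  case (Cons x xs)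
  then have x: "x \<in> carrier R" and IH: "subvec R n (sm K xs)" "sm K xs \<subseteq> K" by auto
  have sub: "sm K (x # xs) \<subseteq> K"
    unfolding sm_Cons using IH(2) subvec_add[OF K] subvec_smult[OF K x] by blast
  have "subvec R n (sm K (x # xs))"
  proof (rule subvecI)
    show "sm K (x # xs) \<subseteq> vec R n" using sub subvec_subset[OF K] by blast
    have "x \<odot>\<^bsub>F\<^esub> \<zero>\<^bsub>F\<^esub> \<oplus>\<^bsub>F\<^esub> \<zero>\<^bsub>F\<^esub> = \<zero>\<^bsub>F\<^esub>"
      unfolding V.smult_r_null[OF x] by (rule V.M.l_zero[OF V.M.zero_closed])
    then show "\<zero>\<^bsub>F\<^esub> \<in> sm K (x # xs)"
      unfolding sm_Cons using subvec_zero[OF K] subvec_zero[OF IH(1)] by (intro CollectI exI conjI) (rule sym)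
    fix u v a assume "u \<in> sm K (x # xs)"
    then obtain k w where u: "u = x \<odot>\<^bsub>F\<^esub> k \<oplus>\<^bsub>F\<^esub> w" "k \<in> K" "w \<in> sm K xs" unfolding sm_Cons by blast
    note kc = subvec_carrier[OF K u(2)] and wc = subvec_carrier[OF IH(1) u(3)]
    { assume "v \<in> sm K (x # xs)"
      then obtain k' w' where v: "v = x \<odot>\<^bsub>F\<^esub> k' \<oplus>\<^bsub>F\<^esub> w'" "k' \<in> K" "w' \<in> sm K xs" unfolding sm_Cons by blast
      note kc' = subvec_carrier[OF K v(2)] and wc' = subvec_carrier[OF IH(1) v(3)]
      have "u \<oplus>\<^bsub>F\<^esub> v = x \<odot>\<^bsub>F\<^esub> (k \<oplus>\<^bsub>F\<^esub> k') \<oplus>\<^bsub>F\<^esub> (w \<oplus>\<^bsub>F\<^esub> w')"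
        unfolding u(1) v(1) V.smult_r_distr[OF x kc kc']
        using V.smult_closed[OF x kc] V.smult_closed[OF x kc'] wc wc' by (simp only: V.M.a_ac V.M.add.m_closed)
      then show "u \<oplus>\<^bsub>F\<^esub> v \<in> sm K (x # xs)"
        unfolding sm_Cons using subvec_add[OF K u(2) v(2)] subvec_add[OF IH(1) u(3) v(3)] by blast }
    { assume a: "a \<in> carrier R"
      have "a \<odot>\<^bsub>F\<^esub> u = x \<odot>\<^bsub>F\<^esub> (a \<odot>\<^bsub>F\<^esub> k) \<oplus>\<^bsub>F\<^esub> a \<odot>\<^bsub>F\<^esub> w"
        unfolding u(1) V.smult_r_distr[OF a V.smult_closed[OF x kc] wc]
          V.smult_assoc1[OF a x kc, symmetric] V.smult_assoc1[OF x a kc, symmetric] m_comm[OF a x] ..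
      then show "a \<odot>\<^bsub>F\<^esub> u \<in> sm K (x # xs)"
        unfolding sm_Cons using subvec_smult[OF K a u(2)] subvec_smult[OF IH(1) a u(3)] by blast }
  qed
  then show ?case using sub by blast
qed

lemma sm_mono: assumes "K \<subseteq> L" shows "sm K xs \<subseteq> sm L xs"
proof (induction xs)
  case (Cons x xs)
  then show ?case unfolding sm_Cons using assms by blast
qed simp

text \<open>\<open>seq_mult\<close> peels off the first element, while regularity speaks about the
  last one; this mediates between the two.\<close>

lemma sm_snoc:
  assumes K: "subvec R n K" and xs: "set xs \<subseteq> carrier R" "y \<in> carrier R"
  shows "sm K (xs @ [y]) = {w \<oplus>\<^bsub>F\<^esub> y \<odot>\<^bsub>F\<^esub> u | w u. w \<in> sm K xs \<and> u \<in> K}"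
  using xs
proof (induction xs)
  case Nil
  have "y \<odot>\<^bsub>F\<^esub> u \<oplus>\<^bsub>F\<^esub> \<zero>\<^bsub>F\<^esub> = \<zero>\<^bsub>F\<^esub> \<oplus>\<^bsub>F\<^esub> y \<odot>\<^bsub>F\<^esub> u" if "u \<in> K" for u
    by (rule V.M.add.m_comm[OF V.smult_closed[OF Nil(2) subvec_carrier[OF K that]] V.M.zero_closed])
  then show ?case by (auto simp del: fun_module_simps) metis
next
  case (Cons x xs)
  then have x: "x \<in> carrier R" "set xs \<subseteq> carrier R" by auto
  note IH = Cons.IH[OF x(2) Cons.prems(2)]
  have assoc: "x \<odot>\<^bsub>F\<^esub> k \<oplus>\<^bsub>F\<^esub> (w \<oplus>\<^bsub>F\<^esub> y \<odot>\<^bsub>F\<^esub> u) = x \<odot>\<^bsub>F\<^esub> k \<oplus>\<^bsub>F\<^esub> w \<oplus>\<^bsub>F\<^esub> y \<odot>\<^bsub>F\<^esub> u"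
    if "k \<in> K" "w \<in> sm K xs" "u \<in> K" for k w u
  proof -
    have "w \<in> carrier F" using sm_subvec[OF K x(2)] subvec_carrier that(2) by blast
    then show ?thesis
      by (rule V.M.add.m_assoc[symmetric, OF V.smult_closed[OF x(1) subvec_carrier[OF K that(1)]]
          _ V.smult_closed[OF Cons.prems(2) subvec_carrier[OF K that(3)]]])
  qed
  show ?case
  proof
    show "sm K ((x # xs) @ [y]) \<subseteq> {w \<oplus>\<^bsub>F\<^esub> y \<odot>\<^bsub>F\<^esub> u | w u. w \<in> sm K (x # xs) \<and> u \<in> K}"
    proof
      fix z assume "z \<in> sm K ((x # xs) @ [y])"
      then obtain k v where z: "z = x \<odot>\<^bsub>F\<^esub> k \<oplus>\<^bsub>F\<^esub> v" "k \<in> K" "v \<in> sm K (xs @ [y])"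
        unfolding append_Cons sm_Cons by blast
      then obtain w u where v: "v = w \<oplus>\<^bsub>F\<^esub> y \<odot>\<^bsub>F\<^esub> u" "w \<in> sm K xs" "u \<in> K" unfolding IH by blast
      have "x \<odot>\<^bsub>F\<^esub> k \<oplus>\<^bsub>F\<^esub> w \<in> sm K (x # xs)" unfolding sm_Cons using z(2) v(2) by blast
      then show "z \<in> {w \<oplus>\<^bsub>F\<^esub> y \<odot>\<^bsub>F\<^esub> u | w u. w \<in> sm K (x # xs) \<and> u \<in> K}"
        unfolding z(1) v(1) assoc[OF z(2) v(2,3)] using v(3) by blast
    qed
    show "{w \<oplus>\<^bsub>F\<^esub> y \<odot>\<^bsub>F\<^esub> u | w u. w \<in> sm K (x # xs) \<and> u \<in> K} \<subseteq> sm K ((x # xs) @ [y])"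
    proof
      fix z assume "z \<in> {w \<oplus>\<^bsub>F\<^esub> y \<odot>\<^bsub>F\<^esub> u | w u. w \<in> sm K (x # xs) \<and> u \<in> K}"
      then obtain w' u where z: "z = w' \<oplus>\<^bsub>F\<^esub> y \<odot>\<^bsub>F\<^esub> u" "w' \<in> sm K (x # xs)" "u \<in> K" by blast
      then obtain k w where w: "w' = x \<odot>\<^bsub>F\<^esub> k \<oplus>\<^bsub>F\<^esub> w" "k \<in> K" "w \<in> sm K xs" unfolding sm_Cons by blast
      have "w \<oplus>\<^bsub>F\<^esub> y \<odot>\<^bsub>F\<^esub> u \<in> sm K (xs @ [y])" unfolding IH using w(3) z(3) by blast
      then show "z \<in> sm K ((x # xs) @ [y])"
        unfolding z(1) w(1) assoc[OF w(2,3) z(3), symmetric] append_Cons sm_Cons using w(2) by blast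
    qed
  qed
qed

lemma sm_lin_image:
  assumes p: "lin R s r p" and xs: "set xs \<subseteq> carrier R"
  shows "p ` sm (vec R s) xs = sm (p ` vec R s) xs"
  using xs
proof (induction xs)
  case Nil
  then show ?case using lin_zero[OF p] by (simp del: fun_module_simps)
next
  case (Cons x xs)
  then have x: "x \<in> carrier R" "set xs \<subseteq> carrier R" and IH: "p ` sm (vec R s) xs = sm (p ` vec R s) xs" by auto
  have *: "p (x \<odot>\<^bsub>F\<^esub> u \<oplus>\<^bsub>F\<^esub> v) = x \<odot>\<^bsub>F\<^esub> p u \<oplus>\<^bsub>F\<^esub> p v" if "u \<in> vec R s" "v \<in> sm (vec R s) xs" for u v
  proof -
    have v: "v \<in> vec R s" using sm_subvec[OF subvec_vec x(2)] that(2) by blast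
    show ?thesis unfolding lin_add[OF p vec_rules(3)[OF x(1) that(1)] v] lin_smult[OF p x(1) that(1)] ..
  qed
  show ?case
  proof
    show "p ` sm (vec R s) (x # xs) \<subseteq> sm (p ` vec R s) (x # xs)"
    proof
      fix z assume "z \<in> p ` sm (vec R s) (x # xs)"
      then obtain u v where z: "z = p (x \<odot>\<^bsub>F\<^esub> u \<oplus>\<^bsub>F\<^esub> v)" "u \<in> vec R s" "v \<in> sm (vec R s) xs" unfolding sm_Cons by blast
      have "p v \<in> sm (p ` vec R s) xs" using IH z(3) by blast
      then show "z \<in> sm (p ` vec R s) (x # xs)" unfolding z(1) *[OF z(2,3)] sm_Cons using z(2) by blast
    qed
    show "sm (p ` vec R s) (x # xs) \<subseteq> p ` sm (vec R s) (x # xs)"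
    proof
      fix z assume "z \<in> sm (p ` vec R s) (x # xs)"
      then obtain u v where z: "z = x \<odot>\<^bsub>F\<^esub> p u \<oplus>\<^bsub>F\<^esub> p v" "u \<in> vec R s" "v \<in> sm (vec R s) xs"
        unfolding sm_Cons IH[symmetric] by blast
      have "x \<odot>\<^bsub>F\<^esub> u \<oplus>\<^bsub>F\<^esub> v \<in> sm (vec R s) (x # xs)" unfolding sm_Cons using z(2,3) by blast
      then show "z \<in> p ` sm (vec R s) (x # xs)" unfolding z(1) *[OF z(2,3), symmetric] by (rule imageI)
    qed
  qed
qed

text \<open>Reduces regularity on a free module to regularity on \<open>R\<close>, coordinate by
  coordinate.\<close>

lemma sm_vec_coords:
  assumes "set xs \<subseteq> carrier R"
  shows "sm (vec R n) xs = {v \<in> vec R n. \<forall>i. v i \<in> seq_mult (self_module R) xs}"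
    and "\<zero> \<in> seq_mult (self_module R) xs"
proof -
  show z: "\<zero> \<in> seq_mult (self_module R) xs"
    using assms
  proof (induction xs)
    case (Cons x xs)
    then have "\<zero> = x \<otimes> \<zero> \<oplus> \<zero>" "\<zero> \<in> seq_mult (self_module R) xs" by auto
    then show ?case by (auto simp: self_module_def intro!: exI[of _ \<zero>])
  qed (simp add: self_module_def)
  show "sm (vec R n) xs = {v \<in> vec R n. \<forall>i. v i \<in> seq_mult (self_module R) xs}"
    using assms
  proof (induction xs)
    case Nil
    have "\<zero>\<^bsub>F\<^esub> \<in> vec R n" by (rule vec_rules)
    then show ?case by (auto simp: self_module_def fun_eq_iff)
  next
    case (Cons x xs)
    then have x: "x \<in> carrier R" "set xs \<subseteq> carrier R"
      and IH: "sm (vec R n) xs = {v \<in> vec R n. \<forall>i. v i \<in> seq_mult (self_module R) xs}" by auto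
    have zxs: "\<zero> \<in> seq_mult (self_module R) xs"
      using x(2)
    proof (induction xs)
      case (Cons x xs)
      then have "\<zero> = x \<otimes> \<zero> \<oplus> \<zero>" "\<zero> \<in> seq_mult (self_module R) xs" by auto
      then show ?case by (auto simp: self_module_def intro!: exI[of _ \<zero>])
    qed (simp add: self_module_def)
    have sc: "seq_mult (self_module R) xs \<subseteq> carrier R"
      using x(2) by (induction xs) (auto simp: self_module_def)
    have C: "seq_mult (self_module R) (x # xs) = {x \<otimes> a \<oplus> b | a b. a \<in> carrier R \<and> b \<in> seq_mult (self_module R) xs}"
      by (simp add: self_module_def)
    show ?case
    proof
      show "sm (vec R n) (x # xs) \<subseteq> {v \<in> vec R n. \<forall>i. v i \<in> seq_mult (self_module R) (x # xs)}"
      proof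
        fix z assume z: "z \<in> sm (vec R n) (x # xs)"
        then obtain u v where uv: "z = x \<odot>\<^bsub>F\<^esub> u \<oplus>\<^bsub>F\<^esub> v" "u \<in> vec R n" "v \<in> sm (vec R n) xs" unfolding sm_Cons by blast
        have "z i \<in> seq_mult (self_module R) (x # xs)" for i
          unfolding C using uv vec_nth[OF uv(2)] unfolding IH by auto
        moreover have "z \<in> vec R n" using sm_subvec[OF subvec_vec Cons.prems] z by blast
        ultimately show "z \<in> {v \<in> vec R n. \<forall>i. v i \<in> seq_mult (self_module R) (x # xs)}" by blast
      qed
      show "{v \<in> vec R n. \<forall>i. v i \<in> seq_mult (self_module R) (x # xs)} \<subseteq> sm (vec R n) (x # xs)"
      proof
        fix z assume "z \<in> {v \<in> vec R n. \<forall>i. v i \<in> seq_mult (self_module R) (x # xs)}"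
        then have z: "z \<in> vec R n" "\<And>i. z i \<in> seq_mult (self_module R) (x # xs)" by auto
        have "\<exists>ab. fst ab \<in> carrier R \<and> snd ab \<in> seq_mult (self_module R) xs \<and> z i = x \<otimes> fst ab \<oplus> snd ab \<and>
          (n \<le> i \<longrightarrow> ab = (\<zero>, \<zero>))" for i
        proof (cases "n \<le> i")
          case True
          then have "z i = \<zero>" using z(1) by (simp add: vec_def)
          then show ?thesis using zxs x(1) by (intro exI[of _ "(\<zero>, \<zero>)"]) simp
        next
          case False
          then show ?thesis using z(2)[of i] unfolding C by auto
        qed
        then obtain f where f: "\<And>i. fst (f i) \<in> carrier R \<and> snd (f i) \<in> seq_mult (self_module R) xs \<and>
          z i = x \<otimes> fst (f i) \<oplus> snd (f i) \<and> (n \<le> i \<longrightarrow> f i = (\<zero>, \<zero>))" by metis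
        have "(\<lambda>i. fst (f i)) \<in> vec R n" using f by (auto simp: vec_def)
        moreover have "(\<lambda>i. snd (f i)) \<in> sm (vec R n) xs" unfolding IH using f sc by (auto simp: vec_def)
        moreover have "z = x \<odot>\<^bsub>F\<^esub> (\<lambda>i. fst (f i)) \<oplus>\<^bsub>F\<^esub> (\<lambda>i. snd (f i))" using f by (auto simp: fun_eq_iff)
        ultimately show "z \<in> sm (vec R n) (x # xs)" unfolding sm_Cons by blast
      qed
    qed
  qed
qed

lemma wreg_vec:
  assumes reg: "regular_sequence R (self_module R) xs"
  shows "wreg R (vec R n) xs"
  unfolding wreg_def
proof (intro allI impI ballI)
  fix i u assume i: "i < length xs" and u: "u \<in> vec R n" and xu: "xs ! i \<odot>\<^bsub>F\<^esub> u \<in> sm (vec R n) (take i xs)"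
  have xs: "set (take i xs) \<subseteq> carrier R"
    using reg set_take_subset[of i xs] unfolding regular_sequence_def by blast
  have "u j \<in> seq_mult (self_module R) (take i xs)" for j
  proof -
    have "xs ! i \<otimes> u j \<in> seq_mult (self_module R) (take i xs)"
      using xu unfolding sm_vec_coords(1)[OF xs] by auto
    then show ?thesis using reg i vec_nth[OF u] unfolding regular_sequence_def by (simp add: self_module_def)
  qed
  then show "u \<in> sm (vec R n) (take i xs)" unfolding sm_vec_coords(1)[OF xs] using u by blast
qed

text \<open>If \<open>xs\<close> is regular on \<open>K = R\<^sup>s/L\<close>, then tensoring \<open>0 \<rightarrow> L \<rightarrow> R\<^sup>s \<rightarrow> K \<rightarrow> 0\<close> with \<open>R/(xs)\<close> keeps the
  left end injective.\<close>

lemma sm_Int_kernel: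
  assumes p: "lin R s r p" and K: "K = p ` vec R s" and L: "L = {v \<in> vec R s. p v = \<zero>\<^bsub>F\<^esub>}"
    and xs: "set xs \<subseteq> carrier R" and reg: "wreg R K xs"
  shows "L \<inter> sm (vec R s) xs \<subseteq> sm L xs"
  using xs reg
proof (induction xs rule: rev_induct)
  case Nil
  then show ?case by (simp del: fun_module_simps)
next
  case (snoc y xs)
  have xs: "set xs \<subseteq> carrier R" "y \<in> carrier R" using snoc.prems by auto
  have Ls: "subvec R s L" unfolding L by (rule subvec_ker[OF p])
  have Ks: "subvec R r K" unfolding K by (rule subvec_image[OF p subvec_vec])
  have smv: "subvec R s (sm (vec R s) xs)" using sm_subvec[OF subvec_vec xs(1)] by blast
  have smK: "subvec R r (sm K xs)" using sm_subvec[OF Ks xs(1)] by blast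
  have "wreg R K xs" using snoc.prems(2) unfolding wreg_def by (auto simp: nth_append less_Suc_eq)
  then have IH: "L \<inter> sm (vec R s) xs \<subseteq> sm L xs" using snoc.IH xs by blast
  have last: "u \<in> sm K xs" if "u \<in> K" "y \<odot>\<^bsub>F\<^esub> u \<in> sm K xs" for u
    using snoc.prems(2)[unfolded wreg_def, rule_format, of "length xs" u] that by simp
  show ?case
  proof
    fix v assume v: "v \<in> L \<inter> sm (vec R s) (xs @ [y])"
    then obtain w u where wu: "v = w \<oplus>\<^bsub>F\<^esub> y \<odot>\<^bsub>F\<^esub> u" "w \<in> sm (vec R s) xs" "u \<in> vec R s"
      unfolding sm_snoc[OF subvec_vec xs] by blast
    note wv = subvec_subset[OF smv wu(2)] and yu = vec_rules(3)[OF xs(2) wu(3)]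
    have pw: "p w \<in> sm K xs" using sm_lin_image[OF p xs(1)] wu(2) unfolding K by blast
    have "p w \<oplus>\<^bsub>F\<^esub> y \<odot>\<^bsub>F\<^esub> p u = p v"
      unfolding wu(1) lin_add[OF p wv yu] lin_smult[OF p xs(2) wu(3)] ..
    also have "\<dots> = \<zero>\<^bsub>F\<^esub>" using v unfolding L by blast
    finally have "p w \<oplus>\<^bsub>F\<^esub> y \<odot>\<^bsub>F\<^esub> p u = \<zero>\<^bsub>F\<^esub>" .
    then have "\<ominus>\<^bsub>F\<^esub> p w = y \<odot>\<^bsub>F\<^esub> p u"
      using V.M.minus_equality[of "y \<odot>\<^bsub>F\<^esub> p u" "p w"]
        V.M.add.m_comm[OF lin_carrier[OF p wv] V.smult_closed[OF xs(2) lin_carrier[OF p wu(3)]]]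
        V.smult_closed[OF xs(2) lin_carrier[OF p wu(3)]] lin_carrier[OF p wv] by metis
    then have "y \<odot>\<^bsub>F\<^esub> p u \<in> sm K xs" using subvec_minus[OF smK pw] by simp
    then have "p u \<in> sm K xs" using last wu(3) K by blast
    then obtain w' where w': "w' \<in> sm (vec R s) xs" "p u = p w'"
      using sm_lin_image[OF p xs(1)] unfolding K by (metis imageE)
    note wv' = subvec_subset[OF smv w'(1)]
    let ?d = "u \<ominus>\<^bsub>F\<^esub> w'"
    have dv: "?d \<in> vec R s" by (rule vec_rules(5)[OF wu(3) wv'])
    have "p ?d = p w' \<ominus>\<^bsub>F\<^esub> p w'" unfolding lin_diff[OF p wu(3) wv'] w'(2) ..
    also have "\<dots> = \<zero>\<^bsub>F\<^esub>" unfolding a_minus_def by (rule V.M.r_neg[OF lin_carrier[OF p wv']])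
    finally have pd: "p ?d = \<zero>\<^bsub>F\<^esub>" .
    then have dL: "?d \<in> L" unfolding L using dv by blast
    \<comment> \<open>Replacing \<open>u\<close> by \<open>w'\<close> moves the rest of the
      \<open>y\<close>-part of \<open>v\<close> into \<open>L\<close>. What remains,
      \<open>?e\<close>, lies in \<open>L\<close> and uses only \<open>xs\<close>, so the induction
      hypothesis applies.\<close>
    let ?e = "w \<oplus>\<^bsub>F\<^esub> y \<odot>\<^bsub>F\<^esub> w'"
    have split: "v = ?e \<oplus>\<^bsub>F\<^esub> y \<odot>\<^bsub>F\<^esub> ?d"
    proof
      fix i
      have c: "w i \<in> carrier R" "u i \<in> carrier R" "w' i \<in> carrier R" using wv wu(3) wv' vec_nth by blast+
      have di: "?d i = u i \<ominus> w' i" by (rule fun_module_diff[OF vec_carrier[OF wu(3)] vec_carrier[OF wv']])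
      show "v i = (?e \<oplus>\<^bsub>F\<^esub> y \<odot>\<^bsub>F\<^esub> ?d) i"
        unfolding wu(1) fun_module_simps(3,4) di using c xs(2) by algebra
    qed
    have e_sm: "?e \<in> sm (vec R s) xs" using subvec_add[OF smv wu(2) subvec_smult[OF smv xs(2) w'(1)]] .
    have "p ?e = p v"
    proof -
      have "p v = p ?e \<oplus>\<^bsub>F\<^esub> y \<odot>\<^bsub>F\<^esub> p ?d"
        unfolding lin_smult[OF p xs(2) dv, symmetric] lin_add[OF p subvec_subset[OF smv e_sm] vec_rules(3)[OF xs(2) dv], symmetric]
        using split by metis
      then show ?thesis
        unfolding pd V.smult_r_null[OF xs(2)] V.M.r_zero[OF lin_carrier[OF p subvec_subset[OF smv e_sm]]] by (rule sym)
    qed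
    then have "?e \<in> L" using v subvec_subset[OF smv e_sm] unfolding L by auto
    then have "?e \<in> sm L xs" using e_sm IH by blast
    then have "?e \<oplus>\<^bsub>F\<^esub> y \<odot>\<^bsub>F\<^esub> ?d \<in> sm L (xs @ [y])" unfolding sm_snoc[OF Ls xs] using dL by blast
    then show "v \<in> sm L (xs @ [y])" unfolding split[symmetric] .
  qed
qed

lemma wreg_take: "wreg R K xs \<Longrightarrow> wreg R K (take n xs)"
  unfolding wreg_def by (auto simp: min_def)

text \<open>Each syzygy gains one element of the sequence. Regularity on the free module puts
  \<open>u\<close> into the multiples by the first \<open>j\<close> elements, and
  \<open>sm_Int_kernel\<close> returns to \<open>K (Suc i)\<close>; it requires those
  \<open>j\<close> elements to be regular on \<open>K i\<close>, which is known as
  \<open>j \<le> Suc i\<close>.\<close>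

lemma wreg_resolution:
  assumes res: "resolution R rk K" and reg: "regular_sequence R (self_module R) xs"
  shows "wreg R (K i) (take (Suc i) xs)"
proof (induction i)
  have xs: "set xs \<subseteq> carrier R" using reg by (simp add: regular_sequence_def)
  case 0
  have K0: "subvec R (rk 0) (K 0)" using res unfolding resolution_def by blast
  show ?case
    unfolding wreg_def
  proof (intro allI impI ballI)
    fix i u assume i: "i < length (take (Suc 0) xs)" and u: "u \<in> K 0"
      and xu: "take (Suc 0) xs ! i \<odot>\<^bsub>F\<^esub> u \<in> sm (K 0) (take i (take (Suc 0) xs))"
    have i0: "i = 0" "0 < length xs" using i by auto
    have "u \<in> sm (vec R (rk 0)) (take 0 xs)"
      using wreg_vec[OF reg, of "rk 0", unfolded wreg_def, rule_format, OF i0(2) subvec_subset[OF K0 u]] xu i0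
      by (simp del: fun_module_simps)
    then show "u \<in> sm (K 0) (take i (take (Suc 0) xs))" using i0 by (simp del: fun_module_simps)
  qed
next
  have xs: "set xs \<subseteq> carrier R" using reg by (simp add: regular_sequence_def)
  case (Suc i)
  obtain p where p: "lin R (rk (Suc i)) (rk i) p" "p ` vec R (rk (Suc i)) = K i"
    "K (Suc i) = {v \<in> vec R (rk (Suc i)). p v = \<zero>\<^bsub>F\<^esub>}"
    using res unfolding resolution_def syz_def by blast
  show ?case
    unfolding wreg_def
  proof (intro allI impI ballI)
    fix j u assume j: "j < length (take (Suc (Suc i)) xs)" and u: "u \<in> K (Suc i)"
      and xu: "take (Suc (Suc i)) xs ! j \<odot>\<^bsub>F\<^esub> u \<in> sm (K (Suc i)) (take j (take (Suc (Suc i)) xs))"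
    have j2: "j < length xs" "j < Suc (Suc i)" using j by simp_all
    then have j': "j < length xs" "take j (take (Suc (Suc i)) xs) = take j xs" "take (Suc (Suc i)) xs ! j = xs ! j"
      "take j xs = take j (take (Suc i) xs)"
      by (auto simp: min_def)
    have uv: "u \<in> vec R (rk (Suc i))" using u p(3) by blast
    have "xs ! j \<odot>\<^bsub>F\<^esub> u \<in> sm (vec R (rk (Suc i))) (take j xs)"
      using xu sm_mono[of "K (Suc i)" "vec R (rk (Suc i))" "take j xs"] p(3) unfolding j'(2,3) by blast
    then have "u \<in> sm (vec R (rk (Suc i))) (take j xs)"
      using wreg_vec[OF reg, of "rk (Suc i)", unfolded wreg_def, rule_format, OF j'(1) uv] by blast
    moreover have "wreg R (K i) (take j xs)" using wreg_take[OF Suc.IH, of j] unfolding j'(4) .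
    moreover have "set (take j xs) \<subseteq> carrier R" using xs set_take_subset[of j xs] by blast
    ultimately show "u \<in> sm (K (Suc i)) (take j (take (Suc (Suc i)) xs))"
      unfolding j'(2) using sm_Int_kernel[OF p(1) p(2)[symmetric] p(3)] u by blast
  qed
qed

end

subsection \<open>Syzygies as maximal Cohen--Macaulay modules\<close>

lemma (in cring) sub_module_submodule:
  assumes K: "subvec R n K" and N: "submodule N R (sub_module R K)"
  shows "subvec R n N"
proof -
  interpret M: module R "sub_module R K" by (rule subvec_module[OF K])
  note E = M.submoduleE[OF N]
  have "N \<subseteq> K" using E(1) by simp
  have "\<zero>\<^bsub>sub_module R K\<^esub> \<in> N" using N by (simp add: submodule_def subgroup_def)
  show ?thesis
  proof (rule subvecI)
    show "N \<subseteq> vec R n" using \<open>N \<subseteq> K\<close> subvec_subset[OF K] by blast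
    show "\<zero>\<^bsub>F\<^esub> \<in> N" using \<open>\<zero>\<^bsub>sub_module R K\<^esub> \<in> N\<close> by (simp del: fun_module_simps)
    show "u \<oplus>\<^bsub>F\<^esub> v \<in> N" if "u \<in> N" "v \<in> N" for u v using E(5)[OF that] by (simp del: fun_module_simps)
    show "a \<odot>\<^bsub>F\<^esub> v \<in> N" if "a \<in> carrier R" "v \<in> N" for a v using E(4)[OF that] by (simp del: fun_module_simps)
  qed
qed

lemma (in noetherian_cring) sub_module_finitely_generated:
  assumes K: "subvec R n K"
  shows "finitely_generated R (sub_module R K)"
proof -
  obtain t p where p: "lin R t n p" "p ` vec R t = K" using subvec_is_image[OF K] by blast
  let ?U = "(\<lambda>i. p (unit_vec R i)) ` {..<t}"
  have "N = K" if N: "submodule N R (sub_module R K)" "?U \<subseteq> N" for N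
  proof
    note Ns = sub_module_submodule[OF K N(1)]
    have NF: "submodule N R F" using Ns by (simp add: subvec_def)
    interpret M: module R "sub_module R K" by (rule subvec_module[OF K])
    show "N \<subseteq> K" using M.submoduleE(1)[OF N(1)] by simp
    have e: "p (unit_vec R i) \<in> N" if "i < t" for i using N(2) that by blast
    show "K \<subseteq> N" unfolding p(2)[symmetric] using vec_induct[OF NF e p(1)] by blast
  qed
  moreover have "?U \<subseteq> K" unfolding p(2)[symmetric] using unit_vec_vec by blast
  ultimately show ?thesis unfolding finitely_generated_def by (intro exI[of _ ?U]) auto
qed

text \<open>Nakayama's lemma through minimal generators: if \<open>K\<close> equalled its multiples
  by \<open>xs\<close>, the first generator could be written with coefficients in \<open>m\<close>,
  a relation whose coordinate \<open>1 - w 0\<close> is a unit.\<close>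

lemma (in noetherian_local_ring) sm_proper:
  assumes K: "subvec R n K" "K \<noteq> {\<zero>\<^bsub>F\<^esub>}" and xs: "set xs \<subseteq> m"
  shows "sm K xs \<noteq> K"
proof
  assume eq: "sm K xs = K"
  have xc: "set xs \<subseteq> carrier R" using xs m_carrier by blast
  obtain t p where p: "lin R t n p" "p ` vec R t = K" "\<forall>v\<in>vec R t. p v = \<zero>\<^bsub>F\<^esub> \<longrightarrow> (\<forall>i. v i \<in> m)"
    using ex_minimal_generators[OF K(1)] by blast
  have "t \<noteq> 0"
  proof
    assume "t = 0"
    then have "K = {\<zero>\<^bsub>F\<^esub>}" using p(2) lin_zero[OF p(1)] vec_0 by simp
    then show False using K(2) by blast
  qed
  then have e: "unit_vec R 0 \<in> vec R t" by (simp add: unit_vec_vec)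
  then have "p (unit_vec R 0) \<in> p ` sm (vec R t) xs"
    unfolding sm_lin_image[OF p(1) xc] using eq p(2) by blast
  then obtain w where w: "p (unit_vec R 0) = p w" "w \<in> sm (vec R t) xs" by (rule imageE)
  have wv: "w \<in> vec R t" using sm_subvec[OF subvec_vec xc] w(2) by blast
  have im: "seq_mult (self_module R) ys \<subseteq> m" if "set ys \<subseteq> m" for ys
    using that
  proof (induction ys)
    case (Cons y ys)
    then have "y \<in> m" "seq_mult (self_module R) ys \<subseteq> m" by auto
    then show ?case using ideal_add[OF m_ideal] ideal_rmult[OF m_ideal] by (auto simp: self_module_def)
  qed (simp add: self_module_def ideal_zero[OF m_ideal])
  have "w 0 \<in> m" using w(2) im[OF xs] unfolding sm_vec_coords(1)[OF xc] by blast
  let ?d = "unit_vec R 0 \<ominus>\<^bsub>F\<^esub> w"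
  have "p ?d = p w \<ominus>\<^bsub>F\<^esub> p w" unfolding lin_diff[OF p(1) e wv] w(1) ..
  also have "\<dots> = \<zero>\<^bsub>F\<^esub>"
    using module.axioms(2)[OF fun_module_module] lin_carrier[OF p(1) wv]
    unfolding a_minus_def by (rule abelian_group.r_neg)
  finally have "?d 0 \<in> m" using p(3) vec_rules(5)[OF e wv] by blast
  then have "\<one> \<ominus> w 0 \<in> m"
    unfolding fun_module_diff[OF vec_carrier[OF e] vec_carrier[OF wv]] by (simp add: unit_vec_def)
  then show False using one_minus_unit[OF \<open>w 0 \<in> m\<close>] unit_iff vec_nth[OF wv] by blast
qed

text \<open>The index is one off: in dimension \<open>d = Suc i\<close> the \<open>d\<close>-th
  syzygy is \<open>K i\<close>, and the whole sequence \<open>xs\<close> is regular on it.\<close>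

lemma (in noetherian_local_ring) syzygy_maximal_CM:
  assumes CM: "cohen_macaulay_ring R m" and dim: "krull_dim R = enat (Suc i)"
    and res: "resolution R rk K" and nz: "K i \<noteq> {\<zero>\<^bsub>F\<^esub>}"
  shows "maximal_CM R m (sub_module R (K i))"
proof -
  obtain xs where xs: "set xs \<subseteq> m" "enat (length xs) = krull_dim R" "regular_sequence R (self_module R) xs"
    using CM unfolding cohen_macaulay_ring_def maximal_CM_def by blast
  have len: "take (Suc i) xs = xs" using xs(2) dim by simp
  have Ki: "subvec R (rk i) (K i)" using res unfolding resolution_def by blast
  have "wreg R (K i) xs" using wreg_resolution[OF res xs(3), of i] unfolding len .
  then have "regular_sequence R (sub_module R (K i)) xs"
    using xs(3) sm_proper[OF Ki nz xs(1)]
    unfolding regular_sequence_def wreg_def by (simp del: fun_module_simps)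
  then show ?thesis
    unfolding maximal_CM_def
    using subvec_module[OF Ki] sub_module_finitely_generated[OF Ki] nz xs(1,2)
    by (auto simp del: fun_module_simps)
qed

section \<open>Maximal Cohen-Macaulay modules under isomorphism\<close>

lemma module_iso_zero:
  assumes M: "module R M" and N: "module R N" and h: "h \<in> module_iso R M N"
  shows "h \<zero>\<^bsub>M\<^esub> = \<zero>\<^bsub>N\<^esub>"
proof -
  interpret M: module R M by fact
  interpret N: module R N by fact
  have z: "\<zero>\<^bsub>M\<^esub> \<in> carrier M" by simp
  have hz: "h \<zero>\<^bsub>M\<^esub> \<in> carrier N" using h z unfolding module_iso_def bij_betw_def by blast
  have "h (\<zero>\<^bsub>R\<^esub> \<odot>\<^bsub>M\<^esub> \<zero>\<^bsub>M\<^esub>) = \<zero>\<^bsub>R\<^esub> \<odot>\<^bsub>N\<^esub> h \<zero>\<^bsub>M\<^esub>"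
    using h z unfolding module_iso_def by blast
  then show ?thesis using M.smult_l_null[OF z] N.smult_l_null[OF hz] by simp
qed

text \<open>The syzygies consist of sequences, whereas countable type is measured on modules of
  lists; this bridges the two.\<close>

lemma maximal_CM_iso:
  assumes MCM: "maximal_CM R m M" and N: "module R N" and h: "h \<in> module_iso R M N"
    and m: "m \<subseteq> carrier R"
  shows "maximal_CM R m N"
proof -
  have M: "module R M" and nz: "carrier M \<noteq> {\<zero>\<^bsub>M\<^esub>}" and fg: "finitely_generated R M"
    using MCM unfolding maximal_CM_def by blast+
  obtain xs where xs: "set xs \<subseteq> m" "enat (length xs) = krull_dim R" "regular_sequence R M xs"
    using MCM unfolding maximal_CM_def by blast
  interpret M: module R M by fact
  interpret N: module R N by fact
  have bij: "inj_on h (carrier M)" "h ` carrier M = carrier N"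
    and add: "\<And>u v. u \<in> carrier M \<Longrightarrow> v \<in> carrier M \<Longrightarrow> h (u \<oplus>\<^bsub>M\<^esub> v) = h u \<oplus>\<^bsub>N\<^esub> h v"
    and smult: "\<And>a u. a \<in> carrier R \<Longrightarrow> u \<in> carrier M \<Longrightarrow> h (a \<odot>\<^bsub>M\<^esub> u) = a \<odot>\<^bsub>N\<^esub> h u"
    using h unfolding module_iso_def bij_betw_def by blast+
  note zero = module_iso_zero[OF M N h]
  have seq: "seq_mult M ys \<subseteq> carrier M \<and> seq_mult N ys = h ` seq_mult M ys" if "set ys \<subseteq> carrier R" for ys
    using that
  proof (induction ys)
    case Nil
    then show ?case using zero by simp
  next
    case (Cons y ys)
    then have y: "y \<in> carrier R" and IH: "seq_mult M ys \<subseteq> carrier M" "seq_mult N ys = h ` seq_mult M ys" by auto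
    have *: "h (y \<odot>\<^bsub>M\<^esub> u \<oplus>\<^bsub>M\<^esub> v) = y \<odot>\<^bsub>N\<^esub> h u \<oplus>\<^bsub>N\<^esub> h v" if "u \<in> carrier M" "v \<in> seq_mult M ys" for u v
      using add smult that y IH(1) by auto
    have "seq_mult N (y # ys) = {y \<odot>\<^bsub>N\<^esub> h u \<oplus>\<^bsub>N\<^esub> h v | u v. u \<in> carrier M \<and> v \<in> seq_mult M ys}"
      unfolding seq_mult.simps IH(2) bij(2)[symmetric] by blast
    also have "\<dots> = h ` seq_mult M (y # ys)"
      unfolding seq_mult.simps using * by (auto simp: image_iff) metis+
    finally show ?case using y IH(1) by auto
  qed
  have xc: "set xs \<subseteq> carrier R" using xs m by blast
  have tc: "set (take i xs) \<subseteq> carrier R" for i using xc set_take_subset[of i xs] by blast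
  have mem: "h u \<in> seq_mult N (take i xs) \<longleftrightarrow> u \<in> seq_mult M (take i xs)" if "u \<in> carrier M" for u i
    using seq[OF tc] inj_on_image_mem_iff[OF bij(1) that] by metis
  have "regular_sequence R N xs"
    unfolding regular_sequence_def
  proof (intro conjI allI impI ballI xc)
    fix i v assume i: "i < length xs" and v: "v \<in> carrier N" and xv: "xs ! i \<odot>\<^bsub>N\<^esub> v \<in> seq_mult N (take i xs)"
    obtain u where u: "u \<in> carrier M" "v = h u" using v bij(2) by blast
    have xi: "xs ! i \<in> carrier R" using i xc nth_mem by blast
    have "xs ! i \<odot>\<^bsub>M\<^esub> u \<in> seq_mult M (take i xs)"
      using xv mem[OF M.smult_closed[OF xi u(1)]] smult[OF xi u(1)] u(2) by simp
    then show "v \<in> seq_mult N (take i xs)"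
      using xs(3) i u mem[OF u(1)] unfolding regular_sequence_def by blast
  next
    show "seq_mult N xs \<noteq> carrier N"
      using seq[OF xc] xs(3) bij inj_on_image_eq_iff[OF bij(1), of "seq_mult M xs" "carrier M"]
      unfolding regular_sequence_def by auto
  qed
  moreover have "carrier N \<noteq> {\<zero>\<^bsub>N\<^esub>}"
  proof
    assume "carrier N = {\<zero>\<^bsub>N\<^esub>}"
    then have "h u = h \<zero>\<^bsub>M\<^esub>" if "u \<in> carrier M" for u
      using imageI[OF that, of h] unfolding bij(2) by (simp add: zero)
    then have "u = \<zero>\<^bsub>M\<^esub>" if "u \<in> carrier M" for u using that inj_onD[OF bij(1)] M.zero_closed by metis
    then show False using nz M.zero_closed by blast
  qed
  moreover have "finitely_generated R N"
  proof -
    obtain U where U: "finite U" "U \<subseteq> carrier M" "\<And>K. submodule K R M \<Longrightarrow> U \<subseteq> K \<Longrightarrow> K = carrier M"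
      using fg unfolding finitely_generated_def by blast
    have "K = carrier N" if K: "submodule K R N" "h ` U \<subseteq> K" for K
    proof -
      note E = N.submoduleE[OF K(1)]
      have z: "\<zero>\<^bsub>N\<^esub> \<in> K" using K(1) by (simp add: submodule_def subgroup_def)
      let ?K = "{u \<in> carrier M. h u \<in> K}"
      have "submodule ?K R M"
      proof (rule M.submoduleI)
        show "\<ominus>\<^bsub>M\<^esub> u \<in> ?K" if u: "u \<in> ?K" for u
        proof -
          have "h (\<ominus>\<^bsub>M\<^esub> u) = h ((\<ominus>\<^bsub>R\<^esub> \<one>\<^bsub>R\<^esub>) \<odot>\<^bsub>M\<^esub> u)" using u M.smult_l_minus[of "\<one>\<^bsub>R\<^esub>" u] by simp
          also have "\<dots> = (\<ominus>\<^bsub>R\<^esub> \<one>\<^bsub>R\<^esub>) \<odot>\<^bsub>N\<^esub> h u" using u by (intro smult) auto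
          finally show ?thesis using u E(4)[of "\<ominus>\<^bsub>R\<^esub> \<one>\<^bsub>R\<^esub>" "h u"] by simp
        qed
      qed (use z zero E(4,5) add smult in auto)
      moreover have "U \<subseteq> ?K" using U(2) K(2) by blast
      ultimately have "?K = carrier M" by (rule U(3))
      then have "h ` carrier M \<subseteq> K" by blast
      then show ?thesis unfolding bij(2) using E(1) by (rule equalityI[rotated])
    qed
    moreover have "h ` U \<subseteq> carrier N" using U(2) bij(2) by blast
    ultimately show ?thesis unfolding finitely_generated_def using U(1) by (intro exI[of _ "h ` U"]) auto
  qed
  ultimately show ?thesis unfolding maximal_CM_def using N xs(1,2) by blast
qed

subsection \<open>The stable annihilator\<close>

text \<open>The ideal of all \<open>a\<close> such that multiplication by \<open>a\<close> on \<open>M\<close> factors through a free module, that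
  is, the annihilator of \<open>Ext\<^sup>1(M, \<Omega>M)\<close>.\<close>

definition stable_ann :: "('a, 'b) ring_scheme \<Rightarrow> ('a, 'c) module \<Rightarrow> 'a set" where
  "stable_ann R M = {a \<in> carrier R. \<exists>n \<alpha> \<beta>.
     (\<forall>u\<in>carrier M. \<alpha> u \<in> vec R n) \<and>
     (\<forall>u\<in>carrier M. \<forall>v\<in>carrier M. \<alpha> (u \<oplus>\<^bsub>M\<^esub> v) = \<alpha> u \<oplus>\<^bsub>fun_module R\<^esub> \<alpha> v) \<and>
     (\<forall>b\<in>carrier R. \<forall>u\<in>carrier M. \<alpha> (b \<odot>\<^bsub>M\<^esub> u) = b \<odot>\<^bsub>fun_module R\<^esub> \<alpha> u) \<and>
     (\<forall>x\<in>vec R n. \<beta> x \<in> carrier M) \<and>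
     (\<forall>x\<in>vec R n. \<forall>y\<in>vec R n. \<beta> (x \<oplus>\<^bsub>fun_module R\<^esub> y) = \<beta> x \<oplus>\<^bsub>M\<^esub> \<beta> y) \<and>
     (\<forall>b\<in>carrier R. \<forall>x\<in>vec R n. \<beta> (b \<odot>\<^bsub>fun_module R\<^esub> x) = b \<odot>\<^bsub>M\<^esub> \<beta> x) \<and>
     (\<forall>u\<in>carrier M. \<beta> (\<alpha> u) = a \<odot>\<^bsub>M\<^esub> u)}"

lemma stable_annI:
  assumes "a \<in> carrier R"
    "\<And>u. u \<in> carrier M \<Longrightarrow> \<alpha> u \<in> vec R n"
    "\<And>u v. u \<in> carrier M \<Longrightarrow> v \<in> carrier M \<Longrightarrow> \<alpha> (u \<oplus>\<^bsub>M\<^esub> v) = \<alpha> u \<oplus>\<^bsub>fun_module R\<^esub> \<alpha> v"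
    "\<And>b u. b \<in> carrier R \<Longrightarrow> u \<in> carrier M \<Longrightarrow> \<alpha> (b \<odot>\<^bsub>M\<^esub> u) = b \<odot>\<^bsub>fun_module R\<^esub> \<alpha> u"
    "\<And>x. x \<in> vec R n \<Longrightarrow> \<beta> x \<in> carrier M"
    "\<And>x y. x \<in> vec R n \<Longrightarrow> y \<in> vec R n \<Longrightarrow> \<beta> (x \<oplus>\<^bsub>fun_module R\<^esub> y) = \<beta> x \<oplus>\<^bsub>M\<^esub> \<beta> y"
    "\<And>b x. b \<in> carrier R \<Longrightarrow> x \<in> vec R n \<Longrightarrow> \<beta> (b \<odot>\<^bsub>fun_module R\<^esub> x) = b \<odot>\<^bsub>M\<^esub> \<beta> x"
    "\<And>u. u \<in> carrier M \<Longrightarrow> \<beta> (\<alpha> u) = a \<odot>\<^bsub>M\<^esub> u"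
  shows "a \<in> stable_ann R M"
  unfolding stable_ann_def using assms(1)
  by (intro CollectI conjI exI[of _ n] exI[of _ \<alpha>] exI[of _ \<beta>] ballI assms(2-)) simp_all

lemma stable_annE:
  assumes "a \<in> stable_ann R M"
  obtains n \<alpha> \<beta> where "a \<in> carrier R"
    "\<And>u. u \<in> carrier M \<Longrightarrow> \<alpha> u \<in> vec R n"
    "\<And>u v. u \<in> carrier M \<Longrightarrow> v \<in> carrier M \<Longrightarrow> \<alpha> (u \<oplus>\<^bsub>M\<^esub> v) = \<alpha> u \<oplus>\<^bsub>fun_module R\<^esub> \<alpha> v"
    "\<And>b u. b \<in> carrier R \<Longrightarrow> u \<in> carrier M \<Longrightarrow> \<alpha> (b \<odot>\<^bsub>M\<^esub> u) = b \<odot>\<^bsub>fun_module R\<^esub> \<alpha> u"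
    "\<And>x. x \<in> vec R n \<Longrightarrow> \<beta> x \<in> carrier M"
    "\<And>x y. x \<in> vec R n \<Longrightarrow> y \<in> vec R n \<Longrightarrow> \<beta> (x \<oplus>\<^bsub>fun_module R\<^esub> y) = \<beta> x \<oplus>\<^bsub>M\<^esub> \<beta> y"
    "\<And>b x. b \<in> carrier R \<Longrightarrow> x \<in> vec R n \<Longrightarrow> \<beta> (b \<odot>\<^bsub>fun_module R\<^esub> x) = b \<odot>\<^bsub>M\<^esub> \<beta> x"
    "\<And>u. u \<in> carrier M \<Longrightarrow> \<beta> (\<alpha> u) = a \<odot>\<^bsub>M\<^esub> u"
proof -
  from assms obtain n \<alpha> \<beta> where "a \<in> carrier R"
     "(\<forall>u\<in>carrier M. \<alpha> u \<in> vec R n) \<and>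
     (\<forall>u\<in>carrier M. \<forall>v\<in>carrier M. \<alpha> (u \<oplus>\<^bsub>M\<^esub> v) = \<alpha> u \<oplus>\<^bsub>fun_module R\<^esub> \<alpha> v) \<and>
     (\<forall>b\<in>carrier R. \<forall>u\<in>carrier M. \<alpha> (b \<odot>\<^bsub>M\<^esub> u) = b \<odot>\<^bsub>fun_module R\<^esub> \<alpha> u) \<and>
     (\<forall>x\<in>vec R n. \<beta> x \<in> carrier M) \<and>
     (\<forall>x\<in>vec R n. \<forall>y\<in>vec R n. \<beta> (x \<oplus>\<^bsub>fun_module R\<^esub> y) = \<beta> x \<oplus>\<^bsub>M\<^esub> \<beta> y) \<and>
     (\<forall>b\<in>carrier R. \<forall>x\<in>vec R n. \<beta> (b \<odot>\<^bsub>fun_module R\<^esub> x) = b \<odot>\<^bsub>M\<^esub> \<beta> x) \<and>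
     (\<forall>u\<in>carrier M. \<beta> (\<alpha> u) = a \<odot>\<^bsub>M\<^esub> u)"
    unfolding stable_ann_def by (elim CollectE conjE exE) (rule that, assumption, intro conjI)
  then show thesis by (intro that[of \<alpha> n \<beta>]) blast+
qed

lemma stable_ann_iso_subset:
  assumes M: "module R M" and N: "module R N" and h: "h \<in> module_iso R M N"
  shows "stable_ann R M \<subseteq> stable_ann R N"
proof
  fix a assume "a \<in> stable_ann R M"
  then obtain n \<alpha> \<beta> where a: "a \<in> carrier R"
    "\<And>u. u \<in> carrier M \<Longrightarrow> \<alpha> u \<in> vec R n"
    "\<And>u v. u \<in> carrier M \<Longrightarrow> v \<in> carrier M \<Longrightarrow> \<alpha> (u \<oplus>\<^bsub>M\<^esub> v) = \<alpha> u \<oplus>\<^bsub>fun_module R\<^esub> \<alpha> v"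
    "\<And>b u. b \<in> carrier R \<Longrightarrow> u \<in> carrier M \<Longrightarrow> \<alpha> (b \<odot>\<^bsub>M\<^esub> u) = b \<odot>\<^bsub>fun_module R\<^esub> \<alpha> u"
    "\<And>x. x \<in> vec R n \<Longrightarrow> \<beta> x \<in> carrier M"
    "\<And>x y. x \<in> vec R n \<Longrightarrow> y \<in> vec R n \<Longrightarrow> \<beta> (x \<oplus>\<^bsub>fun_module R\<^esub> y) = \<beta> x \<oplus>\<^bsub>M\<^esub> \<beta> y"
    "\<And>b x. b \<in> carrier R \<Longrightarrow> x \<in> vec R n \<Longrightarrow> \<beta> (b \<odot>\<^bsub>fun_module R\<^esub> x) = b \<odot>\<^bsub>M\<^esub> \<beta> x"
    "\<And>u. u \<in> carrier M \<Longrightarrow> \<beta> (\<alpha> u) = a \<odot>\<^bsub>M\<^esub> u"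
    by (rule stable_annE) (rule that)
  interpret M: module R M by fact
  have bij: "inj_on h (carrier M)" "h ` carrier M = carrier N"
    and add: "\<And>u v. u \<in> carrier M \<Longrightarrow> v \<in> carrier M \<Longrightarrow> h (u \<oplus>\<^bsub>M\<^esub> v) = h u \<oplus>\<^bsub>N\<^esub> h v"
    and smult: "\<And>a u. a \<in> carrier R \<Longrightarrow> u \<in> carrier M \<Longrightarrow> h (a \<odot>\<^bsub>M\<^esub> u) = a \<odot>\<^bsub>N\<^esub> h u"
    using h unfolding module_iso_def bij_betw_def by blast+
  define g where "g = inv_into (carrier M) h"
  have gh: "g (h u) = u" if "u \<in> carrier M" for u unfolding g_def using bij(1) that by simp
  have lift: "\<exists>w. w \<in> carrier M \<and> u = h w" if "u \<in> carrier N" for u using that bij(2) by blast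
  show "a \<in> stable_ann R N"
  proof (rule stable_annI[where \<alpha> = "\<lambda>u. \<alpha> (g u)" and \<beta> = "\<lambda>x. h (\<beta> x)"])
    show "a \<in> carrier R" by (rule a(1))
    show "\<alpha> (g u) \<in> vec R n" if "u \<in> carrier N" for u using lift[OF that] gh a(2) by auto
    show "\<alpha> (g (u \<oplus>\<^bsub>N\<^esub> v)) = \<alpha> (g u) \<oplus>\<^bsub>fun_module R\<^esub> \<alpha> (g v)" if uv: "u \<in> carrier N" "v \<in> carrier N" for u v
    proof -
      obtain w z where w: "w \<in> carrier M" "u = h w" "z \<in> carrier M" "v = h z" using lift uv by blast
      have "u \<oplus>\<^bsub>N\<^esub> v = h (w \<oplus>\<^bsub>M\<^esub> z)" using w add by simp
      then show ?thesis using w gh a(3) M.add.m_closed by simp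
    qed
    show "\<alpha> (g (b \<odot>\<^bsub>N\<^esub> u)) = b \<odot>\<^bsub>fun_module R\<^esub> \<alpha> (g u)" if bu: "b \<in> carrier R" "u \<in> carrier N" for b u
    proof -
      obtain w where w: "w \<in> carrier M" "u = h w" using lift bu by blast
      have "b \<odot>\<^bsub>N\<^esub> u = h (b \<odot>\<^bsub>M\<^esub> w)" using w smult bu by simp
      then show ?thesis using w gh a(4) bu M.smult_closed by simp
    qed
    show "h (\<beta> (\<alpha> (g u))) = a \<odot>\<^bsub>N\<^esub> u" if u: "u \<in> carrier N" for u
    proof -
      obtain w where w: "w \<in> carrier M" "u = h w" using lift u by blast
      then show ?thesis using gh a(8) smult a(1) by simp
    qed
  qed (use a(5-7) add smult bij(2) in auto)
qed

lemma module_iso_inv: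
  assumes M: "module R M" and h: "h \<in> module_iso R M N"
  shows "inv_into (carrier M) h \<in> module_iso R N M"
proof -
  interpret M: module R M by fact
  let ?g = "inv_into (carrier M) h"
  have bb: "bij_betw h (carrier M) (carrier N)" using h by (simp add: module_iso_def)
  then have bij: "inj_on h (carrier M)" "h ` carrier M = carrier N" by (auto simp: bij_betw_def)
  have gh: "?g (h u) = u" if "u \<in> carrier M" for u using bij(1) that by simp
  have lift: "\<exists>w. w \<in> carrier M \<and> u = h w" if "u \<in> carrier N" for u using that bij(2) by blast
  have "?g (u \<oplus>\<^bsub>N\<^esub> v) = ?g u \<oplus>\<^bsub>M\<^esub> ?g v" if uv: "u \<in> carrier N" "v \<in> carrier N" for u v
  proof -
    obtain w z where w: "w \<in> carrier M" "u = h w" "z \<in> carrier M" "v = h z" using lift uv by blast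
    have "u \<oplus>\<^bsub>N\<^esub> v = h (w \<oplus>\<^bsub>M\<^esub> z)" using w h by (simp add: module_iso_def)
    then show ?thesis using w gh by simp
  qed
  moreover have "?g (b \<odot>\<^bsub>N\<^esub> u) = b \<odot>\<^bsub>M\<^esub> ?g u" if bu: "b \<in> carrier R" "u \<in> carrier N" for b u
  proof -
    obtain w where w: "w \<in> carrier M" "u = h w" using lift bu by blast
    have "b \<odot>\<^bsub>N\<^esub> u = h (b \<odot>\<^bsub>M\<^esub> w)" using w h bu by (simp add: module_iso_def)
    then show ?thesis using w gh bu by simp
  qed
  ultimately show ?thesis using bij_betw_inv_into[OF bb] by (simp add: module_iso_def)
qed

lemma stable_ann_iso:
  assumes "module R M" "module R N" "h \<in> module_iso R M N"
  shows "stable_ann R M = stable_ann R N"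
  using stable_ann_iso_subset[OF assms] stable_ann_iso_subset[OF assms(2,1) module_iso_inv[OF assms(1,3)]] by blast

text \<open>As \<open>K\<close> is isomorphic to \<open>R^s/L\<close>, a factorization of
  multiplication by \<open>a\<close> through \<open>R^n\<close> becomes an endomorphism of
  \<open>R^s\<close>: lift the second map through \<open>p\<close> and compose. Conversely, an
  \<open>E\<close> vanishing on \<open>L\<close> induces a map from \<open>K\<close> to
  \<open>R^s\<close>, and \<open>p\<close> leads back.\<close>

lemma (in cring) stable_ann_syz:
  assumes K: "subvec R r K" and sy: "syz R r K s L"
  shows "stable_ann R (sub_module R K) = {a \<in> carrier R. stab R a s L 0 {\<zero>\<^bsub>F\<^esub>}}"
proof -
  interpret V: module R F by (rule fun_module_module)
  obtain p where p: "lin R s r p" "p ` vec R s = K" "L = {v \<in> vec R s. p v = \<zero>\<^bsub>F\<^esub>}"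
    using sy unfolding syz_def by blast
  have Ls: "subvec R s L" by (rule syz_subvec[OF sy])
  have pK: "p v \<in> K" if "v \<in> vec R s" for v using p(2) that by blast
  have lift: "\<exists>v. v \<in> vec R s \<and> u = p v" if "u \<in> K" for u using p(2) that by blast
  have diffL: "u \<ominus>\<^bsub>F\<^esub> v \<in> L" if "u \<in> vec R s" "v \<in> vec R s" "p u = p v" for u v
  proof -
    have "p (u \<ominus>\<^bsub>F\<^esub> v) = p v \<ominus>\<^bsub>F\<^esub> p v" unfolding lin_diff[OF p(1) that(1,2)] that(3) ..
    also have "\<dots> = \<zero>\<^bsub>F\<^esub>" unfolding a_minus_def by (rule V.M.r_neg[OF lin_carrier[OF p(1) that(2)]])
    finally show ?thesis unfolding p(3) using vec_rules(5)[OF that(1,2)] by blast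
  qed
  show ?thesis
  proof
    show "stable_ann R (sub_module R K) \<subseteq> {a \<in> carrier R. stab R a s L 0 {\<zero>\<^bsub>F\<^esub>}}"
    proof
      fix a assume "a \<in> stable_ann R (sub_module R K)"
      then obtain n \<alpha> \<beta> where a: "a \<in> carrier R"
        "\<And>u. u \<in> carrier (sub_module R K) \<Longrightarrow> \<alpha> u \<in> vec R n"
        "\<And>u v. u \<in> carrier (sub_module R K) \<Longrightarrow> v \<in> carrier (sub_module R K) \<Longrightarrow> \<alpha> (u \<oplus>\<^bsub>sub_module R K\<^esub> v) = \<alpha> u \<oplus>\<^bsub>F\<^esub> \<alpha> v"
        "\<And>b u. b \<in> carrier R \<Longrightarrow> u \<in> carrier (sub_module R K) \<Longrightarrow> \<alpha> (b \<odot>\<^bsub>sub_module R K\<^esub> u) = b \<odot>\<^bsub>F\<^esub> \<alpha> u"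
        "\<And>x. x \<in> vec R n \<Longrightarrow> \<beta> x \<in> carrier (sub_module R K)"
        "\<And>x y. x \<in> vec R n \<Longrightarrow> y \<in> vec R n \<Longrightarrow> \<beta> (x \<oplus>\<^bsub>F\<^esub> y) = \<beta> x \<oplus>\<^bsub>sub_module R K\<^esub> \<beta> y"
        "\<And>b x. b \<in> carrier R \<Longrightarrow> x \<in> vec R n \<Longrightarrow> \<beta> (b \<odot>\<^bsub>F\<^esub> x) = b \<odot>\<^bsub>sub_module R K\<^esub> \<beta> x"
        "\<And>u. u \<in> carrier (sub_module R K) \<Longrightarrow> \<beta> (\<alpha> u) = a \<odot>\<^bsub>sub_module R K\<^esub> u"
        by (rule stable_annE) (rule that)
      note a = a(1) a(2-)[unfolded sub_module_simps]
      have \<beta>: "lin R n r \<beta>"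
        by (rule linI[OF subvec_subset[OF K a(5)] a(6,7)])
      have "\<beta> ` vec R n \<subseteq> p ` vec R s" unfolding p(2) using a(5) by blast
      then obtain \<beta>' where \<beta>': "lin R n s \<beta>'" "\<forall>x\<in>vec R n. p (\<beta>' x) = \<beta> x" using lin_lift[OF \<beta> p(1)] by blast
      have \<alpha>p: "lin R s n (\<lambda>v. \<alpha> (p v))"
        by (rule linI) (simp_all only: lin_add[OF p(1)] lin_smult[OF p(1)] pK a(2-4))
      note E = lin_comp[OF \<alpha>p \<beta>'(1)]
      have "\<beta>' (\<alpha> (p v)) = \<zero>\<^bsub>F\<^esub>" if "v \<in> L" for v
      proof -
        have "p v = p \<zero>\<^bsub>F\<^esub>" using that lin_zero[OF p(1)] unfolding p(3) by simp
        then show ?thesis using lin_zero[OF E] by simp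
      qed
      moreover have "a \<odot>\<^bsub>F\<^esub> v \<ominus>\<^bsub>F\<^esub> \<beta>' (\<alpha> (p v)) \<in> L" if v: "v \<in> vec R s" for v
        using \<beta>'(2) a(8)[OF pK[OF v]] a(2)[OF pK[OF v]] lin_smult[OF p(1) a(1) v]
        by (intro diffL vec_rules(3)[OF a(1) v] lin_vec[OF E v]) simp
      ultimately have "stab R a s L 0 {\<zero>\<^bsub>F\<^esub>}" unfolding stab_zero_iff[OF Ls a(1)] using E by blast
      then show "a \<in> {a \<in> carrier R. stab R a s L 0 {\<zero>\<^bsub>F\<^esub>}}" using a(1) by blast
    qed
    show "{a \<in> carrier R. stab R a s L 0 {\<zero>\<^bsub>F\<^esub>}} \<subseteq> stable_ann R (sub_module R K)"
    proof
      fix a assume "a \<in> {a \<in> carrier R. stab R a s L 0 {\<zero>\<^bsub>F\<^esub>}}"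
      then have a: "a \<in> carrier R" "stab R a s L 0 {\<zero>\<^bsub>F\<^esub>}" by blast+
      obtain E where E: "lin R s s E" "\<forall>v\<in>L. E v = \<zero>\<^bsub>F\<^esub>" "\<forall>v\<in>vec R s. a \<odot>\<^bsub>F\<^esub> v \<ominus>\<^bsub>F\<^esub> E v \<in> L"
        using a(2) stab_zero_iff[OF Ls a(1)] by blast
      have Eeq: "E u = E v" if uv: "u \<in> vec R s" "v \<in> vec R s" "p u = p v" for u v
      proof -
        have "E (u \<ominus>\<^bsub>F\<^esub> v) = \<zero>\<^bsub>F\<^esub>" using E(2) diffL[OF uv] by blast
        then have "E u \<ominus>\<^bsub>F\<^esub> E v = \<zero>\<^bsub>F\<^esub>" unfolding lin_diff[OF E(1) uv(1,2)] .
        then show ?thesis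
          using fun_module_diff_add[OF lin_carrier[OF E(1) uv(1)] lin_carrier[OF E(1) uv(2)]]
            V.M.l_zero[OF lin_carrier[OF E(1) uv(2)]] by metis
      qed
      \<comment> \<open>A mere choice of preimages under \<open>p\<close>, not linear in itself;
        composed with \<open>E\<close> it becomes linear, because by \<open>Eeq\<close> all
        preimages have the same value under \<open>E\<close>.\<close>
      define g where "g = inv_into (vec R s) p"
      have g: "g u \<in> vec R s" "p (g u) = u" if "u \<in> K" for u
      proof -
        have "u \<in> p ` vec R s" using that p(2) by simp
        then show "g u \<in> vec R s" "p (g u) = u" unfolding g_def by (rule inv_into_into, rule f_inv_into_f)
      qed
      show "a \<in> stable_ann R (sub_module R K)"
      proof (rule stable_annI[where \<alpha> = "\<lambda>u. E (g u)" and \<beta> = p and n = s], unfold sub_module_simps)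
        show "a \<in> carrier R" by (rule a(1))
        show "E (g u) \<in> vec R s" if "u \<in> K" for u by (rule lin_vec[OF E(1) g(1)[OF that]])
        show "E (g (u \<oplus>\<^bsub>F\<^esub> v)) = E (g u) \<oplus>\<^bsub>F\<^esub> E (g v)" if uv: "u \<in> K" "v \<in> K" for u v
        proof -
          note guv = vec_rules(2)[OF g(1)[OF uv(1)] g(1)[OF uv(2)]]
          have "E (g (u \<oplus>\<^bsub>F\<^esub> v)) = E (g u \<oplus>\<^bsub>F\<^esub> g v)"
            by (rule Eeq[OF g(1)[OF subvec_add[OF K uv]] guv])
              (simp only: g(2) uv subvec_add[OF K uv] lin_add[OF p(1) g(1)[OF uv(1)] g(1)[OF uv(2)]])
          then show ?thesis unfolding lin_add[OF E(1) g(1)[OF uv(1)] g(1)[OF uv(2)]] .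
        qed
        show "E (g (b \<odot>\<^bsub>F\<^esub> u)) = b \<odot>\<^bsub>F\<^esub> E (g u)" if bu: "b \<in> carrier R" "u \<in> K" for b u
        proof -
          have "E (g (b \<odot>\<^bsub>F\<^esub> u)) = E (b \<odot>\<^bsub>F\<^esub> g u)"
            by (rule Eeq[OF g(1)[OF subvec_smult[OF K bu]] vec_rules(3)[OF bu(1) g(1)[OF bu(2)]]])
              (simp only: g(2) bu subvec_smult[OF K bu] lin_smult[OF p(1) bu(1) g(1)[OF bu(2)]])
          then show ?thesis unfolding lin_smult[OF E(1) bu(1) g(1)[OF bu(2)]] .
        qed
        show "p x \<in> K" if "x \<in> vec R s" for x by (rule pK[OF that])
        show "p (x \<oplus>\<^bsub>F\<^esub> y) = p x \<oplus>\<^bsub>F\<^esub> p y" if "x \<in> vec R s" "y \<in> vec R s" for x y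
          by (rule lin_add[OF p(1) that])
        show "p (b \<odot>\<^bsub>F\<^esub> x) = b \<odot>\<^bsub>F\<^esub> p x" if "b \<in> carrier R" "x \<in> vec R s" for b x
          by (rule lin_smult[OF p(1) that])
        show "p (E (g u)) = a \<odot>\<^bsub>F\<^esub> u" if u: "u \<in> K" for u
        proof -
          note gu = g(1)[OF u]
          have "a \<odot>\<^bsub>F\<^esub> g u \<ominus>\<^bsub>F\<^esub> E (g u) \<in> L" using E(3) gu by blast
          then have "p (a \<odot>\<^bsub>F\<^esub> g u \<ominus>\<^bsub>F\<^esub> E (g u)) = \<zero>\<^bsub>F\<^esub>" unfolding p(3) by blast
          then have "a \<odot>\<^bsub>F\<^esub> u \<ominus>\<^bsub>F\<^esub> p (E (g u)) = \<zero>\<^bsub>F\<^esub>"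
            unfolding lin_diff[OF p(1) vec_rules(3)[OF a(1) gu] lin_vec[OF E(1) gu]] lin_smult[OF p(1) a(1) gu] g(2)[OF u] .
          then show ?thesis
            using fun_module_diff_add[OF V.smult_closed[OF a(1) subvec_carrier[OF K u]] lin_carrier[OF p(1) lin_vec[OF E(1) gu]]]
              V.M.l_zero[OF lin_carrier[OF p(1) lin_vec[OF E(1) gu]]] by metis
        qed
      qed
    qed
  qed
qed

subsection \<open>Invariance of regularity under isomorphism\<close>

text \<open>Seen as a quotient by the zero ideal, an isomorphism inherits the transfer of primes,
  generators and locality from \<open>quot_map\<close>.\<close>

lemma quot_map_iso:
  assumes "cring R" "cring S" "h \<in> ring_iso R S"
  shows "quot_map R S h {\<zero>\<^bsub>R\<^esub>}"
proof -
  interpret R: cring R by fact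
  interpret S: cring S by fact
  have h: "h \<in> ring_hom R S" "h ` carrier R = carrier S" "inj_on h (carrier R)"
    using assms(3) by (auto simp: ring_iso_def bij_betw_def)
  have "h \<zero>\<^bsub>R\<^esub> = \<zero>\<^bsub>S\<^esub>" by (rule ring_hom_zero[OF h(1) R.ring_axioms S.ring_axioms])
  then have "h a = \<zero>\<^bsub>S\<^esub> \<longleftrightarrow> a \<in> {\<zero>\<^bsub>R\<^esub>}" if "a \<in> carrier R" for a
    using inj_onD[OF h(3), of a "\<zero>\<^bsub>R\<^esub>"] that by auto
  then show ?thesis
    unfolding quot_map_def quot_map_axioms_def using assms(1,2) h(1,2) R.zeroideal by blast
qed

lemma chain_dim_mono:
  assumes "\<And>ps. ps \<noteq> [] \<Longrightarrow> sorted_wrt (\<subset>) ps \<Longrightarrow> set ps \<subseteq> Z \<Longrightarrow>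
    \<exists>qs. length qs = length ps \<and> sorted_wrt (\<subset>) qs \<and> set qs \<subseteq> Z'"
  shows "chain_dim Z \<le> chain_dim Z'"
  unfolding chain_dim_def[of Z]
proof (rule SUP_least)
  fix ps assume "ps \<in> {ps. ps \<noteq> [] \<and> sorted_wrt (\<subset>) ps \<and> set ps \<subseteq> Z}"
  then obtain qs where "ps \<noteq> []" "length qs = length ps" "sorted_wrt (\<subset>) qs" "set qs \<subseteq> Z'"
    using assms by blast
  then show "enat (length ps - 1) \<le> chain_dim Z'" using chain_dim_ge[of qs Z'] by fastforce
qed

lemma regular_local_ring_iso:
  fixes R :: "('a, 'b) ring_scheme" and S :: "('c, 'd) ring_scheme"
  assumes S: "cring S" and h: "h \<in> ring_iso R S" and reg: "regular_local_ring R"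
  shows "regular_local_ring S"
proof -
  obtain m U where m: "noetherian_local_ring R m" and U: "finite U" "U \<subseteq> carrier R"
    "enat (card U) = krull_dim R" "m = Idl\<^bsub>R\<^esub> U"
    using reg unfolding regular_local_ring_def by blast
  interpret noetherian_local_ring R m by fact
  interpret quot_map R S h "{\<zero>\<^bsub>R\<^esub>}" by (rule quot_map_iso[OF is_cring S h])
  have inj: "inj_on h (carrier R)" using h by (simp add: ring_iso_def bij_betw_def)
  have I_le: "{\<zero>\<^bsub>R\<^esub>} \<subseteq> p" if "ideal p R" for p using ideal_zero[OF that] by blast
  have loc: "noetherian_local_ring S (h ` m)" by (rule local_image[OF m I_le[OF m_ideal]])
  have dim: "krull_dim S = krull_dim R"
    unfolding krull_dim_def
  proof (rule antisym; rule chain_dim_mono)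
    fix ps :: "'c set list" assume "sorted_wrt (\<subset>) ps" "set ps \<subseteq> spec S"
    from chain_vimage[OF this]
    show "\<exists>qs. length qs = length ps \<and> sorted_wrt (\<subset>) qs \<and> set qs \<subseteq> spec R"
      by (intro exI[of _ "map (\<lambda>q. {a \<in> carrier R. h a \<in> q}) ps"]) auto
  next
    fix ps :: "'a set list" assume ps: "sorted_wrt (\<subset>) ps" "set ps \<subseteq> spec R"
    have "p \<in> spec R \<and> {\<zero>\<^bsub>R\<^esub>} \<subseteq> p" if "p \<in> set ps" for p
      using that ps(2) I_le primeideal_ideal unfolding spec_def by blast
    from chain_image[OF ps(1) this]
    show "\<exists>qs. length qs = length ps \<and> sorted_wrt (\<subset>) qs \<and> set qs \<subseteq> spec S"
      by (intro exI[of _ "map ((`) h) ps"]) auto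
  qed
  have "card (h ` U) = card U" by (rule card_image[OF inj_on_subset[OF inj U(2)]])
  moreover have "h ` m = Idl\<^bsub>S\<^esub> (h ` U)" unfolding U(4) by (rule image_genideal[OF U(2)])
  moreover have "h ` U \<subseteq> carrier S" using U(2) by auto
  ultimately show ?thesis
    unfolding regular_local_ring_def using loc U(1,3) dim
    by (intro exI[of _ "h ` m"] conjI exI[of _ "h ` U"]) auto
qed

text \<open>Fractions are literally sets of pairs, so the isomorphism applies \<open>h\<close> to
  both components of every pair.\<close>

lemma local_at_iso:
  assumes R: "cring R" and S: "cring S" and h: "h \<in> ring_iso R S" and p: "primeideal p R"
  shows "(`) (map_prod h h) \<in> ring_iso (local_at R p) (local_at S (h ` p))"
proof -
  interpret quot_map R S h "{\<zero>\<^bsub>R\<^esub>}" by (rule quot_map_iso[OF R S h])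
  have inj: "inj_on h (carrier R)" using h by (simp add: ring_iso_def bij_betw_def)
  note pi = R.primeideal_ideal[OF p]
  have p': "primeideal (h ` p) S" by (rule image_prime[OF p]) (use R.ideal_zero[OF pi] in blast)
  let ?T = "carrier R - p" and ?T' = "carrier S - h ` p"
  have T': "?T' = h ` ?T" using inj_on_image_set_diff[OF inj, of "carrier R" p] R.ideal_subset[OF pi] surj by simp
  note sm = R.prime_complement_submonoid[OF p] and sm' = S.prime_complement_submonoid[OF p']
  have oneT: "\<one>\<^bsub>R\<^esub> \<in> ?T" using R.primeideal_one[OF p] by simp
  let ?\<Phi> = "(`) (map_prod h h)"
  have frac: "?\<Phi> (fraction R ?T a s) = fraction S ?T' (h a) (h s)" if as: "a \<in> carrier R" "s \<in> ?T" for a s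
  proof -
    have eq: "(\<exists>u\<in>?T. u \<otimes>\<^bsub>R\<^esub> (a \<otimes>\<^bsub>R\<^esub> t) = u \<otimes>\<^bsub>R\<^esub> (b \<otimes>\<^bsub>R\<^esub> s)) \<longleftrightarrow>
        (\<exists>u\<in>?T. h u \<otimes>\<^bsub>S\<^esub> (h a \<otimes>\<^bsub>S\<^esub> h t) = h u \<otimes>\<^bsub>S\<^esub> (h b \<otimes>\<^bsub>S\<^esub> h s))"
      if "b \<in> carrier R" "t \<in> ?T" for b t
    proof (rule bex_cong[OF refl])
      fix u assume u: "u \<in> ?T"
      have "h (u \<otimes>\<^bsub>R\<^esub> (a \<otimes>\<^bsub>R\<^esub> t)) = h (u \<otimes>\<^bsub>R\<^esub> (b \<otimes>\<^bsub>R\<^esub> s)) \<longleftrightarrow> u \<otimes>\<^bsub>R\<^esub> (a \<otimes>\<^bsub>R\<^esub> t) = u \<otimes>\<^bsub>R\<^esub> (b \<otimes>\<^bsub>R\<^esub> s)"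
        using u that as by (intro inj_on_eq_iff[OF inj]) auto
      then show "(u \<otimes>\<^bsub>R\<^esub> (a \<otimes>\<^bsub>R\<^esub> t) = u \<otimes>\<^bsub>R\<^esub> (b \<otimes>\<^bsub>R\<^esub> s)) =
          (h u \<otimes>\<^bsub>S\<^esub> (h a \<otimes>\<^bsub>S\<^esub> h t) = h u \<otimes>\<^bsub>S\<^esub> (h b \<otimes>\<^bsub>S\<^esub> h s))"
        using u that as by simp
    qed
    show ?thesis
    proof
      show "?\<Phi> (fraction R ?T a s) \<subseteq> fraction S ?T' (h a) (h s)"
      proof
        fix z assume "z \<in> ?\<Phi> (fraction R ?T a s)"
        then obtain b t where z: "z = (h b, h t)" "b \<in> carrier R" "t \<in> ?T"
          "\<exists>u\<in>?T. u \<otimes>\<^bsub>R\<^esub> (a \<otimes>\<^bsub>R\<^esub> t) = u \<otimes>\<^bsub>R\<^esub> (b \<otimes>\<^bsub>R\<^esub> s)"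
          unfolding fraction_def by auto
        then show "z \<in> fraction S ?T' (h a) (h s)"
          unfolding fraction_def T' using eq[OF z(2,3)] by auto
      qed
      show "fraction S ?T' (h a) (h s) \<subseteq> ?\<Phi> (fraction R ?T a s)"
      proof
        fix z assume "z \<in> fraction S ?T' (h a) (h s)"
        then obtain b' t' where z: "z = (b', t')" "b' \<in> carrier S" "t' \<in> h ` ?T"
          "\<exists>u\<in>h ` ?T. u \<otimes>\<^bsub>S\<^esub> (h a \<otimes>\<^bsub>S\<^esub> t') = u \<otimes>\<^bsub>S\<^esub> (b' \<otimes>\<^bsub>S\<^esub> h s)"
          unfolding fraction_def T' by auto
        obtain b where b: "b \<in> carrier R" "b' = h b" using lift[OF z(2)] by metis
        obtain t where t: "t \<in> ?T" "t' = h t" using z(3) by blast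
        have "(b, t) \<in> fraction R ?T a s"
          unfolding fraction_def using b(1) t(1) z(4) eq[OF b(1) t(1)] b(2) t(2) by auto
        then have "map_prod h h (b, t) \<in> ?\<Phi> (fraction R ?T a s)" by (rule imageI)
        then show "z \<in> ?\<Phi> (fraction R ?T a s)" using z(1) b(2) t(2) by simp
      qed
    qed
  qed
  have carr: "carrier (local_at R p) = {fraction R ?T a s | a s. a \<in> carrier R \<and> s \<in> ?T}"
    and carr': "carrier (local_at S (h ` p)) = {fraction S ?T' a s | a s. a \<in> carrier S \<and> s \<in> ?T'}"
    by (simp_all add: local_at_def localization_def)
  note ops = R.localization_mult[OF sm, folded local_at_def] R.localization_add[OF sm, folded local_at_def]
  note ops' = S.localization_mult[OF sm', folded local_at_def] S.localization_add[OF sm', folded local_at_def]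
  have hT: "h s \<in> ?T'" if "s \<in> ?T" for s using that unfolding T' by blast
  have multT: "s \<otimes>\<^bsub>R\<^esub> t \<in> ?T" if "s \<in> ?T" "t \<in> ?T" for s t
    using that R.primeideal_mult[OF p] by auto
  have elim: thesis
    if x: "x \<in> carrier (local_at R p)"
      and "\<And>a s. x = fraction R ?T a s \<Longrightarrow> a \<in> carrier R \<Longrightarrow> s \<in> ?T \<Longrightarrow> thesis" for x thesis
    using x that(2) unfolding carr by blast
  have mem': "?\<Phi> (fraction R ?T a s) \<in> carrier (local_at S (h ` p))" if "a \<in> carrier R" "s \<in> ?T" for a s
    unfolding frac[OF that] carr' mem_Collect_eq using hom_simps(1)[OF that(1)] hT[OF that(2)]
    by (intro exI conjI) (rule refl)
  show ?thesis
  proof (rule ring_iso_memI)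
    show "?\<Phi> x \<in> carrier (local_at S (h ` p))" if x: "x \<in> carrier (local_at R p)" for x
    proof -
      obtain a s where "x = fraction R ?T a s" "a \<in> carrier R" "s \<in> ?T" using x by (rule elim)
      then show ?thesis using mem' by simp
    qed
    fix x y assume xy: "x \<in> carrier (local_at R p)" "y \<in> carrier (local_at R p)"
    obtain a s where x: "x = fraction R ?T a s" "a \<in> carrier R" "s \<in> ?T" using xy(1) by (rule elim)
    obtain b t where y: "y = fraction R ?T b t" "b \<in> carrier R" "t \<in> ?T" using xy(2) by (rule elim)
    have c: "s \<in> carrier R" "t \<in> carrier R" using x y by auto
    show "?\<Phi> (x \<otimes>\<^bsub>local_at R p\<^esub> y) = ?\<Phi> x \<otimes>\<^bsub>local_at S (h ` p)\<^esub> ?\<Phi> y"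
      unfolding x(1) y(1) ops(1)[OF x(2,3) y(2,3)] frac[OF x(2,3)] frac[OF y(2,3)]
        frac[OF R.m_closed[OF x(2) y(2)] multT[OF x(3) y(3)]]
        ops'(1)[OF hom_simps(1)[OF x(2)] hT[OF x(3)] hom_simps(1)[OF y(2)] hT[OF y(3)]]
      using x y c by simp
    have sumc: "a \<otimes>\<^bsub>R\<^esub> t \<oplus>\<^bsub>R\<^esub> b \<otimes>\<^bsub>R\<^esub> s \<in> carrier R" using x y c by simp
    show "?\<Phi> (x \<oplus>\<^bsub>local_at R p\<^esub> y) = ?\<Phi> x \<oplus>\<^bsub>local_at S (h ` p)\<^esub> ?\<Phi> y"
      unfolding x(1) y(1) ops(2)[OF x(2,3) y(2,3)] frac[OF x(2,3)] frac[OF y(2,3)]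
        frac[OF sumc multT[OF x(3) y(3)]]
        ops'(2)[OF hom_simps(1)[OF x(2)] hT[OF x(3)] hom_simps(1)[OF y(2)] hT[OF y(3)]]
      using x y c by simp
  next
    show "?\<Phi> \<one>\<^bsub>local_at R p\<^esub> = \<one>\<^bsub>local_at S (h ` p)\<^esub>"
      using frac[OF R.one_closed oneT] by (simp add: local_at_def localization_def)
    have "inj_on (map_prod h h) (carrier R \<times> carrier R)" using inj by (rule map_prod_inj_on) (rule inj)
    then have "inj_on ?\<Phi> (Pow (carrier R \<times> carrier R))" by (rule inj_on_image_Pow)
    moreover have "carrier (local_at R p) \<subseteq> Pow (carrier R \<times> carrier R)"
      unfolding carr fraction_def by auto
    ultimately have "inj_on ?\<Phi> (carrier (local_at R p))" by (rule inj_on_subset)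
    moreover have "?\<Phi> ` carrier (local_at R p) = carrier (local_at S (h ` p))"
    proof
      show "?\<Phi> ` carrier (local_at R p) \<subseteq> carrier (local_at S (h ` p))"
      proof
        fix z assume "z \<in> ?\<Phi> ` carrier (local_at R p)"
        then obtain x where x: "z = ?\<Phi> x" "x \<in> carrier (local_at R p)" by (rule imageE)
        obtain a s where "x = fraction R ?T a s" "a \<in> carrier R" "s \<in> ?T" using x(2) by (rule elim)
        then show "z \<in> carrier (local_at S (h ` p))"
          using mem' x(1) by simp
      qed
      show "carrier (local_at S (h ` p)) \<subseteq> ?\<Phi> ` carrier (local_at R p)"
      proof
        fix z assume "z \<in> carrier (local_at S (h ` p))"
        then obtain a' s' where z: "z = fraction S ?T' a' s'" "a' \<in> carrier S" "s' \<in> h ` ?T"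
          unfolding carr' T' by blast
        obtain a where a: "a \<in> carrier R" "h a = a'" using z(2) by (rule lift)
        obtain s where s: "s \<in> ?T" "s' = h s" using z(3) by blast
        have "fraction R ?T a s \<in> carrier (local_at R p)" unfolding carr using a s by blast
        moreover have "z = ?\<Phi> (fraction R ?T a s)" using z(1) a s(2) frac[OF a(1) s(1)] by simp
        ultimately show "z \<in> ?\<Phi> ` carrier (local_at R p)" by (rule rev_image_eqI)
      qed
    qed
    ultimately show "bij_betw ?\<Phi> (carrier (local_at R p)) (carrier (local_at S (h ` p)))"
      by (simp add: bij_betw_def)
  qed
qed

lemma (in cring) local_at_cring: "primeideal p R \<Longrightarrow> cring (local_at R p)"
  unfolding local_at_def by (rule localization_cring[OF prime_complement_submonoid])

text \<open>The J-2 property speaks only of algebras on one fixed carrier type, so it is applied to a copy of \<open>R\<close> there.\<close>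

lemma (in cring) singular_locus_upward:
  assumes J2: "J2_ring R" and p: "p \<in> singular_locus R" and q: "primeideal q R" "p \<subseteq> q"
  shows "q \<in> singular_locus R"
proof -
  \<comment> \<open>\<open>a\<close> is coded as a formal sum with the constant term
    \<open>a\<close> alone; any injection into that type would serve.\<close>
  define h where "h = (\<lambda>a :: 'a. [(a, [] :: nat list)])"
  let ?S = "image_ring h R"
  have "inj_on h (carrier R)" by (simp add: h_def inj_on_def)
  then have iso: "h \<in> ring_iso R ?S" by (rule inj_imp_image_ring_iso)
  have "cring (?S \<lparr>zero := h \<zero>\<rparr>)" by (rule ring_iso_imp_img_cring[OF iso])
  then have S: "cring ?S" by (simp add: image_ring_def image_group_def monoid.defs)
  interpret quot_map R ?S h "{\<zero>}" by (rule quot_map_iso[OF is_cring S iso])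
  have "generate_ring ?S (h ` carrier R \<union> {}) = carrier ?S"
    using generate_ring.incl[of _ "carrier ?S" ?S] S.generate_ring_in_carrier[of "carrier ?S"] surj by auto
  then have "finite_type_algebra R ?S h"
    unfolding finite_type_algebra_def using S hom by (intro conjI exI[of _ "{}"]) auto
  then obtain I where I: "singular_locus ?S = {p \<in> spec ?S. I \<subseteq> p}"
    using J2 unfolding J2_ring_def by blast
  have le: "{\<zero>} \<subseteq> r" if "primeideal r R" for r using ideal_zero[OF primeideal_ideal[OF that]] by blast
  have pr: "primeideal (h ` r) ?S" if "primeideal r R" for r by (rule image_prime[OF that le[OF that]])
  have reg: "regular_local_ring (local_at R r) \<longleftrightarrow> regular_local_ring (local_at ?S (h ` r))"
    if r: "primeideal r R" for r
  proof
    note iso' = local_at_iso[OF is_cring S iso r]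
    note c = local_at_cring[OF r] and c' = S.local_at_cring[OF pr[OF r]]
    show "regular_local_ring (local_at R r) \<Longrightarrow> regular_local_ring (local_at ?S (h ` r))"
      by (rule regular_local_ring_iso[OF c' iso'])
    show "regular_local_ring (local_at ?S (h ` r)) \<Longrightarrow> regular_local_ring (local_at R r)"
      by (rule regular_local_ring_iso[OF c ring_iso_set_sym[OF cring.axioms(1)[OF c] iso']])
  qed
  have pp: "primeideal p R" "\<not> regular_local_ring (local_at R p)"
    using p by (auto simp: singular_locus_def spec_def)
  have "h ` p \<in> singular_locus ?S"
    using pp reg[OF pp(1)] pr[OF pp(1)] by (simp add: singular_locus_def spec_def)
  then have "I \<subseteq> h ` q" using I q(2) by blast
  then have "h ` q \<in> singular_locus ?S" using I pr[OF q(1)] by (simp add: spec_def)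
  then show ?thesis using reg[OF q(1)] q(1) by (simp add: singular_locus_def spec_def)
qed

subsection \<open>Countably many stable annihilators\<close>

lemma (in noetherian_cring) stable_ann_resolution:
  assumes q: "primeideal q R" and res: "resolution R rk K" "rk 0 = 1" "K 0 = residue_rel R q"
    and sing: "\<not> regular_local_ring (local_at R q)"
  shows "stable_ann R (sub_module R (K i)) = q"
proof -
  have Ki: "subvec R (rk i) (K i)" and sy: "syz R (rk i) (K i) (rk (Suc i)) (K (Suc i))"
    using res(1) unfolding resolution_def by blast+
  note qi = primeideal_ideal[OF q]
  have eq: "stable_ann R (sub_module R (K i)) = {a \<in> carrier R. stab R a (rk (Suc i)) (K (Suc i)) 0 {\<zero>\<^bsub>F\<^esub>}}"
    by (rule stable_ann_syz[OF Ki sy])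
  show ?thesis
  proof
    show "stable_ann R (sub_module R (K i)) \<subseteq> q"
      unfolding eq using regular_local_at[OF q res] sing by blast
    show "q \<subseteq> stable_ann R (sub_module R (K i))"
    proof
      fix a assume a: "a \<in> q"
      have ac: "a \<in> carrier R" by (rule ideal_carrier[OF qi a])
      interpret V: module R F by (rule fun_module_module)
      \<comment> \<open>Multiplication by \<open>a\<close> is already zero on \<open>R/q\<close>, so
        the free part \<open>E\<close> can be taken zero.\<close>
      have "a \<odot>\<^bsub>F\<^esub> v \<ominus>\<^bsub>F\<^esub> \<zero>\<^bsub>F\<^esub> \<in> residue_rel R q" if v: "v \<in> vec R 1" for v
      proof -
        have av: "a \<odot>\<^bsub>F\<^esub> v \<in> vec R 1" by (rule vec_rules(3)[OF ac v])
        have "v 0 \<in> carrier R" using v by (auto simp: vec_def)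
        then have "(a \<odot>\<^bsub>F\<^esub> v) 0 \<in> q" using ideal_rmult[OF qi _ a] by simp
        moreover have "a \<odot>\<^bsub>F\<^esub> v \<ominus>\<^bsub>F\<^esub> \<zero>\<^bsub>F\<^esub> = a \<odot>\<^bsub>F\<^esub> v"
          using vec_carrier[OF av] by (simp add: a_minus_def del: fun_module_simps)
        ultimately show ?thesis using av by simp
      qed
      then have "stab R a (rk 0) (K 0) 0 {\<zero>\<^bsub>F\<^esub>}"
        unfolding res(2,3) stab_zero_iff[OF subvec_ideal[OF qi] ac]
        by (intro exI[of _ "\<lambda>v. \<zero>\<^bsub>F\<^esub>"] conjI lin_const_zero) auto
      \<comment> \<open>Comparison with the resolution of the zero module carries this to stage
        \<open>Suc i\<close>, whose presented module is \<open>K i\<close>.\<close>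
      from stab_resolution[OF res(1) resolution_zero ac this]
      show "a \<in> stable_ann R (sub_module R (K i))" unfolding eq using ac by blast
    qed
  qed
qed

text \<open>Serves to exclude a vanishing syzygy: the prime \<open>q\<close> cannot be the stable
  annihilator of the zero module.\<close>

lemma (in cring) one_mem_stable_ann_zero: "\<one> \<in> stable_ann R (sub_module R {\<zero>\<^bsub>F\<^esub>})"
proof -
  interpret V: module R F by (rule fun_module_module)
  show ?thesis
    by (rule stable_annI[where \<alpha> = "\<lambda>_. \<zero>\<^bsub>F\<^esub>" and \<beta> = "\<lambda>_. \<zero>\<^bsub>F\<^esub>" and n = 0], unfold sub_module_simps vec_0)
      (simp_all del: fun_module_simps)
qed

text \<open>The stable annihilator is constant on isomorphism classes, so one representative of each
  class suffices.\<close>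

lemma countable_stable_ann:
  assumes "countable_CM_type R m"
  shows "countable (stable_ann R ` MCM_modules R m)"
proof -
  let ?C = "MCM_modules R m"
  let ?r = "module_iso_rel R ?C"
  have "stable_ann R ` ?C \<subseteq> (\<lambda>c. stable_ann R (SOME N. N \<in> c)) ` (?C // ?r)"
  proof
    fix A assume "A \<in> stable_ann R ` ?C"
    then obtain M where M: "A = stable_ann R M" "M \<in> ?C" by (rule imageE)
    have "id \<in> module_iso R M M" by (simp add: module_iso_def)
    then have "M \<in> ?r `` {M}" using M(2) by (auto simp: module_iso_rel_def)
    then have "(SOME N. N \<in> ?r `` {M}) \<in> ?r `` {M}" by (rule someI)
    then obtain h where "h \<in> module_iso R M (SOME N. N \<in> ?r `` {M})" "(SOME N. N \<in> ?r `` {M}) \<in> ?C"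
      unfolding module_iso_rel_def by blast
    then have "stable_ann R M = stable_ann R (SOME N. N \<in> ?r `` {M})"
      using M(2) unfolding MCM_modules_def maximal_CM_def by (intro stable_ann_iso) blast+
    moreover have "?r `` {M} \<in> ?C // ?r" using M(2) by (rule quotientI)
    ultimately show "A \<in> (\<lambda>c. stable_ann R (SOME N. N \<in> c)) ` (?C // ?r)"
      unfolding M(1) by (rule image_eqI)
  qed
  moreover have "countable (?C // ?r)" using assms by (simp add: countable_CM_type_def)
  ultimately show ?thesis by (meson countable_image countable_subset)
qed

lemma (in noetherian_local_ring) singular_prime_stable_ann:
  assumes CM: "cohen_macaulay_ring R m" and dim: "krull_dim R = enat (Suc i)"
    and q: "q \<in> singular_locus R"
  shows "q \<in> stable_ann R ` MCM_modules R m"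
proof -
  have q: "primeideal q R" and sing: "\<not> regular_local_ring (local_at R q)"
    using q by (auto simp: singular_locus_def spec_def)
  obtain rk K where res: "resolution R rk K" "rk 0 = 1" "K 0 = residue_rel R q"
    using ex_resolution[OF subvec_ideal[OF primeideal_ideal[OF q]]] by blast
  have ann: "stable_ann R (sub_module R (K i)) = q" by (rule stable_ann_resolution[OF q res sing])
  have "K i \<noteq> {\<zero>\<^bsub>F\<^esub>}" using ann one_mem_stable_ann_zero primeideal_one[OF q] by metis
  then have MCM: "maximal_CM R m (sub_module R (K i))" by (rule syzygy_maximal_CM[OF CM dim res(1)])
  then have M: "module R (sub_module R (K i))" "finitely_generated R (sub_module R (K i))"
    by (auto simp: maximal_CM_def)
  obtain N :: "('a, 'a list) module" and h where N: "module R N" "h \<in> module_iso R (sub_module R (K i)) N"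
    using ex_list_module[OF M] by blast
  have "m \<subseteq> carrier R" using ideal_carrier[OF m_ideal] by blast
  from maximal_CM_iso[OF MCM N this] have "N \<in> MCM_modules R m" by (simp add: MCM_modules_def)
  moreover have "q = stable_ann R N" using stable_ann_iso[OF M(1) N] ann by simp
  ultimately show ?thesis by (rule rev_image_eqI)
qed

section \<open>The bound on the dimension\<close>

lemma (in noetherian_local_ring) no_singular_chain:
  assumes J2: "J2_ring R" and CM: "cohen_macaulay_ring R m" and dim: "krull_dim R = enat d"
    and compl: "adically_complete R m \<or> uncountable (carrier (R Quot m))"
    and count: "countable_CM_type R m"
    and p: "p \<in> singular_locus R" "primeideal q R" "primeideal r R"
  shows "\<not> (p \<subset> q \<and> q \<subset> r)"
proof
  assume chain: "p \<subset> q \<and> q \<subset> r"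
  have pp: "primeideal p R" using p(1) by (simp add: singular_locus_def spec_def)
  \<comment> \<open>The chain makes the dimension positive, so \<open>d = Suc i\<close>, and this
    \<open>i\<close> selects the \<open>d\<close>-th syzygy.\<close>
  have "enat 1 \<le> krull_dim R" unfolding krull_dim_def
    using chain_dim_ge[of "[p, q]" "spec R"] pp p(2) chain by (simp add: spec_def)
  then obtain i where i: "d = Suc i" using dim by (cases d) auto
  \<comment> \<open>By \<open>singular_prime_stable_ann\<close> this countable set contains every
    prime of the singular locus other than \<open>m\<close>.\<close>
  let ?PS = "{P \<in> stable_ann R ` MCM_modules R m. primeideal P R \<and> P \<noteq> m}"
  have "countable ?PS" using countable_stable_ann[OF count] by (rule countable_subset[rotated]) blast
  from countable_prime_avoidance[OF compl this]
  obtain f where f: "f \<in> m" "\<forall>P\<in>?PS. f \<notin> P" by blast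
  have "r \<subseteq> m" by (rule prime_le_m[OF p(3)])
  \<comment> \<open>This is the purpose of \<open>r\<close>: the principal ideal theorem needs a
    prime strictly between \<open>p\<close> and \<open>m\<close>.\<close>
  then have "q \<noteq> m" using chain by blast
  then obtain P where P: "primeideal P R" "p \<subseteq> P" "f \<in> P" "P \<noteq> m"
    using principal_ideal_theorem[OF pp p(2) _ _ f(1)] chain by blast
  have "P \<in> singular_locus R" by (rule singular_locus_upward[OF J2 p(1) P(1,2)])
  from singular_prime_stable_ann[OF CM dim[unfolded i] this] have "P \<in> ?PS" using P by blast
  then show False using f(2) P(3) by blast
qed

lemma (in cring) quot_map_Quot:
  assumes I: "ideal I R"
  shows "quot_map R (R Quot I) ((+>) I) I"
proof -
  interpret I: ideal I R by fact
  have "(+>) I ` carrier R = carrier (R Quot I)" by (auto simp: FactRing_def A_RCOSETS_def')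
  then show ?thesis
    unfolding quot_map_def quot_map_axioms_def
    using is_cring I.quotient_is_cring[OF is_cring] I.rcos_ring_hom I I.a_rcos_self I.a_rcos_const
    by (auto simp: FactRing_def)
qed

theorem theorem1p3:
  fixes R :: "('a, 'b) ring_scheme" and m :: "'a set" and d :: nat
  assumes "noetherian_local_ring R m"
    and "excellent R"
    and "cohen_macaulay_ring R m"
    and "krull_dim R = enat d"
    and "adically_complete R m \<or> uncountable (carrier (R Quot m))"
    and "countable_CM_type R m"
  shows "chain_dim (singular_locus R) \<le> 1 \<and>
    (\<forall>p. primeideal p R \<longrightarrow> krull_dim (R Quot p) > 1 \<longrightarrow> regular_local_ring (local_at R p))"
proof -
  interpret noetherian_local_ring R m by fact
  have J2: "J2_ring R" using assms(2) by (simp add: excellent_def)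
  note no_chain = no_singular_chain[OF J2 assms(3-6)]
  have "chain_dim (singular_locus R) \<le> 1"
  proof (rule ccontr)
    assume "\<not> chain_dim (singular_locus R) \<le> 1"
    then have "enat 1 < chain_dim (singular_locus R)" by (simp add: one_enat_def)
    then obtain f where f: "\<And>i. i \<le> Suc 1 \<Longrightarrow> f i \<in> singular_locus R" "\<And>i. i < Suc 1 \<Longrightarrow> f i \<subset> f (Suc i)"
      by (rule chain_dim_less_fun) (rule that)
    have "primeideal (f 1) R" "primeideal (f 2) R"
      using f(1)[of 1] f(1)[of 2] by (simp_all add: singular_locus_def spec_def)
    from no_chain[OF f(1)[of 0] this] show False using f(2)[of 0] f(2)[of 1] by (simp add: numeral_2_eq_2)
  qed
  moreover have "regular_local_ring (local_at R p)" if p: "primeideal p R" "krull_dim (R Quot p) > 1" for p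
  proof (rule ccontr)
    assume "\<not> regular_local_ring (local_at R p)"
    then have sing: "p \<in> singular_locus R" using p(1) by (simp add: singular_locus_def spec_def)
    interpret Q: quot_map R "R Quot p" "(+>\<^bsub>R\<^esub>) p" p by (rule quot_map_Quot[OF primeideal_ideal[OF p(1)]])
    have "enat 1 < chain_dim (spec (R Quot p))" using p(2) by (simp add: krull_dim_def one_enat_def)
    then obtain f where f: "\<And>i. i \<le> Suc 1 \<Longrightarrow> f i \<in> spec (R Quot p)" "\<And>i. i < Suc 1 \<Longrightarrow> f i \<subset> f (Suc i)"
      by (rule chain_dim_less_fun) (rule that)
    \<comment> \<open>Primes of \<open>R/p\<close> pull back to primes containing \<open>p\<close>;
      the lowest one is again singular because the singular locus is closed.\<close>
    let ?g = "\<lambda>i. {a \<in> carrier R. p +>\<^bsub>R\<^esub> a \<in> f i}"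
    have "sorted_wrt (\<subset>) [f 0, f 1, f 2]" using f(2)[of 0] f(2)[of 1] by (auto simp: numeral_2_eq_2)
    moreover have "set [f 0, f 1, f 2] \<subseteq> spec (R Quot p)" using f(1)[of 0] f(1)[of 1] f(1)[of 2] by simp
    ultimately have g: "sorted_wrt (\<subset>) [?g 0, ?g 1, ?g 2]" "\<And>q. q \<in> set [?g 0, ?g 1, ?g 2] \<Longrightarrow> q \<in> spec R \<and> p \<subseteq> q"
      using Q.chain_vimage[of "[f 0, f 1, f 2]"] unfolding list.map by blast+
    have "?g 0 \<in> singular_locus R"
      using singular_locus_upward[OF J2 sing] g(2)[of "?g 0"] by (simp add: spec_def)
    moreover have "primeideal (?g 1) R" "primeideal (?g 2) R"
      using g(2)[of "?g 1"] g(2)[of "?g 2"] by (simp_all add: spec_def)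
    moreover have "?g 0 \<subset> ?g 1" "?g 1 \<subset> ?g 2" using g(1) unfolding sorted_wrt.simps by simp_all
    ultimately show False using no_chain by blast
  qed
  ultimately show ?thesis by blast
qed

end
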